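(* Let $(M,L,\Psi)$ be a connected, timelike geodesically complete, weighted Berwald spacetime with $\dim M=n+1\ge 2$, and let $N\in(-\infty,0)\cup[n,+\infty]$ be such that $\mathrm{Ric}_N(v)\ge 0$ for all $v\in\Omega$. Suppose also that (1) $(M,L,\Psi)$ is timelike $\epsilon$-complete for some $\epsilon\in\mathbb{R}$ in the $\epsilon$-range associated with $N$; (2) there is a timelike straight line $\eta:\mathbb{R}\to M$; (3) there is a timelike geodesically complete Lorentzian metric $g$ on $M$ whose Levi-Civita connection coincides with the Chern connection of $L$ and such that $\eta$ is timelike for $g$; (4) in the universal cover $(\widetilde{M},\tilde{g})$ of $(M,g)$, a lift of $\eta$ is a timelike straight line (up to constant-speed reparametrization). Let $M=\mathbb{R}\times\Sigma$ be the product structure given by the isometric splitting of $(M,g_{\nabla\overline{\mathbf{b}}^{\eta}})$, that is, $(\Sigma,h)$ is an $n$-dimensional complete Riemannian manifold and $M$ is identified with $\mathbb{R}\times\Sigma$ by an isometry $\Theta:(\mathbb{R}\times\Sigma,-dt^2+h)\to(M,g_{\nabla\overline{\mathbf{b}}^{\eta}})$ such that, for every $x\in\Sigma$, $t\mapsto\Theta(t,x)$ is a straight line bi-asymptotic to $\eta$. Then the translations $$\Phi_t(s,x):=(s+t,x),\qquad (s,x)\in\mathbb{R}\times\Sigma,\ t\in\mathbb{R},$$ are isometric transformations of $(M,L)$, i.e., for every $t\in\mathbb{R}$, $\Phi_t:M\to M$ is a diffeomorphism with $L(d\Phi_t(v))=L(v)$ for all $v\in TM$.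
   Context: **Finsler spacetimes.** $M$ is a connected $C^\infty$-manifold without boundary of dimension $n+1\ge2$; $(x^\alpha)_{\alpha=0}^n$ are local coordinates and $(v^\alpha)$ the induced fiber coordinates. A Lorentz--Finsler structure is a function $L:TM\to\mathbb{R}$, $C^\infty$ on $TM\setminus 0$, with $L(cv)=c^2L(v)$ for $c>0$, and such that $g_{\alpha\beta}(v):=\frac{\partial^2L}{\partial v^\alpha\partial v^\beta}(v)$ is non-degenerate of signature $(-,+,\ldots,+)$ for all $v\in TM\setminus 0$. For $v\in T_xM\setminus\{0\}$, $g_v$ is the Lorentzian inner product on $T_xM$ with matrix $(g_{\alpha\beta}(v))$; for a nowhere vanishing vector field $V$, $g_V$ is the metric $x\mapsto g_{V(x)}$. A vector $v$ is timelike if $L(v)<0$, causal if $L(v)\le0$ and $v\ne0$; for causal $v$, $F(v):=\sqrt{-2L(v)}$. A Finsler spacetime is $(M,L)$ with a smooth timelike vector field $X$ (time orientation). $\Omega_x$ is the connected component of the set of timelike vectors of $T_xM$ containing $X(x)$, and $\Omega=\bigcup_x\Omega_x$; vectors of $\Omega$ (resp. of $\overline{\Omega}_x\setminus\{0\}$) are future-directed timelike (resp. causal). A $C^1$-curve is timelike/causal if its tangent vectors are; all causal curves are future-directed. $x\ll y$ (resp. $x<y$) means there is a timelike (resp. causal) curve from $x$ to $y$; $I^+(x)=\{y: x\ll y\}$, $I^-(x)=\{y: y\ll x\}$. $\ell(\gamma)=\int F(\dot\gamma)\,dt$, and $d(x,y)$ is the supremum of $\ell(\gamma)$ over causal curves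 from $x$ to $y$ ($0$ if none). A causal geodesic from $x$ to $y$ is maximizing if its length is $d(x,y)$. Unit speed means $F(\dot\gamma)\equiv1$. **Connection, curvature.** $\gamma^\alpha_{\beta\delta}(v)=\frac12\sum_\lambda g^{\alpha\lambda}(v)\{\frac{\partial g_{\lambda\delta}}{\partial x^\beta}+\frac{\partial g_{\beta\lambda}}{\partial x^\delta}-\frac{\partial g_{\beta\delta}}{\partial x^\lambda}\}(v)$, $G^\alpha(v)=\frac12\sum\gamma^\alpha_{\beta\delta}(v)v^\beta v^\delta$, $N^\alpha_\beta=\partial G^\alpha/\partial v^\beta$, and the Chern connection coefficients are $\Gamma^\alpha_{\beta\delta}(v)=\gamma^\alpha_{\beta\delta}(v)-\frac12\sum_{\lambda,\mu}g^{\alpha\lambda}(v)\big(\frac{\partial g_{\lambda\delta}}{\partial v^\mu}N^\mu_\beta+\frac{\partial g_{\beta\lambda}}{\partial v^\mu}N^\mu_\delta-\frac{\partial g_{\beta\delta}}{\partial v^\mu}N^\mu_\lambda\big)(v)$. $(M,L)$ is a Berwald spacetime if $\Gamma^\alpha_{\beta\delta}$ is constant on $T_xM\setminus\{0\}$ for every $x$ in every coordinate domain; (3) means that the Christoffel symbols of $g$ equal these $\Gamma^\alpha_{\beta\delta}$. Geodesics are solutions of $\ddot\gamma^\alpha+2G^\alpha(\dot\gamma)=0$. With $R^\alpha_\beta(v)=2\frac{\partial G^\alpha}{\partial x^\beta}-\sum_\delta\big(\frac{\partial N^\alpha_\beta}{\partial x^\delta}v^\delta-2\frac{\partial N^\alpha_\beta}{\partial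 v^\delta}G^\delta\big)-\sum_\delta N^\alpha_\delta N^\delta_\beta$, set $\mathrm{Ric}(v)=\sum_\alpha R^\alpha_\alpha(v)$ for causal $v$. **Weights.** A weight is a $C^\infty$-function $\Psi:M\to\mathbb{R}$. For future-directed causal $v$ and the geodesic $\gamma$ with $\dot\gamma(0)=v$: $\mathrm{Ric}_N(v)=\mathrm{Ric}(v)+(\Psi\circ\gamma)''(0)-\frac{(\Psi\circ\gamma)'(0)^2}{N-n}$ for $N\in\mathbb{R}\setminus\{n\}$, $\mathrm{Ric}_\infty(v)=\mathrm{Ric}(v)+(\Psi\circ\gamma)''(0)$, $\mathrm{Ric}_n(v)=\lim_{N\downarrow n}\mathrm{Ric}_N(v)$. The $\epsilon$-range: $|\epsilon|<\sqrt{N/(N-n)}$ if $N\ne n$ (read as $|\epsilon|<1$ if $N=+\infty$), and $\epsilon\in\mathbb{R}$ arbitrary if $N=n$. **Reverse structure and completeness.** $\overleftarrow{L}(v):=L(-v)$, time oriented by $-X$. $(M,L)$ is timelike geodesically complete if every timelike geodesic extends to a geodesic defined on $\mathbb{R}$ (likewise for a Lorentzian metric). $(M,L,\Psi)$ is future timelike $\epsilon$-complete if $\lim_{t\to T}\int_0^t e^{\frac{2(\epsilon-1)}{n}\Psi(\gamma(s))}ds=\infty$ for every future inextendible timelike geodesic $\gamma:[0,T)\to M$, and timelike $\epsilon$-complete if both $(M,L,\Psi)$ and $(M,\overleftarrow{L},\Psi)$ are future timelike $\epsilon$-complete. **Gradient.** $\Omega^*_x=\{\omega\in T^*_xM:\omega(v)<0\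 \forall v\in\overline\Omega_x\setminus\{0\}\}$; $L^*(\omega)=-\frac12\big(\sup_{v\in\Omega_x,F(v)=1}\omega(v)\big)^2$; the Legendre transform $\mathscr{L}^*(\omega)$ of $\omega\in\Omega_x^*$ is the unique $v\in\Omega_x$ with $L(v)=L^*(\omega)=\omega(v)/2$. A $C^1$-function $f$ is temporal if $-df(x)\in\Omega^*_x$ for all $x$; then $\nabla(-f)(x):=\mathscr{L}^*(-df(x))\in\Omega_x$. **Lines and Busemann functions.** A timelike straight line is a timelike geodesic $\eta:\mathbb{R}\to M$ of unit speed with $d(\eta(s),\eta(t))=t-s$ for all $s<t$. In (4): with $\widetilde M$ time oriented so that the lift $\tilde\eta$ is future-directed, the Lorentzian distance of $\tilde g$ satisfies $d_{\tilde g}(\tilde\eta(s),\tilde\eta(t))=\sqrt{-\tilde g(\dot{\tilde\eta},\dot{\tilde\eta})}\,(t-s)$ for all $s<t$. For a straight line $\eta$, $\mathbf{b}^\eta(x)=\lim_{t\to\infty}\{t-d(x,\eta(t))\}$, $\overline{\mathbf{b}}^\eta(x)=\lim_{t\to\infty}\{t-d(\eta(-t),x)\}$, $I(\eta)=\big(\bigcup_{t>0}I^+(\eta(-t))\big)\cap\big(\bigcup_{t>0}I^-(\eta(t))\big)$, and $\bar\eta(t)=\eta(-t)$. A ray is a future inextendible causal geodesic $[0,\infty)\to M$ all of whose segments are maximizing. For $x\in I(\eta)$, an asymptote of $\eta$ emanating from $x$ is a ray that is a limit (of a subsequence, suitably reparametrized, uniformly on compact intervals) of maximizing causal curves $\zeta_k:[0,a_k]\to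 M$ with $\zeta_k(0)=x$, $\zeta_k(a_k)=\eta(t_k)$, $t_k\to\infty$; asymptotes of $\bar\eta$ are defined in the same way with respect to $\overleftarrow{L}$. A timelike straight line $\zeta$ is bi-asymptotic to $\eta$ if $x=\zeta(0)\in I(\eta)$, $\mathbf{b}^\eta(x)+\overline{\mathbf{b}}^\eta(x)=0$, $\zeta|_{[0,\infty)}$ is a timelike asymptote of $\eta$ and $t\mapsto\zeta(-t)$ ($t\ge0$) is a timelike asymptote of $\bar\eta$ (with respect to $\overleftarrow{L}$). **Product structure.** Under the hypotheses (1)--(4), the splitting theorem of the paper states that $-\overline{\mathbf b}^\eta$ is a smooth temporal function on $M$ and that a product structure $\Theta$ as described in the claim exists. *)

theory Defs
  imports "HOL-Analysis.Analysis"
begin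

section \<open>Smooth manifolds\<close>

primrec C_k_on :: "nat \<Rightarrow> 'a::euclidean_space set \<Rightarrow> ('a \<Rightarrow> 'b::real_normed_vector) \<Rightarrow> bool" where
  "C_k_on 0 S f \<longleftrightarrow> continuous_on S f"
| "C_k_on (Suc k) S f \<longleftrightarrow> (\<forall>x\<in>S. f differentiable (at x)) \<and>
     (\<forall>v. C_k_on k S (\<lambda>x. frechet_derivative f (at x) v))"

text \<open>Used for open sets only, since the derivatives are taken at \<open>at x\<close>.\<close>

definition smooth_on :: "'a::euclidean_space set \<Rightarrow> ('a \<Rightarrow> 'b::real_normed_vector) \<Rightarrow> bool" where
  "smooth_on S f \<longleftrightarrow> (\<forall>k. C_k_on k S f)"

text \<open>The underlying space of a manifold is a whole type, Hausdorff and second countable by its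
  sort. A chart is its domain together with a coordinate map whose values outside the domain
  are irrelevant. A smooth structure is a maximal atlas, so that its elements are all the
  coordinate systems of the manifold.\<close>

type_synonym ('m, 'e) chart = "'m set \<times> ('m \<Rightarrow> 'e)"

abbreviation cdom :: "('m, 'e) chart \<Rightarrow> 'm set" where "cdom c \<equiv> fst c"
abbreviation cmap :: "('m, 'e) chart \<Rightarrow> 'm \<Rightarrow> 'e" where "cmap c \<equiv> snd c"
abbreviation cimg :: "('m, 'e) chart \<Rightarrow> 'e set" where "cimg c \<equiv> cmap c ` cdom c"
abbreviation cinv :: "('m, 'e) chart \<Rightarrow> 'e \<Rightarrow> 'm" where "cinv c \<equiv> inv_into (cdom c) (cmap c)"

definition is_chart :: "('m::topological_space, 'e::euclidean_space) chart \<Rightarrow> bool" where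
  "is_chart c \<longleftrightarrow> open (cdom c) \<and> open (cimg c) \<and> homeomorphism (cdom c) (cimg c) (cmap c) (cinv c)"

definition compatible :: "('m, 'e::euclidean_space) chart \<Rightarrow> ('m, 'e) chart \<Rightarrow> bool" where
  "compatible c d \<longleftrightarrow>
     smooth_on (cmap c ` (cdom c \<inter> cdom d)) (cmap d \<circ> cinv c) \<and>
     smooth_on (cmap d ` (cdom c \<inter> cdom d)) (cmap c \<circ> cinv d)"

definition smooth_manifold ::
  "('m::{t2_space,second_countable_topology}, 'e::euclidean_space) chart set \<Rightarrow> bool" where
  "smooth_manifold A \<longleftrightarrow>
     (\<forall>c\<in>A. is_chart c) \<and> (\<Union>c\<in>A. cdom c) = UNIV \<and>
     (\<forall>c\<in>A. \<forall>d\<in>A. compatible c d) \<and>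
     (\<forall>c. is_chart c \<and> (\<forall>d\<in>A. compatible c d) \<longrightarrow> c \<in> A)"

definition chart_at :: "('m, 'e) chart set \<Rightarrow> 'm \<Rightarrow> ('m, 'e) chart" where
  "chart_at A p = (SOME c. c \<in> A \<and> p \<in> cdom c)"

definition smooth_fun :: "('m::topological_space, 'e::euclidean_space) chart set \<Rightarrow> ('m \<Rightarrow> real) \<Rightarrow> bool" where
  "smooth_fun A f \<longleftrightarrow> (\<forall>c\<in>A. smooth_on (cimg c) (f \<circ> cinv c))"

definition smooth_map ::
  "('m::topological_space, 'e::euclidean_space) chart set \<Rightarrow>
   ('k::topological_space, 'f::euclidean_space) chart set \<Rightarrow> ('m \<Rightarrow> 'k) \<Rightarrow> bool" where
  "smooth_map A B f \<longleftrightarrow> continuous_on UNIV f \<and>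
     (\<forall>c\<in>A. \<forall>d\<in>B. smooth_on (cmap c ` (cdom c \<inter> f -` cdom d)) (cmap d \<circ> f \<circ> cinv c))"

definition diffeomorphism ::
  "('m::topological_space, 'e::euclidean_space) chart set \<Rightarrow>
   ('k::topological_space, 'f::euclidean_space) chart set \<Rightarrow> ('m \<Rightarrow> 'k) \<Rightarrow> bool" where
  "diffeomorphism A B f \<longleftrightarrow> bij f \<and> smooth_map A B f \<and> smooth_map B A (inv f)"

text \<open>The maximal atlas on \<open>\<real> \<times> \<Sigma>\<close> containing the products of the identity of \<open>\<real>\<close> with the
  charts of \<open>\<Sigma>\<close>.\<close>

definition line_product ::
  "('s::topological_space, 'f::euclidean_space) chart set \<Rightarrow> (real \<times> 's, real \<times> 'f) chart set" where
  "line_product B = {c. is_chart c \<and> (\<forall>b\<in>B. compatible c (UNIV \<times> cdom b, map_prod id (cmap b)))}"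


section \<open>Tangent vectors\<close>

text \<open>A tangent vector is a base point \<open>p\<close> together with the family of its coordinate vectors in
  all charts around \<open>p\<close>, related by the derivatives of the coordinate changes; the entries for
  other charts are set to \<open>0\<close>. The topology of the type
  (the product topology) induces on each tangent space its usual vector space topology.\<close>

type_synonym ('m, 'e) tvec = "'m \<times> (('m, 'e) chart \<Rightarrow> 'e)"

definition tangent_space ::
  "('m, 'e::euclidean_space) chart set \<Rightarrow> 'm \<Rightarrow> ('m, 'e) tvec set" where
  "tangent_space A p = {v. fst v = p \<and>
     (\<forall>c. \<not> (c \<in> A \<and> p \<in> cdom c) \<longrightarrow> snd v c = 0) \<and>
     (\<forall>c\<in>A. \<forall>d\<in>A. p \<in> cdom c \<inter> cdom d \<longrightarrow>
        snd v d = frechet_derivative (cmap d \<circ> cinv c) (at (cmap c p)) (snd v c))}"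

definition tangent_bundle :: "('m, 'e::euclidean_space) chart set \<Rightarrow> ('m, 'e) tvec set" where
  "tangent_bundle A = (\<Union>p. tangent_space A p)"

definition tzero :: "'m \<Rightarrow> ('m, 'e::euclidean_space) tvec" where
  "tzero p = (p, \<lambda>_. 0)"

definition tscale :: "real \<Rightarrow> ('m, 'e::euclidean_space) tvec \<Rightarrow> ('m, 'e) tvec" where
  "tscale r v = (fst v, \<lambda>c. r *\<^sub>R snd v c)"

definition tminus :: "('m, 'e::euclidean_space) tvec \<Rightarrow> ('m, 'e) tvec" where
  "tminus v = (fst v, \<lambda>c. - snd v c)"

text \<open>The tangent vector at \<open>p\<close> with coordinates \<open>u\<close> in the chart \<open>c\<close>.\<close>

definition tvec_of ::
  "('m, 'e::euclidean_space) chart set \<Rightarrow> ('m, 'e) chart \<Rightarrow> 'm \<Rightarrow> 'e \<Rightarrow> ('m, 'e) tvec" where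
  "tvec_of A c p u = (p, \<lambda>d. if d \<in> A \<and> p \<in> cdom d
     then frechet_derivative (cmap d \<circ> cinv c) (at (cmap c p)) u else 0)"

definition dmap ::
  "('m, 'e::euclidean_space) chart set \<Rightarrow> ('k, 'f::euclidean_space) chart set \<Rightarrow> ('m \<Rightarrow> 'k) \<Rightarrow>
   ('m, 'e) tvec \<Rightarrow> ('k, 'f) tvec" where
  "dmap A B f v = (let c = chart_at A (fst v) in
     (f (fst v), \<lambda>d. if d \<in> B \<and> f (fst v) \<in> cdom d
        then frechet_derivative (cmap d \<circ> f \<circ> cinv c) (at (cmap c (fst v))) (snd v c) else 0))"

definition dfun :: "('m, 'e::euclidean_space) chart set \<Rightarrow> ('m \<Rightarrow> real) \<Rightarrow> ('m, 'e) tvec \<Rightarrow> real" where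
  "dfun A f v = (let c = chart_at A (fst v) in
     frechet_derivative (f \<circ> cinv c) (at (cmap c (fst v))) (snd v c))"

definition smooth_vector_field ::
  "('m, 'e::euclidean_space) chart set \<Rightarrow> ('m \<Rightarrow> ('m, 'e) tvec) \<Rightarrow> bool" where
  "smooth_vector_field A X \<longleftrightarrow> (\<forall>p. X p \<in> tangent_space A p) \<and>
     (\<forall>c\<in>A. smooth_on (cimg c) (\<lambda>x. snd (X (cinv c x)) c))"


section \<open>Curves\<close>

text \<open>Curves are considered on intervals with nonempty interior, with one-sided derivatives at
  end points that belong to the interval.\<close>

definition interval_dom :: "real set \<Rightarrow> bool" where
  "interval_dom I \<longleftrightarrow> is_interval I \<and> interior I \<noteq> {}"

definition coord_velocity ::
  "('m, 'e::euclidean_space) chart \<Rightarrow> real set \<Rightarrow> (real \<Rightarrow> 'm) \<Rightarrow> real \<Rightarrow> 'e" where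
  "coord_velocity c I \<gamma> t = vector_derivative (cmap c \<circ> \<gamma>) (at t within I)"

definition velocity ::
  "('m, 'e::euclidean_space) chart set \<Rightarrow> real set \<Rightarrow> (real \<Rightarrow> 'm) \<Rightarrow> real \<Rightarrow> ('m, 'e) tvec" where
  "velocity A I \<gamma> t =
     (\<gamma> t, \<lambda>c. if c \<in> A \<and> \<gamma> t \<in> cdom c then coord_velocity c I \<gamma> t else 0)"

definition C1_curve ::
  "('m::topological_space, 'e::euclidean_space) chart set \<Rightarrow> real set \<Rightarrow> (real \<Rightarrow> 'm) \<Rightarrow> bool" where
  "C1_curve A I \<gamma> \<longleftrightarrow> continuous_on I \<gamma> \<and>
     (\<forall>c\<in>A. \<forall>t\<in>I. \<gamma> t \<in> cdom c \<longrightarrow>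
        (cmap c \<circ> \<gamma>) differentiable (at t within I) \<and>
        continuous (at t within I) (coord_velocity c I \<gamma>))"


section \<open>Lorentz--Finsler structures in coordinates\<close>

text \<open>Functions of \<open>(x, v)\<close> are curried; \<open>dx\<close> and \<open>dv\<close> are the partial derivatives with
  respect to the base and the fiber coordinates.\<close>

definition pd :: "'i::finite \<Rightarrow> (real^'i \<Rightarrow> real) \<Rightarrow> real^'i \<Rightarrow> real" where
  "pd \<alpha> f x = frechet_derivative f (at x) (axis \<alpha> 1)"

definition dx :: "'i::finite \<Rightarrow> (real^'i \<Rightarrow> real^'i \<Rightarrow> real) \<Rightarrow> real^'i \<Rightarrow> real^'i \<Rightarrow> real" where
  "dx \<alpha> f x v = pd \<alpha> (\<lambda>y. f y v) x"

definition dv :: "'i::finite \<Rightarrow> (real^'i \<Rightarrow> real^'i \<Rightarrow> real) \<Rightarrow> real^'i \<Rightarrow> real^'i \<Rightarrow> real" where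
  "dv \<alpha> f x v = pd \<alpha> (f x) v"

definition christoffel ::
  "(real^'i \<Rightarrow> real^'i^'i) \<Rightarrow> 'i::finite \<Rightarrow> 'i \<Rightarrow> 'i \<Rightarrow> real^'i \<Rightarrow> real" where
  "christoffel g \<alpha> \<beta> \<delta> x = 1/2 * (\<Sum>\<mu>\<in>UNIV. matrix_inv (g x) $ \<alpha> $ \<mu> *
     (pd \<beta> (\<lambda>y. g y $ \<mu> $ \<delta>) x + pd \<delta> (\<lambda>y. g y $ \<beta> $ \<mu>) x - pd \<mu> (\<lambda>y. g y $ \<beta> $ \<delta>) x))"

definition Lc ::
  "('m, real^'i) chart set \<Rightarrow> (('m, real^'i) tvec \<Rightarrow> real) \<Rightarrow> ('m, real^'i) chart \<Rightarrow>
   real^'i \<Rightarrow> real^'i \<Rightarrow> real" where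
  "Lc A L c x v = L (tvec_of A c (cinv c x) v)"

definition fund ::
  "('m, real^'i) chart set \<Rightarrow> (('m, real^'i) tvec \<Rightarrow> real) \<Rightarrow> ('m, real^'i) chart \<Rightarrow>
   real^'i \<Rightarrow> real^'i \<Rightarrow> real^'i^'i" where
  "fund A L c x v = (\<chi> \<alpha> \<beta>. dv \<alpha> (dv \<beta> (Lc A L c)) x v)"

definition formal_christoffel ::
  "('m, real^'i) chart set \<Rightarrow> (('m, real^'i) tvec \<Rightarrow> real) \<Rightarrow> ('m, real^'i) chart \<Rightarrow>
   'i \<Rightarrow> 'i \<Rightarrow> 'i \<Rightarrow> real^'i \<Rightarrow> real^'i \<Rightarrow> real" where
  "formal_christoffel A L c \<alpha> \<beta> \<delta> x v = christoffel (\<lambda>y. fund A L c y v) \<alpha> \<beta> \<delta> x"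

definition spray ::
  "('m, real^'i) chart set \<Rightarrow> (('m, real^'i) tvec \<Rightarrow> real) \<Rightarrow> ('m, real^'i) chart \<Rightarrow>
   'i \<Rightarrow> real^'i \<Rightarrow> real^'i \<Rightarrow> real" where
  "spray A L c \<alpha> x v =
     1/2 * (\<Sum>\<beta>\<in>UNIV. \<Sum>\<delta>\<in>UNIV. formal_christoffel A L c \<alpha> \<beta> \<delta> x v * v $ \<beta> * v $ \<delta>)"

definition nonlinear_conn ::
  "('m, real^'i) chart set \<Rightarrow> (('m, real^'i) tvec \<Rightarrow> real) \<Rightarrow> ('m, real^'i) chart \<Rightarrow>
   'i \<Rightarrow> 'i \<Rightarrow> real^'i \<Rightarrow> real^'i \<Rightarrow> real" where
  "nonlinear_conn A L c \<alpha> \<beta> = dv \<beta> (spray A L c \<alpha>)"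

definition chern ::
  "('m, real^'i) chart set \<Rightarrow> (('m, real^'i) tvec \<Rightarrow> real) \<Rightarrow> ('m, real^'i) chart \<Rightarrow>
   'i \<Rightarrow> 'i \<Rightarrow> 'i \<Rightarrow> real^'i \<Rightarrow> real^'i \<Rightarrow> real" where
  "chern A L c \<alpha> \<beta> \<delta> x v =
     (let g = (\<lambda>\<sigma> \<tau> y w. fund A L c y w $ \<sigma> $ \<tau>);
          N = (\<lambda>\<sigma> \<tau>. nonlinear_conn A L c \<sigma> \<tau> x v)
      in formal_christoffel A L c \<alpha> \<beta> \<delta> x v
         - 1/2 * (\<Sum>\<kappa>\<in>UNIV. \<Sum>\<mu>\<in>UNIV. matrix_inv (fund A L c x v) $ \<alpha> $ \<kappa> *
             (dv \<mu> (g \<kappa> \<delta>) x v * N \<mu> \<beta> + dv \<mu> (g \<beta> \<kappa>) x v * N \<mu> \<delta>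
              - dv \<mu> (g \<beta> \<delta>) x v * N \<mu> \<kappa>)))"

definition curv ::
  "('m, real^'i) chart set \<Rightarrow> (('m, real^'i) tvec \<Rightarrow> real) \<Rightarrow> ('m, real^'i) chart \<Rightarrow>
   'i \<Rightarrow> 'i \<Rightarrow> real^'i \<Rightarrow> real^'i \<Rightarrow> real" where
  "curv A L c \<alpha> \<beta> x v =
     (let G = spray A L c; N = nonlinear_conn A L c
      in 2 * dx \<beta> (G \<alpha>) x v
         - (\<Sum>\<delta>\<in>UNIV. dx \<delta> (N \<alpha> \<beta>) x v * v $ \<delta> - 2 * dv \<delta> (N \<alpha> \<beta>) x v * G \<delta> x v)
         - (\<Sum>\<delta>\<in>UNIV. N \<alpha> \<delta> x v * N \<delta> \<beta> x v))"

definition Ric ::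
  "('m, real^'i) chart set \<Rightarrow> (('m, real^'i) tvec \<Rightarrow> real) \<Rightarrow> ('m, real^'i) tvec \<Rightarrow> real" where
  "Ric A L v = (let c = chart_at A (fst v) in
     \<Sum>\<alpha>\<in>UNIV. curv A L c \<alpha> \<alpha> (cmap c (fst v)) (snd v c))"

definition lorentzian_signature :: "real^'i^'i::finite \<Rightarrow> bool" where
  "lorentzian_signature G \<longleftrightarrow> transpose G = G \<and>
     (\<exists>(P :: real^'i^'i) k. invertible P \<and>
        transpose P ** G ** P = (\<chi> i j. if i \<noteq> j then 0 else if i = k then -1 else 1))"

definition lorentz_finsler ::
  "('m, real^'i) chart set \<Rightarrow> (('m, real^'i) tvec \<Rightarrow> real) \<Rightarrow> bool" where
  "lorentz_finsler A L \<longleftrightarrow>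
     (\<forall>c\<in>A. smooth_on (cimg c \<times> (UNIV - {0})) (\<lambda>(x, v). Lc A L c x v)) \<and>
     (\<forall>v\<in>tangent_bundle A. \<forall>r>0. L (tscale r v) = r\<^sup>2 * L v) \<and>
     (\<forall>c\<in>A. \<forall>x\<in>cimg c. \<forall>v. v \<noteq> 0 \<longrightarrow> lorentzian_signature (fund A L c x v))"

text \<open>A Finsler spacetime, \<open>X\<close> being the time orientation.\<close>

definition finsler_spacetime ::
  "('m::{t2_space,second_countable_topology}, real^'i) chart set \<Rightarrow>
   (('m, real^'i) tvec \<Rightarrow> real) \<Rightarrow> ('m \<Rightarrow> ('m, real^'i) tvec) \<Rightarrow> bool" where
  "finsler_spacetime A L X \<longleftrightarrow> smooth_manifold A \<and> connected (UNIV :: 'm set) \<and>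
     lorentz_finsler A L \<and> smooth_vector_field A X \<and> (\<forall>p. L (X p) < 0)"

definition berwald ::
  "('m, real^'i) chart set \<Rightarrow> (('m, real^'i) tvec \<Rightarrow> real) \<Rightarrow> bool" where
  "berwald A L \<longleftrightarrow> (\<forall>c\<in>A. \<forall>x\<in>cimg c. \<forall>\<alpha> \<beta> \<delta> v w. v \<noteq> 0 \<and> w \<noteq> 0 \<longrightarrow>
     chern A L c \<alpha> \<beta> \<delta> x v = chern A L c \<alpha> \<beta> \<delta> x w)"

definition g_at ::
  "('m, real^'i) chart set \<Rightarrow> (('m, real^'i) tvec \<Rightarrow> real) \<Rightarrow> ('m, real^'i) tvec \<Rightarrow>
   ('m, real^'i) tvec \<Rightarrow> ('m, real^'i) tvec \<Rightarrow> real" where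
  "g_at A L v u w = (let c = chart_at A (fst v) in
     snd u c \<bullet> (fund A L c (cmap c (fst v)) (snd v c) *v snd w c))"

definition reverse_L ::
  "(('m, real^'i) tvec \<Rightarrow> real) \<Rightarrow> ('m, real^'i) tvec \<Rightarrow> real" where
  "reverse_L L v = L (tminus v)"

definition reverse_X :: "('m \<Rightarrow> ('m, real^'i) tvec) \<Rightarrow> 'm \<Rightarrow> ('m, real^'i) tvec" where
  "reverse_X X p = tminus (X p)"


section \<open>Causality\<close>

definition timelike_cone ::
  "('m::topological_space, real^'i) chart set \<Rightarrow> (('m, real^'i) tvec \<Rightarrow> real) \<Rightarrow>
   ('m \<Rightarrow> ('m, real^'i) tvec) \<Rightarrow> 'm \<Rightarrow> ('m, real^'i) tvec set" where
  "timelike_cone A L X p = connected_component_set {v \<in> tangent_space A p. L v < 0} (X p)"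

text \<open>Tangent spaces are closed in the type of tangent vectors, so this is the closure within the
  tangent space.\<close>

definition causal_cone ::
  "('m::topological_space, real^'i) chart set \<Rightarrow> (('m, real^'i) tvec \<Rightarrow> real) \<Rightarrow>
   ('m \<Rightarrow> ('m, real^'i) tvec) \<Rightarrow> 'm \<Rightarrow> ('m, real^'i) tvec set" where
  "causal_cone A L X p = closure (timelike_cone A L X p) - {tzero p}"

definition finsler_F :: "(('m, real^'i) tvec \<Rightarrow> real) \<Rightarrow> ('m, real^'i) tvec \<Rightarrow> real" where
  "finsler_F L v = sqrt (- 2 * L v)"

definition has_timelike_velocity where
  "has_timelike_velocity A L X I \<gamma> \<longleftrightarrow> (\<forall>t\<in>I. velocity A I \<gamma> t \<in> timelike_cone A L X (\<gamma> t))"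

definition has_causal_velocity where
  "has_causal_velocity A L X I \<gamma> \<longleftrightarrow> (\<forall>t\<in>I. velocity A I \<gamma> t \<in> causal_cone A L X (\<gamma> t))"

definition chronological ::
  "('m::topological_space, real^'i) chart set \<Rightarrow> (('m, real^'i) tvec \<Rightarrow> real) \<Rightarrow>
   ('m \<Rightarrow> ('m, real^'i) tvec) \<Rightarrow> 'm \<Rightarrow> 'm \<Rightarrow> bool" where
  "chronological A L X x y \<longleftrightarrow> (\<exists>\<gamma> a b. a < b \<and> C1_curve A {a..b} \<gamma> \<and>
     has_timelike_velocity A L X {a..b} \<gamma> \<and> \<gamma> a = x \<and> \<gamma> b = y)"

definition curve_length ::
  "('m, real^'i) chart set \<Rightarrow> (('m, real^'i) tvec \<Rightarrow> real) \<Rightarrow> (real \<Rightarrow> 'm) \<Rightarrow> real \<Rightarrow> real \<Rightarrow> real" where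
  "curve_length A L \<gamma> a b = integral {a..b} (\<lambda>t. finsler_F L (velocity A {a..b} \<gamma> t))"

text \<open>\<open>d\<close> may take the value \<open>\<infinity>\<close>; lengths are nonnegative, so inserting \<open>0\<close> only matters when
  there is no causal curve.\<close>

definition lorentz_dist ::
  "('m::topological_space, real^'i) chart set \<Rightarrow> (('m, real^'i) tvec \<Rightarrow> real) \<Rightarrow>
   ('m \<Rightarrow> ('m, real^'i) tvec) \<Rightarrow> 'm \<Rightarrow> 'm \<Rightarrow> ereal" where
  "lorentz_dist A L X x y = Sup (insert 0 {ereal (curve_length A L \<gamma> a b) | \<gamma> a b.
     a < b \<and> C1_curve A {a..b} \<gamma> \<and> has_causal_velocity A L X {a..b} \<gamma> \<and> \<gamma> a = x \<and> \<gamma> b = y})"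

definition is_maximizing ::
  "('m::topological_space, real^'i) chart set \<Rightarrow> (('m, real^'i) tvec \<Rightarrow> real) \<Rightarrow>
   ('m \<Rightarrow> ('m, real^'i) tvec) \<Rightarrow> (real \<Rightarrow> 'm) \<Rightarrow> real \<Rightarrow> real \<Rightarrow> bool" where
  "is_maximizing A L X \<gamma> a b \<longleftrightarrow>
     ereal (curve_length A L \<gamma> a b) = lorentz_dist A L X (\<gamma> a) (\<gamma> b)"


section \<open>Geodesics and completeness\<close>

text \<open>The definition makes sense for any \<open>L\<close> with nondegenerate \<open>g\<^sub>v\<close>, in particular for the
  quadratic function of a semi-Riemannian metric of any signature.\<close>

definition geodesic ::
  "('m::topological_space, real^'i) chart set \<Rightarrow> (('m, real^'i) tvec \<Rightarrow> real) \<Rightarrow>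
   real set \<Rightarrow> (real \<Rightarrow> 'm) \<Rightarrow> bool" where
  "geodesic A L I \<gamma> \<longleftrightarrow> continuous_on I \<gamma> \<and>
     (\<forall>c\<in>A. \<forall>t\<in>I. \<gamma> t \<in> cdom c \<longrightarrow>
        (cmap c \<circ> \<gamma>) differentiable (at t within I) \<and>
        (coord_velocity c I \<gamma> has_vector_derivative
           (\<chi> \<alpha>. - 2 * spray A L c \<alpha> (cmap c (\<gamma> t)) (coord_velocity c I \<gamma> t))) (at t within I))"

definition timelike_geodesic where
  "timelike_geodesic A L X I \<gamma> \<longleftrightarrow> geodesic A L I \<gamma> \<and> has_timelike_velocity A L X I \<gamma>"

definition timelike_geodesically_complete ::
  "('m::topological_space, real^'i) chart set \<Rightarrow> (('m, real^'i) tvec \<Rightarrow> real) \<Rightarrow>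
   ('m \<Rightarrow> ('m, real^'i) tvec) \<Rightarrow> bool" where
  "timelike_geodesically_complete A L X \<longleftrightarrow>
     (\<forall>I \<gamma>. interval_dom I \<and> timelike_geodesic A L X I \<gamma> \<longrightarrow>
        (\<exists>\<sigma>. geodesic A L UNIV \<sigma> \<and> (\<forall>t\<in>I. \<sigma> t = \<gamma> t)))"

text \<open>\<open>ray_dom T\<close> is \<open>[0, T)\<close>, where \<open>T = \<infinity>\<close> is allowed; \<open>to_end T\<close> is the filter \<open>t \<rightarrow> T\<close> on
  the reals.\<close>

definition ray_dom :: "ereal \<Rightarrow> real set" where
  "ray_dom T = {t. 0 \<le> t \<and> ereal t < T}"

definition to_end :: "ereal \<Rightarrow> real filter" where
  "to_end T = filtercomap ereal (at_left T)"

definition future_inextendible :: "ereal \<Rightarrow> (real \<Rightarrow> 'm::topological_space) \<Rightarrow> bool" where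
  "future_inextendible T \<gamma> \<longleftrightarrow> \<not> (\<exists>p. (\<gamma> \<longlongrightarrow> p) (to_end T))"

definition future_timelike_eps_complete ::
  "nat \<Rightarrow> ('m::topological_space, real^'i) chart set \<Rightarrow> (('m, real^'i) tvec \<Rightarrow> real) \<Rightarrow>
   ('m \<Rightarrow> ('m, real^'i) tvec) \<Rightarrow> ('m \<Rightarrow> real) \<Rightarrow> real \<Rightarrow> bool" where
  "future_timelike_eps_complete n A L X \<Psi> \<epsilon> \<longleftrightarrow>
     (\<forall>T \<gamma>. 0 < T \<and> timelike_geodesic A L X (ray_dom T) \<gamma> \<and> future_inextendible T \<gamma> \<longrightarrow>
        filterlim (\<lambda>t. integral {0..t} (\<lambda>s. exp (2 * (\<epsilon> - 1) / real n * \<Psi> (\<gamma> s))))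
          at_top (to_end T))"

definition timelike_eps_complete ::
  "nat \<Rightarrow> ('m::topological_space, real^'i) chart set \<Rightarrow> (('m, real^'i) tvec \<Rightarrow> real) \<Rightarrow>
   ('m \<Rightarrow> ('m, real^'i) tvec) \<Rightarrow> ('m \<Rightarrow> real) \<Rightarrow> real \<Rightarrow> bool" where
  "timelike_eps_complete n A L X \<Psi> \<epsilon> \<longleftrightarrow>
     future_timelike_eps_complete n A L X \<Psi> \<epsilon> \<and>
     future_timelike_eps_complete n A (reverse_L L) (reverse_X X) \<Psi> \<epsilon>"


section \<open>Weighted Ricci curvature\<close>

text \<open>The geodesic with initial velocity \<open>v\<close>; only its germ at \<open>0\<close> is determined.\<close>

definition geodesic_from ::
  "('m::topological_space, real^'i) chart set \<Rightarrow> (('m, real^'i) tvec \<Rightarrow> real) \<Rightarrow>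
   ('m, real^'i) tvec \<Rightarrow> real \<Rightarrow> 'm" where
  "geodesic_from A L v = (SOME \<gamma>. \<exists>e>0. geodesic A L {-e<..<e} \<gamma> \<and> velocity A {-e<..<e} \<gamma> 0 = v)"

text \<open>The value is in \<open>ereal\<close> because the limit defining it for \<open>N = n\<close> can be \<open>-\<infinity>\<close>. The
  parameter \<open>N\<close> is a real number or \<open>\<infinity>\<close>.\<close>

definition Ric_weighted ::
  "nat \<Rightarrow> ('m::topological_space, real^'i) chart set \<Rightarrow> (('m, real^'i) tvec \<Rightarrow> real) \<Rightarrow>
   ('m \<Rightarrow> real) \<Rightarrow> ereal \<Rightarrow> ('m, real^'i) tvec \<Rightarrow> ereal" where
  "Ric_weighted n A L \<Psi> N v =
     (let f = \<Psi> \<circ> geodesic_from A L v;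
          Ric_N = (\<lambda>r. Ric A L v + deriv (deriv f) 0 - (deriv f 0)\<^sup>2 / (r - real n))
      in if N = \<infinity> then ereal (Ric A L v + deriv (deriv f) 0)
         else if N = ereal (real n) then Lim (at_right (real n)) (\<lambda>r. ereal (Ric_N r))
         else ereal (Ric_N (real_of_ereal N)))"

definition eps_range :: "nat \<Rightarrow> ereal \<Rightarrow> real set" where
  "eps_range n N =
     (if N = \<infinity> then {\<epsilon>. \<bar>\<epsilon>\<bar> < 1}
      else if N = ereal (real n) then UNIV
      else {\<epsilon>. \<bar>\<epsilon>\<bar> < sqrt (real_of_ereal N / (real_of_ereal N - real n))})"


section \<open>Semi-Riemannian metrics\<close>

definition metric_comp ::
  "('m, real^'i) chart set \<Rightarrow> (('m, real^'i) tvec \<Rightarrow> ('m, real^'i) tvec \<Rightarrow> real) \<Rightarrow>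
   ('m, real^'i) chart \<Rightarrow> real^'i \<Rightarrow> real^'i^'i" where
  "metric_comp A g c x =
     (\<chi> \<alpha> \<beta>. g (tvec_of A c (cinv c x) (axis \<alpha> 1)) (tvec_of A c (cinv c x) (axis \<beta> 1)))"

definition smooth_bilinear_field ::
  "('m, real^'i) chart set \<Rightarrow> (('m, real^'i) tvec \<Rightarrow> ('m, real^'i) tvec \<Rightarrow> real) \<Rightarrow> bool" where
  "smooth_bilinear_field A g \<longleftrightarrow> (\<forall>c\<in>A. smooth_on (cimg c) (metric_comp A g c) \<and>
     (\<forall>p\<in>cdom c. bilinear (\<lambda>u w. g (tvec_of A c p u) (tvec_of A c p w))))"

definition lorentzian_metric ::
  "('m, real^'i) chart set \<Rightarrow> (('m, real^'i) tvec \<Rightarrow> ('m, real^'i) tvec \<Rightarrow> real) \<Rightarrow> bool" where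
  "lorentzian_metric A g \<longleftrightarrow> smooth_bilinear_field A g \<and>
     (\<forall>c\<in>A. \<forall>x\<in>cimg c. lorentzian_signature (metric_comp A g c x))"

definition riemannian_metric ::
  "('m, real^'i) chart set \<Rightarrow> (('m, real^'i) tvec \<Rightarrow> ('m, real^'i) tvec \<Rightarrow> real) \<Rightarrow> bool" where
  "riemannian_metric A g \<longleftrightarrow> smooth_bilinear_field A g \<and>
     (\<forall>p. \<forall>u\<in>tangent_space A p. \<forall>w\<in>tangent_space A p. g u w = g w u) \<and>
     (\<forall>p. \<forall>u\<in>tangent_space A p - {tzero p}. 0 < g u u)"

text \<open>The Lorentz--Finsler function of a metric: its fundamental tensor is \<open>g\<close>, hence its
  geodesics, causality and distance are those of \<open>g\<close>.\<close>

definition metric_L ::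
  "(('m, real^'i) tvec \<Rightarrow> ('m, real^'i) tvec \<Rightarrow> real) \<Rightarrow> ('m, real^'i) tvec \<Rightarrow> real" where
  "metric_L g v = g v v / 2"

definition levi_civita_is_chern ::
  "('m, real^'i) chart set \<Rightarrow> (('m, real^'i) tvec \<Rightarrow> ('m, real^'i) tvec \<Rightarrow> real) \<Rightarrow>
   (('m, real^'i) tvec \<Rightarrow> real) \<Rightarrow> bool" where
  "levi_civita_is_chern A g L \<longleftrightarrow> (\<forall>c\<in>A. \<forall>x\<in>cimg c. \<forall>\<alpha> \<beta> \<delta> v. v \<noteq> 0 \<longrightarrow>
     christoffel (metric_comp A g c) \<alpha> \<beta> \<delta> x = chern A L c \<alpha> \<beta> \<delta> x v)"

text \<open>No time orientation is needed here.\<close>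

definition metric_timelike_complete ::
  "('m::topological_space, real^'i) chart set \<Rightarrow>
   (('m, real^'i) tvec \<Rightarrow> ('m, real^'i) tvec \<Rightarrow> real) \<Rightarrow> bool" where
  "metric_timelike_complete A g \<longleftrightarrow>
     (\<forall>I \<gamma>. interval_dom I \<and> geodesic A (metric_L g) I \<gamma> \<and>
        (\<forall>t\<in>I. g (velocity A I \<gamma> t) (velocity A I \<gamma> t) < 0) \<longrightarrow>
        (\<exists>\<sigma>. geodesic A (metric_L g) UNIV \<sigma> \<and> (\<forall>t\<in>I. \<sigma> t = \<gamma> t)))"

text \<open>Completeness is geodesic completeness (equivalent to metric completeness by Hopf--Rinow).\<close>

definition complete_riemannian ::
  "('m::{t2_space,second_countable_topology}, real^'i) chart set \<Rightarrow>
   (('m, real^'i) tvec \<Rightarrow> ('m, real^'i) tvec \<Rightarrow> real) \<Rightarrow> bool" where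
  "complete_riemannian A g \<longleftrightarrow> smooth_manifold A \<and> riemannian_metric A g \<and>
     (\<forall>I \<gamma>. interval_dom I \<and> geodesic A (metric_L g) I \<gamma> \<longrightarrow>
        (\<exists>\<sigma>. geodesic A (metric_L g) UNIV \<sigma> \<and> (\<forall>t\<in>I. \<sigma> t = \<gamma> t)))"

definition metric_isometry ::
  "('m::topological_space, 'e::euclidean_space) chart set \<Rightarrow>
   (('m, 'e) tvec \<Rightarrow> ('m, 'e) tvec \<Rightarrow> real) \<Rightarrow>
   ('k::topological_space, 'f::euclidean_space) chart set \<Rightarrow>
   (('k, 'f) tvec \<Rightarrow> ('k, 'f) tvec \<Rightarrow> real) \<Rightarrow> ('m \<Rightarrow> 'k) \<Rightarrow> bool" where
  "metric_isometry A g B h f \<longleftrightarrow> diffeomorphism A B f \<and>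
     (\<forall>p. \<forall>u\<in>tangent_space A p. \<forall>w\<in>tangent_space A p. h (dmap A B f u) (dmap A B f w) = g u w)"

definition lorentz_product ::
  "('s::topological_space, 'f::euclidean_space) chart set \<Rightarrow>
   (('s, 'f) tvec \<Rightarrow> ('s, 'f) tvec \<Rightarrow> real) \<Rightarrow>
   (real \<times> 's, real \<times> 'f) tvec \<Rightarrow> (real \<times> 's, real \<times> 'f) tvec \<Rightarrow> real" where
  "lorentz_product B h u w =
     - dfun (line_product B) fst u * dfun (line_product B) fst w
     + h (dmap (line_product B) B snd u) (dmap (line_product B) B snd w)"

text \<open>Smooth covering by a simply connected manifold; the last condition says that \<open>\<pi>\<close> is a local
  diffeomorphism. The library notion of simple connectedness includes path-connectedness.\<close>

definition universal_cover ::
  "('q::{t2_space,second_countable_topology}, 'e::euclidean_space) chart set \<Rightarrow>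
   ('m::topological_space, 'e) chart set \<Rightarrow> ('q \<Rightarrow> 'm) \<Rightarrow> bool" where
  "universal_cover B A \<pi> \<longleftrightarrow> smooth_manifold B \<and> simply_connected (UNIV :: 'q set) \<and>
     covering_space UNIV \<pi> UNIV \<and> smooth_map B A \<pi> \<and>
     (\<forall>q. bij_betw (dmap B A \<pi>) (tangent_space B q) (tangent_space A (\<pi> q)))"

definition pullback_metric ::
  "('q, 'e::euclidean_space) chart set \<Rightarrow> ('m, 'e) chart set \<Rightarrow> ('q \<Rightarrow> 'm) \<Rightarrow>
   (('m, 'e) tvec \<Rightarrow> ('m, 'e) tvec \<Rightarrow> real) \<Rightarrow> ('q, 'e) tvec \<Rightarrow> ('q, 'e) tvec \<Rightarrow> real" where
  "pullback_metric B A \<pi> g u w = g (dmap B A \<pi> u) (dmap B A \<pi> w)"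


section \<open>Gradient\<close>

definition L_dual ::
  "('m::topological_space, real^'i) chart set \<Rightarrow> (('m, real^'i) tvec \<Rightarrow> real) \<Rightarrow>
   ('m \<Rightarrow> ('m, real^'i) tvec) \<Rightarrow> 'm \<Rightarrow> (('m, real^'i) tvec \<Rightarrow> real) \<Rightarrow> real" where
  "L_dual A L X p \<omega> =
     - 1/2 * (SUP v \<in> {v \<in> timelike_cone A L X p. finsler_F L v = 1}. \<omega> v)\<^sup>2"

text \<open>Meaningful for linear \<open>\<omega>\<close> that are negative on \<open>causal_cone A L X p\<close>.\<close>

definition legendre ::
  "('m::topological_space, real^'i) chart set \<Rightarrow> (('m, real^'i) tvec \<Rightarrow> real) \<Rightarrow>
   ('m \<Rightarrow> ('m, real^'i) tvec) \<Rightarrow> 'm \<Rightarrow> (('m, real^'i) tvec \<Rightarrow> real) \<Rightarrow> ('m, real^'i) tvec" where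
  "legendre A L X p \<omega> = (THE v. v \<in> timelike_cone A L X p \<and>
     L v = L_dual A L X p \<omega> \<and> L v = \<omega> v / 2)"

text \<open>The gradient of a \<open>C\<^sup>1\<close> function \<open>h\<close> such that \<open>- h\<close> is temporal, that is, such that \<open>dh\<close> is
  negative on causal vectors.\<close>

definition gradient ::
  "('m::topological_space, real^'i) chart set \<Rightarrow> (('m, real^'i) tvec \<Rightarrow> real) \<Rightarrow>
   ('m \<Rightarrow> ('m, real^'i) tvec) \<Rightarrow> ('m \<Rightarrow> real) \<Rightarrow> 'm \<Rightarrow> ('m, real^'i) tvec" where
  "gradient A L X h p = legendre A L X p (dfun A h)"


section \<open>Lines, Busemann functions and asymptotes\<close>

definition straight_line ::
  "('m::topological_space, real^'i) chart set \<Rightarrow> (('m, real^'i) tvec \<Rightarrow> real) \<Rightarrow>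
   ('m \<Rightarrow> ('m, real^'i) tvec) \<Rightarrow> (real \<Rightarrow> 'm) \<Rightarrow> bool" where
  "straight_line A L X \<eta> \<longleftrightarrow> timelike_geodesic A L X UNIV \<eta> \<and>
     (\<forall>t. finsler_F L (velocity A UNIV \<eta> t) = 1) \<and>
     (\<forall>s t. s < t \<longrightarrow> lorentz_dist A L X (\<eta> s) (\<eta> t) = ereal (t - s))"

definition busemann ::
  "('m::topological_space, real^'i) chart set \<Rightarrow> (('m, real^'i) tvec \<Rightarrow> real) \<Rightarrow>
   ('m \<Rightarrow> ('m, real^'i) tvec) \<Rightarrow> (real \<Rightarrow> 'm) \<Rightarrow> 'm \<Rightarrow> ereal" where
  "busemann A L X \<eta> x = Lim at_top (\<lambda>t. ereal t - lorentz_dist A L X x (\<eta> t))"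

definition busemann_bar ::
  "('m::topological_space, real^'i) chart set \<Rightarrow> (('m, real^'i) tvec \<Rightarrow> real) \<Rightarrow>
   ('m \<Rightarrow> ('m, real^'i) tvec) \<Rightarrow> (real \<Rightarrow> 'm) \<Rightarrow> 'm \<Rightarrow> ereal" where
  "busemann_bar A L X \<eta> x = Lim at_top (\<lambda>t. ereal t - lorentz_dist A L X (\<eta> (- t)) x)"

definition line_domain ::
  "('m::topological_space, real^'i) chart set \<Rightarrow> (('m, real^'i) tvec \<Rightarrow> real) \<Rightarrow>
   ('m \<Rightarrow> ('m, real^'i) tvec) \<Rightarrow> (real \<Rightarrow> 'm) \<Rightarrow> 'm set" where
  "line_domain A L X \<eta> =
     (\<Union>t\<in>{0<..}. {y. chronological A L X (\<eta> (- t)) y}) \<inter>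
     (\<Union>t\<in>{0<..}. {y. chronological A L X y (\<eta> t)})"

definition is_ray ::
  "('m::topological_space, real^'i) chart set \<Rightarrow> (('m, real^'i) tvec \<Rightarrow> real) \<Rightarrow>
   ('m \<Rightarrow> ('m, real^'i) tvec) \<Rightarrow> (real \<Rightarrow> 'm) \<Rightarrow> bool" where
  "is_ray A L X \<gamma> \<longleftrightarrow> geodesic A L {0..} \<gamma> \<and> has_causal_velocity A L X {0..} \<gamma> \<and>
     future_inextendible \<infinity> \<gamma> \<and> (\<forall>s t. 0 \<le> s \<and> s < t \<longrightarrow> is_maximizing A L X \<gamma> s t)"

text \<open>Uniform convergence on compact intervals of curves \<open>z k\<close> on \<open>[0, a k]\<close> to a continuous curve
  on \<open>[0, \<infinity>)\<close>, expressed through the compact-open topology, with which it agrees for any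
  metric inducing the topology of the manifold.\<close>

definition curves_converge ::
  "(nat \<Rightarrow> real \<Rightarrow> 'm::topological_space) \<Rightarrow> (nat \<Rightarrow> real) \<Rightarrow> (real \<Rightarrow> 'm) \<Rightarrow> bool" where
  "curves_converge z a \<gamma> \<longleftrightarrow> (\<forall>s t U. 0 \<le> s \<and> s \<le> t \<and> open U \<and> \<gamma> ` {s..t} \<subseteq> U \<longrightarrow>
     (\<forall>\<^sub>F k in sequentially. t \<le> a k \<and> z k ` {s..t} \<subseteq> U))"

text \<open>Here \<open>r\<close> selects the subsequence and the \<open>\<rho> k\<close> are the reparametrizations.\<close>

definition asymptote ::
  "('m::topological_space, real^'i) chart set \<Rightarrow> (('m, real^'i) tvec \<Rightarrow> real) \<Rightarrow>
   ('m \<Rightarrow> ('m, real^'i) tvec) \<Rightarrow> (real \<Rightarrow> 'm) \<Rightarrow> 'm \<Rightarrow> (real \<Rightarrow> 'm) \<Rightarrow> bool" where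
  "asymptote A L X \<eta> x \<gamma> \<longleftrightarrow> x \<in> line_domain A L X \<eta> \<and> is_ray A L X \<gamma> \<and>
     (\<exists>z a \<tau>. filterlim \<tau> at_top sequentially \<and>
        (\<forall>k. 0 < a k \<and> C1_curve A {0..a k} (z k) \<and> has_causal_velocity A L X {0..a k} (z k) \<and>
             is_maximizing A L X (z k) 0 (a k) \<and> z k 0 = x \<and> z k (a k) = \<eta> (\<tau> k)) \<and>
        (\<exists>r \<rho> a'. strict_mono r \<and>
           (\<forall>k. 0 < a' k \<and> continuous_on {0..a' k} (\<rho> k) \<and> strict_mono_on {0..a' k} (\<rho> k) \<and>
                \<rho> k 0 = 0 \<and> \<rho> k (a' k) = a (r k)) \<and>
           curves_converge (\<lambda>k. z (r k) \<circ> \<rho> k) a' \<gamma>))"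

definition bi_asymptotic ::
  "('m::topological_space, real^'i) chart set \<Rightarrow> (('m, real^'i) tvec \<Rightarrow> real) \<Rightarrow>
   ('m \<Rightarrow> ('m, real^'i) tvec) \<Rightarrow> (real \<Rightarrow> 'm) \<Rightarrow> (real \<Rightarrow> 'm) \<Rightarrow> bool" where
  "bi_asymptotic A L X \<eta> \<zeta> \<longleftrightarrow> straight_line A L X \<zeta> \<and> \<zeta> 0 \<in> line_domain A L X \<eta> \<and>
     busemann A L X \<eta> (\<zeta> 0) + busemann_bar A L X \<eta> (\<zeta> 0) = 0 \<and>
     asymptote A L X \<eta> (\<zeta> 0) \<zeta> \<and> has_timelike_velocity A L X {0..} \<zeta> \<and>
     asymptote A (reverse_L L) (reverse_X X) (\<lambda>t. \<eta> (- t)) (\<zeta> 0) (\<lambda>t. \<zeta> (- t)) \<and>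
     has_timelike_velocity A (reverse_L L) (reverse_X X) {0..} (\<lambda>t. \<zeta> (- t))"

text \<open>For a Lorentzian metric \<open>g\<close>, time oriented by \<open>X\<close>: \<open>\<eta>\<close> is future-directed timelike and, up to
  the scaling of its parameter, a straight line.\<close>

definition metric_line ::
  "('m::topological_space, real^'i) chart set \<Rightarrow>
   (('m, real^'i) tvec \<Rightarrow> ('m, real^'i) tvec \<Rightarrow> real) \<Rightarrow>
   ('m \<Rightarrow> ('m, real^'i) tvec) \<Rightarrow> (real \<Rightarrow> 'm) \<Rightarrow> bool" where
  "metric_line A g X \<eta> \<longleftrightarrow> smooth_vector_field A X \<and> (\<forall>p. g (X p) (X p) < 0) \<and>
     has_timelike_velocity A (metric_L g) X UNIV \<eta> \<and>
     (\<forall>s t. s < t \<longrightarrow> lorentz_dist A (metric_L g) X (\<eta> s) (\<eta> t) =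
        ereal (sqrt (- g (velocity A UNIV \<eta> s) (velocity A UNIV \<eta> s)) * (t - s)))"

text \<open>\<open>\<Theta>\<close> is an isometry from \<open>(\<real> \<times> \<Sigma>, -dt\<^sup>2 + h)\<close> onto \<open>M\<close> with the metric
  \<open>g\<^sub>V\<close>, where \<open>V\<close> is the gradient of the Busemann function \<open>busemann_bar\<close>, and
  the curves \<open>t \<mapsto> \<Theta> (t, x)\<close> are bi-asymptotic to \<open>\<eta>\<close>.\<close>

definition splitting ::
  "('m::topological_space, real^'i) chart set \<Rightarrow> (('m, real^'i) tvec \<Rightarrow> real) \<Rightarrow>
   ('m \<Rightarrow> ('m, real^'i) tvec) \<Rightarrow> (real \<Rightarrow> 'm) \<Rightarrow>
   ('s::{t2_space,second_countable_topology}, real^'j) chart set \<Rightarrow>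
   (('s, real^'j) tvec \<Rightarrow> ('s, real^'j) tvec \<Rightarrow> real) \<Rightarrow> (real \<times> 's \<Rightarrow> 'm) \<Rightarrow> bool" where
  "splitting A L X \<eta> S h \<Theta> \<longleftrightarrow> complete_riemannian S h \<and>
     (let V = gradient A L X (\<lambda>x. real_of_ereal (busemann_bar A L X \<eta> x))
      in metric_isometry (line_product S) (lorentz_product S h) A (\<lambda>u w. g_at A L (V (fst u)) u w) \<Theta>) \<and>
     (\<forall>x. bi_asymptotic A L X \<eta> (\<lambda>t. \<Theta> (t, x)))"

definition translation :: "(real \<times> 's \<Rightarrow> 'm) \<Rightarrow> real \<Rightarrow> 'm \<Rightarrow> 'm" where
  "translation \<Theta> t = \<Theta> \<circ> (\<lambda>(s, x). (s + t, x)) \<circ> inv \<Theta>"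

end

theory Submission
  imports Defs
begin

text \<open>Let \<open>b\<close> be the Busemann function of the reversed line and \<open>W = \<partial>\<^sub>t\<close> the velocity field of the lines
  \<open>t \<mapsto> \<Theta>(t, x)\<close>. Both Busemann functions of \<open>\<eta>\<close> add up to zero along a bi-asymptotic line and have a sum of
  constant sign nearby, so that one-sided estimates from the first variation of length along the line squeeze \<open>b\<close>
  into being differentiable there with \<open>db = g\<^sub>W(W, \<cdot>)\<close>. By the equality case of the reverse Cauchy--Schwarz
  inequality \<open>W\<close> is then the gradient, and the metric of the splitting is \<open>g\<^sub>W\<close>. In product coordinates with
  \<open>W\<close> the \<open>k\<close>-th coordinate field, \<open>g\<^sub>W = -dt\<^sup>2 + h\<close> yields that the Chern coefficients with one lower index \<open>k\<close>
  vanish at \<open>W\<close>. For a Berwald structure they vanish at every vector, so \<open>\<partial>\<^sub>t\<close> is parallel, and horizontal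
  constancy of \<open>L\<close> gives \<open>\<partial>L/\<partial>t = 0\<close>.\<close>

section \<open>Smooth functions\<close>

text \<open>The obstacle is that \<open>lorentz_dist\<close> is a supremum over C^1 causal curves,
  so two curves cannot simply be concatenated and the reverse triangle inequality is not free.
  Curves are therefore composed through their end velocities; where these differ, the corner is cut
  at an arbitrarily small loss of length, which works as soon as one of the two velocities at the
  joint is timelike. This is why the comparison of both Busemann functions at a single point is done
  at two points joined by a short timelike curve, which then shrinks. At W the Chern coefficients
  vanish for three reasons: the base derivatives of g_W that enter vanish, the spray is zero on the
  ray through W and so is its derivative along that ray, and the Cartan tensor contracted with W is
  zero by homogeneity. At a general v, the vanishing of these coefficients makes g horizontally
  constant in the time direction; contracting twice with v removes the nonlinear connection, by
  homogeneity again.\<close>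

lemma frechet_eqI: "(f has_derivative F) (at x) \<Longrightarrow> frechet_derivative f (at x) = F"
  by (rule frechet_derivative_at[symmetric])

lemma frechet_has_derivative:
  "f differentiable (at x) \<Longrightarrow> (f has_derivative frechet_derivative f (at x)) (at x)"
  by (simp add: frechet_derivative_works)

lemma C_k_on_cong:
  assumes "open S" "\<And>x. x \<in> S \<Longrightarrow> f x = g x" "C_k_on k S f"
  shows "C_k_on k S g"
  using assms(2,3)
proof (induction k arbitrary: f g)
  case 0
  then show ?case by (simp cong: continuous_on_cong)
next
  case (Suc k)
  have d: "(g has_derivative frechet_derivative f (at x)) (at x)" if "x \<in> S" for x
    using Suc.prems that assms(1)
    by (intro has_derivative_transform_within_open[OF frechet_has_derivative assms(1) that]) auto
  have e: "frechet_derivative f (at x) = frechet_derivative g (at x)" if "x \<in> S" for x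
    using frechet_eqI[OF d[OF that]] by simp
  show ?case
    unfolding C_k_on.simps
  proof (intro conjI ballI allI)
    fix v
    show "C_k_on k S (\<lambda>x. frechet_derivative g (at x) v)"
      by (rule Suc.IH[of "\<lambda>x. frechet_derivative f (at x) v"]) (use e Suc.prems in auto)
  qed (use d in \<open>auto simp: differentiable_def\<close>)
qed

lemma C_k_on_subset: "T \<subseteq> S \<Longrightarrow> C_k_on k S f \<Longrightarrow> C_k_on k T f"
  by (induction k arbitrary: f) (auto intro: continuous_on_subset)

lemma C_k_on_SucD: "C_k_on (Suc k) S f \<Longrightarrow> C_k_on k S f"
proof (induction k arbitrary: f)
  case 0
  then have "f differentiable_on S"
    by (auto simp: differentiable_on_def intro: differentiable_at_withinI)
  then show ?case by (simp add: differentiable_imp_continuous_on)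
next
  case (Suc k)
  from Suc.prems have "C_k_on k S (\<lambda>x. frechet_derivative f (at x) v)" for v
    by (metis C_k_on.simps(2) Suc.IH)
  with Suc.prems show ?case by simp
qed

text \<open>Composing maps between manifolds goes through an intermediate chart that depends on the
  point, so smoothness has to be checked near each point separately.\<close>

lemma C_k_on_local:
  assumes "\<And>x. x \<in> S \<Longrightarrow> \<exists>U. open U \<and> x \<in> U \<and> C_k_on k (U \<inter> S) f"
  shows "C_k_on k S f"
  using assms
proof (induction k arbitrary: f)
  case 0
  have "continuous (at x within S) f" if x: "x \<in> S" for x
  proof -
    obtain U where U: "open U" "x \<in> U" "continuous_on (U \<inter> S) f" using 0[OF x] by auto
    then have "continuous (at x within U \<inter> S) f" using x by (auto simp: continuous_on_eq_continuous_within)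
    then show ?thesis
      using U x at_within_nhd[of x U "U \<inter> S" S] by (metis Int_assoc Int_commute Int_absorb)
  qed
  then show ?case by (simp add: continuous_on_eq_continuous_within)
next
  case (Suc k)
  show ?case
    unfolding C_k_on.simps
  proof (intro conjI ballI allI)
    fix x assume "x \<in> S"
    with Suc.prems[OF this] show "f differentiable at x" by auto
  next
    fix v show "C_k_on k S (\<lambda>x. frechet_derivative f (at x) v)"
    proof (rule Suc.IH)
      fix x assume "x \<in> S"
      with Suc.prems[OF this] show "\<exists>U. open U \<and> x \<in> U \<and> C_k_on k (U \<inter> S) (\<lambda>x. frechet_derivative f (at x) v)"
        by auto
    qed
  qed
qed

lemma C_k_on_const: "open S \<Longrightarrow> C_k_on k S (\<lambda>_. c)"
  by (induction k arbitrary: c) (simp_all add: frechet_derivative_const)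

lemma C_k_on_bounded_linear:
  assumes "open S" "bounded_linear l" "C_k_on k S f"
  shows "C_k_on k S (\<lambda>x. l (f x))"
  using assms(3)
proof (induction k arbitrary: f)
  case 0
  then show ?case using assms(2) by (simp add: bounded_linear.continuous_on)
next
  case (Suc k)
  have d: "((\<lambda>x. l (f x)) has_derivative (\<lambda>v. l (frechet_derivative f (at x) v))) (at x)" if "x \<in> S" for x
    using Suc.prems that
    by (intro bounded_linear.has_derivative[OF assms(2)] frechet_has_derivative) auto
  show ?case
    unfolding C_k_on.simps
  proof (intro conjI ballI allI)
    fix v
    show "C_k_on k S (\<lambda>x. frechet_derivative (\<lambda>x. l (f x)) (at x) v)"
      by (rule C_k_on_cong[OF assms(1) _ Suc.IH[of "\<lambda>x. frechet_derivative f (at x) v"]])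
        (use frechet_eqI[OF d] Suc.prems in auto)
  qed (use d in \<open>auto simp: differentiable_def\<close>)
qed

lemma C_k_on_id: "open S \<Longrightarrow> C_k_on k S (\<lambda>x. x)"
proof (cases k)
  case (Suc m)
  assume S: "open S"
  have "frechet_derivative (\<lambda>x. x) (at x) v = v" for x v :: 'a
    by (metis frechet_eqI has_derivative_ident)
  then show ?thesis using S Suc by (simp add: C_k_on_const)
qed simp

lemma C_k_on_linear: "open S \<Longrightarrow> bounded_linear l \<Longrightarrow> C_k_on k S l"
  using C_k_on_bounded_linear[of S l k "\<lambda>x. x"] C_k_on_id by auto

lemma C_k_on_add:
  assumes "open S" "C_k_on k S f" "C_k_on k S g"
  shows "C_k_on k S (\<lambda>x. f x + g x)"
  using assms(2,3)
proof (induction k arbitrary: f g)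
  case 0
  then show ?case by (simp add: continuous_on_add)
next
  case (Suc k)
  have d: "((\<lambda>x. f x + g x) has_derivative (\<lambda>v. frechet_derivative f (at x) v + frechet_derivative g (at x) v)) (at x)" 
    if "x \<in> S" for x
    using Suc.prems that by (intro has_derivative_add frechet_has_derivative) auto
  show ?case
    unfolding C_k_on.simps
  proof (intro conjI ballI allI)
    fix v
    show "C_k_on k S (\<lambda>x. frechet_derivative (\<lambda>x. f x + g x) (at x) v)"
      by (rule C_k_on_cong[OF assms(1) _ Suc.IH[of "\<lambda>x. frechet_derivative f (at x) v" "\<lambda>x. frechet_derivative g (at x) v"]])
        (use frechet_eqI[OF d] Suc.prems in auto)
  qed (use d in \<open>auto simp: differentiable_def\<close>)
qed

lemma C_k_on_sum:
  assumes "open S" "\<And>i. i \<in> I \<Longrightarrow> C_k_on k S (f i)"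
  shows "C_k_on k S (\<lambda>x. \<Sum>i\<in>I. f i x)"
  using assms(2)
  by (induction I rule: infinite_finite_induct) (simp_all add: C_k_on_const C_k_on_add assms(1))

lemma C_k_on_bilinear:
  assumes "open S" "bounded_bilinear B" "C_k_on k S f" "C_k_on k S g"
  shows "C_k_on k S (\<lambda>x. B (f x) (g x))"
  using assms(3,4)
proof (induction k arbitrary: f g)
  case 0
  then show ?case using assms(2) by (simp add: bounded_bilinear.continuous_on)
next
  case (Suc k)
  have d: "((\<lambda>x. B (f x) (g x)) has_derivative
     (\<lambda>v. B (f x) (frechet_derivative g (at x) v) + B (frechet_derivative f (at x) v) (g x))) (at x)" 
    if "x \<in> S" for x
    using Suc.prems that by (intro bounded_bilinear.FDERIV[OF assms(2)] frechet_has_derivative) auto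
  have "C_k_on k S f" "C_k_on k S g" using Suc.prems C_k_on_SucD by blast+
  then have c: "C_k_on k S (\<lambda>x. B (f x) (frechet_derivative g (at x) v) + B (frechet_derivative f (at x) v) (g x))" for v
    using Suc.prems by (intro C_k_on_add[OF assms(1)] Suc.IH) auto
  show ?case
    unfolding C_k_on.simps
  proof (intro conjI ballI allI)
    fix v
    show "C_k_on k S (\<lambda>x. frechet_derivative (\<lambda>x. B (f x) (g x)) (at x) v)"
      by (rule C_k_on_cong[OF assms(1) _ c]) (use frechet_eqI[OF d] in auto)
  qed (use d in \<open>auto simp: differentiable_def\<close>)
qed

text \<open>\<open>C_k_on\<close> controls derivatives in fixed directions only, whereas the chain
  rule applies the derivative of g to a vector that moves with x. Expanding this vector in
  \<open>Basis\<close> leaves finitely many products of a coordinate function with a derivative of g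
  in a fixed direction, to which the induction hypothesis applies.\<close>

lemma C_k_on_compose:
  fixes f :: "'a::euclidean_space \<Rightarrow> 'b::euclidean_space" and g :: "'b \<Rightarrow> 'c::real_normed_vector"
  assumes "open S" "open T" "f ` S \<subseteq> T" "C_k_on k S f" "C_k_on k T g"
  shows "C_k_on k S (\<lambda>x. g (f x))"
  using assms(4,5)
proof (induction k arbitrary: g)
  case 0
  then show ?case using assms(3) by (auto intro: continuous_on_compose2)
next
  case (Suc k)
  have d: "((\<lambda>x. g (f x)) has_derivative (\<lambda>v. frechet_derivative g (at (f x)) (frechet_derivative f (at x) v))) (at x)" 
    if "x \<in> S" for x
    using Suc.prems that assms(3)
    by (intro has_derivative_compose[OF frechet_has_derivative frechet_has_derivative]) auto
  have e: "frechet_derivative g (at (f x)) (frechet_derivative f (at x) v) =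
     (\<Sum>b\<in>Basis. (frechet_derivative f (at x) v \<bullet> b) *\<^sub>R frechet_derivative g (at (f x)) b)" if "x \<in> S" for x v
  proof -
    have "linear (frechet_derivative g (at (f x)))"
      using Suc.prems that assms(3) by (intro linear_frechet_derivative) auto
    then show ?thesis
      using linear_sum[of "frechet_derivative g (at (f x))" "\<lambda>b. (frechet_derivative f (at x) v \<bullet> b) *\<^sub>R b" Basis]
      by (simp add: euclidean_representation linear_scale)
  qed
  have f: "C_k_on k S f" using Suc.prems C_k_on_SucD by blast
  have c: "C_k_on k S (\<lambda>x. \<Sum>b\<in>Basis. (frechet_derivative f (at x) v \<bullet> b) *\<^sub>R frechet_derivative g (at (f x)) b)" for v
    using Suc.prems
    by (intro C_k_on_sum[OF assms(1)] C_k_on_bilinear[OF assms(1) bounded_bilinear_scaleR] Suc.IH f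
        C_k_on_bounded_linear[OF assms(1) bounded_linear_inner_left]) auto
  show ?case
    unfolding C_k_on.simps
  proof (intro conjI ballI allI)
    fix v
    show "C_k_on k S (\<lambda>x. frechet_derivative (\<lambda>x. g (f x)) (at x) v)"
      by (rule C_k_on_cong[OF assms(1) _ c]) (use frechet_eqI[OF d] e in auto)
  qed (use d in \<open>auto simp: differentiable_def\<close>)
qed

lemma C_k_on_Pair:
  assumes "open S" "C_k_on k S f" "C_k_on k S g"
  shows "C_k_on k S (\<lambda>x. (f x, g x))"
proof -
  have "C_k_on k S (\<lambda>x. (f x, 0) + (0, g x))"
    by (intro C_k_on_add assms C_k_on_bounded_linear[of S "\<lambda>x. (x, 0)"] C_k_on_bounded_linear[of S "\<lambda>x. (0, x)"])
      (auto intro!: bounded_linear_Pair bounded_linear_zero bounded_linear_ident)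
  then show ?thesis by simp
qed

lemma smooth_on_cong: "open S \<Longrightarrow> (\<And>x. x \<in> S \<Longrightarrow> f x = g x) \<Longrightarrow> smooth_on S f \<Longrightarrow> smooth_on S g"
  unfolding smooth_on_def using C_k_on_cong by blast

lemma smooth_on_subset: "T \<subseteq> S \<Longrightarrow> smooth_on S f \<Longrightarrow> smooth_on T f"
  unfolding smooth_on_def using C_k_on_subset by blast

lemma smooth_on_local:
  "(\<And>x. x \<in> S \<Longrightarrow> \<exists>U. open U \<and> x \<in> U \<and> smooth_on (U \<inter> S) f) \<Longrightarrow> smooth_on S f"
  unfolding smooth_on_def by (meson C_k_on_local)

lemma smooth_on_compose:
  fixes f :: "'a::euclidean_space \<Rightarrow> 'b::euclidean_space"
  shows "open S \<Longrightarrow> open T \<Longrightarrow> f ` S \<subseteq> T \<Longrightarrow> smooth_on S f \<Longrightarrow> smooth_on T g \<Longrightarrow> smooth_on S (\<lambda>x. g (f x))"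
  unfolding smooth_on_def using C_k_on_compose by blast

lemma smooth_on_linear: "open S \<Longrightarrow> bounded_linear l \<Longrightarrow> smooth_on S l"
  unfolding smooth_on_def using C_k_on_linear by blast

lemma smooth_on_id: "open S \<Longrightarrow> smooth_on S (\<lambda>x. x)"
  unfolding smooth_on_def using C_k_on_id by blast

lemma smooth_on_const: "open S \<Longrightarrow> smooth_on S (\<lambda>x. c)"
  unfolding smooth_on_def using C_k_on_const by blast

lemma smooth_on_add: "open S \<Longrightarrow> smooth_on S f \<Longrightarrow> smooth_on S g \<Longrightarrow> smooth_on S (\<lambda>x. f x + g x)"
  unfolding smooth_on_def using C_k_on_add by blast

lemma smooth_on_Pair: "open S \<Longrightarrow> smooth_on S f \<Longrightarrow> smooth_on S g \<Longrightarrow> smooth_on S (\<lambda>x. (f x, g x))"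
  unfolding smooth_on_def using C_k_on_Pair by blast

lemma smooth_on_imp_continuous: "smooth_on S f \<Longrightarrow> continuous_on S f"
  unfolding smooth_on_def using C_k_on.simps(1) by blast

lemma smooth_on_has_derivative:
  "smooth_on S f \<Longrightarrow> x \<in> S \<Longrightarrow> (f has_derivative frechet_derivative f (at x)) (at x)"
  unfolding smooth_on_def by (metis C_k_on.simps(2) frechet_has_derivative)

lemma smooth_on_derivative: "smooth_on S f \<Longrightarrow> smooth_on S (\<lambda>x. frechet_derivative f (at x) v)"
  unfolding smooth_on_def by (metis C_k_on.simps(2))

text \<open>Both iterated derivatives are limits of the same second difference quotient.\<close>

lemma symmetric_frechet:
  fixes f :: "'a::euclidean_space \<Rightarrow> real"
  assumes S: "open S" "smooth_on S f" "x \<in> S"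
  shows "frechet_derivative (\<lambda>y. frechet_derivative f (at y) u) (at x) v =
         frechet_derivative (\<lambda>y. frechet_derivative f (at y) v) (at x) u"
proof -
  define D where "D u v y = frechet_derivative (\<lambda>y. frechet_derivative f (at y) u) (at y) v" for u v y
  have cont: "isCont (D u v) x" for u v
  proof -
    have "smooth_on S (D u v)" unfolding D_def by (intro smooth_on_derivative S)
    then show ?thesis using S smooth_on_imp_continuous continuous_on_eq_continuous_at by blast
  qed
  obtain r where r: "r > 0" "ball x r \<subseteq> S" using S open_contains_ball by blast
  define \<Delta> where "\<Delta> u v h = f (x + h *\<^sub>R u + h *\<^sub>R v) - f (x + h *\<^sub>R u) - f (x + h *\<^sub>R v) + f x" for u v h
  have *: "\<exists>z. dist x z \<le> h * (norm u + norm v) \<and> \<Delta> u v h = h * h * D u v z"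
    if h: "0 < h" "h * (norm u + norm v) < r" for u v h
  proof -
    have inS: "x + a *\<^sub>R u + b *\<^sub>R v \<in> S \<and> dist x (x + a *\<^sub>R u + b *\<^sub>R v) \<le> h * (norm u + norm v)" 
      if "0 \<le> a" "a \<le> h" "0 \<le> b" "b \<le> h" for a b
    proof -
      have "dist x (x + a *\<^sub>R u + b *\<^sub>R v) = norm (a *\<^sub>R u + b *\<^sub>R v)" 
        by (metis add.assoc add_diff_cancel_left' dist_norm norm_minus_commute)
      also have "\<dots> \<le> a * norm u + b * norm v" using norm_triangle_ineq[of "a *\<^sub>R u" "b *\<^sub>R v"] that by simp
      also have "\<dots> \<le> h * (norm u + norm v)" using that by (simp add: mult_right_mono add_mono distrib_left)
      finally show ?thesis using h r by auto
    qed
    \<comment> \<open>This is the first difference in direction v, as a function of the position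
      along u. The mean value theorem for it, and then for its derivative in direction v, yields a
      single intermediate point.\<close>
    define \<phi> where "\<phi> s = f (x + s *\<^sub>R u + h *\<^sub>R v) - f (x + s *\<^sub>R u)" for s
    define \<phi>' where "\<phi>' s = frechet_derivative f (at (x + s *\<^sub>R u + h *\<^sub>R v)) u - frechet_derivative f (at (x + s *\<^sub>R u)) u" for s
    have d1: "(f has_derivative frechet_derivative f (at y)) (at y)" if "y \<in> S" for y
      using smooth_on_has_derivative S that by blast
    have dg: "((\<lambda>s. F (p + s *\<^sub>R w)) has_real_derivative F' w) (at s)"
      if "(F has_derivative F') (at (p + s *\<^sub>R w))" for F :: "'a \<Rightarrow> real" and F' p s w
    proof -
      have "((\<lambda>s. F (p + s *\<^sub>R w)) has_derivative (\<lambda>t. F' (t *\<^sub>R w))) (at s)"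
        
        by (rule has_derivative_compose[of "\<lambda>s. p + s *\<^sub>R w" "\<lambda>t. t *\<^sub>R w" s UNIV F F'])
          (use that in \<open>auto intro!: derivative_eq_intros\<close>)
      moreover have "(\<lambda>t. F' (t *\<^sub>R w)) = (*) (F' w)"
        using has_derivative_linear[OF that] by (auto simp: linear_scale fun_eq_iff)
      ultimately show ?thesis by (simp add: has_field_derivative_def)
    qed
    have "(\<phi> has_real_derivative \<phi>' s) (at s)" if "0 \<le> s" "s \<le> h" for s
      unfolding \<phi>_def \<phi>'_def
    proof (rule DERIV_diff)
      show "((\<lambda>s. f (x + s *\<^sub>R u + h *\<^sub>R v)) has_real_derivative frechet_derivative f (at (x + s *\<^sub>R u + h *\<^sub>R v)) u) (at s)"
        using dg[of f _ "x + h *\<^sub>R v" s u] d1[of "x + s *\<^sub>R u + h *\<^sub>R v"] inS[of s h] that h by (simp add: ac_simps)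
      show "((\<lambda>s. f (x + s *\<^sub>R u)) has_real_derivative frechet_derivative f (at (x + s *\<^sub>R u)) u) (at s)"
        using dg[of f _ "x" s u] d1[of "x + s *\<^sub>R u"] inS[of s 0] that h by (simp add: ac_simps)
    qed
    from MVT2[OF h(1) this] obtain s where s: "0 < s" "s < h" "\<phi> h - \<phi> 0 = h * \<phi>' s" by auto
    have "((\<lambda>t. frechet_derivative f (at (x + s *\<^sub>R u + t *\<^sub>R v)) u) has_real_derivative D u v (x + s *\<^sub>R u + t *\<^sub>R v)) (at t)"
      if "0 \<le> t" "t \<le> h" for t
      unfolding D_def
      by (rule dg, rule smooth_on_has_derivative[OF smooth_on_derivative[OF S(2)]]) (use inS[of s t] that s in auto)
    from MVT2[OF h(1) this] obtain t where t: "0 < t" "t < h" "\<phi>' s = h * D u v (x + s *\<^sub>R u + t *\<^sub>R v)"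
      by (auto simp: \<phi>'_def)
    have "\<Delta> u v h = \<phi> h - \<phi> 0" by (simp add: \<Delta>_def \<phi>_def)
    also have "\<dots> = h * h * D u v (x + s *\<^sub>R u + t *\<^sub>R v)" using s t by simp
    finally show ?thesis using inS[of s t] s t by (intro exI[of _ "x + s *\<^sub>R u + t *\<^sub>R v"]) auto
  qed
  have close: "\<bar>D u v x - D v u x\<bar> \<le> e + e" if e: "e > 0" for e
  proof -
    from cont[of u v] cont[of v u] e obtain d1 d2 where d: "d1 > 0" "d2 > 0"
      "\<And>z. dist z x < d1 \<Longrightarrow> dist (D u v z) (D u v x) < e" "\<And>z. dist z x < d2 \<Longrightarrow> dist (D v u z) (D v u x) < e"
      unfolding continuous_at_eps_delta by metis
    define m where "m = Min {r, d1, d2}"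
    have m: "m > 0" "m \<le> r" "m \<le> d1" "m \<le> d2" using d r by (auto simp: m_def)
    \<comment> \<open>The summand 1 keeps the denominator positive when u and v both vanish;
      \<open>m / (2 * c)\<close> then keeps both intermediate points within m of x.\<close>
    define c where "c = norm u + norm v + 1"
    define h where "h = m / (2 * c)"
    have nuv: "c > 0" by (simp add: c_def add_nonneg_pos)
    have h0: "h > 0" unfolding h_def using m(1) nuv by (intro divide_pos_pos mult_pos_pos) auto
    have "h * (norm u + norm v) < h * c" using h0 by (simp add: c_def)
    also have "\<dots> = m / 2"
    proof -
      show ?thesis using nuv by (simp add: h_def)
    qed
    finally have hm: "h * (norm u + norm v) < m" using m by simp
    obtain z where z: "dist x z \<le> h * (norm u + norm v)" "\<Delta> u v h = h * h * D u v z"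
      using *[of h u v] h0 hm m by auto
    obtain y where y: "dist x y \<le> h * (norm v + norm u)" "\<Delta> v u h = h * h * D v u y"
      using *[of h v u] h0 hm m by (auto simp: add.commute)
    have "\<Delta> u v h = \<Delta> v u h" by (simp add: \<Delta>_def algebra_simps)
    then have "D u v z = D v u y" using z y h0 by simp
    moreover have "dist (D u v z) (D u v x) < e" using d(3)[of z] z hm m by (simp add: dist_commute)
    moreover have "dist (D v u y) (D v u x) < e" using d(4)[of y] y hm m by (simp add: dist_commute add.commute)
    ultimately show ?thesis by (simp add: dist_real_def abs_if split: if_splits)
  qed
  have "\<bar>D u v x - D v u x\<bar> \<le> 0"
    by (rule field_le_epsilon) (use close[of "_ / 2"] in auto)
  then show ?thesis by (simp add: D_def)
qed

section \<open>Lorentzian Minkowski norms\<close>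

lemma lorentzian_signature_diag:
  assumes "lorentzian_signature (G :: real^'i^'i::finite)"
  shows "\<exists>P k. invertible (P :: real^'i^'i) \<and>
    (\<forall>a b. (P *v a) \<bullet> (G *v (P *v b)) = (\<Sum>i\<in>UNIV-{k}. a $ i * b $ i) - a $ k * b $ k)"
proof -
  define J :: "'i \<Rightarrow> real^'i^'i" where "J k = (\<chi> i j. if i \<noteq> j then 0 else if i = k then -1 else 1)" for k
  obtain P :: "real^'i^'i" and k where P: "invertible P" "transpose P ** G ** P = J k"
    using assms unfolding lorentzian_signature_def J_def by blast
  have "(P *v a) \<bullet> (G *v (P *v b)) = (\<Sum>i\<in>UNIV-{k}. a $ i * b $ i) - a $ k * b $ k" for a b
  proof -
    have "(P *v a) \<bullet> (G *v (P *v b)) = a \<bullet> ((transpose P ** G ** P) *v b)"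
      by (simp add: dot_lmul_matrix inner_commute matrix_vector_mul_assoc[symmetric] transpose_matrix_vector)
        (metis dot_lmul_matrix inner_commute transpose_matrix_vector transpose_transpose)
    also have "\<dots> = (\<Sum>i\<in>UNIV. a $ i * (if i = k then - b $ i else b $ i))"
    proof -
      have "(J k *v b) $ i = (if i = k then - b $ i else b $ i)" for i
      proof -
        have "(J k *v b) $ i = (\<Sum>j\<in>UNIV. if j = i then (if i = k then - b $ i else b $ i) else 0)"
          unfolding matrix_vector_mult_def vec_lambda_beta by (intro sum.cong) (auto simp: J_def)
        then show ?thesis by simp
      qed
      then show ?thesis unfolding P(2) by (simp add: inner_vec_def)
    qed
    also have "\<dots> = a $ k * (- b $ k) + (\<Sum>i\<in>UNIV-{k}. a $ i * (if i = k then - b $ i else b $ i))"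
      by (subst sum.remove[of _ k]) auto
    also have "(\<Sum>i\<in>UNIV-{k}. a $ i * (if i = k then - b $ i else b $ i)) = (\<Sum>i\<in>UNIV-{k}. a $ i * b $ i)"
      by (intro sum.cong) auto
    finally show ?thesis by simp
  qed
  with P(1) show ?thesis by blast
qed

lemma lorentzian_signature_nondegenerate:
  assumes "lorentzian_signature (G :: real^'i^'i::finite)" "\<And>z. z \<bullet> (G *v w) = 0"
  shows "w = 0"
proof -
  obtain P :: "real^'i^'i" and k where P: "invertible P"
    "\<And>a b. (P *v a) \<bullet> (G *v (P *v b)) = (\<Sum>i\<in>UNIV-{k}. a $ i * b $ i) - a $ k * b $ k"
    using lorentzian_signature_diag[OF assms(1)] by blast
  obtain Q where Q: "P ** Q = mat 1" "Q ** P = mat 1" using P(1) by (auto simp: invertible_def)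
  define b where "b = Q *v w"
  have w: "w = P *v b" unfolding b_def matrix_vector_mul_assoc Q by simp
  have "b $ i = 0" for i
  proof -
    have "(\<Sum>j\<in>UNIV-{k}. (axis i 1 :: real^'i) $ j * b $ j) - (axis i 1 :: real^'i) $ k * b $ k = 0"
      using assms(2)[of "P *v axis i 1"] P(2) w by simp
    moreover have "(\<Sum>j\<in>UNIV-{k}. (axis i 1 :: real^'i) $ j * b $ j) = (\<Sum>j\<in>UNIV-{k}. if j = i then b $ i else 0)"
      by (intro sum.cong) (auto simp: axis_def)
    ultimately show ?thesis by (auto simp: axis_def split: if_splits)
  qed
  then have "b = 0" by (simp add: vec_eq_iff)
  then show ?thesis by (simp add: w)
qed

text \<open>In coordinates where the form is the Minkowski form, timelikeness reads
  \<open>A < (a $ k)\<^sup>2\<close> and orthogonality \<open>C = a $ k * b $ k\<close>.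
  Cauchy-Schwarz on the spatial parts gives
  \<open>(a $ k)\<^sup>2 * (b $ k)\<^sup>2 \<le> A * B\<close>, and for B > 0 this is less than
  \<open>(a $ k)\<^sup>2 * B\<close>.\<close>

lemma lorentzian_signature_orthogonal_pos:
  assumes "lorentzian_signature (G :: real^'i^'i::finite)" "v \<bullet> (G *v v) < 0" "v \<bullet> (G *v w) = 0" "w \<noteq> 0"
  shows "w \<bullet> (G *v w) > 0"
proof -
  obtain P :: "real^'i^'i" and k where P: "invertible P"
    "\<And>a b. (P *v a) \<bullet> (G *v (P *v b)) = (\<Sum>i\<in>UNIV-{k}. a $ i * b $ i) - a $ k * b $ k"
    using lorentzian_signature_diag[OF assms(1)] by blast
  obtain Q where Q: "P ** Q = mat 1" "Q ** P = mat 1" using P(1) by (auto simp: invertible_def)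
  define a where "a = Q *v v"
  define b where "b = Q *v w"
  have vw: "v = P *v a" "w = P *v b" unfolding a_def b_def matrix_vector_mul_assoc Q by simp_all
  have b0: "b \<noteq> 0" using assms(4) vw by auto
  define A where "A = (\<Sum>i\<in>UNIV-{k}. (a $ i)\<^sup>2)"
  define B where "B = (\<Sum>i\<in>UNIV-{k}. (b $ i)\<^sup>2)"
  define C where "C = (\<Sum>i\<in>UNIV-{k}. a $ i * b $ i)"
  have 1: "A < (a $ k)\<^sup>2" using assms(2) by (simp add: vw P(2) A_def power2_eq_square)
  have 2: "C = a $ k * b $ k" using assms(3) by (simp add: vw P(2) C_def)
  have 3: "C\<^sup>2 \<le> A * B" unfolding A_def B_def C_def by (rule Cauchy_Schwarz_ineq_sum)
  have A0: "A \<ge> 0" "B \<ge> 0" by (auto simp: A_def B_def intro: sum_nonneg)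
  have Bk: "B > 0 \<or> b $ k \<noteq> 0"
  proof (rule ccontr)
    assume *: "\<not> ?thesis"
    then have "B = 0" using A0 by auto
    then have "b $ i = 0" if "i \<noteq> k" for i
      using that by (simp add: B_def sum_nonneg_eq_0_iff)
    with * b0 show False by (metis vec_eq_iff zero_index)
  qed
  \<comment> \<open>If the spatial part of b vanished, then b $ k would be nonzero, and
    Cauchy-Schwarz would force a $ k = 0, against timelikeness.\<close>
  have B: "B > 0"
  proof (rule ccontr)
    assume "\<not> B > 0"
    with A0 have "B = 0" by auto
    with 3 2 Bk have "a $ k = 0" by auto
    with 1 A0 show False by auto
  qed
  have "(a $ k)\<^sup>2 * (b $ k)\<^sup>2 \<le> A * B" using 3 2 by (simp add: power_mult_distrib)
  also have "\<dots> < (a $ k)\<^sup>2 * B" using 1 B by simp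
  finally have "(b $ k)\<^sup>2 < B" using 1 A0 by (simp add: mult_less_cancel_left)
  then show ?thesis by (simp add: vw P(2) B_def power2_eq_square)
qed

section \<open>The Lorentz-Finsler function on a single tangent space\<close>

locale minkowski_norm =
  fixes f :: "real^'i::finite \<Rightarrow> real"
  assumes smooth: "smooth_on (UNIV - {0}) f"
    and homogeneous: "r > 0 \<Longrightarrow> f (r *\<^sub>R v) = r\<^sup>2 * f v"
    and signature: "v \<noteq> 0 \<Longrightarrow> lorentzian_signature (\<chi> \<alpha> \<beta>. pd \<alpha> (pd \<beta> f) v)"
begin

definition D :: "real^'i \<Rightarrow> real^'i \<Rightarrow> real" where "D v = frechet_derivative f (at v)"

definition H :: "real^'i \<Rightarrow> real^'i \<Rightarrow> real^'i \<Rightarrow> real" where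
  "H v u w = frechet_derivative (\<lambda>y. D y w) (at v) u"

definition G :: "real^'i \<Rightarrow> real^'i^'i" where "G v = (\<chi> \<alpha> \<beta>. pd \<alpha> (pd \<beta> f) v)"

definition F :: "real^'i \<Rightarrow> real" where "F v = sqrt (- 2 * f v)"

lemma has_derivative_D: "v \<noteq> 0 \<Longrightarrow> (f has_derivative D v) (at v)"
  unfolding D_def by (rule smooth_on_has_derivative[OF smooth]) simp

lemma smooth_D: "smooth_on (UNIV - {0}) (\<lambda>y. D y w)"
  unfolding D_def by (rule smooth_on_derivative[OF smooth])

lemma has_derivative_H: "v \<noteq> 0 \<Longrightarrow> ((\<lambda>y. D y w) has_derivative (\<lambda>u. H v u w)) (at v)"
  unfolding H_def by (rule smooth_on_has_derivative[OF smooth_D]) simp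

lemma linear_D: "v \<noteq> 0 \<Longrightarrow> linear (D v)"
  using has_derivative_D has_derivative_linear by blast

lemma H_commute: "v \<noteq> 0 \<Longrightarrow> H v u w = H v w u"
  unfolding H_def D_def by (rule symmetric_frechet[OF _ smooth]) auto

lemma linear_H: "v \<noteq> 0 \<Longrightarrow> linear (\<lambda>u. H v u w)"
  using has_derivative_H has_derivative_linear by blast

lemma linear_H2: assumes "v \<noteq> 0" shows "linear (H v u)"
proof -
  have "H v u = (\<lambda>w. H v w u)" by (rule ext) (rule H_commute[OF assms])
  then show ?thesis using linear_H[OF assms, of u] by simp
qed

lemma H_eq_G: assumes "v \<noteq> 0" shows "H v u w = u \<bullet> (G v *v w)"
proof -
  have *: "l u = (\<Sum>\<alpha>\<in>UNIV. u $ \<alpha> * l (axis \<alpha> 1))" if "linear l" for l :: "real^'i \<Rightarrow> real" and u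
  proof -
    have "l u = l (\<Sum>\<alpha>\<in>UNIV. u $ \<alpha> *\<^sub>R axis \<alpha> 1)" 
      by (simp add: basis_expansion scalar_mult_eq_scaleR[symmetric] del: scalar_mult_eq_scaleR)
    then show ?thesis using that by (simp add: linear_sum linear_scale)
  qed
  have "H v u w = (\<Sum>\<alpha>\<in>UNIV. u $ \<alpha> * (\<Sum>\<beta>\<in>UNIV. w $ \<beta> * H v (axis \<alpha> 1) (axis \<beta> 1)))"
    by (subst *[OF linear_H[OF assms]], subst *[OF linear_H2[OF assms], of _ w]) simp
  also have "\<dots> = u \<bullet> (G v *v w)"
    by (simp add: inner_vec_def matrix_vector_mult_def G_def pd_def[abs_def] H_def D_def mult.commute)
  finally show ?thesis .
qed

lemma f_zero [simp]: "f 0 = 0"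
  using homogeneous[of 2 0] by simp

lemma D_homogeneous:
  assumes "v \<noteq> 0" "r > 0"
  shows "D (r *\<^sub>R v) w = r * D v w"
proof -
  have rv: "r *\<^sub>R v \<noteq> 0" using assms by simp
  have "((\<lambda>v. f (r *\<^sub>R v)) has_derivative (\<lambda>w. D (r *\<^sub>R v) (r *\<^sub>R w))) (at v)"
    by (rule has_derivative_compose[of "\<lambda>v. r *\<^sub>R v" "\<lambda>v. r *\<^sub>R v" v UNIV f "D (r *\<^sub>R v)"])
      (use has_derivative_D[OF rv] in \<open>auto intro!: derivative_eq_intros\<close>)
  moreover have "((\<lambda>v. f (r *\<^sub>R v)) has_derivative (\<lambda>w. r\<^sup>2 * D v w)) (at v)"
    unfolding homogeneous[OF assms(2)] by (intro has_derivative_mult_right has_derivative_D assms)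
  ultimately have "D (r *\<^sub>R v) (r *\<^sub>R w) = r\<^sup>2 * D v w"
    using has_derivative_unique by metis
  then show ?thesis using linear_D[OF rv] assms by (simp add: linear_scale power2_eq_square)
qed

lemma curve_derivative:
  assumes "(h has_derivative h') (at (u + s *\<^sub>R q))"
  shows "((\<lambda>s. h (u + s *\<^sub>R q)) has_real_derivative h' q) (at s)"
proof -
  have "((\<lambda>s. h (u + s *\<^sub>R q)) has_derivative (\<lambda>t. h' (t *\<^sub>R q))) (at s)"
    by (rule has_derivative_compose[of "\<lambda>s. u + s *\<^sub>R q" "\<lambda>t. t *\<^sub>R q" s UNIV h h'])
      (use assms in \<open>auto intro!: derivative_eq_intros\<close>)
  moreover have "(\<lambda>t. h' (t *\<^sub>R q)) = (*) (h' q)"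
    using has_derivative_linear[OF assms] by (auto simp: linear_scale fun_eq_iff)
  ultimately show ?thesis by (simp add: has_field_derivative_def)
qed

lemma D_euler: assumes "v \<noteq> 0" shows "D v v = 2 * f v"
proof -
  have 1: "((\<lambda>s. f (0 + s *\<^sub>R v)) has_real_derivative D v v) (at 1)"
    using assms by (intro curve_derivative) (simp add: has_derivative_D)
  have "((\<lambda>s. s\<^sup>2 * f v) has_real_derivative 2 * f v) (at 1)"
    by (auto intro!: derivative_eq_intros)
  then have "((\<lambda>s. f (0 + s *\<^sub>R v)) has_real_derivative 2 * f v) (at 1)"
    by (rule has_field_derivative_transform_within[where d = 1]) (auto simp: homogeneous dist_real_def)
  with 1 show ?thesis using DERIV_unique by blast
qed

lemma H_euler: assumes "v \<noteq> 0" shows "H v v w = D v w"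
proof -
  have 1: "((\<lambda>s. D (0 + s *\<^sub>R v) w) has_real_derivative H v v w) (at 1)"
    using assms by (intro curve_derivative) (simp add: has_derivative_H)
  have "((\<lambda>s. s * D v w) has_real_derivative D v w) (at 1)"
    by (auto intro!: derivative_eq_intros)
  then have "((\<lambda>s. D (0 + s *\<^sub>R v) w) has_real_derivative D v w) (at 1)"
    by (rule has_field_derivative_transform_within[where d = 1]) (auto simp: D_homogeneous assms dist_real_def)
  with 1 show ?thesis using DERIV_unique by blast
qed

text \<open>\<open>D v\<close> is g_v(v, .), so a vanishing differential would contradict
  nondegeneracy. The point is the lightlike case, where \<open>D v v = 0\<close>.\<close>

lemma D_nonzero: assumes "v \<noteq> 0" obtains z where "D v z > 0"
proof -
  have "\<exists>z. D v z \<noteq> 0"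
  proof (rule ccontr)
    assume "\<not> ?thesis"
    then have "z \<bullet> (G v *v v) = 0" for z
      using H_euler[OF assms] H_commute[OF assms] H_eq_G[OF assms] by metis
    then show False using lorentzian_signature_nondegenerate signature[OF assms] assms unfolding G_def by blast
  qed
  then obtain z where "D v z \<noteq> 0" by blast
  then have "D v z > 0 \<or> D v (- z) > 0" using linear_D[OF assms] by (auto simp: linear_neg)
  with that show ?thesis by blast
qed

lemma H_pos_orthogonal:
  assumes "f v < 0" "D v w = 0" "w \<noteq> 0"
  shows "H v w w > 0"
proof -
  have v: "v \<noteq> 0" using assms by auto
  have "v \<bullet> (G v *v v) < 0" using H_eq_G[OF v, of v v] H_euler[OF v] D_euler[OF v] assms by simp
  moreover have "v \<bullet> (G v *v w) = 0" using H_eq_G[OF v, of v w] H_euler[OF v] assms by simp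
  ultimately show ?thesis
    using lorentzian_signature_orthogonal_pos[OF signature[OF v, folded G_def]] assms(3) H_eq_G[OF v] by metis
qed

text \<open>Split w into its g_v-components along v and orthogonal to v. The first gives equality,
  and the second contributes nonnegatively by \<open>H_pos_orthogonal\<close>. For N = - 2 f along a
  line the inequality reads 2 N N'' \<le> N'^2, which is concavity of sqrt N.\<close>

lemma H_reverse_CS:
  assumes "f v < 0"
  shows "2 * f v * H v w w \<le> (D v w)\<^sup>2"
proof -
  have v: "v \<noteq> 0" using assms by auto
  define c where "c = D v w / (2 * f v)"
  define w' where "w' = w - c *\<^sub>R v"
  have 1: "D v w' = 0"
    using linear_D[OF v] assms by (simp add: w'_def linear_diff linear_scale D_euler[OF v] c_def)
  have "H v w' w' \<ge> 0"
    using H_pos_orthogonal[OF assms 1] linear_0[OF linear_H[OF v]] by (cases "w' = 0") force+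
  moreover have "H v (c *\<^sub>R v + w') (c *\<^sub>R v + w') = c * c * (2 * f v) + H v w' w'"
    using 1 H_commute[OF v, of w' v]
    by (simp add: linear_add[OF linear_H[OF v]] linear_add[OF linear_H2[OF v]] linear_scale[OF linear_H[OF v]]
        linear_scale[OF linear_H2[OF v]] H_euler[OF v] D_euler[OF v])
  then have "H v w w = c * c * (2 * f v) + H v w' w'" by (simp add: w'_def)
  moreover have "c * c * (2 * f v) * (2 * f v) = (D v w)\<^sup>2"
    using assms by (simp add: c_def power2_eq_square)
  ultimately show ?thesis using assms
    by (simp add: distrib_left) (smt (verit, best) mult.commute mult.left_commute mult_nonneg_nonpos)
qed

text \<open>Smoothness is assumed off the origin only. At 0, homogeneity gives
  \<open>\<bar>f v\<bar> \<le> K * (norm v)\<^sup>2\<close>, where K bounds f on the unit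
  sphere.\<close>

lemma continuous_f: "continuous_on UNIV f"
proof -
  have cont: "continuous_on (sphere 0 1) f"
    using smooth_on_imp_continuous[OF smooth] by (rule continuous_on_subset) auto
  then have "compact (f ` sphere 0 1)" using compact_sphere compact_continuous_image by blast
  then obtain K where K: "\<And>v. norm v = 1 \<Longrightarrow> \<bar>f v\<bar> \<le> K"
    using compact_imp_bounded bounded_iff by (metis (mono_tags) imageI mem_sphere_0 real_norm_def)
  have bd: "norm (f v) \<le> K * (norm v)\<^sup>2" for v
  proof (cases "v = 0")
    case False
    have "f v = f (norm v *\<^sub>R (v /\<^sub>R norm v))" using False by simp
    also have "\<dots> = (norm v)\<^sup>2 * f (v /\<^sub>R norm v)" by (rule homogeneous) (use False in simp)
    finally show ?thesis using K[of "v /\<^sub>R norm v"] False by (simp add: abs_mult mult.commute mult_left_mono)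
  qed simp
  have "isCont f v" for v
  proof (cases "v = 0")
    case True
    have "((\<lambda>v :: real^'i. norm v) \<longlongrightarrow> 0) (at 0)" by (rule tendsto_norm_zero[OF tendsto_ident_at])
    then have "((\<lambda>v :: real^'i. K * (norm v)\<^sup>2) \<longlongrightarrow> 0) (at 0)"
      unfolding power2_eq_square by (intro tendsto_mult_right_zero tendsto_mult_zero)
    then have "(f \<longlongrightarrow> 0) (at 0)"
      by (rule Lim_null_comparison[rotated]) (rule always_eventually, rule allI, rule bd)
    then show ?thesis using True by (simp add: isCont_def)
  next
    case False
    then show ?thesis using has_derivative_D has_derivative_continuous by blast
  qed
  then show ?thesis by (simp add: continuous_at_imp_continuous_on)
qed

lemma open_timelike: "open {v. f v < 0}"
  using continuous_f by (intro open_Collect_less) (auto intro: continuous_intros)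

text \<open>The hypothesis concerns the segment and not membership in a cone, because convexity of
  the cone will be deduced from this concavity.\<close>

lemma F_concave:
  assumes "closed_segment u v \<subseteq> {v. f v < 0}" "0 \<le> s" "s \<le> 1"
  shows "(1 - s) * F u + s * F v \<le> F ((1 - s) *\<^sub>R u + s *\<^sub>R v)"
proof -
  define q where "q = v - u"
  have neg: "f (u + s *\<^sub>R q) < 0" if "s \<in> {0..1}" for s
  proof -
    have "u + s *\<^sub>R q = (1 - s) *\<^sub>R u + s *\<^sub>R v" by (simp add: q_def algebra_simps)
    then have "u + s *\<^sub>R q \<in> closed_segment u v" using that by (auto simp: in_segment)
    then show ?thesis using assms by auto
  qed
  define N where "N s = - 2 * f (u + s *\<^sub>R q)" for s
  define N' where "N' s = - 2 * D (u + s *\<^sub>R q) q" for s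
  define N'' where "N'' s = - 2 * H (u + s *\<^sub>R q) q q" for s
  have N: "N s > 0" if "s \<in> {0..1}" for s using neg[OF that] by (simp add: N_def)
  have nz: "u + s *\<^sub>R q \<noteq> 0" if "s \<in> {0..1}" for s using neg[OF that] by auto
  have N1: "(N has_real_derivative N' s) (at s)" if "s \<in> {0..1}" for s
    unfolding N_def N'_def using curve_derivative[OF has_derivative_D[OF nz[OF that]]] by (rule DERIV_cmult)
  have N2: "(N' has_real_derivative N'' s) (at s)" if "s \<in> {0..1}" for s
    unfolding N''_def N'_def using curve_derivative[OF has_derivative_H[OF nz[OF that]]] by (rule DERIV_cmult)
  have ineq: "2 * N s * N'' s \<le> (N' s)\<^sup>2" if "s \<in> {0..1}" for s
    using H_reverse_CS[OF neg[OF that], of q] by (simp add: N_def N'_def N''_def power_mult_distrib)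
  have "convex_on {0..1} (\<lambda>s. - sqrt (N s))"
  proof (rule f''_ge0_imp_convex)
    fix s :: real assume s: "s \<in> {0..1}"
    have sq: "sqrt (N s) > 0" "sqrt (N s) \<noteq> 0" using N[OF s] by auto
    show "((\<lambda>s. - sqrt (N s)) has_real_derivative - (N' s / (2 * sqrt (N s)))) (at s)"
      using N[OF s] by (auto intro!: derivative_eq_intros N1[OF s] simp: divide_simps)
    have "((\<lambda>s. - (N' s / (2 * sqrt (N s)))) has_real_derivative
        - ((N'' s * (2 * sqrt (N s)) - N' s * (2 * (N' s / (2 * sqrt (N s))))) / (2 * sqrt (N s))\<^sup>2)) (at s)"
      using N[OF s] sq by (auto intro!: derivative_eq_intros N1[OF s] N2[OF s] simp: divide_simps power2_eq_square)
    moreover have "N'' s * (2 * sqrt (N s)) - N' s * (2 * (N' s / (2 * sqrt (N s)))) = (2 * N s * N'' s - (N' s)\<^sup>2) / sqrt (N s)"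
      using sq N[OF s] by (simp add: divide_simps power2_eq_square algebra_simps)
    ultimately show "((\<lambda>s. - (N' s / (2 * sqrt (N s)))) has_real_derivative
        - ((2 * N s * N'' s - (N' s)\<^sup>2) / sqrt (N s) / (2 * sqrt (N s))\<^sup>2)) (at s)" by simp
    show "- ((2 * N s * N'' s - (N' s)\<^sup>2) / sqrt (N s) / (2 * sqrt (N s))\<^sup>2) \<ge> 0"
      using ineq[OF s] sq by (simp add: divide_nonpos_pos)
  qed simp
  from convex_onD[OF this, of s 0 1] assms have "- sqrt (N s) \<le> (1 - s) * - sqrt (N 0) + s * - sqrt (N 1)"
    by simp
  moreover have "N 0 = - 2 * f u" "N 1 = - 2 * f v" "N s = - 2 * f ((1 - s) *\<^sub>R u + s *\<^sub>R v)"
    by (simp_all add: N_def q_def algebra_simps)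
  ultimately show ?thesis by (simp add: F_def)
qed

lemma F_pos: "f v < 0 \<Longrightarrow> F v > 0"
  by (simp add: F_def)

lemma F_sq: "f v \<le> 0 \<Longrightarrow> (F v)\<^sup>2 = - 2 * f v"
  by (simp add: F_def)

lemma continuous_F: "continuous_on UNIV F"
  unfolding F_def by (intro continuous_intros continuous_f)

section \<open>Convexity of the timelike cone and the reverse Cauchy-Schwarz inequality\<close>

definition cone :: "real^'i \<Rightarrow> (real^'i) set" where
  "cone x = connected_component_set {v. f v < 0} x"

lemma cone_timelike: "v \<in> cone x \<Longrightarrow> f v < 0"
  using connected_component_subset unfolding cone_def by fastforce

lemma open_cone: "open (cone x)"
  unfolding cone_def by (intro open_connected_component open_timelike)

lemma segment_in_cone_iff:
  assumes "u \<in> cone x"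
  shows "closed_segment u v \<subseteq> cone x \<longleftrightarrow> closed_segment u v \<subseteq> {v. f v < 0}"
proof
  assume *: "closed_segment u v \<subseteq> {v. f v < 0}"
  have "connected_component_set {v. f v < 0} x = connected_component_set {v. f v < 0} u"
    using assms connected_component_eq unfolding cone_def by blast
  moreover have "closed_segment u v \<subseteq> connected_component_set {v. f v < 0} u"
    by (intro connected_component_maximal *) auto
  ultimately show "closed_segment u v \<subseteq> cone x" by (simp add: cone_def)
qed (use cone_timelike in auto)

text \<open>A limit of timelike segments might touch the boundary of the cone. Concavity excludes
  this: the lower bound by the interpolated end values passes to the limit, and it is positive
  because both ends are timelike.\<close>

lemma limit_segment_timelike:
  assumes "\<And>k. closed_segment u (v k) \<subseteq> {v. f v < 0}" "v \<longlonglongrightarrow> w" "f w < 0"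
  shows "closed_segment u w \<subseteq> {v. f v < 0}"
proof
  fix y assume "y \<in> closed_segment u w"
  then obtain s where s: "0 \<le> s" "s \<le> 1" "y = (1 - s) *\<^sub>R u + s *\<^sub>R w" by (auto simp: in_segment)
  have fu: "f u < 0" using assms(1)[of 0] by auto
  have "(\<lambda>k. F ((1 - s) *\<^sub>R u + s *\<^sub>R v k)) \<longlonglongrightarrow> F ((1 - s) *\<^sub>R u + s *\<^sub>R w)"
    by (rule continuous_on_tendsto_compose[OF continuous_F]) (auto intro!: tendsto_intros assms)
  moreover have "(\<lambda>k. (1 - s) * F u + s * F (v k)) \<longlonglongrightarrow> (1 - s) * F u + s * F w"
    by (intro tendsto_intros continuous_on_tendsto_compose[OF continuous_F assms(2)]) auto
  ultimately have "(1 - s) * F u + s * F w \<le> F y"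
    unfolding s(3) using F_concave[OF assms(1) s(1,2)] by (intro LIMSEQ_le) auto
  moreover have "(1 - s) * F u + s * F w > 0"
  proof (cases "s = 0")
    case False
    then show ?thesis using s F_pos[OF fu] F_pos[OF assms(3)]
      by (intro add_nonneg_pos) auto
  qed (use F_pos[OF fu] in simp)
  ultimately have "F y > 0" by linarith
  then show "y \<in> {v. f v < 0}" by (simp add: F_def)
qed

text \<open>For fixed u, the points of the cone that u sees along a timelike segment form an open
  set by compactness of segments and a closed one by \<open>limit_segment_timelike\<close>. The cone
  is connected, so u sees all of it.\<close>

lemma convex_cone: "convex (cone x)"
proof -
  have "closed_segment u v \<subseteq> cone x" if u: "u \<in> cone x" and v: "v \<in> cone x" for u v
  proof -
    define T where "T = {v \<in> cone x. closed_segment u v \<subseteq> {v. f v < 0}}"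
    have "openin (top_of_set (cone x)) T"
    proof -
      have "\<exists>e>0. ball v e \<inter> cone x \<subseteq> T" if v: "v \<in> T" for v
      proof -
        obtain e where e: "e > 0" "(\<Union>y\<in>closed_segment u v. ball y e) \<subseteq> {v. f v < 0}"
          using compact_subset_open_imp_ball_epsilon_subset[OF compact_segment open_timelike, of u v] v
          by (auto simp: T_def)
        have "v' \<in> T" if v': "v' \<in> ball v e \<inter> cone x" for v'
          unfolding T_def
        proof (safe)
          show "v' \<in> cone x" using v' by simp
          fix y assume "y \<in> closed_segment u v'"
          then obtain s where s: "0 \<le> s" "s \<le> 1" "y = (1 - s) *\<^sub>R u + s *\<^sub>R v'" by (auto simp: in_segment)
          have "dist ((1 - s) *\<^sub>R u + s *\<^sub>R v) y = s * dist v v'"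
            using s by (simp add: dist_norm scaleR_diff_right[symmetric])
          also have "\<dots> \<le> 1 * dist v v'" by (intro mult_right_mono) (use s in auto)
          also have "\<dots> < e" using v' by simp
          finally have "y \<in> ball ((1 - s) *\<^sub>R u + s *\<^sub>R v) e" by simp
          moreover have "(1 - s) *\<^sub>R u + s *\<^sub>R v \<in> closed_segment u v" using s by (auto simp: in_segment)
          ultimately show "f y < 0" using e(2) by blast
        qed
        with e(1) show ?thesis by blast
      qed
      then have "T = cone x \<inter> (\<Union>v\<in>T. \<Union>e\<in>{e. e > 0 \<and> ball v e \<inter> cone x \<subseteq> T}. ball v e)"
        by (auto simp: T_def) 
      then show ?thesis by (metis (no_types, lifting) openin_open open_UN open_ball)
    qed
    moreover have "closedin (top_of_set (cone x)) T"
    proof -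
      have "T = cone x \<inter> closure T"
      proof (intro equalityI subsetI)
        fix w assume w: "w \<in> cone x \<inter> closure T"
        then obtain v where v: "\<And>k. v k \<in> T" "v \<longlonglongrightarrow> w" by (auto simp: closure_sequential)
        have "closed_segment u w \<subseteq> {v. f v < 0}"
          by (rule limit_segment_timelike[of _ v]) (use v w cone_timelike in \<open>auto simp: T_def\<close>)
        then show "w \<in> T" using w by (simp add: T_def)
      next
        fix w assume "w \<in> T"
        moreover have "T \<subseteq> cone x" by (auto simp: T_def)
        ultimately show "w \<in> cone x \<inter> closure T" using closure_subset[of T] by blast
      qed
      then show ?thesis by (metis closedin_closed closed_closure)
    qed
    moreover have "u \<in> T" using u cone_timelike by (auto simp: T_def)
    moreover have "connected (cone x)" unfolding cone_def by simp
    ultimately have "T = cone x" by (metis connected_clopen empty_iff)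
    with v have "closed_segment u v \<subseteq> {v. f v < 0}" by (auto simp: T_def)
    then show ?thesis using segment_in_cone_iff[OF u] by simp
  qed
  then show ?thesis by (simp add: convex_contains_segment)
qed

lemma cone_scale: assumes "v \<in> cone x" "r > 0" shows "r *\<^sub>R v \<in> cone x"
proof -
  have "f y < 0" if "y \<in> closed_segment v (r *\<^sub>R v)" for y
  proof -
    from that obtain s where s: "0 \<le> s" "s \<le> 1" "y = (1 - s) *\<^sub>R v + s *\<^sub>R r *\<^sub>R v" by (auto simp: in_segment)
    then have "y = ((1 - s) + s * r) *\<^sub>R v" by (simp add: algebra_simps)
    moreover have "(1 - s) + s * r > 0" using s assms(2) by (cases "s = 0") (auto intro: add_nonneg_pos)
    ultimately show ?thesis using homogeneous cone_timelike[OF assms(1)] by (simp add: mult_pos_neg)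
  qed
  then have "closed_segment v (r *\<^sub>R v) \<subseteq> cone x" using segment_in_cone_iff[OF assms(1)] by auto
  then show ?thesis by auto
qed

text \<open>The midpoint of a point of the closure and an interior point is interior to a convex
  set; doubling it gives the sum. The case \<open>u = w'\<close> is separate because the open
  segment is then empty.\<close>

lemma cone_closure_add:
  assumes "u \<in> closure (cone x)" "w \<in> cone x" "r > 0"
  shows "u + r *\<^sub>R w \<in> cone x"
proof -
  define w' where "w' = r *\<^sub>R w"
  have w': "w' \<in> cone x" using cone_scale assms by (simp add: w'_def)
  show ?thesis
  proof (cases "u = w'")
    case True
    then have "u + r *\<^sub>R w = 2 *\<^sub>R w'" unfolding scaleR_2 by (simp add: w'_def)
    then show ?thesis using cone_scale[OF w', of 2] by simp
  next
    case False
    have "open_segment w' u \<subseteq> interior (cone x)"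
      by (rule in_interior_closure_convex_segment[OF convex_cone]) (use w' assms open_cone in \<open>auto simp: interior_open\<close>)
    moreover have "(1/2) *\<^sub>R (u + w') \<in> open_segment w' u"
      unfolding in_segment using False by (intro conjI exI[of _ "1/2"]) (auto simp: algebra_simps)
    ultimately have "(1/2) *\<^sub>R (u + w') \<in> cone x" using interior_subset by blast
    from cone_scale[OF this, of 2] show ?thesis by (simp add: w'_def)
  qed
qed

text \<open>By concavity the derivative of F at v in the direction of \<open>w - v\<close> is at
  least \<open>F w - F v\<close>, and it equals \<open>- D v q / F v\<close>. Euler's relation
  \<open>D v v = 2 * f v\<close> rearranges this into the claim.\<close>

lemma D_reverse_CS:
  assumes "v \<in> cone x" "w \<in> cone x"
  shows "D v w \<le> - F v * F w"
proof -
  define q where "q = w - v"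
  have fv: "f v < 0" "v \<noteq> 0" using cone_timelike[OF assms(1)] by auto
  have seg: "closed_segment v w \<subseteq> {v. f v < 0}"
    using convex_cone[of x] assms cone_timelike unfolding convex_contains_segment by blast
  have "((\<lambda>s. f (v + s *\<^sub>R q)) has_real_derivative D v q) (at 0)"
    by (rule curve_derivative) (use has_derivative_D fv in simp)
  then have "((\<lambda>s. F (v + s *\<^sub>R q)) has_real_derivative - D v q / F v) (at 0)"
    unfolding F_def using fv by (auto intro!: derivative_eq_intros simp: divide_simps)
  then have "((\<lambda>s. (F (v + s *\<^sub>R q) - F v) / s) \<longlongrightarrow> - D v q / F v) (at_right 0)"
    by (auto simp: has_field_derivative_iff intro: tendsto_within_subset)
  moreover have "F w - F v \<le> (F (v + s *\<^sub>R q) - F v) / s" if "0 < s" "s < 1" for s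
  proof -
    have "v + s *\<^sub>R q = (1 - s) *\<^sub>R v + s *\<^sub>R w" by (simp add: q_def algebra_simps)
    with F_concave[OF seg, of s] that have "(1 - s) * F v + s * F w \<le> F (v + s *\<^sub>R q)" by simp
    then show ?thesis using that by (simp add: field_simps)
  qed
  then have "\<forall>\<^sub>F s in at_right 0. F w - F v \<le> (F (v + s *\<^sub>R q) - F v) / s"
    by (auto simp: eventually_at_right[of 0 1] intro!: exI[of _ 1])
  ultimately have "F w - F v \<le> - D v q / F v"
    by (intro tendsto_lowerbound) auto
  moreover have "D v q = D v w - 2 * f v" using linear_D[OF fv(2)] by (simp add: q_def linear_diff D_euler[OF fv(2)])
  ultimately show ?thesis using F_pos[OF fv(1)] F_sq[of v] fv by (simp add: field_simps power2_eq_square)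
qed

text \<open>Equality makes \<open>q = w - v\<close> orthogonal to v for g_v, hence spacelike if
  nonzero. Then f strictly increases from v along q for a short time, so F falls below the common
  value \<open>F v = F w\<close>, against concavity.\<close>

lemma D_reverse_CS_eq:
  assumes "v \<in> cone x" "w \<in> cone x" "F w = F v" "D v w = - F v * F w"
  shows "w = v"
proof (rule ccontr)
  assume "w \<noteq> v"
  define q where "q = w - v"
  have q: "q \<noteq> 0" using \<open>w \<noteq> v\<close> by (simp add: q_def)
  have fv: "f v < 0" "v \<noteq> 0" using cone_timelike[OF assms(1)] by auto
  have seg: "closed_segment v w \<subseteq> {v. f v < 0}"
    using convex_cone[of x] assms cone_timelike unfolding convex_contains_segment by blast
  have Dq: "D v q = 0" using linear_D[OF fv(2)] assms F_sq[of v] fv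
    by (simp add: q_def linear_diff D_euler[OF fv(2)] power2_eq_square)
  have eq: "v + s *\<^sub>R q = (1 - s) *\<^sub>R v + s *\<^sub>R w" for s by (simp add: q_def algebra_simps)
  have neg: "f (v + s *\<^sub>R q) < 0" if "0 \<le> s" "s \<le> 1" for s
    using seg that by (auto simp: eq in_segment subset_iff)
  have d: "((\<lambda>s. f (v + s *\<^sub>R q)) has_real_derivative D (v + s *\<^sub>R q) q) (at s)" if "0 \<le> s" "s \<le> 1" for s
    by (rule curve_derivative, rule has_derivative_D) (use neg[OF that] in auto)
  have "((\<lambda>s. D (v + s *\<^sub>R q) q) has_real_derivative H v q q) (at 0)"
    by (rule curve_derivative) (use has_derivative_H fv in simp)
  from DERIV_pos_inc_right[OF this H_pos_orthogonal[OF fv(1) Dq q]]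
  obtain e where e: "e > 0" "\<And>h. 0 < h \<Longrightarrow> h < e \<Longrightarrow> D (v + h *\<^sub>R q) q > 0" using Dq by auto
  define h where "h = min 1 (e / 2)"
  have h: "0 < h" "h \<le> 1" "h < e" using e by (auto simp: h_def)
  obtain z where z: "0 < z" "z < h" "f (v + h *\<^sub>R q) - f (v + 0 *\<^sub>R q) = (h - 0) * D (v + z *\<^sub>R q) q"
    using MVT2[OF h(1), of "\<lambda>s. f (v + s *\<^sub>R q)" "\<lambda>s. D (v + s *\<^sub>R q) q"] d h by auto
  moreover have "h * D (v + z *\<^sub>R q) q > 0" using e(2)[of z] h z by simp
  ultimately have "f (v + h *\<^sub>R q) > f v" by simp
  then have "F (v + h *\<^sub>R q) < F v" by (simp add: F_def)
  moreover have "(1 - h) * F v + h * F w \<le> F (v + h *\<^sub>R q)"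
    using F_concave[OF seg, of h] h by (simp add: eq)
  ultimately show False using assms(3) by (simp add: algebra_simps)
qed

lemma continuous_D: "continuous_on (UNIV - {0}) (\<lambda>y. D y w)"
  by (rule smooth_on_imp_continuous[OF smooth_D])

text \<open>Here v may be lightlike. The weak inequality is the limit of
  \<open>D_reverse_CS\<close>. The linear form \<open>D v\<close> cannot attain its maximum 0 at a
  point w of the open cone, because moving w slightly in a direction of increase would make it
  positive.\<close>

lemma D_neg_closure:
  assumes "v \<in> closure (cone x)" "v \<noteq> 0" "w \<in> cone x"
  shows "D v w < 0"
proof -
  have le: "D v w \<le> 0" if w: "w \<in> cone x" for w
  proof -
    obtain y where y: "\<And>k. y k \<in> cone x" "y \<longlonglongrightarrow> v" using assms(1) by (auto simp: closure_sequential)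
    have "isCont (\<lambda>y. D y w) v" using continuous_D assms(2)
      by (simp add: continuous_on_eq_continuous_at open_delete)
    then have lim: "(\<lambda>k. D (y k) w) \<longlonglongrightarrow> D v w" using y(2) isCont_tendsto_compose by blast
    have "D (y k) w \<le> 0" for k
      using D_reverse_CS[OF y(1) w, of k] F_pos[OF cone_timelike[OF y(1)], of k] F_pos[OF cone_timelike[OF w]]
      by (smt (verit) mult_minus_left mult_pos_pos)
    then show ?thesis using lim by (intro LIMSEQ_le_const2[of "\<lambda>k. D (y k) w"]) auto
  qed
  have "D v w \<noteq> 0"
  proof
    assume 0: "D v w = 0"
    obtain z where z: "D v z > 0" using D_nonzero[OF assms(2)] by blast
    have "((\<lambda>e. w + e *\<^sub>R z) \<longlongrightarrow> w + 0 *\<^sub>R z) (at_right 0)" by (intro tendsto_intros)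
    then have "\<forall>\<^sub>F e in at_right 0. w + e *\<^sub>R z \<in> cone x"
      using topological_tendstoD[OF _ open_cone] assms(3) by fastforce
    moreover have "\<forall>\<^sub>F e :: real in at_right 0. e > 0" by (simp add: eventually_at_right_less)
    ultimately have "\<forall>\<^sub>F e :: real in at_right 0. e > 0 \<and> w + e *\<^sub>R z \<in> cone x" by eventually_elim simp
    then obtain e :: real where e: "e > 0" "w + e *\<^sub>R z \<in> cone x"
      using eventually_happens' trivial_limit_at_right_real by blast
    have "D v (w + e *\<^sub>R z) = e * D v z" using linear_D[OF assms(2)] 0 by (simp add: linear_add linear_scale)
    with le[OF e(2)] z e(1) show False by (simp add: mult_le_0_iff)
  qed
  with le[OF assms(3)] show ?thesis by simp
qed

end

section \<open>Derivatives at moving points\<close>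

lemma frechet_expand:
  fixes \<phi> :: "'a::euclidean_space \<Rightarrow> 'b::real_normed_vector"
  assumes "\<phi> differentiable (at x)"
  shows "frechet_derivative \<phi> (at x) u = (\<Sum>b\<in>Basis. (u \<bullet> b) *\<^sub>R frechet_derivative \<phi> (at x) b)"
  using linear_sum[OF linear_frechet_derivative[OF assms], of "\<lambda>b. (u \<bullet> b) *\<^sub>R b" Basis]
  by (simp add: euclidean_representation linear_scale[OF linear_frechet_derivative[OF assms]])

lemma smooth_on_differentiable: "smooth_on S f \<Longrightarrow> x \<in> S \<Longrightarrow> f differentiable (at x)"
  using smooth_on_has_derivative differentiableI by blast

lemma tendsto_frechet:
  fixes \<phi> :: "'a::euclidean_space \<Rightarrow> 'b::real_normed_vector"
  assumes S: "open S" "smooth_on S \<phi>" "x \<in> S" and lim: "(X \<longlongrightarrow> x) F" "(U \<longlongrightarrow> u) F"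
  shows "((\<lambda>s. frechet_derivative \<phi> (at (X s)) (U s)) \<longlongrightarrow> frechet_derivative \<phi> (at x) u) F"
proof -
  have "((\<lambda>s. \<Sum>b\<in>Basis. (U s \<bullet> b) *\<^sub>R frechet_derivative \<phi> (at (X s)) b) \<longlongrightarrow>
         (\<Sum>b\<in>Basis. (u \<bullet> b) *\<^sub>R frechet_derivative \<phi> (at x) b)) F"
  proof (intro tendsto_intros lim)
    fix b
    have "isCont (\<lambda>y. frechet_derivative \<phi> (at y) b) x"
      using smooth_on_imp_continuous[OF smooth_on_derivative[OF S(2)]] S continuous_on_eq_continuous_at by blast
    then show "((\<lambda>s. frechet_derivative \<phi> (at (X s)) b) \<longlongrightarrow> frechet_derivative \<phi> (at x) b) F"
      using lim(1) isCont_tendsto_compose by blast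
  qed
  moreover have "\<forall>\<^sub>F s in F. X s \<in> S" using topological_tendstoD[OF lim(1) S(1,3)] .
  then have "\<forall>\<^sub>F s in F. (\<Sum>b\<in>Basis. (U s \<bullet> b) *\<^sub>R frechet_derivative \<phi> (at (X s)) b) =
      frechet_derivative \<phi> (at (X s)) (U s)"
    by eventually_elim (metis frechet_expand smooth_on_differentiable[OF S(2)])
  ultimately show ?thesis
    unfolding frechet_expand[OF smooth_on_differentiable[OF S(2,3)], of u] by (rule Lim_transform_eventually)
qed

text \<open>For C^1 maps the linearization error is small relative to the distance of two arbitrary
  points near \<open>z0\<close>, not only relative to the distance from \<open>z0\<close>. This
  uniformity is what perturbing a whole curve requires. The operator norm of the change of the
  derivative is bounded through its values on \<open>Basis\<close>.\<close>

lemma strict_differentiability: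
  fixes g :: "'a::euclidean_space \<Rightarrow> 'b::real_normed_vector"
  assumes S: "open S" "z0 \<in> S" and D: "\<And>z. z \<in> S \<Longrightarrow> (g has_derivative D z) (at z)"
    and cont: "\<And>b. continuous_on S (\<lambda>z. D z b)" and e: "e > 0"
  obtains r where "r > 0" "ball z0 r \<subseteq> S"
    "\<And>z z'. z \<in> ball z0 r \<Longrightarrow> z' \<in> ball z0 r \<Longrightarrow>
       norm (g z' - g z - D z0 (z' - z)) \<le> e * norm (z' - z)"
proof -
  define h where "h z = (\<Sum>b\<in>Basis. norm (D z b - D z0 b))" for z
  have "continuous_on S h"
    unfolding h_def by (intro continuous_intros cont)
  then have "isCont h z0" using S continuous_on_eq_continuous_at by blast
  moreover have "h z0 = 0" by (simp add: h_def)
  ultimately obtain r1 where r1: "r1 > 0" "\<And>z. dist z z0 < r1 \<Longrightarrow> h z < e"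
    using e unfolding continuous_at_eps_delta by (metis abs_less_iff diff_zero dist_real_def)
  obtain r2 where r2: "r2 > 0" "ball z0 r2 \<subseteq> S" using S open_contains_ball by blast
  define r where "r = min r1 r2"
  show thesis
  proof (rule that[of r])
    show "r > 0" "ball z0 r \<subseteq> S" using r1 r2 by (auto simp: r_def)
    fix z z' assume z: "z \<in> ball z0 r" "z' \<in> ball z0 r"
    have "norm (g z' - g z - D z0 (z' - z)) \<le> norm (z' - z) * e"
    proof (rule differentiable_bound_linearization[where S = "ball z0 r" and f' = D])
      fix t :: real assume t: "t \<in> {0..1}"
      have "z + t *\<^sub>R (z' - z) = (1 - t) *\<^sub>R z + t *\<^sub>R z'" by (simp add: algebra_simps)
      then show "z + t *\<^sub>R (z' - z) \<in> ball z0 r"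
        using convexD[OF convex_ball[of z0 r] z, of "1 - t" t] t by simp
    next
      fix x assume x: "x \<in> ball z0 r"
      then have xS: "x \<in> S" using r2 by (auto simp: r_def)
      then show "(g has_derivative D x) (at x within ball z0 r)"
        using D has_derivative_at_withinI by blast
      have "bounded_linear (\<lambda>v. D x v - D z0 v)"
        using D xS S(2) by (intro bounded_linear_sub has_derivative_bounded_linear)
      then have "onorm (\<lambda>v. D x v - D z0 v) \<le> (\<Sum>b\<in>Basis. norm (D x b - D z0 b))"
        by (rule onorm_componentwise)
      also have "\<dots> \<le> e" using r1(2)[of x] x by (auto simp: h_def r_def dist_commute less_imp_le)
      finally show "onorm (D x - D z0) \<le> e" by (simp add: fun_diff_def)
    next
      show "z0 \<in> ball z0 r" using r1 r2 by (simp add: r_def)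
    qed
    then show "norm (g z' - g z - D z0 (z' - z)) \<le> e * norm (z' - z)" by (simp add: mult.commute)
  qed
qed

section \<open>Charts, tangent vectors and curves\<close>

lemma chart_open: "is_chart c \<Longrightarrow> open (cdom c)" "is_chart c \<Longrightarrow> open (cimg c)"
  by (auto simp: is_chart_def)

lemma chart_cinv:
  assumes "is_chart c"
  shows "x \<in> cdom c \<Longrightarrow> cinv c (cmap c x) = x" "y \<in> cimg c \<Longrightarrow> cmap c (cinv c y) = y"
    "y \<in> cimg c \<Longrightarrow> cinv c y \<in> cdom c"
proof -
  have "homeomorphism (cdom c) (cimg c) (cmap c) (cinv c)" using assms by (simp add: is_chart_def)
  then show "x \<in> cdom c \<Longrightarrow> cinv c (cmap c x) = x" by (simp add: homeomorphism_def)
qed (auto simp: f_inv_into_f inv_into_into)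

lemma chart_continuous:
  assumes "is_chart c"
  shows "continuous_on (cdom c) (cmap c)" "continuous_on (cimg c) (cinv c)"
  using assms by (auto simp: is_chart_def homeomorphism_def)

lemma chart_image_open:
  assumes "is_chart c" "open U"
  shows "open (cmap c ` (cdom c \<inter> U))"
proof -
  have "cmap c ` (cdom c \<inter> U) = cimg c \<inter> cinv c -` U"
  proof (intro equalityI subsetI)
    fix y assume "y \<in> cimg c \<inter> cinv c -` U"
    then have "y = cmap c (cinv c y)" "cinv c y \<in> cdom c \<inter> U" using chart_cinv[OF assms(1)] by auto
    then show "y \<in> cmap c ` (cdom c \<inter> U)" by blast
  qed (auto simp: chart_cinv[OF assms(1)])
  then show ?thesis
    using continuous_openin_preimage_gen[OF chart_continuous(2)[OF assms(1)] assms(2)]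
      chart_open[OF assms(1)] openin_open_eq by metis
qed

lemma ivl_perfect: "a < b \<Longrightarrow> t \<in> {a..b} \<Longrightarrow> at t within {a..b} \<noteq> (bot :: real filter)"
proof -
  assume *: "a < b" "t \<in> {a..b}"
  then have "\<not> {a..b} = {t'}" for t' by (metis atLeastAtMost_iff less_irrefl order.refl order_less_imp_le singletonD)
  then have "t islimpt {a..b}" using * connected_imp_perfect[of "{a..b}" t] by auto
  then show ?thesis by (simp add: trivial_limit_within)
qed

locale smooth_mfd =
  fixes A :: "('m::{t2_space,second_countable_topology}, 'e::euclidean_space) chart set"
  assumes manifold: "smooth_manifold A"
begin

lemma chart: "c \<in> A \<Longrightarrow> is_chart c"
  using manifold by (auto simp: smooth_manifold_def)

lemma chart_exists: obtains c where "c \<in> A" "p \<in> cdom c"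
  using manifold unfolding smooth_manifold_def by (metis UN_iff UNIV_I)

lemma chart_at: "chart_at A p \<in> A" "p \<in> cdom (chart_at A p)"
proof -
  have "chart_at A p \<in> A \<and> p \<in> cdom (chart_at A p)"
    unfolding chart_at_def by (rule someI_ex) (metis chart_exists)
  then show "chart_at A p \<in> A" "p \<in> cdom (chart_at A p)" by auto
qed

lemmas chart_simps = chart_cinv[OF chart]

lemma transition_smooth:
  "c \<in> A \<Longrightarrow> d \<in> A \<Longrightarrow> smooth_on (cmap c ` (cdom c \<inter> cdom d)) (cmap d \<circ> cinv c)"
  using manifold by (auto simp: smooth_manifold_def compatible_def)

lemma overlap_open: "c \<in> A \<Longrightarrow> d \<in> A \<Longrightarrow> open (cmap c ` (cdom c \<inter> cdom d))"
  by (intro chart_image_open chart chart_open)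

definition trans :: "('m, 'e) chart \<Rightarrow> ('m, 'e) chart \<Rightarrow> 'm \<Rightarrow> 'e \<Rightarrow> 'e" where
  "trans c d p = frechet_derivative (cmap d \<circ> cinv c) (at (cmap c p))"

lemma trans_derivative:
  "c \<in> A \<Longrightarrow> d \<in> A \<Longrightarrow> p \<in> cdom c \<Longrightarrow> p \<in> cdom d \<Longrightarrow>
    ((cmap d \<circ> cinv c) has_derivative trans c d p) (at (cmap c p))"
  unfolding trans_def by (rule smooth_on_has_derivative[OF transition_smooth]) auto

lemma linear_trans: "c \<in> A \<Longrightarrow> d \<in> A \<Longrightarrow> p \<in> cdom c \<Longrightarrow> p \<in> cdom d \<Longrightarrow> linear (trans c d p)"
  using trans_derivative has_derivative_linear by blast

lemma trans_chain:
  assumes "c \<in> A" "d \<in> A" "e \<in> A" "p \<in> cdom c" "p \<in> cdom d" "p \<in> cdom e"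
  shows "trans d e p (trans c d p u) = trans c e p u"
proof -
  have "((\<lambda>x. (cmap e \<circ> cinv d) ((cmap d \<circ> cinv c) x)) has_derivative (\<lambda>u. trans d e p (trans c d p u))) (at (cmap c p))"
    by (rule has_derivative_compose[OF trans_derivative])
      (use assms trans_derivative[of d e p] in \<open>auto simp: chart_simps o_def\<close>)
  then have "((cmap e \<circ> cinv c) has_derivative (\<lambda>u. trans d e p (trans c d p u))) (at (cmap c p))"
    by (rule has_derivative_transform_within_open[OF _ overlap_open[of c d]])
      (use assms in \<open>auto simp: chart_simps\<close>)
  then show ?thesis
    using trans_derivative[of c e p] assms has_derivative_unique by metis
qed

lemma trans_same: "c \<in> A \<Longrightarrow> p \<in> cdom c \<Longrightarrow> trans c c p u = u"
proof -
  assume *: "c \<in> A" "p \<in> cdom c"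
  have "((\<lambda>x. x) has_derivative (\<lambda>x. x)) (at (cmap c p))" by simp
  then have "((cmap c \<circ> cinv c) has_derivative (\<lambda>x. x)) (at (cmap c p))"
    by (rule has_derivative_transform_within_open[OF _ chart_open(2)[OF chart]])
      (use * in \<open>auto simp: chart_simps\<close>)
  then show ?thesis using trans_derivative[of c c p] * has_derivative_unique by metis
qed

lemma fst_tvec_of [simp]: "fst (tvec_of A c p u) = p"
  by (simp add: tvec_of_def)

lemma snd_tvec_of: "d \<in> A \<Longrightarrow> p \<in> cdom d \<Longrightarrow> snd (tvec_of A c p u) d = trans c d p u"
  by (simp add: tvec_of_def trans_def)

lemma snd_tvec_of_same: "c \<in> A \<Longrightarrow> p \<in> cdom c \<Longrightarrow> snd (tvec_of A c p u) c = u"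
  by (simp add: snd_tvec_of trans_same)

lemma tvec_of_tangent: "c \<in> A \<Longrightarrow> p \<in> cdom c \<Longrightarrow> tvec_of A c p u \<in> tangent_space A p"
  unfolding tangent_space_def
proof (intro CollectI conjI ballI allI impI)
  assume c: "c \<in> A" "p \<in> cdom c"
  fix d e assume "d \<in> A" "e \<in> A" "p \<in> cdom d \<inter> cdom e"
  with c show "snd (tvec_of A c p u) e = frechet_derivative (cmap e \<circ> cinv d) (at (cmap d p)) (snd (tvec_of A c p u) d)"
    by (simp add: snd_tvec_of trans_chain trans_def[symmetric])
qed (auto simp: tvec_of_def)

lemma tangentD:
  assumes "v \<in> tangent_space A p"
  shows "fst v = p" "d \<notin> A \<or> p \<notin> cdom d \<Longrightarrow> snd v d = 0"
    "c \<in> A \<Longrightarrow> d \<in> A \<Longrightarrow> p \<in> cdom c \<Longrightarrow> p \<in> cdom d \<Longrightarrow> snd v d = trans c d p (snd v c)"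
  using assms unfolding tangent_space_def trans_def by blast+

lemma tvec_of_snd:
  assumes "v \<in> tangent_space A p" "c \<in> A" "p \<in> cdom c"
  shows "tvec_of A c p (snd v c) = v"
proof (rule prod_eqI)
  show "snd (tvec_of A c p (snd v c)) = snd v"
  proof
    fix d
    show "snd (tvec_of A c p (snd v c)) d = snd v d"
    proof (cases "d \<in> A \<and> p \<in> cdom d")
      case True
      then show ?thesis using tangentD(3)[OF assms(1), of c d] assms by (simp add: snd_tvec_of)
    next
      case False
      then show ?thesis using tangentD(2)[OF assms(1)] by (auto simp: tvec_of_def)
    qed
  qed
qed (use tangentD(1)[OF assms(1)] in simp)

lemma tvec_of_trans:
  assumes "c \<in> A" "d \<in> A" "p \<in> cdom c" "p \<in> cdom d"
  shows "tvec_of A d p (trans c d p u) = tvec_of A c p u"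
  using tvec_of_snd[OF tvec_of_tangent[OF assms(1,3)] assms(2,4), of u] assms by (simp add: snd_tvec_of)

lemma continuous_tvec_of:
  assumes "c \<in> A" "p \<in> cdom c"
  shows "continuous_on UNIV (tvec_of A c p)"
proof -
  have "continuous_on UNIV (\<lambda>u. if d \<in> A \<and> p \<in> cdom d then trans c d p u else 0)" for d
    using linear_trans[of c d p] assms
    by (cases "d \<in> A \<and> p \<in> cdom d") (auto simp: linear_continuous_on linear_conv_bounded_linear)
  then show ?thesis
    unfolding tvec_of_def trans_def[symmetric]
    by (intro continuous_on_Pair continuous_on_const continuous_on_coordinatewise_then_product) simp
qed

lemma continuous_snd: "continuous_on UNIV (\<lambda>v :: ('m, 'e) tvec. snd v c)"
  by (rule continuous_on_product_then_coordinatewise[OF continuous_on_snd[OF continuous_on_id]])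

lemma tvec_of_scale: 
  assumes "c \<in> A" "p \<in> cdom c"
  shows "tscale r (tvec_of A c p u) = tvec_of A c p (r *\<^sub>R u)"
  using assms by (simp add: tscale_def tvec_of_def trans_def[symmetric] fun_eq_iff linear_scale[OF linear_trans] del: split_paired_All)

lemma tvec_of_minus: 
  assumes "c \<in> A" "p \<in> cdom c"
  shows "tminus (tvec_of A c p u) = tvec_of A c p (- u)"
  using assms by (simp add: tminus_def tvec_of_def trans_def[symmetric] fun_eq_iff linear_neg[OF linear_trans] del: split_paired_All)

lemma tvec_of_zero: 
  assumes "c \<in> A" "p \<in> cdom c"
  shows "tvec_of A c p 0 = tzero p"
  using assms by (simp add: tzero_def tvec_of_def trans_def[symmetric] fun_eq_iff linear_0[OF linear_trans] del: split_paired_All)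

section \<open>Velocities of curves\<close>

lemma velocity_change_chart:
  assumes c: "c \<in> A" "\<gamma> t \<in> cdom c" and d: "d \<in> A" "\<gamma> t \<in> cdom d"
    and t: "t \<in> I" "continuous (at t within I) \<gamma>"
    and u: "((cmap c \<circ> \<gamma>) has_vector_derivative u) (at t within I)"
  shows "((cmap d \<circ> \<gamma>) has_vector_derivative trans c d (\<gamma> t) u) (at t within I)"
proof -
  have "((\<lambda>s. (cmap d \<circ> cinv c) ((cmap c \<circ> \<gamma>) s)) has_derivative (\<lambda>s. trans c d (\<gamma> t) (s *\<^sub>R u))) (at t within I)"
    by (rule has_derivative_compose[OF u[unfolded has_vector_derivative_def]])
      (use trans_derivative[of c d "\<gamma> t"] c d in \<open>simp add: o_def\<close>)
  then have *: "((\<lambda>s. (cmap d \<circ> cinv c) ((cmap c \<circ> \<gamma>) s)) has_vector_derivative trans c d (\<gamma> t) u) (at t within I)"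
    using linear_trans[of c d "\<gamma> t"] c d by (simp add: has_vector_derivative_def linear_scale)
  have "\<forall>\<^sub>F s in at t within I. \<gamma> s \<in> cdom c"
    using t(2) c chart_open(1)[OF chart[OF c(1)]] by (auto simp: continuous_within intro: topological_tendstoD)
  then obtain e where e: "e > 0" "\<And>s. s \<in> I \<Longrightarrow> s \<noteq> t \<Longrightarrow> dist s t < e \<Longrightarrow> \<gamma> s \<in> cdom c"
    by (auto simp: eventually_at)
  show ?thesis
  proof (rule has_vector_derivative_transform_within[OF * e(1) t(1)])
    fix s assume "s \<in> I" "dist s t < e"
    then have "\<gamma> s \<in> cdom c" using e(2) c by blast
    then show "(cmap d \<circ> cinv c) ((cmap c \<circ> \<gamma>) s) = (cmap d \<circ> \<gamma>) s" using c by (simp add: chart_simps)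
  qed
qed

lemma velocity_eq:
  assumes "c \<in> A" "\<gamma> t \<in> cdom c" "t \<in> I" "continuous (at t within I) \<gamma>" "at t within I \<noteq> bot"
    and u: "((cmap c \<circ> \<gamma>) has_vector_derivative u) (at t within I)"
  shows "velocity A I \<gamma> t = tvec_of A c (\<gamma> t) u"
proof -
  have "coord_velocity d I \<gamma> t = trans c d (\<gamma> t) u" if "d \<in> A" "\<gamma> t \<in> cdom d" for d
    unfolding coord_velocity_def
    by (rule vector_derivative_within[OF assms(5)]) (use velocity_change_chart[of c \<gamma> t d I u] assms that in auto)
  then show ?thesis by (auto simp: velocity_def tvec_of_def trans_def)
qed

lemma C1_curve_chart:
  assumes "C1_curve A I \<gamma>" "t \<in> I" "c \<in> A" "\<gamma> t \<in> cdom c"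
  shows "((cmap c \<circ> \<gamma>) has_vector_derivative coord_velocity c I \<gamma> t) (at t within I)"
    "continuous (at t within I) (coord_velocity c I \<gamma>)" "continuous (at t within I) \<gamma>"
  using assms by (auto simp: C1_curve_def coord_velocity_def vector_derivative_works[symmetric] continuous_on_eq_continuous_within)

lemma C1_curve_velocity:
  assumes "C1_curve A I \<gamma>" "t \<in> I" "c \<in> A" "\<gamma> t \<in> cdom c" "at t within I \<noteq> bot"
  shows "velocity A I \<gamma> t = tvec_of A c (\<gamma> t) (coord_velocity c I \<gamma> t)"
  by (rule velocity_eq) (use assms C1_curve_chart[OF assms(1-4)] in auto)

lemma C1_curve_velocity_tangent:
  assumes "C1_curve A I \<gamma>" "t \<in> I" "at t within I \<noteq> bot"
  shows "velocity A I \<gamma> t \<in> tangent_space A (\<gamma> t)"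
  by (metis C1_curve_velocity assms chart_exists tvec_of_tangent)

text \<open>\<open>C1_curve\<close> quantifies over all charts of the maximal atlas. The chain rule
  transfers regularity from one chart near each time to all others, the velocity being transformed
  by \<open>trans\<close>.\<close>

lemma C1_curveI:
  assumes I: "\<And>t. t \<in> I \<Longrightarrow> at t within I \<noteq> bot" and cont: "continuous_on I \<gamma>"
    and loc: "\<And>t. t \<in> I \<Longrightarrow> \<exists>c\<in>A. \<exists>u. \<gamma> t \<in> cdom c \<and> continuous (at t within I) u \<and>
       (\<exists>e>0. \<forall>s\<in>I. dist s t < e \<longrightarrow> ((cmap c \<circ> \<gamma>) has_vector_derivative u s) (at s within I))"
  shows "C1_curve A I \<gamma>"
  unfolding C1_curve_def
proof (intro conjI ballI impI cont)
  fix d t assume d: "d \<in> A" "t \<in> I" "\<gamma> t \<in> cdom d"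
  from loc[OF d(2)] obtain c u e where c: "c \<in> A" "\<gamma> t \<in> cdom c" "continuous (at t within I) u" "e > 0"
    "\<And>s. s \<in> I \<Longrightarrow> dist s t < e \<Longrightarrow> ((cmap c \<circ> \<gamma>) has_vector_derivative u s) (at s within I)" by blast
  have ct: "continuous (at s within I) \<gamma>" if "s \<in> I" for s using cont that by (simp add: continuous_on_eq_continuous_within)
  have chg: "((cmap d \<circ> \<gamma>) has_vector_derivative trans c d (\<gamma> s) (u s)) (at s within I)"
    if "s \<in> I" "dist s t < e" "\<gamma> s \<in> cdom c" "\<gamma> s \<in> cdom d" for s
    by (rule velocity_change_chart) (use c d that ct in auto)
  show "cmap d \<circ> \<gamma> differentiable at t within I"
    by (rule differentiableI_vector[OF chg]) (use c d in auto)
  have "\<forall>\<^sub>F s in at t within I. \<gamma> s \<in> cdom c" "\<forall>\<^sub>F s in at t within I. \<gamma> s \<in> cdom d"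
    using topological_tendstoD[OF ct[OF d(2), unfolded continuous_within]] c d chart_open(1)[OF chart] by blast+
  moreover have "\<forall>\<^sub>F s in at t within I. s \<in> I \<and> dist s t < e"
    using c(4) by (auto simp: eventually_at)
  ultimately have ev: "\<forall>\<^sub>F s in at t within I. trans c d (\<gamma> s) (u s) = coord_velocity d I \<gamma> s"
  proof eventually_elim
    case (elim s)
    then show ?case unfolding coord_velocity_def
      by (intro vector_derivative_within[symmetric] I chg) auto
  qed
  have "((\<lambda>s. cmap c (\<gamma> s)) \<longlongrightarrow> cmap c (\<gamma> t)) (at t within I)"
    using continuous_on_tendsto_compose[OF chart_continuous(1)[OF chart[OF c(1)]], of \<gamma> "\<gamma> t" "at t within I"]
      \<open>\<forall>\<^sub>F s in at t within I. \<gamma> s \<in> cdom c\<close> ct[OF d(2)] c by (auto simp: continuous_within)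
  then have "((\<lambda>s. trans c d (\<gamma> s) (u s)) \<longlongrightarrow> trans c d (\<gamma> t) (u t)) (at t within I)"
    unfolding trans_def
    by (intro tendsto_frechet[OF overlap_open transition_smooth])
      (use c d in \<open>auto simp: continuous_within\<close>)
  moreover have "coord_velocity d I \<gamma> t = trans c d (\<gamma> t) (u t)"
    unfolding coord_velocity_def
    by (intro vector_derivative_within I chg) (use c d in auto)
  ultimately show "continuous (at t within I) (coord_velocity d I \<gamma>)"
    unfolding continuous_within using Lim_transform_eventually[OF _ ev] by simp
qed

text \<open>Velocities are derivatives within the parameter interval, so they formally depend on it.
  On a nondegenerate subinterval the one-sided derivatives are still unique and agree.\<close>

lemma C1_curve_subset:
  assumes "C1_curve A I \<gamma>" "{a..b} \<subseteq> I" "a < b"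
  shows "C1_curve A {a..b} \<gamma>" and "t \<in> {a..b} \<Longrightarrow> velocity A {a..b} \<gamma> t = velocity A I \<gamma> t"
proof -
  have nt: "at t within I \<noteq> bot" "at t within {a..b} \<noteq> bot" if "t \<in> {a..b}" for t
    using ivl_perfect[OF assms(3) that] at_le[OF assms(2), of t] by (auto simp: bot_unique)
  have d: "((cmap c \<circ> \<gamma>) has_vector_derivative coord_velocity c I \<gamma> t) (at t within {a..b})"
    if "t \<in> {a..b}" "c \<in> A" "\<gamma> t \<in> cdom c" for t c
    using C1_curve_chart(1)[OF assms(1) _ that(2,3)] that assms(2) has_vector_derivative_within_subset by blast
  have cont: "continuous_on {a..b} \<gamma>" using assms(1,2) by (auto simp: C1_curve_def intro: continuous_on_subset)
  show "velocity A {a..b} \<gamma> t = velocity A I \<gamma> t" if t: "t \<in> {a..b}" for t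
  proof -
    obtain c where c: "c \<in> A" "\<gamma> t \<in> cdom c" using chart_exists by blast
    have "velocity A {a..b} \<gamma> t = tvec_of A c (\<gamma> t) (coord_velocity c I \<gamma> t)"
      by (rule velocity_eq) (use c t nt d cont in \<open>auto simp: continuous_on_eq_continuous_within\<close>)
    then show ?thesis using C1_curve_velocity[OF assms(1) _ c nt(1)[OF t]] t assms(2) by auto
  qed
  show "C1_curve A {a..b} \<gamma>"
  proof (rule C1_curveI)
    fix t assume t: "t \<in> {a..b}"
    obtain c where c: "c \<in> A" "\<gamma> t \<in> cdom c" using chart_exists by blast
    have "\<forall>\<^sub>F s in at t within {a..b}. \<gamma> s \<in> cdom c"
      using cont t c chart_open(1)[OF chart[OF c(1)]] by (metis continuous_on_def topological_tendstoD)
    then obtain e where e: "e > 0" "\<And>s. s \<in> {a..b} \<Longrightarrow> dist s t < e \<Longrightarrow> \<gamma> s \<in> cdom c"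
      using c unfolding eventually_at by metis
    have "continuous (at t within {a..b}) (coord_velocity c I \<gamma>)"
      using C1_curve_chart(2)[OF assms(1) _ c] t assms(2) continuous_within_subset by blast
    then show "\<exists>c\<in>A. \<exists>u. \<gamma> t \<in> cdom c \<and> continuous (at t within {a..b}) u \<and>
       (\<exists>e>0. \<forall>s\<in>{a..b}. dist s t < e \<longrightarrow> ((cmap c \<circ> \<gamma>) has_vector_derivative u s) (at s within {a..b}))"
      using c d e by blast
  qed (use nt cont in auto)
qed

end

section \<open>Timelike cones\<close>

lemma connected_component_image:
  assumes "connected_component S x y" "continuous_on S h" "h ` S \<subseteq> T"
  shows "connected_component T (h x) (h y)"
proof -
  from assms(1) obtain t where t: "connected t" "t \<subseteq> S" "x \<in> t" "y \<in> t"
    unfolding connected_component_def by blast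
  then have "connected (h ` t)" using assms(2) connected_continuous_image continuous_on_subset by blast
  with t assms(3) show ?thesis unfolding connected_component_def by (intro exI[of _ "h ` t"]) blast
qed

text \<open>A tube lemma: the maximum over the compact parameter interval leaves a margin below 0
  that survives a small change of x.\<close>

lemma eventually_within_compact:
  fixes \<phi> :: "'a::metric_space \<times> real \<Rightarrow> real"
  assumes "open U" "x0 \<in> U" "continuous_on (U \<times> {0..1}) \<phi>" "\<And>s. s \<in> {0..1} \<Longrightarrow> \<phi> (x0, s) < 0"
  shows "\<exists>W. open W \<and> x0 \<in> W \<and> W \<subseteq> U \<and> (\<forall>x\<in>W. \<forall>s\<in>{0..1}. \<phi> (x, s) < 0)"
proof -
  have "continuous_on {0..1} (\<lambda>s. \<phi> (x0, s))"
    by (rule continuous_on_compose2[OF assms(3)]) (use assms(2) in \<open>auto intro!: continuous_intros\<close>)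
  from continuous_attains_sup[OF _ _ this] obtain s0 where s0: "s0 \<in> {0..1}" "\<And>s. s \<in> {0..1} \<Longrightarrow> \<phi> (x0, s) \<le> \<phi> (x0, s0)"
    by auto
  define e where "e = - \<phi> (x0, s0) / 2"
  have e: "e > 0" using assms(4)[OF s0(1)] by (simp add: e_def)
  obtain X0 where X0: "x0 \<in> X0" "open X0" "\<forall>x\<in>X0 \<inter> U. \<forall>t\<in>{0..1}. dist (\<phi> (x, t)) (\<phi> (x0, t)) \<le> e"
    using continuous_on_prod_compactE[OF assms(3) compact_Icc assms(2) e] by blast
  have "\<phi> (x, s) < 0" if "x \<in> X0 \<inter> U" "s \<in> {0..1}" for x s
  proof -
    have "dist (\<phi> (x, s)) (\<phi> (x0, s)) \<le> e" using X0(3) that by blast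
    then have "\<phi> (x, s) \<le> \<phi> (x0, s) + e" by (simp add: dist_real_def abs_le_iff)
    also have "\<dots> < 0" using s0(2)[OF that(2)] e by (simp add: e_def)
    finally show ?thesis .
  qed
  then show ?thesis using X0 assms(1,2) by (intro exI[of _ "X0 \<inter> U"]) auto
qed

lemma common_lower_bound:
  fixes F :: "real set"
  assumes "finite F" "\<forall>x\<in>F. 0 < x"
  shows "\<exists>r>0. \<forall>x\<in>F. r \<le> x"
  using assms
proof (induction F rule: finite_induct)
  case empty
  then show ?case using zero_less_one by blast
next
  case (insert a F)
  then obtain r where "r > 0" "\<forall>x\<in>F. r \<le> x" by auto
  with insert show ?case by (intro exI[of _ "min r a"]) (auto simp: min_le_iff_disj)
qed

locale spacetime =
  fixes A :: "('m::{t2_space,second_countable_topology}, real^'i::finite) chart set"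
    and L :: "('m, real^'i) tvec \<Rightarrow> real"
    and X :: "'m \<Rightarrow> ('m, real^'i) tvec"
  assumes spacetime: "finsler_spacetime A L X"

sublocale spacetime \<subseteq> smooth_mfd A
  using spacetime by unfold_locales (simp add: finsler_spacetime_def)

context spacetime
begin

abbreviation l where "l \<equiv> Lc A L"

definition Xc :: "('m, real^'i) chart \<Rightarrow> real^'i \<Rightarrow> real^'i" where
  "Xc c x = snd (X (cinv c x)) c"

text \<open>The timelike cone in the coordinates of c. It is a connected component taken in each
  fibre separately, so its dependence on x is not evident; the lemmas \<open>Om_open\<close> and
  \<open>Om_closed\<close> provide it.\<close>

definition Om :: "('m, real^'i) chart \<Rightarrow> real^'i \<Rightarrow> (real^'i) set" where
  "Om c x = connected_component_set {v. l c x v < 0} (Xc c x)"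

lemma L_smooth: "c \<in> A \<Longrightarrow> smooth_on (cimg c \<times> (UNIV - {0})) (\<lambda>(x, v). l c x v)"
  using spacetime by (auto simp: finsler_spacetime_def lorentz_finsler_def)

lemma open_slit: "c \<in> A \<Longrightarrow> open (cimg c \<times> (UNIV - {0 :: real^'i}))"
  by (intro open_Times chart_open chart open_delete open_UNIV)

lemma X_tangent: "X p \<in> tangent_space A p"
  using spacetime by (auto simp: finsler_spacetime_def smooth_vector_field_def)

lemma X_timelike: "L (X p) < 0"
  using spacetime by (auto simp: finsler_spacetime_def)

lemma minkowski: assumes "c \<in> A" "x \<in> cimg c" shows "minkowski_norm (l c x)"
proof
  have "smooth_on (UNIV - {0}) (\<lambda>v. (\<lambda>(x, v). l c x v) (x, v))"
    by (rule smooth_on_compose[OF _ open_slit[OF assms(1)] _ _ L_smooth[OF assms(1)]])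
      (use assms in \<open>auto intro!: smooth_on_Pair smooth_on_const smooth_on_id open_delete\<close>)
  then show "smooth_on (UNIV - {0}) (l c x)" by simp
next
  fix r :: real and v :: "real^'i" assume r: "r > 0"
  have cx: "cinv c x \<in> cdom c" using assms by (simp add: chart_simps)
  have "tvec_of A c (cinv c x) v \<in> tangent_bundle A"
    using tvec_of_tangent[OF assms(1) cx] by (auto simp: tangent_bundle_def)
  then have "L (tscale r (tvec_of A c (cinv c x) v)) = r\<^sup>2 * L (tvec_of A c (cinv c x) v)"
    using spacetime r by (auto simp: finsler_spacetime_def lorentz_finsler_def)
  then show "l c x (r *\<^sub>R v) = r\<^sup>2 * l c x v" by (simp add: Lc_def tvec_of_scale[OF assms(1) cx])
next
  fix v :: "real^'i" assume v: "v \<noteq> 0"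
  have "fund A L c x v = (\<chi> \<alpha> \<beta>. pd \<alpha> (pd \<beta> (l c x)) v)"
    by (simp add: fund_def dv_def[abs_def])
  then show "lorentzian_signature (\<chi> \<alpha> \<beta>. pd \<alpha> (pd \<beta> (l c x)) v)"
    using spacetime assms v unfolding finsler_spacetime_def lorentz_finsler_def by metis
qed

lemma L_chart:
  assumes "v \<in> tangent_space A p" "c \<in> A" "p \<in> cdom c"
  shows "L v = l c (cmap c p) (snd v c)"
  using assms by (simp add: Lc_def chart_simps tvec_of_snd)

lemma Xc_timelike: "c \<in> A \<Longrightarrow> x \<in> cimg c \<Longrightarrow> l c x (Xc c x) < 0"
  using L_chart[OF X_tangent, of c "cinv c x"] X_timelike[of "cinv c x"]
  by (simp add: Xc_def chart_simps)

lemma Xc_continuous: "c \<in> A \<Longrightarrow> continuous_on (cimg c) (Xc c)"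
  using spacetime smooth_on_imp_continuous unfolding finsler_spacetime_def smooth_vector_field_def Xc_def by blast

lemma Om_cone: "c \<in> A \<Longrightarrow> x \<in> cimg c \<Longrightarrow> Om c x = minkowski_norm.cone (l c x) (Xc c x)"
  by (simp add: Om_def minkowski_norm.cone_def[OF minkowski])

lemma Xc_Om: "c \<in> A \<Longrightarrow> x \<in> cimg c \<Longrightarrow> Xc c x \<in> Om c x"
  by (simp add: Om_def Xc_timelike)

lemma Om_timelike: "c \<in> A \<Longrightarrow> x \<in> cimg c \<Longrightarrow> v \<in> Om c x \<Longrightarrow> l c x v < 0"
  using minkowski_norm.cone_timelike[OF minkowski] by (simp add: Om_cone)

lemma Om_nonzero: "c \<in> A \<Longrightarrow> x \<in> cimg c \<Longrightarrow> v \<in> Om c x \<Longrightarrow> v \<noteq> 0"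
  by (metis Om_timelike less_irrefl minkowski minkowski_norm.f_zero)

lemma timelike_cone_subset: "timelike_cone A L X p \<subseteq> {v \<in> tangent_space A p. L v < 0}"
  unfolding timelike_cone_def by (rule connected_component_subset)

text \<open>On the tangent space at p, reading off the coordinates in c and
  \<open>tvec_of A c p\<close> are inverse to each other and continuous, so they carry components to
  components.\<close>

lemma timelike_cone_iff:
  assumes "c \<in> A" "p \<in> cdom c"
  shows "v \<in> timelike_cone A L X p \<longleftrightarrow> v \<in> tangent_space A p \<and> snd v c \<in> Om c (cmap c p)"
proof
  assume v: "v \<in> timelike_cone A L X p"
  then have "connected_component {v \<in> tangent_space A p. L v < 0} (X p) v" by (simp add: timelike_cone_def)
  then have "connected_component {u. l c (cmap c p) u < 0} (snd (X p) c) (snd v c)"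
    by (rule connected_component_image[of _ _ _ "\<lambda>v. snd v c"])
      (use L_chart[OF _ assms] in \<open>auto intro: continuous_on_subset[OF continuous_snd]\<close>)
  then show "v \<in> tangent_space A p \<and> snd v c \<in> Om c (cmap c p)"
    using v timelike_cone_subset assms by (auto simp: Om_def Xc_def chart_simps)
next
  assume v: "v \<in> tangent_space A p \<and> snd v c \<in> Om c (cmap c p)"
  then have "connected_component {u. l c (cmap c p) u < 0} (snd (X p) c) (snd v c)"
    using assms by (simp add: Om_def Xc_def chart_simps)
  then have "connected_component {v \<in> tangent_space A p. L v < 0} (tvec_of A c p (snd (X p) c)) (tvec_of A c p (snd v c))"
    by (rule connected_component_image)
      (use assms in \<open>auto simp: Lc_def chart_simps intro: continuous_on_subset[OF continuous_tvec_of] tvec_of_tangent\<close>)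
  then show "v \<in> timelike_cone A L X p"
    using v assms by (simp add: timelike_cone_def tvec_of_snd X_tangent)
qed

lemma tvec_of_timelike: "c \<in> A \<Longrightarrow> p \<in> cdom c \<Longrightarrow> tvec_of A c p u \<in> timelike_cone A L X p \<longleftrightarrow> u \<in> Om c (cmap c p)"
  by (simp add: timelike_cone_iff tvec_of_tangent snd_tvec_of_same)

lemma timelike_causal: "v \<in> timelike_cone A L X p \<Longrightarrow> v \<in> causal_cone A L X p"
proof -
  assume v: "v \<in> timelike_cone A L X p"
  obtain c where c: "c \<in> A" "p \<in> cdom c" using chart_exists by blast
  have "snd v c \<noteq> 0" using v c timelike_cone_iff Om_nonzero by blast
  then have "v \<noteq> tzero p" by (auto simp: tzero_def)
  then show ?thesis using v closure_subset by (auto simp: causal_cone_def)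
qed

lemma causal_chart:
  assumes "c \<in> A" "p \<in> cdom c" "v \<in> causal_cone A L X p" "v \<in> tangent_space A p"
  shows "snd v c \<in> closure (Om c (cmap c p))" "snd v c \<noteq> 0"
proof -
  have "(\<lambda>v. snd v c) ` closure (timelike_cone A L X p) \<subseteq> closure (Om c (cmap c p))"
  proof (rule image_closure_subset[OF continuous_on_subset[OF continuous_snd] closed_closure])
    show "(\<lambda>v. snd v c) ` timelike_cone A L X p \<subseteq> closure (Om c (cmap c p))"
      using timelike_cone_iff[OF assms(1,2)] closure_subset by blast
  qed simp
  moreover have "v \<in> closure (timelike_cone A L X p)" using assms(3) by (simp add: causal_cone_def)
  ultimately show "snd v c \<in> closure (Om c (cmap c p))" by blast
  show "snd v c \<noteq> 0"
    using tvec_of_snd[OF assms(4,1,2)] assms(3) tvec_of_zero[OF assms(1,2)] by (auto simp: causal_cone_def)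
qed

lemma l_nonpos: 
  assumes "c \<in> A" "x \<in> cimg c" "v \<in> closure (Om c x)"
  shows "l c x v \<le> 0"
proof -
  have "closure (Om c x) \<subseteq> {v. l c x v \<le> 0}"
    using Om_timelike[OF assms(1,2)] minkowski_norm.continuous_f[OF minkowski[OF assms(1,2)]]
    by (intro closure_minimal closed_Collect_le continuous_intros) (auto simp: less_imp_le)
  with assms show ?thesis by auto
qed

lemma causal_L_nonpos:
  assumes "v \<in> causal_cone A L X p" "v \<in> tangent_space A p"
  shows "L v \<le> 0"
  by (metis L_chart assms causal_chart(1) chart_exists imageI l_nonpos)

text \<open>The zero section has to be included, where L need not be smooth. There the bound
  \<open>K * (norm v)\<^sup>2\<close> holds with one K for all base points in a compact
  ball.\<close>

lemma l_continuous: assumes c: "c \<in> A" shows "continuous_on (cimg c \<times> UNIV) (\<lambda>(x, v). l c x v)"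
proof -
  let ?g = "\<lambda>(x, v). l c x v"
  have "isCont ?g (x0, v0)" if x0: "x0 \<in> cimg c" for x0 v0
  proof (cases "v0 = 0")
    case False
    then show ?thesis
      using smooth_on_imp_continuous[OF L_smooth[OF c]] open_slit[OF c] x0 continuous_on_eq_continuous_at by blast
  next
    case True
    obtain r where r: "r > 0" "cball x0 r \<subseteq> cimg c"
      using chart_open(2)[OF chart[OF c]] x0 open_contains_cball by blast
    have "compact (?g ` (cball x0 r \<times> sphere 0 1))"
      by (intro compact_continuous_image compact_Times continuous_on_subset[OF smooth_on_imp_continuous[OF L_smooth[OF c]]])
        (use r in auto)
    then have "bounded (?g ` (cball x0 r \<times> sphere 0 1))" by (rule compact_imp_bounded)
    then obtain K where K: "\<And>x v. x \<in> cball x0 r \<Longrightarrow> norm v = 1 \<Longrightarrow> \<bar>l c x v\<bar> \<le> K"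
      unfolding bounded_iff by fastforce
    have bd: "norm (l c x v) \<le> K * (norm v)\<^sup>2" if x: "x \<in> cball x0 r" for x v
    proof (cases "v = 0")
      case False
      interpret minkowski_norm "l c x" by (rule minkowski) (use c r x in auto)
      have "l c x v = l c x (norm v *\<^sub>R (v /\<^sub>R norm v))" using False by simp
      also have "\<dots> = (norm v)\<^sup>2 * l c x (v /\<^sub>R norm v)" by (rule homogeneous) (use False in simp)
      finally show ?thesis using K[OF x, of "v /\<^sub>R norm v"] False by (simp add: abs_mult mult.commute mult_left_mono)
    qed (use minkowski_norm.f_zero[OF minkowski[OF c]] x r in auto)
    have z: "l c x0 0 = 0" using minkowski_norm.f_zero[OF minkowski[OF c x0]] .
    have "((\<lambda>z :: (real^'i) \<times> (real^'i). snd z) \<longlongrightarrow> 0) (at (x0, 0))" using tendsto_snd[OF tendsto_ident_at, of "(x0, 0)" UNIV] by simp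
    from tendsto_norm_zero[OF this]
    have "((\<lambda>z :: (real^'i) \<times> (real^'i). K * (norm (snd z))\<^sup>2) \<longlongrightarrow> 0) (at (x0, 0))"
      unfolding power2_eq_square by (intro tendsto_mult_right_zero tendsto_mult_zero)
    moreover have "\<forall>\<^sub>F z in at (x0, 0). norm (?g z) \<le> K * (norm (snd z))\<^sup>2"
    proof -
      have "\<forall>\<^sub>F z in at (x0, 0 :: real^'i). fst z \<in> ball x0 r"
        using topological_tendstoD[OF tendsto_fst[OF tendsto_ident_at, of "(x0, 0)" UNIV], of "ball x0 r"] r by simp
      then show ?thesis by eventually_elim (use bd in \<open>auto split: prod.splits\<close>)
    qed
    ultimately have "(?g \<longlongrightarrow> 0) (at (x0, 0))" by (rule Lim_null_comparison[rotated])
    then show ?thesis using z True by (simp add: isCont_def)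
  qed
  then show ?thesis by (intro continuous_at_imp_continuous_on) auto
qed

lemma l_tendsto:
  assumes "c \<in> A" "x \<in> cimg c" "(Y \<longlongrightarrow> x) F" "(V \<longlongrightarrow> v) F"
  shows "((\<lambda>s. l c (Y s) (V s)) \<longlongrightarrow> l c x v) F"
proof -
  have "isCont (\<lambda>(x, v). l c x v) (x, v)"
    using l_continuous[OF assms(1)] assms(2)
      continuous_on_eq_continuous_at[OF open_Times[OF chart_open(2)[OF chart[OF assms(1)]] open_UNIV]] by blast
  from isCont_tendsto_compose[OF this tendsto_Pair[OF assms(3,4)]] show ?thesis by simp
qed

lemma Om_segment: 
  assumes "c \<in> A" "x \<in> cimg c" "v \<in> Om c x"
  shows "closed_segment (Xc c x) v \<subseteq> Om c x"
  using minkowski_norm.convex_cone[OF minkowski[OF assms(1,2)]] assms Xc_Om[OF assms(1,2)]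
  by (simp add: Om_cone convex_contains_segment)

lemma Om_memI:
  assumes "c \<in> A" "x \<in> cimg c" "closed_segment (Xc c x) v \<subseteq> {v. l c x v < 0}"
  shows "v \<in> Om c x"
  using minkowski_norm.segment_in_cone_iff[OF minkowski[OF assms(1,2)], of "Xc c x" "Xc c x" v] assms Xc_Om[OF assms(1,2)]
  by (auto simp: Om_cone)

text \<open>By convexity, v lies in the cone exactly if the segment from the time orientation
  \<open>Xc c x\<close> to v is timelike. This condition, unlike membership in a component, is
  visibly stable under perturbing x and v, by compactness of the segment.\<close>

lemma Om_open: assumes c: "c \<in> A" shows "open {(x, v). x \<in> cimg c \<and> v \<in> Om c x}"
proof (rule topological_space_class.openI)
  fix z assume "z \<in> {(x, v). x \<in> cimg c \<and> v \<in> Om c x}"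
  then obtain x v where z: "z = (x, v)" "x \<in> cimg c" "v \<in> Om c x" by auto
  let ?\<phi> = "\<lambda>((x, v), s). l c x ((1 - s) *\<^sub>R Xc c x + s *\<^sub>R v)"
  have "\<exists>W. open W \<and> (x, v) \<in> W \<and> W \<subseteq> cimg c \<times> UNIV \<and> (\<forall>z\<in>W. \<forall>s\<in>{0..1}. ?\<phi> (z, s) < 0)"
  proof (rule eventually_within_compact)
    have "continuous_on ((cimg c \<times> UNIV) \<times> {0..1 :: real}) (\<lambda>z. (\<lambda>(x, v). l c x v) (fst (fst z), (1 - snd z) *\<^sub>R Xc c (fst (fst z)) + snd z *\<^sub>R snd (fst z)))"
      by (rule continuous_on_compose2[OF l_continuous[OF c]])
        (auto intro!: continuous_intros continuous_on_compose2[OF Xc_continuous[OF c]])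
    then show "continuous_on ((cimg c \<times> UNIV) \<times> {0..1}) ?\<phi>" by (simp add: case_prod_unfold)
    fix s :: real assume "s \<in> {0..1}"
    then have "(1 - s) *\<^sub>R Xc c x + s *\<^sub>R v \<in> closed_segment (Xc c x) v" by (auto simp: in_segment)
    then show "?\<phi> ((x, v), s) < 0" using Om_segment[OF c z(2,3)] Om_timelike[OF c z(2)] by auto
  qed (use z chart_open(2)[OF chart[OF c]] in \<open>auto intro: open_Times\<close>)
  then obtain W where W: "open W" "(x, v) \<in> W" "W \<subseteq> cimg c \<times> UNIV" "\<And>z s. z \<in> W \<Longrightarrow> s \<in> {0..1} \<Longrightarrow> ?\<phi> (z, s) < 0" by blast
  have "W \<subseteq> {(x, v). x \<in> cimg c \<and> v \<in> Om c x}"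
  proof clarify
    fix x' v' assume w: "(x', v') \<in> W"
    then have "x' \<in> cimg c" using W by auto
    moreover have "closed_segment (Xc c x') v' \<subseteq> {v. l c x' v < 0}"
      using W(4)[OF w] by (auto simp: in_segment)
    ultimately show "x' \<in> cimg c \<and> v' \<in> Om c x'" using Om_memI[OF c] by blast
  qed
  then show "\<exists>T. open T \<and> z \<in> T \<and> T \<subseteq> {(x, v). x \<in> cimg c \<and> v \<in> Om c x}" using W z by blast
qed

text \<open>The argument of \<open>limit_segment_timelike\<close> with moving base points: the lower
  bounds from concavity in the fibres over \<open>Y k\<close> pass to the limit fibre.\<close>

lemma Om_closed:
  assumes c: "c \<in> A" and Y: "\<And>k. Y k \<in> cimg c" "\<And>k. V k \<in> Om c (Y k)" "Y \<longlonglongrightarrow> x" "V \<longlonglongrightarrow> v"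
    and x: "x \<in> cimg c" "l c x v < 0"
  shows "v \<in> Om c x"
proof (rule Om_memI[OF c x(1)], rule)
  fix y assume "y \<in> closed_segment (Xc c x) v"
  then obtain s where s: "0 \<le> s" "s \<le> 1" "y = (1 - s) *\<^sub>R Xc c x + s *\<^sub>R v" by (auto simp: in_segment)
  let ?F = "\<lambda>x v. sqrt (- 2 * l c x v)"
  have Xl: "(\<lambda>k. Xc c (Y k)) \<longlonglongrightarrow> Xc c x"
    by (rule continuous_on_tendsto_compose[OF Xc_continuous[OF c] Y(3) x(1)]) (use Y in auto)
  have "(1 - s) * ?F (Y k) (Xc c (Y k)) + s * ?F (Y k) (V k) \<le> ?F (Y k) ((1 - s) *\<^sub>R Xc c (Y k) + s *\<^sub>R V k)" for k
  proof -
    interpret minkowski_norm "l c (Y k)" by (rule minkowski[OF c Y(1)])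
    have "closed_segment (Xc c (Y k)) (V k) \<subseteq> {v. l c (Y k) v < 0}"
      using Om_segment[OF c Y(1,2)] Om_timelike[OF c Y(1)] by blast
    from F_concave[OF this s(1,2)] show ?thesis by (simp add: F_def)
  qed
  moreover have "(\<lambda>k. ?F (Y k) ((1 - s) *\<^sub>R Xc c (Y k) + s *\<^sub>R V k)) \<longlonglongrightarrow> ?F x y"
    unfolding s(3) by (intro tendsto_intros l_tendsto[OF c x(1)] Xl Y)
  moreover have "(\<lambda>k. (1 - s) * ?F (Y k) (Xc c (Y k)) + s * ?F (Y k) (V k)) \<longlonglongrightarrow> (1 - s) * ?F x (Xc c x) + s * ?F x v"
    by (intro tendsto_intros l_tendsto[OF c x(1)] Xl Y)
  ultimately have "(1 - s) * ?F x (Xc c x) + s * ?F x v \<le> ?F x y"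
    by (intro LIMSEQ_le) auto
  moreover have "(1 - s) * ?F x (Xc c x) + s * ?F x v > 0"
    using s x(2) Xc_timelike[OF c x(1)] by (cases "s = 0") (auto intro!: add_nonneg_pos)
  ultimately have "?F x y > 0" by linarith
  then show "y \<in> {v. l c x v < 0}" by simp
qed

text \<open>The time orientation cannot switch along a connected family of timelike vectors, since
  being future-directed is open and closed in it.\<close>

lemma Om_connected:
  assumes c: "c \<in> A" and T: "connected T" "\<And>x v. (x, v) \<in> T \<Longrightarrow> x \<in> cimg c \<and> l c x v < 0"
    and x: "(x, v) \<in> T" "v \<in> Om c x" and y: "(y, w) \<in> T"
  shows "w \<in> Om c y"
proof -
  define E where "E = {(x, v). x \<in> cimg c \<and> v \<in> Om c x}"
  have "openin (top_of_set T) (T \<inter> E)" using Om_open[OF c] by (auto simp: E_def openin_open)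
  moreover have "closedin (top_of_set T) (T \<inter> E)"
  proof -
    have "T \<inter> E = T \<inter> closure (T \<inter> E)"
    proof (intro equalityI subsetI)
      fix z assume z: "z \<in> T \<inter> closure (T \<inter> E)"
      then obtain Z where Z: "\<And>k. Z k \<in> T \<inter> E" "Z \<longlonglongrightarrow> z" by (auto simp: closure_sequential)
      have zz: "fst z \<in> cimg c" "l c (fst z) (snd z) < 0" using T(2)[of "fst z" "snd z"] z by auto
      have "snd z \<in> Om c (fst z)"
        by (rule Om_closed[OF c, of "\<lambda>k. fst (Z k)" "\<lambda>k. snd (Z k)"])
          (use Z zz in \<open>auto simp: E_def case_prod_unfold intro: tendsto_fst tendsto_snd\<close>)
      then show "z \<in> T \<inter> E" using z zz by (auto simp: E_def case_prod_unfold)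
    next
      fix z assume "z \<in> T \<inter> E"
      then show "z \<in> T \<inter> closure (T \<inter> E)" using closure_subset[of "T \<inter> E"] by blast
    qed
    then show ?thesis by (metis closedin_closed closed_closure)
  qed
  moreover have "(x, v) \<in> T \<inter> E" using x T(2)[OF x(1)] by (simp add: E_def)
  ultimately have "T \<inter> E = T" using T(1) by (metis connected_clopen empty_iff)
  then show ?thesis using y by (auto simp: E_def)
qed

lemma Om_near:
  assumes "c \<in> A" "x \<in> cimg c" "v \<in> Om c x"
  obtains r where "r > 0" "\<And>x' v'. dist x' x < r \<Longrightarrow> dist v' v < r \<Longrightarrow> x' \<in> cimg c \<and> v' \<in> Om c x'"
proof -
  from Om_open[OF assms(1)] assms(2,3) obtain r where r: "r > 0" "ball (x, v) r \<subseteq> {(x, v). x \<in> cimg c \<and> v \<in> Om c x}"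
    by (metis (mono_tags, lifting) case_prodI mem_Collect_eq open_contains_ball)
  show thesis
  proof (rule that[of "r / 2"])
    fix x' v' assume "dist x' x < r / 2" "dist v' v < r / 2"
    then have "dist (x, v) (x', v') < r"
      by (simp add: dist_Pair_Pair dist_commute) (smt (verit) real_sqrt_sum_squares_triangle_ineq sqrt_sum_squares_le_sum zero_le_dist field_sum_of_halves)
    then show "x' \<in> cimg c \<and> v' \<in> Om c x'" using r(2) by auto
  qed (use r in auto)
qed

text \<open>Pushing a causal vector \<open>u\<close> by a timelike one absorbs a proportional change of the base point.\<close>

lemma push_off:
  assumes c: "c \<in> A" "y \<in> cimg c" and v: "v \<in> closure (Om c y)" "v \<noteq> 0" and w: "w \<in> Om c y"
  obtains r where "r > 0"
    "\<And>x u t x'. dist x y < r \<Longrightarrow> dist u v < r \<Longrightarrow> u \<in> closure (Om c x) \<Longrightarrow> 0 < t \<Longrightarrow> t < r \<Longrightarrow>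
       dist x' x \<le> r * t \<Longrightarrow> x' \<in> cimg c \<and> u + t *\<^sub>R w \<in> Om c x'"
proof -
  let ?g = "\<lambda>(x, v). l c x v"
  define Dg where "Dg = frechet_derivative ?g (at (y, v))"
  interpret mn: minkowski_norm "l c y" by (rule minkowski[OF c])
  have z0: "(y, v) \<in> cimg c \<times> (UNIV - {0})" using c v by auto
  have Dg: "(?g has_derivative Dg) (at (y, v))"
    unfolding Dg_def by (rule smooth_on_has_derivative[OF L_smooth[OF c(1)] z0])
  have Dv: "Dg (0, h) = mn.D v h" for h
  proof -
    have "((\<lambda>v. ?g (y, v)) has_derivative (\<lambda>h. Dg (0, h))) (at v)"
      by (rule has_derivative_compose[of "\<lambda>v. (y, v)" "\<lambda>h. (0, h)" v UNIV ?g Dg])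
        (use Dg in \<open>auto intro!: derivative_eq_intros\<close>)
    then have "(l c y has_derivative (\<lambda>h. Dg (0, h))) (at v)" by simp
    then show ?thesis using mn.has_derivative_D[OF v(2)] has_derivative_unique by metis
  qed
  have Dlin: "linear Dg" using Dg has_derivative_linear by blast
  \<comment> \<open>The rate at which pushing v by \<open>t *\<^sub>R w\<close> decreases L. It is
    positive for lightlike v as well, by \<open>D_neg_closure\<close>.\<close>
  define k where "k = - Dg (0, w)"
  have k: "k > 0" using mn.D_neg_closure[of v "Xc c y" w] v w c by (simp add: k_def Dv Om_cone)
  define K where "K = onorm Dg"
  have K: "Dg h \<le> K * norm h" for h
    using onorm[OF has_derivative_bounded_linear[OF Dg], of h] by (simp add: K_def)
  have K0: "K \<ge> 0" using onorm_pos_le[OF has_derivative_bounded_linear[OF Dg]] by (simp add: K_def)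
  \<comment> \<open>The gain \<open>k * t\<close> has to beat the cost
    \<open>(K + e) * r * t\<close> of moving the base point and the linearization error
    \<open>e * norm w * t\<close>. The choices of e and r make each of these less than
    \<open>k * t / 2\<close>.\<close>
  define e where "e = k / (4 * (norm w + 1))"
  have nw: "norm w + 1 > 0" by (simp add: add_nonneg_pos)
  have e: "e > 0" unfolding e_def using k nw by (intro divide_pos_pos mult_pos_pos) auto
  have ew: "e * norm w < k / 2"
  proof -
    have "e * (norm w + 1) = k / 4" using nw by (simp add: e_def field_simps)
    then show ?thesis using k e by (simp add: distrib_left)
  qed
  obtain r0 where r0: "r0 > 0" "ball (y, v) r0 \<subseteq> cimg c \<times> (UNIV - {0})"
    "\<And>z z'. z \<in> ball (y, v) r0 \<Longrightarrow> z' \<in> ball (y, v) r0 \<Longrightarrow> norm (?g z' - ?g z - Dg (z' - z)) \<le> e * norm (z' - z)"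
    using strict_differentiability[OF open_slit[OF c(1)] z0 smooth_on_has_derivative[OF L_smooth[OF c(1)]]
        smooth_on_imp_continuous[OF smooth_on_derivative[OF L_smooth[OF c(1)]]] e, folded Dg_def] by blast
  obtain r1 where r1: "r1 > 0" "\<And>x' v'. dist x' y < r1 \<Longrightarrow> dist v' w < r1 \<Longrightarrow> x' \<in> cimg c \<and> v' \<in> Om c x'"
    using Om_near[OF c w] by blast
  have Ke: "K + e + 1 > 0" using K0 e by simp
  have "\<forall>x\<in>{1, r0 / 8, r0 / (8 * (norm w + 1)), r1 / 2, k / (2 * (K + e + 1))}. 0 < x"
    using r0(1) r1(1) nw k Ke by (auto simp del: distrib_left_numeral intro!: divide_pos_pos mult_pos_pos)
  from common_lower_bound[OF _ this] obtain r where
    r': "r > 0" "\<forall>x\<in>{1, r0 / 8, r0 / (8 * (norm w + 1)), r1 / 2, k / (2 * (K + e + 1))}. r \<le> x" by blast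
  have r: "r > 0" "r \<le> 1" "r \<le> r0 / 8" "r \<le> r0 / (8 * (norm w + 1))" "r \<le> r1 / 2" "r \<le> k / (2 * (K + e + 1))"
    using r' by blast+
  have rw: "r * norm w \<le> r0 / 8"
  proof -
    have "r * norm w \<le> r * (norm w + 1)" using r by simp
    also have "\<dots> \<le> r0 / 8" using r(4) nw by (simp add: field_simps)
    finally show ?thesis .
  qed
  have rK: "(K + e) * r < k / 2"
  proof -
    have "r * (K + e + 1) \<le> k / 2" using r(6) Ke by (simp add: field_simps)
    then show ?thesis using r(1) by (simp add: algebra_simps)
  qed
  show thesis
  proof (rule that[OF r(1)])
    fix x u t x' assume a: "dist x y < r" "dist u v < r" "u \<in> closure (Om c x)" "0 < t" "t < r" "dist x' x \<le> r * t"
    have x: "x \<in> cimg c" "w \<in> Om c x" using r1(2)[of x w] a(1) r by auto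
    have inb: "(p, q) \<in> ball (y, v) r0" if "dist p y < r0 / 2" "dist q v < r0 / 2" for p q
      using that by (simp add: dist_Pair_Pair dist_commute) (smt (verit) sqrt_sum_squares_le_sum zero_le_dist field_sum_of_halves)
    have zu: "(x, u) \<in> ball (y, v) r0" using a r r0 by (intro inb) auto
    have neg: "p \<in> cimg c \<and> l c p (u + t *\<^sub>R w) < 0" if p: "dist p x \<le> r * t" for p
    proof -
      have "r * t \<le> 1 * t" using r a by (intro mult_right_mono) auto
      then have "dist p y < 2 * r" using p a dist_triangle[of p y x] by linarith
      then have p1: "dist p y < r0 / 2" using r r0 by simp
      have "dist (u + t *\<^sub>R w) v \<le> dist u v + t * norm w"
        using dist_triangle[of "u + t *\<^sub>R w" v u] a by (simp add: dist_norm)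
      also have "t * norm w \<le> r * norm w" using a by (intro mult_right_mono) auto
      finally have p2: "dist (u + t *\<^sub>R w) v < r0 / 2" using rw a r r0 by simp
      have z: "(p, u + t *\<^sub>R w) \<in> ball (y, v) r0" by (rule inb[OF p1 p2])
      have "l c p (u + t *\<^sub>R w) \<le> l c x u + Dg (p - x, t *\<^sub>R w) + e * norm (p - x, t *\<^sub>R w)"
        using r0(3)[OF zu z] by (simp add: abs_le_iff)
      also have "Dg (p - x, t *\<^sub>R w) = Dg (p - x, 0) + t * Dg (0, w)"
      proof -
        have "Dg (p - x, t *\<^sub>R w) = Dg ((p - x, 0) + t *\<^sub>R (0, w))" by simp
        then show ?thesis using Dlin by (simp only: linear_add linear_scale real_scaleR_def)
      qed
      also have "Dg (p - x, 0) \<le> K * (r * t)"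
        using K[of "(p - x, 0)"] p K0 by (simp add: norm_Pair dist_norm) (meson mult_left_mono order_trans)
      also have "norm (p - x, t *\<^sub>R w) \<le> r * t + t * norm w"
        using p a sqrt_sum_squares_le_sum[of "norm (p - x)" "norm (t *\<^sub>R w)"] by (simp add: norm_Pair dist_norm)
      also have "l c x u \<le> 0" using l_nonpos c x a by blast
      finally have "l c p (u + t *\<^sub>R w) \<le> K * (r * t) + t * Dg (0, w) + e * (r * t + t * norm w)"
        using e by (simp add: mult_left_mono)
      also have "\<dots> = t * ((K + e) * r + e * norm w - k)" by (simp add: k_def algebra_simps)
      also have "\<dots> < 0" using rK ew a by (intro mult_pos_neg) auto
      finally show ?thesis using z r0(2) by auto
    qed
    have start: "u + t *\<^sub>R w \<in> Om c x"
      using minkowski_norm.cone_closure_add[OF minkowski[OF c(1) x(1)]] a x c by (simp add: Om_cone)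
    \<comment> \<open>The estimate only yields negative L. It holds on the whole segment from x to
      x', so future-directedness is carried over from the fibre at x.\<close>
    have "u + t *\<^sub>R w \<in> Om c x'"
    proof (rule Om_connected[OF c(1), of "closed_segment x x' \<times> {u + t *\<^sub>R w}"])
      fix p q assume "(p, q) \<in> closed_segment x x' \<times> {u + t *\<^sub>R w}"
      then have "q = u + t *\<^sub>R w" "dist p x \<le> dist x' x"
        using segment_bound(1)[of p x x'] by (auto simp: dist_norm norm_minus_commute)
      then show "p \<in> cimg c \<and> l c p q < 0" using neg[of p] a(6) by simp
    qed (use start in \<open>auto intro: connected_Times\<close>)
    then show "x' \<in> cimg c \<and> u + t *\<^sub>R w \<in> Om c x'" using neg[OF a(6)] by blast
  qed
qed

end

section \<open>Reparametrizing and joining curves\<close>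

lemma tscale_1: "tscale 1 v = v"
  by (simp add: tscale_def prod_eq_iff)

context smooth_mfd
begin

lemma chart_near:
  assumes "continuous_on I \<gamma>" "t \<in> I" "c \<in> A" "\<gamma> t \<in> cdom c"
  shows "\<exists>e>0. \<forall>s\<in>I. dist s t < e \<longrightarrow> \<gamma> s \<in> cdom c"
proof -
  have "(\<gamma> \<longlongrightarrow> \<gamma> t) (at t within I)" using assms by (simp add: continuous_on_def)
  from topological_tendstoD[OF this chart_open(1)[OF chart[OF assms(3)]] assms(4)]
  show ?thesis using assms(4) unfolding eventually_at by metis
qed

lemma C1_curveI_chart:
  assumes "\<And>t. t \<in> I \<Longrightarrow> at t within I \<noteq> bot" "continuous_on I \<gamma>"
    and "\<And>t. t \<in> I \<Longrightarrow> \<exists>c\<in>A. \<exists>u. \<gamma> t \<in> cdom c \<and> continuous (at t within I) u \<and>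
       (\<forall>s\<in>I. \<gamma> s \<in> cdom c \<longrightarrow> ((cmap c \<circ> \<gamma>) has_vector_derivative u s) (at s within I))"
  shows "C1_curve A I \<gamma>"
proof (rule C1_curveI)
  fix t assume t: "t \<in> I"
  from assms(3)[OF this] obtain c u where c: "c \<in> A" "\<gamma> t \<in> cdom c" "continuous (at t within I) u"
     "\<forall>s\<in>I. \<gamma> s \<in> cdom c \<longrightarrow> ((cmap c \<circ> \<gamma>) has_vector_derivative u s) (at s within I)" by blast
  with chart_near[OF assms(2) t c(1,2)]
  show "\<exists>c\<in>A. \<exists>u. \<gamma> t \<in> cdom c \<and> continuous (at t within I) u \<and>
       (\<exists>e>0. \<forall>s\<in>I. dist s t < e \<longrightarrow> ((cmap c \<circ> \<gamma>) has_vector_derivative u s) (at s within I))"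
    by blast
qed (use assms in auto)

text \<open>Applied with \<open>m = 1\<close> to shift and with \<open>m = - 1\<close> to reverse a
  curve.\<close>

lemma C1_curve_affine:
  assumes \<gamma>: "C1_curve A I \<gamma>" and I: "\<And>t. t \<in> I \<Longrightarrow> at t within I \<noteq> bot"
    and I': "\<And>t. t \<in> I' \<Longrightarrow> at t within I' \<noteq> bot" "\<And>t. t \<in> I' \<Longrightarrow> m * t + s \<in> I"
  shows "C1_curve A I' (\<lambda>t. \<gamma> (m * t + s))"
    and "t \<in> I' \<Longrightarrow> velocity A I' (\<lambda>t. \<gamma> (m * t + s)) t = tscale m (velocity A I \<gamma> (m * t + s))"
proof -
  let ?p = "\<lambda>t. m * t + s"
  have sub: "?p ` I' \<subseteq> I" using I' by auto
  have d: "((cmap c \<circ> (\<lambda>t. \<gamma> (?p t))) has_vector_derivative m *\<^sub>R coord_velocity c I \<gamma> (?p t)) (at t within I')"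
    if "t \<in> I'" "c \<in> A" "\<gamma> (?p t) \<in> cdom c" for t c
  proof -
    have "((cmap c \<circ> \<gamma>) has_vector_derivative coord_velocity c I \<gamma> (?p t)) (at (?p t) within ?p ` I')"
      by (rule has_vector_derivative_within_subset[OF C1_curve_chart(1)[OF \<gamma> I'(2)[OF that(1)] that(2,3)] sub])
    moreover have "(?p has_vector_derivative m) (at t within I')"
      by (auto intro!: derivative_eq_intros)
    ultimately have "(((cmap c \<circ> \<gamma>) \<circ> ?p) has_vector_derivative m *\<^sub>R coord_velocity c I \<gamma> (?p t)) (at t within I')"
      by (intro vector_diff_chain_within)
    then show ?thesis by (simp add: o_def)
  qed
  have cont: "continuous_on I' (\<lambda>t. \<gamma> (?p t))"
  proof (rule continuous_on_compose2[OF _ _ sub])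
    show "continuous_on I \<gamma>" using \<gamma> by (simp add: C1_curve_def)
  qed (intro continuous_intros)
  show "C1_curve A I' (\<lambda>t. \<gamma> (?p t))"
  proof (rule C1_curveI_chart)
    fix t assume t: "t \<in> I'"
    obtain c where c: "c \<in> A" "\<gamma> (?p t) \<in> cdom c" using chart_exists by blast
    have "continuous (at (?p t) within ?p ` I') (coord_velocity c I \<gamma>)"
      by (rule continuous_within_subset[OF C1_curve_chart(2)[OF \<gamma> I'(2)[OF t] c] sub])
    then have "continuous (at t within I') (\<lambda>t. coord_velocity c I \<gamma> (?p t))"
      by (rule continuous_within_compose2[rotated]) (intro continuous_intros)
    then have "continuous (at t within I') (\<lambda>t. m *\<^sub>R coord_velocity c I \<gamma> (?p t))"
      by (intro continuous_intros)
    then show "\<exists>c\<in>A. \<exists>u. \<gamma> (?p t) \<in> cdom c \<and> continuous (at t within I') u \<and>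
       (\<forall>s\<in>I'. \<gamma> (?p s) \<in> cdom c \<longrightarrow> ((cmap c \<circ> (\<lambda>t. \<gamma> (?p t))) has_vector_derivative u s) (at s within I'))"
      using c d by blast
  qed (use I' cont in auto)
  show "velocity A I' (\<lambda>t. \<gamma> (?p t)) t = tscale m (velocity A I \<gamma> (?p t))" if t: "t \<in> I'"
  proof -
    obtain c where c: "c \<in> A" "\<gamma> (?p t) \<in> cdom c" using chart_exists by blast
    have "velocity A I' (\<lambda>t. \<gamma> (?p t)) t = tvec_of A c (\<gamma> (?p t)) (m *\<^sub>R coord_velocity c I \<gamma> (?p t))"
      by (rule velocity_eq) (use c t I' d cont in \<open>auto simp: continuous_on_eq_continuous_within\<close>)
    then show ?thesis using C1_curve_velocity[OF \<gamma> I'(2)[OF t] c I[OF I'(2)[OF t]]] c by (simp add: tvec_of_scale)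
  qed
qed

lemma velocity_cong:
  assumes "C1_curve A I \<gamma>" "t \<in> I" "at t within I \<noteq> bot" "\<And>s. s \<in> I \<Longrightarrow> \<gamma>' s = \<gamma> s"
  shows "velocity A I \<gamma>' t = velocity A I \<gamma> t"
proof -
  obtain c where c: "c \<in> A" "\<gamma> t \<in> cdom c" using chart_exists by blast
  have "velocity A I \<gamma>' t = tvec_of A c (\<gamma>' t) (coord_velocity c I \<gamma> t)"
  proof (rule velocity_eq)
    show "((cmap c \<circ> \<gamma>') has_vector_derivative coord_velocity c I \<gamma> t) (at t within I)"
      by (rule has_vector_derivative_transform[OF assms(2) _ C1_curve_chart(1)[OF assms(1,2) c]]) (use assms in auto)
    have "continuous_on I \<gamma>'" using assms(1,4) by (simp add: C1_curve_def cong: continuous_on_cong)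
    then show "continuous (at t within I) \<gamma>'" using assms(2) by (simp add: continuous_on_eq_continuous_within)
  qed (use c assms in auto)
  then show ?thesis using C1_curve_velocity[OF assms(1,2) c assms(3)] assms by simp
qed

lemma snd_velocity: "c \<in> A \<Longrightarrow> \<gamma> t \<in> cdom c \<Longrightarrow> snd (velocity A I \<gamma> t) c = coord_velocity c I \<gamma> t"
  by (simp add: velocity_def)

lemma fst_velocity [simp]: "fst (velocity A I \<gamma> t) = \<gamma> t"
  by (simp add: velocity_def)

lemma continuous_within_union:
  assumes "closed S" "closed T" "t \<in> S \<Longrightarrow> continuous (at t within S) u" "t \<in> T \<Longrightarrow> continuous (at t within T) u"
  shows "continuous (at t within S \<union> T) (u :: real \<Rightarrow> 'b::topological_space)"
proof -
  have "continuous (at t within S) u" if "closed S" "t \<notin> S" for S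
  proof -
    have "at t within S = bot" using that by (metis closed_limpt trivial_limit_within)
    then show ?thesis by (simp add: continuous_bot)
  qed
  with assms show ?thesis unfolding continuous_within by (intro Lim_Un) blast+
qed

text \<open>Equality of the velocities as tangent vectors contains equality of their base points
  and, in every chart around the joint, of the two one-sided derivatives.\<close>

lemma C1_curve_glue:
  assumes "a < b" "b < e" and \<gamma>1: "C1_curve A {a..b} \<gamma>1" and \<gamma>2: "C1_curve A {b..e} \<gamma>2"
    and v: "velocity A {a..b} \<gamma>1 b = velocity A {b..e} \<gamma>2 b"
  defines "\<gamma> \<equiv> (\<lambda>t. if t \<in> {a..b} then \<gamma>1 t else \<gamma>2 t)"
  shows "C1_curve A {a..e} \<gamma>" (is ?C1)
    and "t \<in> {a..b} \<Longrightarrow> velocity A {a..e} \<gamma> t = velocity A {a..b} \<gamma>1 t"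
    and "t \<in> {b..e} \<Longrightarrow> velocity A {a..e} \<gamma> t = velocity A {b..e} \<gamma>2 t"
proof -
  have U: "{a..e} = {a..b} \<union> {b..e}" using assms(1,2) by auto
  have Int: "closure {a..b} \<inter> closure {b..e} = {b}" using assms(1,2) by auto
  have Un: "{a..b} \<union> {b} = {a..b}" "{b..e} \<union> {b} = {b..e}" using assms(1,2) by auto
  have b: "\<gamma>1 b = \<gamma>2 b" using arg_cong[OF v, of fst] by simp
  have vb: "coord_velocity c {a..b} \<gamma>1 b = coord_velocity c {b..e} \<gamma>2 b" if "c \<in> A" "\<gamma>1 b \<in> cdom c" for c
    using arg_cong[OF v, of "\<lambda>v. snd v c"] that b by (simp add: snd_velocity)
  have cont: "continuous_on {a..e} \<gamma>"
    unfolding U \<gamma>_def using \<gamma>1 \<gamma>2 b assms(1,2) by (intro continuous_on_If) (auto simp: C1_curve_def)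
  have ae: "a < e" using assms(1,2) by simp
  show C1: ?C1
  proof (rule C1_curveI_chart)
    fix t assume t: "t \<in> {a..e}"
    obtain c where c: "c \<in> A" "\<gamma> t \<in> cdom c" using chart_exists by blast
    define u where "u s = (if s \<in> {a..b} then coord_velocity c {a..b} \<gamma>1 s else coord_velocity c {b..e} \<gamma>2 s)" for s
    have "((cmap c \<circ> \<gamma>) has_vector_derivative u s) (at s within {a..e})" if s: "s \<in> {a..e}" "\<gamma> s \<in> cdom c" for s
    proof -
      have "((\<lambda>s. if s \<in> {a..b} then (cmap c \<circ> \<gamma>1) s else (cmap c \<circ> \<gamma>2) s) has_vector_derivative u s) (at s within {a..e})"
        unfolding u_def
      proof (rule has_vector_derivative_If_within_closures[OF _ U], goal_cases)
        case 2
        then show ?case unfolding Int Un using s c by (intro C1_curve_chart(1)[OF \<gamma>1]) (auto simp: \<gamma>_def)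
      next
        case 3
        then show ?case unfolding Int Un using s c b by (intro C1_curve_chart(1)[OF \<gamma>2]) (auto simp: \<gamma>_def split: if_splits)
      next
        case 4
        then have "s = b" using assms(1,2) by auto
        then show ?case using b by simp
      next
        case 5
        then have "s = b" using assms(1,2) by auto
        then show ?case using vb s c assms(1,2) by (simp add: \<gamma>_def)
      qed (use s U in auto)
      then show ?thesis by (rule has_vector_derivative_transform[rotated 2]) (use s in \<open>auto simp: \<gamma>_def\<close>)
    qed
    moreover have "continuous (at t within {a..e}) u"
      unfolding U
    proof (rule continuous_within_union)
      assume t: "t \<in> {a..b}"
      have *: "continuous (at t within {a..b}) (coord_velocity c {a..b} \<gamma>1)"
        by (rule C1_curve_chart(2)[OF \<gamma>1 t]) (use c t in \<open>auto simp: \<gamma>_def\<close>)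
      show "continuous (at t within {a..b}) u"
        by (rule continuous_transform_within[OF * zero_less_one t]) (auto simp: u_def)
    next
      assume t: "t \<in> {b..e}"
      have *: "continuous (at t within {b..e}) (coord_velocity c {b..e} \<gamma>2)"
        by (rule C1_curve_chart(2)[OF \<gamma>2 t]) (use c t b in \<open>auto simp: \<gamma>_def split: if_splits\<close>)
      show "continuous (at t within {b..e}) u"
      proof (cases "\<gamma>1 b \<in> cdom c")
        case True
        show ?thesis
          by (rule continuous_transform_within[OF * zero_less_one t]) (use vb[OF c(1) True] in \<open>auto simp: u_def\<close>)
      next
        \<comment> \<open>In a chart that misses the joint the two coordinate velocities need not
          match, but then t is not the joint and only times closer to t than b matter.\<close>
        case False
        then have "t \<noteq> b" using c assms(1,2) by (auto simp: \<gamma>_def)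
        then have "0 < t - b" using t by simp
        show ?thesis
          by (rule continuous_transform_within[OF * \<open>0 < t - b\<close> t]) (auto simp: u_def dist_real_def)
      qed
    qed auto
    ultimately show "\<exists>c\<in>A. \<exists>u. \<gamma> t \<in> cdom c \<and> continuous (at t within {a..e}) u \<and>
       (\<forall>s\<in>{a..e}. \<gamma> s \<in> cdom c \<longrightarrow> ((cmap c \<circ> \<gamma>) has_vector_derivative u s) (at s within {a..e}))"
      using c by blast
  qed (use ivl_perfect[OF ae] cont in auto)
  show "velocity A {a..e} \<gamma> t = velocity A {a..b} \<gamma>1 t" if t: "t \<in> {a..b}"
  proof -
    have "velocity A {a..b} \<gamma> t = velocity A {a..e} \<gamma> t"
      by (rule C1_curve_subset(2)[OF C1]) (use t assms(1,2) in auto)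
    moreover have "velocity A {a..b} \<gamma> t = velocity A {a..b} \<gamma>1 t"
      by (rule velocity_cong[OF \<gamma>1 t ivl_perfect[OF assms(1) t]]) (simp add: \<gamma>_def)
    ultimately show ?thesis by simp
  qed
  show "velocity A {a..e} \<gamma> t = velocity A {b..e} \<gamma>2 t" if t: "t \<in> {b..e}"
  proof -
    have "velocity A {b..e} \<gamma> t = velocity A {a..e} \<gamma> t"
      by (rule C1_curve_subset(2)[OF C1]) (use t assms(1,2) in auto)
    moreover have "velocity A {b..e} \<gamma> t = velocity A {b..e} \<gamma>2 t"
      by (rule velocity_cong[OF \<gamma>2 t ivl_perfect[OF assms(2) t]]) (use b in \<open>auto simp: \<gamma>_def\<close>)
    ultimately show ?thesis by simp
  qed
qed

lemma C1_curve_from_chart: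
  assumes c: "c \<in> A" and ab: "a < b"
    and \<kappa>: "\<And>t. t \<in> {a..b} \<Longrightarrow> \<kappa> t \<in> cimg c"
      "\<And>t. t \<in> {a..b} \<Longrightarrow> (\<kappa> has_vector_derivative \<kappa>' t) (at t within {a..b})" "continuous_on {a..b} \<kappa>'"
  shows "C1_curve A {a..b} (\<lambda>t. cinv c (\<kappa> t))"
    and "t \<in> {a..b} \<Longrightarrow> velocity A {a..b} (\<lambda>t. cinv c (\<kappa> t)) t = tvec_of A c (cinv c (\<kappa> t)) (\<kappa>' t)"
proof -
  have d: "((cmap c \<circ> (\<lambda>t. cinv c (\<kappa> t))) has_vector_derivative \<kappa>' t) (at t within {a..b})" if "t \<in> {a..b}" for t
    by (rule has_vector_derivative_transform[OF that _ \<kappa>(2)[OF that]]) (use \<kappa>(1) c in \<open>simp add: chart_simps\<close>)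
  have "continuous_on {a..b} \<kappa>"
    using \<kappa>(2) has_vector_derivative_continuous continuous_on_eq_continuous_within by blast
  then have cont: "continuous_on {a..b} (\<lambda>t. cinv c (\<kappa> t))"
    by (rule continuous_on_compose2[OF chart_continuous(2)[OF chart[OF c]]]) (use \<kappa> in auto)
  show "C1_curve A {a..b} (\<lambda>t. cinv c (\<kappa> t))"
  proof (rule C1_curveI_chart)
    fix t assume t: "t \<in> {a..b}"
    show "\<exists>d\<in>A. \<exists>u. cinv c (\<kappa> t) \<in> cdom d \<and> continuous (at t within {a..b}) u \<and>
       (\<forall>s\<in>{a..b}. cinv c (\<kappa> s) \<in> cdom d \<longrightarrow> ((cmap d \<circ> (\<lambda>t. cinv c (\<kappa> t))) has_vector_derivative u s) (at s within {a..b}))"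
      by (rule bexI[OF _ c], rule exI[of _ \<kappa>'])
        (use c t \<kappa> d in \<open>auto simp: chart_simps continuous_on_eq_continuous_within\<close>)
  qed (use ivl_perfect[OF ab] cont in auto)
  show "velocity A {a..b} (\<lambda>t. cinv c (\<kappa> t)) t = tvec_of A c (cinv c (\<kappa> t)) (\<kappa>' t)" if t: "t \<in> {a..b}"
    by (rule velocity_eq) (use c t ivl_perfect[OF ab t] d cont \<kappa> in \<open>auto simp: chart_simps continuous_on_eq_continuous_within\<close>)
qed

end

text \<open>Curves are recorded by their end velocities instead of their end points, which are the
  \<open>fst\<close> components. In this form C^1 curves compose like arrows: two of them can be
  joined when the intermediate tangent vectors agree.\<close>

definition causal_path ::
  "('m::topological_space, real^'i) chart set \<Rightarrow> (('m, real^'i) tvec \<Rightarrow> real) \<Rightarrow>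
   ('m \<Rightarrow> ('m, real^'i) tvec) \<Rightarrow> ('m, real^'i) tvec \<Rightarrow> ('m, real^'i) tvec \<Rightarrow> real \<Rightarrow> bool" where
  "causal_path A L X u w len \<longleftrightarrow> (\<exists>\<gamma> a b. a < b \<and> C1_curve A {a..b} \<gamma> \<and> has_causal_velocity A L X {a..b} \<gamma> \<and>
     velocity A {a..b} \<gamma> a = u \<and> velocity A {a..b} \<gamma> b = w \<and> curve_length A L \<gamma> a b = len)"

lemma lorentz_dist_eq:
  "lorentz_dist A L X x y = Sup (insert 0 {ereal len | len u w. causal_path A L X u w len \<and> fst u = x \<and> fst w = y})"
proof -
  have "{ereal (curve_length A L \<gamma> a b) | \<gamma> a b. a < b \<and> C1_curve A {a..b} \<gamma> \<and> has_causal_velocity A L X {a..b} \<gamma> \<and> \<gamma> a = x \<and> \<gamma> b = y}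
    = {ereal len | len u w. causal_path A L X u w len \<and> fst u = x \<and> fst w = y}"
    unfolding causal_path_def by (auto simp: velocity_def)
  then show ?thesis unfolding lorentz_dist_def by simp
qed

lemma lorentz_dist_ge: "causal_path A L X u w len \<Longrightarrow> ereal len \<le> lorentz_dist A L X (fst u) (fst w)"
  unfolding lorentz_dist_eq by (intro Sup_upper) blast

lemma lorentz_dist_nonneg: "0 \<le> lorentz_dist A L X x y"
  unfolding lorentz_dist_eq by (intro Sup_upper) auto

context spacetime
begin

lemma L_velocity_continuous:
  assumes "C1_curve A I \<gamma>" "\<And>t. t \<in> I \<Longrightarrow> at t within I \<noteq> bot"
  shows "continuous_on I (\<lambda>t. L (velocity A I \<gamma> t))"
  unfolding continuous_on_def
proof
  fix t assume t: "t \<in> I"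
  obtain c where c: "c \<in> A" "\<gamma> t \<in> cdom c" using chart_exists by blast
  have cont: "continuous_on I \<gamma>" using assms(1) by (simp add: C1_curve_def)
  obtain e where e: "e > 0" "\<And>s. s \<in> I \<Longrightarrow> dist s t < e \<Longrightarrow> \<gamma> s \<in> cdom c" using chart_near[OF cont t c] by blast
  have eq: "L (velocity A I \<gamma> s) = l c (cmap c (\<gamma> s)) (coord_velocity c I \<gamma> s)" if "s \<in> I" "\<gamma> s \<in> cdom c" for s
    using L_chart[OF C1_curve_velocity_tangent[OF assms(1) that(1) assms(2)[OF that(1)]] c(1) that(2)] c that
    by (simp add: snd_velocity)
  have ev: "\<forall>\<^sub>F s in at t within I. \<gamma> s \<in> cdom c" using e by (auto simp: eventually_at)
  have "((\<lambda>s. cmap c (\<gamma> s)) \<longlongrightarrow> cmap c (\<gamma> t)) (at t within I)"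
    using continuous_on_tendsto_compose[OF chart_continuous(1)[OF chart[OF c(1)]], of \<gamma> "\<gamma> t" "at t within I"]
      ev cont c t by (auto simp: continuous_on_def)
  then have "((\<lambda>s. l c (cmap c (\<gamma> s)) (coord_velocity c I \<gamma> s)) \<longlongrightarrow> l c (cmap c (\<gamma> t)) (coord_velocity c I \<gamma> t)) (at t within I)"
    by (intro l_tendsto) (use c C1_curve_chart(2)[OF assms(1) t c] in \<open>auto simp: continuous_within\<close>)
  moreover have "\<forall>\<^sub>F s in at t within I. l c (cmap c (\<gamma> s)) (coord_velocity c I \<gamma> s) = L (velocity A I \<gamma> s)"
    using e eq by (auto simp: eventually_at intro!: exI[of _ e])
  ultimately show "((\<lambda>t. L (velocity A I \<gamma> t)) \<longlongrightarrow> L (velocity A I \<gamma> t)) (at t within I)"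
    using eq[OF t c(2)] Lim_transform_eventually by fastforce
qed

lemma F_velocity_continuous:
  assumes "C1_curve A {a..b} \<gamma>" "a < b"
  shows "continuous_on {a..b} (\<lambda>t. finsler_F L (velocity A {a..b} \<gamma> t))"
  unfolding finsler_F_def by (intro continuous_intros L_velocity_continuous assms ivl_perfect)

lemma F_velocity_nonneg:
  assumes "C1_curve A {a..b} \<gamma>" "a < b" "has_causal_velocity A L X {a..b} \<gamma>" "t \<in> {a..b}"
  shows "finsler_F L (velocity A {a..b} \<gamma> t) \<ge> 0"
  using causal_L_nonpos[of "velocity A {a..b} \<gamma> t" "\<gamma> t"] assms C1_curve_velocity_tangent[OF assms(1,4) ivl_perfect[OF assms(2,4)]]
  by (auto simp: finsler_F_def has_causal_velocity_def)

lemma causal_path_nonneg: "causal_path A L X u w len \<Longrightarrow> 0 \<le> len"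
  unfolding causal_path_def curve_length_def using F_velocity_nonneg
  by (auto intro!: integral_nonneg integrable_continuous_interval F_velocity_continuous)

lemma causal_path_sub:
  assumes \<gamma>: "C1_curve A {a..b} \<gamma>" "has_causal_velocity A L X {a..b} \<gamma>" and pq: "a \<le> p" "p < q" "q \<le> b"
  shows "causal_path A L X (velocity A {a..b} \<gamma> p) (velocity A {a..b} \<gamma> q)
     (integral {p..q} (\<lambda>t. finsler_F L (velocity A {a..b} \<gamma> t)))"
proof -
  have sub: "{p..q} \<subseteq> {a..b}" using pq by auto
  note C1 = C1_curve_subset[OF \<gamma>(1) sub pq(2)]
  have "integral {p..q} (\<lambda>t. finsler_F L (velocity A {p..q} \<gamma> t)) = integral {p..q} (\<lambda>t. finsler_F L (velocity A {a..b} \<gamma> t))"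
    by (rule integral_cong) (simp add: C1(2))
  then show ?thesis unfolding causal_path_def using C1 pq \<gamma>(2) sub
    by (intro exI[of _ \<gamma>] exI[of _ p] exI[of _ q]) (auto simp: has_causal_velocity_def curve_length_def)
qed

lemma causal_path_shift:
  assumes "causal_path A L X u w len"
  obtains \<gamma> b where "s < b" "C1_curve A {s..b} \<gamma>" "has_causal_velocity A L X {s..b} \<gamma>"
    "velocity A {s..b} \<gamma> s = u" "velocity A {s..b} \<gamma> b = w" "curve_length A L \<gamma> s b = len"
proof -
  from assms obtain \<gamma> a b where \<gamma>: "a < b" "C1_curve A {a..b} \<gamma>" "has_causal_velocity A L X {a..b} \<gamma>"
     "velocity A {a..b} \<gamma> a = u" "velocity A {a..b} \<gamma> b = w" "curve_length A L \<gamma> a b = len"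
    unfolding causal_path_def by blast
  define b' where "b' = b + (s - a)"
  define \<gamma>' where "\<gamma>' = (\<lambda>t. \<gamma> (1 * t + (a - s)))"
  have sb: "s < b'" using \<gamma>(1) by (simp add: b'_def)
  have C1: "C1_curve A {s..b'} \<gamma>'" 
    and "\<And>t. t \<in> {s..b'} \<Longrightarrow> velocity A {s..b'} \<gamma>' t = tscale 1 (velocity A {a..b} \<gamma> (1 * t + (a - s)))"
    unfolding \<gamma>'_def by (rule C1_curve_affine[OF \<gamma>(2) ivl_perfect[OF \<gamma>(1)] ivl_perfect[OF sb]]; force simp: b'_def)+
  then have v: "velocity A {s..b'} \<gamma>' t = velocity A {a..b} \<gamma> (t + (a - s))" if "t \<in> {s..b'}" for t
    using that by (simp add: tscale_1)
  have "integral {s..b'} (\<lambda>t. finsler_F L (velocity A {s..b'} \<gamma>' t)) =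
     integral {s..b'} ((\<lambda>t. finsler_F L (velocity A {a..b} \<gamma> t)) \<circ> (+) (a - s))"
    by (rule integral_cong) (simp add: v add.commute)
  also have "\<dots> = len" using \<gamma>(6) by (simp add: integral_shift_Icc_real b'_def curve_length_def)
  finally have len: "curve_length A L \<gamma>' s b' = len" by (simp add: curve_length_def)
  have "has_causal_velocity A L X {s..b'} \<gamma>'"
    unfolding has_causal_velocity_def
  proof
    fix t assume t: "t \<in> {s..b'}"
    then have "t + (a - s) \<in> {a..b}" by (auto simp: b'_def)
    then show "velocity A {s..b'} \<gamma>' t \<in> causal_cone A L X (\<gamma>' t)"
      using \<gamma>(3) v[OF t] by (auto simp: has_causal_velocity_def \<gamma>'_def)
  qed
  with sb C1 len v[of s] v[of b'] \<gamma> show thesis by (intro that) (auto simp: b'_def)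
qed

text \<open>Lengths add exactly here, as matching velocities leave no corner. The lossy version for
  different velocities is \<open>corner\<close>.\<close>

lemma causal_path_trans:
  assumes "causal_path A L X u v l1" "causal_path A L X v w l2"
  shows "causal_path A L X u w (l1 + l2)"
proof -
  from assms(1) obtain \<gamma>1 a b where 1: "a < b" "C1_curve A {a..b} \<gamma>1" "has_causal_velocity A L X {a..b} \<gamma>1"
     "velocity A {a..b} \<gamma>1 a = u" "velocity A {a..b} \<gamma>1 b = v" "curve_length A L \<gamma>1 a b = l1"
    unfolding causal_path_def by blast
  obtain \<gamma>2 e where 2: "b < e" "C1_curve A {b..e} \<gamma>2" "has_causal_velocity A L X {b..e} \<gamma>2"
     "velocity A {b..e} \<gamma>2 b = v" "velocity A {b..e} \<gamma>2 e = w" "curve_length A L \<gamma>2 b e = l2"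
    using causal_path_shift[OF assms(2)] by metis
  have veq: "velocity A {a..b} \<gamma>1 b = velocity A {b..e} \<gamma>2 b" using 1 2 by simp
  define \<gamma> where "\<gamma> = (\<lambda>t. if t \<in> {a..b} then \<gamma>1 t else \<gamma>2 t)"
  note glue = C1_curve_glue[OF 1(1) 2(1) 1(2) 2(2) veq, folded \<gamma>_def]
  have ae: "a < e" using 1 2 by simp
  let ?F = "\<lambda>t. finsler_F L (velocity A {a..e} \<gamma> t)"
  have "integral {a..b} ?F = integral {a..b} (\<lambda>t. finsler_F L (velocity A {a..b} \<gamma>1 t))"
    by (rule integral_cong) (simp add: glue(2))
  then have "integral {a..b} ?F = l1" using 1(6) by (simp add: curve_length_def)
  moreover have "integral {b..e} ?F = integral {b..e} (\<lambda>t. finsler_F L (velocity A {b..e} \<gamma>2 t))"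
    by (rule integral_cong) (simp add: glue(3))
  then have "integral {b..e} ?F = l2" using 2(6) by (simp add: curve_length_def)
  moreover have "integral {a..b} ?F + integral {b..e} ?F = integral {a..e} ?F"
    using 1 2 by (intro Henstock_Kurzweil_Integration.integral_combine integrable_continuous_interval F_velocity_continuous glue ae) auto
  ultimately have len: "curve_length A L \<gamma> a e = l1 + l2" by (simp add: curve_length_def)
  have "has_causal_velocity A L X {a..e} \<gamma>"
    unfolding has_causal_velocity_def
  proof
    fix t assume "t \<in> {a..e}"
    then consider "t \<in> {a..b}" | "t \<in> {b..e}" by fastforce
    then show "velocity A {a..e} \<gamma> t \<in> causal_cone A L X (\<gamma> t)"
    proof cases
      case 1
      then show ?thesis using glue(2)[OF 1] \<open>has_causal_velocity A L X {a..b} \<gamma>1\<close> by (simp add: has_causal_velocity_def \<gamma>_def)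
    next
      case 2
      have "\<gamma> t = \<gamma>2 t" using arg_cong[OF glue(3)[OF 2], of fst] by simp
      then show ?thesis using glue(3)[OF 2] \<open>has_causal_velocity A L X {b..e} \<gamma>2\<close> 2 by (simp add: has_causal_velocity_def)
    qed
  qed
  then show ?thesis unfolding causal_path_def
    using ae glue(1) glue(2)[of a] glue(3)[of e] 1 2 len by (intro exI[of _ \<gamma>] exI[of _ a] exI[of _ e]) auto
qed

lemma causal_path_from_chart:
  assumes c: "c \<in> A" and ab: "a < b"
    and \<kappa>: "\<And>t. t \<in> {a..b} \<Longrightarrow> \<kappa> t \<in> cimg c"
      "\<And>t. t \<in> {a..b} \<Longrightarrow> (\<kappa> has_vector_derivative \<kappa>' t) (at t within {a..b})" "continuous_on {a..b} \<kappa>'"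
      "\<And>t. t \<in> {a..b} \<Longrightarrow> tvec_of A c (cinv c (\<kappa> t)) (\<kappa>' t) \<in> causal_cone A L X (cinv c (\<kappa> t))"
  shows "causal_path A L X (tvec_of A c (cinv c (\<kappa> a)) (\<kappa>' a)) (tvec_of A c (cinv c (\<kappa> b)) (\<kappa>' b))
    (integral {a..b} (\<lambda>t. sqrt (- 2 * l c (\<kappa> t) (\<kappa>' t))))"
proof -
  note C1 = C1_curve_from_chart[OF c ab \<kappa>(1-3)]
  have "integral {a..b} (\<lambda>t. finsler_F L (velocity A {a..b} (\<lambda>t. cinv c (\<kappa> t)) t)) = 
     integral {a..b} (\<lambda>t. sqrt (- 2 * l c (\<kappa> t) (\<kappa>' t)))"
  proof (rule integral_cong)
    fix t assume t: "t \<in> {a..b}"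
    show "finsler_F L (velocity A {a..b} (\<lambda>t. cinv c (\<kappa> t)) t) = sqrt (- 2 * l c (\<kappa> t) (\<kappa>' t))"
      unfolding finsler_F_def Lc_def by (subst C1(2)) (use t in auto)
  qed
  then show ?thesis
    unfolding causal_path_def using C1 ab \<kappa>(4)
    by (intro exI[of _ "\<lambda>t. cinv c (\<kappa> t)"] exI[of _ a] exI[of _ b]) (auto simp: curve_length_def has_causal_velocity_def)
qed

end

section \<open>The reverse structure\<close>

lemma reverse_involution:
  "tminus (tminus v) = v" "reverse_L (reverse_L L) = L" "reverse_X (reverse_X X) = X"
  by (auto simp: tminus_def reverse_L_def reverse_X_def prod_eq_iff)

lemma fst_tminus [simp]: "fst (tminus v) = fst v"
  by (simp add: tminus_def)

lemma continuous_tminus: "continuous_on UNIV (tminus :: ('m::topological_space, 'e::euclidean_space) tvec \<Rightarrow> _)"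
  unfolding tminus_def
  by (intro continuous_on_Pair continuous_on_coordinatewise_then_product continuous_on_minus
      continuous_on_product_then_coordinatewise[OF continuous_on_snd[OF continuous_on_id]] continuous_on_fst continuous_on_id)

lemma tscale_minus: "tscale (- 1) v = tminus v"
  by (simp add: tscale_def tminus_def)

context smooth_mfd
begin

lemma tminus_tangent: "v \<in> tangent_space A p \<Longrightarrow> tminus v \<in> tangent_space A p"
  by (metis chart_exists tvec_of_minus tvec_of_snd tvec_of_tangent)

end

context spacetime
begin

lemma Lc_reverse: "c \<in> A \<Longrightarrow> x \<in> cimg c \<Longrightarrow> Lc A (reverse_L L) c x v = l c x (- v)"
  by (simp add: Lc_def reverse_L_def tvec_of_minus chart_simps)

lemma pd_reflect:
  assumes "f differentiable (at (- v))"
  shows "pd \<alpha> (\<lambda>v. f (- v)) v = - pd \<alpha> f (- v)"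
proof -
  have "((\<lambda>v. f (- v)) has_derivative (\<lambda>h. frechet_derivative f (at (- v)) (- h))) (at v)"
    by (rule has_derivative_compose[of uminus uminus v UNIV f])
      (use assms frechet_has_derivative in \<open>auto intro!: derivative_eq_intros\<close>)
  from frechet_eqI[OF this] show ?thesis
    using linear_frechet_derivative[OF assms] by (simp add: pd_def linear_neg)
qed

text \<open>The two signs from differentiating twice through v \<mapsto> -v cancel.\<close>

lemma reverse_signature:
  assumes "c \<in> A" "x \<in> cimg c" "v \<noteq> 0"
  shows "fund A (reverse_L L) c x v = fund A L c x (- v)"
proof -
  interpret minkowski_norm "l c x" by (rule minkowski[OF assms(1,2)])
  have 1: "pd \<beta> (Lc A (reverse_L L) c x) w = - pd \<beta> (l c x) (- w)" if "w \<noteq> 0" for w \<beta>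
  proof -
    have "Lc A (reverse_L L) c x = (\<lambda>v. l c x (- v))" using Lc_reverse[OF assms(1,2)] by blast
    then show ?thesis using pd_reflect[of "l c x" w \<beta>] has_derivative_D[of "- w"] that differentiableI by auto
  qed
  have "pd \<alpha> (pd \<beta> (Lc A (reverse_L L) c x)) v = pd \<alpha> (pd \<beta> (l c x)) (- v)" for \<alpha> \<beta>
  proof -
    have diff: "pd \<beta> (l c x) differentiable (at (- v))"
      using has_derivative_H[of "- v" "axis \<beta> 1"] assms(3) by (auto simp: pd_def[abs_def] D_def[abs_def] intro: differentiableI)
    have "((\<lambda>w. pd \<beta> (l c x) (- w)) has_derivative (\<lambda>h. frechet_derivative (pd \<beta> (l c x)) (at (- v)) (- h))) (at v)"
      by (rule has_derivative_compose[of uminus uminus v UNIV "pd \<beta> (l c x)"])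
        (use diff frechet_has_derivative in \<open>auto intro!: derivative_eq_intros\<close>)
    then have "((\<lambda>w. - pd \<beta> (l c x) (- w)) has_derivative (\<lambda>h. - frechet_derivative (pd \<beta> (l c x)) (at (- v)) (- h))) (at v)"
      by (rule has_derivative_minus)
    then have "(pd \<beta> (Lc A (reverse_L L) c x) has_derivative (\<lambda>h. - frechet_derivative (pd \<beta> (l c x)) (at (- v)) (- h))) (at v)"
      by (rule has_derivative_transform_within_open[OF _ open_delete[OF open_UNIV, of 0]]) (use assms(3) 1 in auto)
    from frechet_eqI[OF this] show ?thesis
      using linear_frechet_derivative[OF diff] by (simp add: pd_def[of \<alpha>] linear_neg)
  qed
  then show ?thesis by (simp add: fund_def dv_def[abs_def])
qed

text \<open>Every statement about the past becomes an instance of the corresponding statement about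
  the future, for the reversed structure.\<close>

lemma reverse_spacetime: "spacetime A (reverse_L L) (reverse_X X)"
proof
  have man: "smooth_manifold A" "connected (UNIV :: 'm set)" using spacetime by (auto simp: finsler_spacetime_def)
  have "lorentz_finsler A (reverse_L L)"
    unfolding lorentz_finsler_def
  proof (intro conjI ballI allI impI)
    fix c assume c: "c \<in> A"
    have "smooth_on (cimg c \<times> (UNIV - {0})) (\<lambda>z. (\<lambda>(x, v). l c x v) (fst z, - snd z))"
      by (rule smooth_on_compose[OF open_slit[OF c] open_slit[OF c] _ _ L_smooth[OF c]])
        (auto intro!: smooth_on_linear[OF open_slit[OF c]] bounded_linear_Pair bounded_linear_fst bounded_linear_minus bounded_linear_snd)
    then show "smooth_on (cimg c \<times> (UNIV - {0})) (\<lambda>(x, v). Lc A (reverse_L L) c x v)"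
      by (rule smooth_on_cong[OF open_slit[OF c], rotated]) (auto simp: Lc_reverse c)
  next
    fix v and r :: real assume v: "v \<in> tangent_bundle A" "0 < r"
    then have "tminus v \<in> tangent_bundle A" using tminus_tangent unfolding tangent_bundle_def by blast
    then have "L (tscale r (tminus v)) = r\<^sup>2 * L (tminus v)"
      using spacetime v by (auto simp: finsler_spacetime_def lorentz_finsler_def)
    moreover have "tscale r (tminus v) = tminus (tscale r v)" by (simp add: tscale_def tminus_def)
    ultimately show "reverse_L L (tscale r v) = r\<^sup>2 * reverse_L L v" by (simp add: reverse_L_def)
  next
    fix c x and v :: "real^'i" assume "c \<in> A" "x \<in> cimg c" "v \<noteq> 0"
    then show "lorentzian_signature (fund A (reverse_L L) c x v)"
      using spacetime unfolding finsler_spacetime_def lorentz_finsler_def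
      by (metis neg_equal_0_iff_equal reverse_signature)
  qed
  moreover have "smooth_vector_field A (reverse_X X)"
    unfolding smooth_vector_field_def
  proof (intro conjI allI ballI)
    fix p show "reverse_X X p \<in> tangent_space A p" using tminus_tangent[OF X_tangent] by (simp add: reverse_X_def)
  next
    fix c assume c: "c \<in> A"
    then have "smooth_on (cimg c) (\<lambda>x. snd (X (cinv c x)) c)"
      using spacetime by (auto simp: finsler_spacetime_def smooth_vector_field_def)
    then have "smooth_on (cimg c) (\<lambda>x. - snd (X (cinv c x)) c)"
      by (intro smooth_on_compose[OF chart_open(2)[OF chart[OF c]] open_UNIV _ _ smooth_on_linear[OF open_UNIV bounded_linear_minus[OF bounded_linear_ident]]]) auto
    then show "smooth_on (cimg c) (\<lambda>x. snd (reverse_X X (cinv c x)) c)"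
      by (simp add: reverse_X_def tminus_def)
  qed
  moreover have "reverse_L L (reverse_X X p) < 0" for p
    using X_timelike by (simp add: reverse_L_def reverse_X_def reverse_involution)
  ultimately show "finsler_spacetime A (reverse_L L) (reverse_X X)"
    using man by (simp add: finsler_spacetime_def)
qed

lemma reverse_timelike: "v \<in> timelike_cone A L X p \<Longrightarrow> tminus v \<in> timelike_cone A (reverse_L L) (reverse_X X) p"
proof -
  assume "v \<in> timelike_cone A L X p"
  then have "connected_component {v \<in> tangent_space A p. L v < 0} (X p) v" by (simp add: timelike_cone_def)
  then have "connected_component {v \<in> tangent_space A p. reverse_L L v < 0} (tminus (X p)) (tminus v)"
    by (rule connected_component_image)
      (auto simp: reverse_L_def reverse_involution intro: continuous_on_subset[OF continuous_tminus] tminus_tangent)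
  then show ?thesis by (simp add: timelike_cone_def reverse_X_def)
qed

lemma reverse_causal:
  assumes "v \<in> causal_cone A L X p"
  shows "tminus v \<in> causal_cone A (reverse_L L) (reverse_X X) p"
proof -
  have "tminus ` closure (timelike_cone A L X p) \<subseteq> closure (timelike_cone A (reverse_L L) (reverse_X X) p)"
    by (rule image_closure_subset[OF continuous_on_subset[OF continuous_tminus] closed_closure])
      (use reverse_timelike closure_subset in blast)+
  moreover have "tminus v \<noteq> tzero p" if "v \<noteq> tzero p"
    using that by (auto simp: tminus_def tzero_def prod_eq_iff fun_eq_iff)
  ultimately show ?thesis using assms by (auto simp: causal_cone_def)
qed

lemma reverse_causal_path:
  assumes "causal_path A L X u w len"
  shows "causal_path A (reverse_L L) (reverse_X X) (tminus w) (tminus u) len"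
proof -
  from assms obtain \<gamma> a b where \<gamma>: "a < b" "C1_curve A {a..b} \<gamma>" "has_causal_velocity A L X {a..b} \<gamma>"
     "velocity A {a..b} \<gamma> a = u" "velocity A {a..b} \<gamma> b = w" "curve_length A L \<gamma> a b = len"
    unfolding causal_path_def by blast
  define \<gamma>' where "\<gamma>' = (\<lambda>t. \<gamma> ((- 1) * t + 0))"
  have ab: "- b < - a" using \<gamma>(1) by simp
  have C1: "C1_curve A {-b..-a} \<gamma>'" 
    and "\<And>t. t \<in> {-b..-a} \<Longrightarrow> velocity A {-b..-a} \<gamma>' t = tscale (-1) (velocity A {a..b} \<gamma> ((-1) * t + 0))"
    unfolding \<gamma>'_def by (rule C1_curve_affine[OF \<gamma>(2) ivl_perfect[OF \<gamma>(1)] ivl_perfect[OF ab]]; force)+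
  then have v: "velocity A {-b..-a} \<gamma>' t = tminus (velocity A {a..b} \<gamma> (- t))" if "t \<in> {-b..-a}" for t
    using that by (simp add: tscale_minus)
  have "integral {-b..-a} (\<lambda>t. finsler_F (reverse_L L) (velocity A {-b..-a} \<gamma>' t)) =
     integral {-b..-a} (\<lambda>t. finsler_F L (velocity A {a..b} \<gamma> (- t)))"
  proof (rule integral_cong)
    fix t assume t: "t \<in> {-b..-a}"
    show "finsler_F (reverse_L L) (velocity A {-b..-a} \<gamma>' t) = finsler_F L (velocity A {a..b} \<gamma> (- t))"
      unfolding v[OF t] by (simp add: finsler_F_def reverse_L_def reverse_involution)
  qed
  also have "\<dots> = len"
    using \<gamma>(6) Henstock_Kurzweil_Integration.integral_reflect_real[of b a "\<lambda>t. finsler_F L (velocity A {a..b} \<gamma> t)"] by (simp only: curve_length_def)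
  finally have len: "curve_length A (reverse_L L) \<gamma>' (-b) (-a) = len" by (simp add: curve_length_def)
  have "has_causal_velocity A (reverse_L L) (reverse_X X) {-b..-a} \<gamma>'"
    unfolding has_causal_velocity_def
  proof
    fix t assume t: "t \<in> {-b..-a}"
    then have "velocity A {a..b} \<gamma> (- t) \<in> causal_cone A L X (\<gamma> (- t))"
      using \<gamma>(3) by (auto simp: has_causal_velocity_def)
    from reverse_causal[OF this] show "velocity A {-b..-a} \<gamma>' t \<in> causal_cone A (reverse_L L) (reverse_X X) (\<gamma>' t)"
      using v[OF t] by (simp add: \<gamma>'_def)
  qed
  then show ?thesis unfolding causal_path_def
    using ab C1 len v[of "-b"] v[of "-a"] \<gamma> by (intro exI[of _ \<gamma>'] exI[of _ "-b"] exI[of _ "-a"]) auto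
qed

lemma reverse_dist: "lorentz_dist A (reverse_L L) (reverse_X X) x y = lorentz_dist A L X y x"
proof -
  interpret rev: spacetime A "reverse_L L" "reverse_X X" by (rule reverse_spacetime)
  have "{ereal len | len u w. causal_path A (reverse_L L) (reverse_X X) u w len \<and> fst u = x \<and> fst w = y} =
    {ereal len | len u w. causal_path A L X u w len \<and> fst u = y \<and> fst w = x}"
  proof (intro equalityI subsetI)
    fix z assume "z \<in> {ereal len | len u w. causal_path A (reverse_L L) (reverse_X X) u w len \<and> fst u = x \<and> fst w = y}"
    then obtain len u w where z: "z = ereal len" "causal_path A (reverse_L L) (reverse_X X) u w len" "fst u = x" "fst w = y" by blast
    have "causal_path A L X (tminus w) (tminus u) len"
      using rev.reverse_causal_path[OF z(2)] by (simp add: reverse_involution)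
    moreover have "fst (tminus w) = y" "fst (tminus u) = x" using z by auto
    ultimately show "z \<in> {ereal len | len u w. causal_path A L X u w len \<and> fst u = y \<and> fst w = x}" using z(1) by blast
  next
    fix z assume "z \<in> {ereal len | len u w. causal_path A L X u w len \<and> fst u = y \<and> fst w = x}"
    then obtain len u w where z: "z = ereal len" "causal_path A L X u w len" "fst u = y" "fst w = x" by blast
    have "fst (tminus w) = x" "fst (tminus u) = y" using z by auto
    then show "z \<in> {ereal len | len u w. causal_path A (reverse_L L) (reverse_X X) u w len \<and> fst u = x \<and> fst w = y}"
      using z(1) reverse_causal_path[OF z(2)] by blast
  qed
  then show ?thesis unfolding lorentz_dist_eq by simp
qed

end

section \<open>Cutting corners\<close>

text \<open>The velocity is the quadratic Bernstein combination of a, m and b in the parameter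
  \<open>t / \<sigma>\<close>, and the cubic coefficients are the antiderivatives of the weights.
  Each weight has integral \<open>\<sigma> / 3\<close> over [0, \<sigma>].\<close>

lemma bezier_derivative:
  fixes a m b :: "'a::real_normed_vector"
  assumes "\<sigma> \<noteq> 0"
  shows "((\<lambda>t. x + (t - t\<^sup>2 / \<sigma> + t ^ 3 / (3 * \<sigma>\<^sup>2)) *\<^sub>R a + (t\<^sup>2 / \<sigma> - 2 * t ^ 3 / (3 * \<sigma>\<^sup>2)) *\<^sub>R m + (t ^ 3 / (3 * \<sigma>\<^sup>2)) *\<^sub>R b)
    has_vector_derivative ((1 - t / \<sigma>)\<^sup>2 *\<^sub>R a + (2 * (t / \<sigma>) * (1 - t / \<sigma>)) *\<^sub>R m + (t / \<sigma>)\<^sup>2 *\<^sub>R b)) (at t within S)"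
proof -
  have 1: "((\<lambda>t. t - t\<^sup>2 / \<sigma> + t ^ 3 / (3 * \<sigma>\<^sup>2)) has_real_derivative (1 - t / \<sigma>)\<^sup>2) (at t within S)"
    using assms by (auto intro!: derivative_eq_intros simp: field_simps power2_eq_square)
  have 2: "((\<lambda>t. t\<^sup>2 / \<sigma> - 2 * t ^ 3 / (3 * \<sigma>\<^sup>2)) has_real_derivative 2 * (t / \<sigma>) * (1 - t / \<sigma>)) (at t within S)"
    using assms by (auto intro!: derivative_eq_intros simp: field_simps power2_eq_square)
  have 3: "((\<lambda>t. t ^ 3 / (3 * \<sigma>\<^sup>2)) has_real_derivative (t / \<sigma>)\<^sup>2) (at t within S)"
    using assms by (auto intro!: derivative_eq_intros simp: field_simps power2_eq_square)
  note sc = has_vector_derivative_scaleR[OF _ has_vector_derivative_const, simplified]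
  show ?thesis
    using has_vector_derivative_add[OF has_vector_derivative_add[OF has_vector_derivative_add[OF
      has_vector_derivative_const[of x] sc[OF 1, of a]] sc[OF 2, of m]] sc[OF 3, of b]] by simp
qed

context spacetime
begin

lemma causal_path_timelike_chart:
  assumes c: "c \<in> A" and ab: "a < b"
    and \<kappa>: "\<And>t. t \<in> {a..b} \<Longrightarrow> \<kappa> t \<in> cimg c" "\<And>t. t \<in> {a..b} \<Longrightarrow> \<kappa>' t \<in> Om c (\<kappa> t)"
      "\<And>t. t \<in> {a..b} \<Longrightarrow> (\<kappa> has_vector_derivative \<kappa>' t) (at t within {a..b})" "continuous_on {a..b} \<kappa>'"
  shows "causal_path A L X (tvec_of A c (cinv c (\<kappa> a)) (\<kappa>' a)) (tvec_of A c (cinv c (\<kappa> b)) (\<kappa>' b))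
    (integral {a..b} (\<lambda>t. sqrt (- 2 * l c (\<kappa> t) (\<kappa>' t))))"
  by (rule causal_path_from_chart[OF c ab])
    (use \<kappa> c in \<open>auto intro!: timelike_causal simp: tvec_of_timelike chart_simps\<close>)

text \<open>The velocity is a convex combination of a, m and b, so it stays in the convex cone as
  long as the curve stays where all three are timelike. The end velocities are prescribed, and the
  middle vector m remains free to adjust the end point.\<close>

lemma bezier_path:
  assumes c: "c \<in> A" and \<sigma>: "\<sigma> > 0"
    and near: "\<And>x. dist x x0 < \<rho> \<Longrightarrow> x \<in> cimg c \<and> a \<in> Om c x \<and> m \<in> Om c x \<and> b \<in> Om c x"
    and small: "dist x x0 + \<sigma> * (norm a + norm m + norm b) < \<rho>"
  shows "\<exists>len. causal_path A L X (tvec_of A c (cinv c x) a) (tvec_of A c (cinv c (x + (\<sigma> / 3) *\<^sub>R (a + m + b))) b) len"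
proof -
  define \<kappa> where "\<kappa> t = x + (t - t\<^sup>2 / \<sigma> + t ^ 3 / (3 * \<sigma>\<^sup>2)) *\<^sub>R a + (t\<^sup>2 / \<sigma> - 2 * t ^ 3 / (3 * \<sigma>\<^sup>2)) *\<^sub>R m + (t ^ 3 / (3 * \<sigma>\<^sup>2)) *\<^sub>R b" for t
  define \<kappa>' where "\<kappa>' t = (1 - t / \<sigma>)\<^sup>2 *\<^sub>R a + (2 * (t / \<sigma>) * (1 - t / \<sigma>)) *\<^sub>R m + (t / \<sigma>)\<^sup>2 *\<^sub>R b" for t
  have nrm: "dist (\<kappa> t) x0 < \<rho>" if t: "t \<in> {0..\<sigma>}" for t
  proof -
    define q where "q = t / \<sigma>"
    have q: "0 \<le> q" "q \<le> 1" "t = q * \<sigma>" using t \<sigma> by (auto simp: q_def)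
    have e: "t - t\<^sup>2 / \<sigma> + t ^ 3 / (3 * \<sigma>\<^sup>2) = \<sigma> * (q - q\<^sup>2 + q ^ 3 / 3)"
      "t\<^sup>2 / \<sigma> - 2 * t ^ 3 / (3 * \<sigma>\<^sup>2) = \<sigma> * (q\<^sup>2 - 2 * q ^ 3 / 3)" "t ^ 3 / (3 * \<sigma>\<^sup>2) = \<sigma> * (q ^ 3 / 3)"
      using \<sigma> by (simp_all add: q(3) power2_eq_square power3_eq_cube field_simps)
    have q2: "q\<^sup>2 \<le> q" "q ^ 3 \<le> q\<^sup>2" "0 \<le> q ^ 3" "0 \<le> q\<^sup>2"
      using q power_decreasing[of 1 2 q] power_decreasing[of 2 3 q] by auto
    have bnd: "norm ((\<sigma> * s) *\<^sub>R w) \<le> \<sigma> * norm w" if "0 \<le> s" "s \<le> 1" for s and w :: "real^'i"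
      using that \<sigma> by (simp add: abs_mult mult_left_le_one_le mult.assoc)
    have "dist (\<kappa> t) x0 \<le> dist x x0 + norm (\<kappa> t - x)"
      using dist_triangle[of "\<kappa> t" x0 x] by (simp add: dist_norm)
    also have "\<kappa> t - x = (\<sigma> * (q - q\<^sup>2 + q ^ 3 / 3)) *\<^sub>R a + ((\<sigma> * (q\<^sup>2 - 2 * q ^ 3 / 3)) *\<^sub>R m + (\<sigma> * (q ^ 3 / 3)) *\<^sub>R b)"
      unfolding \<kappa>_def unfolding e(1) unfolding e(2) unfolding e(3) by (simp only: add.assoc add_diff_cancel_left')
    also have "norm \<dots> \<le> \<sigma> * norm a + (\<sigma> * norm m + \<sigma> * norm b)"
      by (intro order_trans[OF norm_triangle_ineq] add_mono bnd; use q2 q in linarith)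
    finally show ?thesis using small by (simp add: distrib_left)
  qed
  have 1: "\<kappa>' t \<in> Om c (\<kappa> t)" if t: "t \<in> {0..\<sigma>}" for t
  proof -
    define q where "q = t / \<sigma>"
    have q: "0 \<le> q" "q \<le> 1" using t \<sigma> by (auto simp: q_def)
    have o: "\<kappa> t \<in> cimg c" "a \<in> Om c (\<kappa> t)" "m \<in> Om c (\<kappa> t)" "b \<in> Om c (\<kappa> t)" using near[OF nrm[OF t]] by auto
    have conv: "convex (Om c (\<kappa> t))"
      using minkowski_norm.convex_cone[OF minkowski[OF c o(1)]] by (simp add: Om_cone[OF c o(1)])
    \<comment> \<open>De Casteljau's form: a convex combination of two convex combinations.\<close>
    have "\<kappa>' t = (1 - q) *\<^sub>R ((1 - q) *\<^sub>R a + q *\<^sub>R m) + q *\<^sub>R ((1 - q) *\<^sub>R m + q *\<^sub>R b)"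
    proof -
      have k: "2 * q * (1 - q) = (1 - q) * q + q * (1 - q)" by (simp add: algebra_simps)
      show ?thesis unfolding \<kappa>'_def q_def[symmetric] k
        by (simp only: scaleR_add_right scaleR_add_left scaleR_scaleR power2_eq_square add.assoc)
    qed
    then show ?thesis using q o by (simp add: convexD[OF conv])
  qed
  have "causal_path A L X (tvec_of A c (cinv c (\<kappa> 0)) (\<kappa>' 0)) (tvec_of A c (cinv c (\<kappa> \<sigma>)) (\<kappa>' \<sigma>))
    (integral {0..\<sigma>} (\<lambda>t. sqrt (- 2 * l c (\<kappa> t) (\<kappa>' t))))"
  proof (rule causal_path_timelike_chart[OF c \<sigma> _ 1])
    show "continuous_on {0..\<sigma>} \<kappa>'" unfolding \<kappa>'_def by (intro continuous_intros) (use \<sigma> in auto)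
    show "(\<kappa> has_vector_derivative \<kappa>' t) (at t within {0..\<sigma>})" for t
      unfolding \<kappa>_def \<kappa>'_def by (rule bezier_derivative) (use \<sigma> in simp)
  qed (use near nrm in auto)
  moreover have "\<kappa> 0 = x" "\<kappa>' 0 = a" "\<kappa>' \<sigma> = b" using \<sigma> by (simp_all add: \<kappa>_def \<kappa>'_def)
  moreover have "\<kappa> \<sigma> = x + (\<sigma> / 3) *\<^sub>R (a + m + b)"
  proof -
    have "\<sigma> - \<sigma>\<^sup>2 / \<sigma> + \<sigma> ^ 3 / (3 * \<sigma>\<^sup>2) = \<sigma> / 3" "\<sigma>\<^sup>2 / \<sigma> - 2 * \<sigma> ^ 3 / (3 * \<sigma>\<^sup>2) = \<sigma> / 3" "\<sigma> ^ 3 / (3 * \<sigma>\<^sup>2) = \<sigma> / 3"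
      using \<sigma> by (simp_all add: power2_eq_square power3_eq_cube)
    then show ?thesis by (simp only: \<kappa>_def scaleR_add_right add.assoc)
  qed
  ultimately show ?thesis by auto
qed

text \<open>The curve is displaced by \<open>\<theta> / \<delta> * (\<delta> - t)\<^sup>2\<close>
  against w, whereby its velocity gains \<open>2 * \<theta> * (1 - t / \<delta>)\<close> times w.
  The length of the displacement is this gain times \<open>(\<delta> - t) * norm w / 2\<close>,
  which \<open>push_off\<close> tolerates. Displacement and gain both vanish at \<delta>, so the new
  curve joins the old one with the same, possibly only causal, velocity, while it starts with a
  timelike one.\<close>

lemma push_path:
  assumes c: "c \<in> A" and \<delta>: "\<delta> > 0" "0 < \<theta>"
    and push: "\<And>x u t x'. dist x x0 < r \<Longrightarrow> dist u v < r \<Longrightarrow> u \<in> closure (Om c x) \<Longrightarrow> 0 < t \<Longrightarrow> t < r \<Longrightarrow>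
       dist x' x \<le> r * t \<Longrightarrow> x' \<in> cimg c \<and> u + t *\<^sub>R w \<in> Om c x'"
    and r: "2 * \<theta> < r" "\<delta> * norm w \<le> 2 * r"
    and \<kappa>: "\<And>t. t \<in> {0..\<delta>} \<Longrightarrow> \<kappa> t \<in> cimg c \<and> dist (\<kappa> t) x0 < r \<and> dist (\<kappa>' t) v < r \<and> \<kappa>' t \<in> closure (Om c (\<kappa> t))"
      "\<And>t. t \<in> {0..\<delta>} \<Longrightarrow> (\<kappa> has_vector_derivative \<kappa>' t) (at t within {0..\<delta>})" "continuous_on {0..\<delta>} \<kappa>'"
      "tvec_of A c (cinv c (\<kappa> \<delta>)) (\<kappa>' \<delta>) \<in> causal_cone A L X (cinv c (\<kappa> \<delta>))"
  shows "\<exists>len. causal_path A L X (tvec_of A c (cinv c (\<kappa> 0 - (\<theta> * \<delta>) *\<^sub>R w)) (\<kappa>' 0 + (2 * \<theta>) *\<^sub>R w))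
     (tvec_of A c (cinv c (\<kappa> \<delta>)) (\<kappa>' \<delta>)) len"
proof -
  define p where "p t = \<kappa> t - (\<theta> / \<delta> * (\<delta> - t)\<^sup>2) *\<^sub>R w" for t
  define p' where "p' t = \<kappa>' t + (2 * \<theta> * (1 - t / \<delta>)) *\<^sub>R w" for t
  have d: "(p has_vector_derivative p' t) (at t within {0..\<delta>})" if t: "t \<in> {0..\<delta>}" for t
  proof -
    have "((\<lambda>t. \<theta> / \<delta> * (\<delta> - t)\<^sup>2) has_real_derivative - (2 * \<theta> * (1 - t / \<delta>))) (at t within {0..\<delta>})"
      using \<delta> by (auto intro!: derivative_eq_intros simp: field_simps)
    from has_vector_derivative_scaleR[OF this has_vector_derivative_const[of w]]
    show ?thesis unfolding p_def p'_def
      using has_vector_derivative_diff[OF \<kappa>(2)[OF t]] by fastforce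
  qed
  have tl: "p t \<in> cimg c \<and> p' t \<in> Om c (p t)" if t: "t \<in> {0..<\<delta>}" for t
  proof -
    let ?t = "2 * \<theta> * (1 - t / \<delta>)"
    have tt: "0 < ?t" "?t \<le> 2 * \<theta>" using t \<delta> by (auto simp: field_simps)
    have tr: "?t < r" using tt r(1) by linarith
    have "dist (p t) (\<kappa> t) = \<theta> / \<delta> * (\<delta> - t)\<^sup>2 * norm w" using \<delta> by (simp add: p_def dist_norm abs_mult)
    also have "\<dots> = ?t * ((\<delta> - t) * norm w / 2)" using \<delta> by (simp add: field_simps power2_eq_square)
    also have "\<dots> \<le> ?t * (\<delta> * norm w / 2)" using tt t by (intro mult_left_mono divide_right_mono mult_right_mono) auto
    also have "\<dots> \<le> r * ?t" using tt r(2) by (subst mult.commute, intro mult_right_mono) auto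
    finally show ?thesis
      unfolding p'_def by (intro push[OF _ _ _ tt(1) tr]) (use \<kappa>(1)[of t] t in auto)
  qed
  have pd: "p \<delta> = \<kappa> \<delta>" "p' \<delta> = \<kappa>' \<delta>" using \<delta> by (auto simp: p_def p'_def)
  have "causal_path A L X (tvec_of A c (cinv c (p 0)) (p' 0)) (tvec_of A c (cinv c (p \<delta>)) (p' \<delta>))
    (integral {0..\<delta>} (\<lambda>t. sqrt (- 2 * l c (p t) (p' t))))"
  proof (rule causal_path_from_chart[OF c \<delta>(1) _ d])
    show "continuous_on {0..\<delta>} p'" unfolding p'_def by (intro continuous_intros \<kappa>) (use \<delta> in auto)
    fix t assume t: "t \<in> {0..\<delta>}"
    show "p t \<in> cimg c" using tl[of t] pd \<kappa>(1)[OF t] t by (cases "t = \<delta>") auto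
    show "tvec_of A c (cinv c (p t)) (p' t) \<in> causal_cone A L X (cinv c (p t))"
    proof (cases "t = \<delta>")
      case False
      then show ?thesis using tl[of t] t c by (intro timelike_causal) (simp add: tvec_of_timelike chart_simps)
    qed (use pd \<kappa>(4) in simp)
  qed
  moreover have "p 0 = \<kappa> 0 - (\<theta> * \<delta>) *\<^sub>R w" "p' 0 = \<kappa>' 0 + (2 * \<theta>) *\<^sub>R w" using \<delta> by (simp_all add: p_def p'_def power2_eq_square)
  ultimately show ?thesis using pd by auto
qed

lemma curve_chart_limits:
  assumes \<gamma>: "C1_curve A {a..b} \<gamma>" and t: "t \<in> {a..b}" and c: "c \<in> A" "\<gamma> t \<in> cdom c" and e: "e > 0"
  shows "\<exists>d>0. \<forall>s\<in>{a..b}. \<bar>s - t\<bar> < d \<longrightarrow> \<gamma> s \<in> cdom c \<and> dist (cmap c (\<gamma> s)) (cmap c (\<gamma> t)) < e \<and>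
     dist (coord_velocity c {a..b} \<gamma> s) (coord_velocity c {a..b} \<gamma> t) < e \<and>
     norm (cmap c (\<gamma> s) - cmap c (\<gamma> t) - (s - t) *\<^sub>R coord_velocity c {a..b} \<gamma> t) \<le> e * \<bar>s - t\<bar>"
proof -
  have cont: "continuous_on {a..b} \<gamma>" using \<gamma> by (simp add: C1_curve_def)
  note C = C1_curve_chart[OF \<gamma> t c]
  obtain d1 where d1: "d1 > 0" "\<And>s. s \<in> {a..b} \<Longrightarrow> dist s t < d1 \<Longrightarrow> \<gamma> s \<in> cdom c"
    using chart_near[OF cont t c] by blast
  have "continuous (at t within {a..b}) (cmap c \<circ> \<gamma>)" using C(1) has_vector_derivative_continuous by blast
  then obtain d2 where d2: "d2 > 0" "\<And>s. s \<in> {a..b} \<Longrightarrow> dist s t < d2 \<Longrightarrow> dist (cmap c (\<gamma> s)) (cmap c (\<gamma> t)) < e"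
    using e unfolding continuous_within_eps_delta by fastforce
  obtain d3 where d3: "d3 > 0" "\<And>s. s \<in> {a..b} \<Longrightarrow> dist s t < d3 \<Longrightarrow> dist (coord_velocity c {a..b} \<gamma> s) (coord_velocity c {a..b} \<gamma> t) < e"
    using C(2) e unfolding continuous_within_eps_delta by blast
  have "\<forall>e>0. \<exists>d>0. \<forall>s\<in>{a..b}. norm (s - t) < d \<longrightarrow>
      norm ((cmap c \<circ> \<gamma>) s - (cmap c \<circ> \<gamma>) t - (s - t) *\<^sub>R coord_velocity c {a..b} \<gamma> t) \<le> e * norm (s - t)"
    using C(1) unfolding has_vector_derivative_def has_derivative_within_alt by blast
  with e obtain d4 where d4: "d4 > 0" "\<And>s. s \<in> {a..b} \<Longrightarrow> \<bar>s - t\<bar> < d4 \<Longrightarrow>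
      norm (cmap c (\<gamma> s) - cmap c (\<gamma> t) - (s - t) *\<^sub>R coord_velocity c {a..b} \<gamma> t) \<le> e * \<bar>s - t\<bar>"
    by fastforce
  have "\<exists>d>0. \<forall>x\<in>{d1, d2, d3, d4}. d \<le> x" by (rule common_lower_bound) (use d1 d2 d3 d4 in auto)
  then obtain d where "d > 0" "d \<le> d1" "d \<le> d2" "d \<le> d3" "d \<le> d4" by auto
  with d1 d2 d3 d4 show ?thesis by (intro exI[of _ d]) (auto simp: dist_real_def)
qed

lemma small_piece_length:
  assumes "C1_curve A {a..b} \<gamma>" "a < b"
  shows "\<exists>K. \<forall>p q. a \<le> p \<and> p \<le> q \<and> q \<le> b \<longrightarrow> integral {p..q} (\<lambda>t. finsler_F L (velocity A {a..b} \<gamma> t)) \<le> K * (q - p)"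
proof -
  let ?F = "\<lambda>t. finsler_F L (velocity A {a..b} \<gamma> t)"
  note cont = F_velocity_continuous[OF assms]
  obtain K where K: "\<And>t. t \<in> {a..b} \<Longrightarrow> norm (?F t) \<le> K"
    using compact_imp_bounded[OF compact_continuous_image[OF cont compact_Icc]] unfolding bounded_iff by blast
  have "integral {p..q} ?F \<le> K * (q - p)" if "a \<le> p" "p \<le> q" "q \<le> b" for p q
    using integral_bound[OF that(2) continuous_on_subset[OF cont], of K] K that by fastforce
  then show ?thesis by blast
qed

text \<open>The corner is cut by leaving the first curve slightly before it, and joining the second one tangentially
  from below. The connecting arc has the cubic Bezier form with velocities \<open>a\<close>, \<open>m\<close>, \<open>b\<close>.\<close>

lemma corner:
  assumes P1: "causal_path A L X u v l1" and v: "v \<in> timelike_cone A L X (fst v)"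
    and P2: "causal_path A L X v' w l2" and v': "fst v' = fst v" and e: "e > 0"
  shows "\<exists>len\<ge>l1 + l2 - e. causal_path A L X u w len"
proof -
  from P1 obtain \<gamma>1 a1 b1 where g1: "a1 < b1" "C1_curve A {a1..b1} \<gamma>1" "has_causal_velocity A L X {a1..b1} \<gamma>1"
     "velocity A {a1..b1} \<gamma>1 a1 = u" "velocity A {a1..b1} \<gamma>1 b1 = v" "curve_length A L \<gamma>1 a1 b1 = l1"
    unfolding causal_path_def by blast
  obtain \<gamma>2 b2 where g2: "0 < b2" "C1_curve A {0..b2} \<gamma>2" "has_causal_velocity A L X {0..b2} \<gamma>2"
     "velocity A {0..b2} \<gamma>2 0 = v'" "velocity A {0..b2} \<gamma>2 b2 = w" "curve_length A L \<gamma>2 0 b2 = l2"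
    using causal_path_shift[OF P2] by metis
  define y where "y = fst v"
  have y: "\<gamma>1 b1 = y" "\<gamma>2 0 = y" using arg_cong[OF g1(5), of fst] arg_cong[OF g2(4), of fst] v' by (auto simp: y_def)
  obtain c where c: "c \<in> A" "y \<in> cdom c" using chart_exists by blast
  define x0 where "x0 = cmap c y"
  have x0: "x0 \<in> cimg c" using c by (simp add: x0_def)
  define \<alpha>' where "\<alpha>' t = coord_velocity c {a1..b1} \<gamma>1 t" for t
  define \<kappa>' where "\<kappa>' t = coord_velocity c {0..b2} \<gamma>2 t" for t
  define U where "U = \<alpha>' b1"
  define V where "V = \<kappa>' 0"
  have U: "U \<in> Om c x0"
    using timelike_cone_iff[OF c(1), of y v] v c g1(5) y snd_velocity[of c \<gamma>1 b1 "{a1..b1}"] by (simp add: U_def \<alpha>'_def x0_def y_def)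
  have causal2: "tvec_of A c (\<gamma>2 t) (\<kappa>' t) \<in> causal_cone A L X (\<gamma>2 t)" "\<kappa>' t \<in> closure (Om c (cmap c (\<gamma>2 t)))" "\<kappa>' t \<noteq> 0"
      "velocity A {0..b2} \<gamma>2 t = tvec_of A c (\<gamma>2 t) (\<kappa>' t)"
    if t: "t \<in> {0..b2}" "\<gamma>2 t \<in> cdom c" for t
  proof -
    have tan: "velocity A {0..b2} \<gamma>2 t \<in> tangent_space A (\<gamma>2 t)"
      by (rule C1_curve_velocity_tangent[OF g2(2) t(1) ivl_perfect[OF g2(1) t(1)]])
    have cau: "velocity A {0..b2} \<gamma>2 t \<in> causal_cone A L X (\<gamma>2 t)" using g2(3) t by (simp add: has_causal_velocity_def)
    have snd: "snd (velocity A {0..b2} \<gamma>2 t) c = \<kappa>' t" using snd_velocity c t by (simp add: \<kappa>'_def)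
    show "\<kappa>' t \<in> closure (Om c (cmap c (\<gamma>2 t)))" "\<kappa>' t \<noteq> 0"
      using causal_chart[OF c(1) t(2) cau tan] snd by auto
    show eq: "velocity A {0..b2} \<gamma>2 t = tvec_of A c (\<gamma>2 t) (\<kappa>' t)"
      using tvec_of_snd[OF tan c(1) t(2)] snd by simp
    show "tvec_of A c (\<gamma>2 t) (\<kappa>' t) \<in> causal_cone A L X (\<gamma>2 t)" using cau eq by simp
  qed
  have V: "V \<in> closure (Om c x0)" "V \<noteq> 0" using causal2[of 0] g2(1) y c by (auto simp: V_def x0_def)
  obtain r where r: "r > 0" and push:
    "\<And>x u t x'. dist x x0 < r \<Longrightarrow> dist u V < r \<Longrightarrow> u \<in> closure (Om c x) \<Longrightarrow> 0 < t \<Longrightarrow> t < r \<Longrightarrow>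
       dist x' x \<le> r * t \<Longrightarrow> x' \<in> cimg c \<and> u + t *\<^sub>R U \<in> Om c x'"
    using push_off[OF c(1) x0 V U] by blast
  \<comment> \<open>The bound 1/4 keeps the factor \<open>1 - \<theta>\<close> in \<mu> positive,
    and r/4 keeps the velocity gain \<open>2 * \<theta>\<close> in the range of
    \<open>push_off\<close>.\<close>
  define \<theta> where "\<theta> = min (1 / 4) (r / 4)"
  have \<theta>: "0 < \<theta>" "\<theta> \<le> 1 / 4" "2 * \<theta> < r" using r by (auto simp: \<theta>_def)
  interpret mn: minkowski_norm "l c x0" by (rule minkowski[OF c(1) x0])
  have Om_eq: "Om c x0 = mn.cone (Xc c x0)" by (rule Om_cone[OF c(1) x0])
  \<comment> \<open>U is interior to the cone, so \<open>U - s *\<^sub>R V\<close> is timelike for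
    small s > 0; then B is 1 / s. The vector \<open>B *\<^sub>R U - V\<close> will be the
    approximate middle velocity of the arc, chosen so that V cancels from the sum of the three
    velocities.\<close>
  obtain B where B: "B > 0" "B *\<^sub>R U - V \<in> Om c x0"
  proof -
    have "((\<lambda>s. U - s *\<^sub>R V) \<longlongrightarrow> U - 0 *\<^sub>R V) (at_right 0)" by (intro tendsto_intros)
    then have "\<forall>\<^sub>F s in at_right 0. U - s *\<^sub>R V \<in> Om c x0"
      using topological_tendstoD[OF _ mn.open_cone[of "Xc c x0", folded Om_eq]] U by fastforce
    moreover have "\<forall>\<^sub>F s :: real in at_right 0. s > 0" by (simp add: eventually_at_right_less)
    ultimately have "\<forall>\<^sub>F s :: real in at_right 0. s > 0 \<and> U - s *\<^sub>R V \<in> Om c x0" by eventually_elim simp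
    then obtain s :: real where s: "s > 0" "U - s *\<^sub>R V \<in> Om c x0"
      using eventually_happens' trivial_limit_at_right_real by blast
    have "(1 / s) *\<^sub>R (U - s *\<^sub>R V) \<in> Om c x0" using mn.cone_scale s unfolding Om_eq by simp
    then show thesis using s by (intro that[of "1 / s"]) (auto simp: scaleR_diff_right)
  qed
  \<comment> \<open>To first order the arc leads from \<open>x0 - \<delta> *\<^sub>R U\<close> to
    \<open>x0 - (\<theta> * \<delta>) *\<^sub>R U\<close>, with velocities U, \<open>m0\<close> and
    \<open>b0\<close> whose sum is \<open>(B + 1 + 2 * \<theta>) *\<^sub>R U\<close>. Its
    displacement is \<open>\<sigma> / 3\<close> times this sum, and equating it with
    \<open>(1 - \<theta>) * \<delta>\<close> times U gives \<sigma> = \<mu> * \<delta>.\<close>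
  define \<mu> where "\<mu> = 3 * (1 - \<theta>) / (B + 1 + 2 * \<theta>)"
  have \<mu>: "\<mu> > 0" unfolding \<mu>_def using \<theta> B by (intro divide_pos_pos) auto
  define b0 where "b0 = V + (2 * \<theta>) *\<^sub>R U"
  define m0 where "m0 = B *\<^sub>R U - V"
  have b0: "b0 \<in> Om c x0" unfolding b0_def Om_eq by (rule mn.cone_closure_add) (use V U \<theta> Om_eq in auto)
  obtain \<rho>1 where \<rho>1: "\<rho>1 > 0" "\<And>x' v'. dist x' x0 < \<rho>1 \<Longrightarrow> dist v' U < \<rho>1 \<Longrightarrow> x' \<in> cimg c \<and> v' \<in> Om c x'"
    using Om_near[OF c(1) x0 U] by blast
  obtain \<rho>2 where \<rho>2: "\<rho>2 > 0" "\<And>x' v'. dist x' x0 < \<rho>2 \<Longrightarrow> dist v' m0 < \<rho>2 \<Longrightarrow> x' \<in> cimg c \<and> v' \<in> Om c x'"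
    using Om_near[OF c(1) x0 B(2)[folded m0_def]] by blast
  obtain \<rho>3 where \<rho>3: "\<rho>3 > 0" "\<And>x' v'. dist x' x0 < \<rho>3 \<Longrightarrow> dist v' b0 < \<rho>3 \<Longrightarrow> x' \<in> cimg c \<and> v' \<in> Om c x'"
    using Om_near[OF c(1) x0 b0] by blast
  have "\<exists>\<rho>>0. \<forall>x\<in>{\<rho>1, \<rho>2, \<rho>3}. \<rho> \<le> x" by (rule common_lower_bound) (use \<rho>1 \<rho>2 \<rho>3 in auto)
  then obtain \<rho> where \<rho>: "\<rho> > 0" "\<rho> \<le> \<rho>1" "\<rho> \<le> \<rho>2" "\<rho> \<le> \<rho>3" by auto
  \<comment> \<open>The bound \<open>\<rho> / 4\<close> is for the distance of a from U. The bound
    \<open>\<mu> * \<rho> / 12\<close> is for the differentiability error of the first curve, which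
    enters m multiplied by \<open>3 / \<sigma>\<close>.\<close>
  define e1 where "e1 = min (\<rho> / 4) (\<mu> * \<rho> / 12)"
  have e1: "e1 > 0" "e1 \<le> \<rho> / 4" "e1 \<le> \<mu> * \<rho> / 12" using \<rho> \<mu> by (auto simp: e1_def)
  obtain d1 where d1: "d1 > 0" "\<And>s. s \<in> {a1..b1} \<Longrightarrow> \<bar>s - b1\<bar> < d1 \<Longrightarrow> \<gamma>1 s \<in> cdom c \<and> dist (cmap c (\<gamma>1 s)) x0 < e1 \<and>
     dist (\<alpha>' s) U < e1 \<and> norm (cmap c (\<gamma>1 s) - x0 - (s - b1) *\<^sub>R U) \<le> e1 * \<bar>s - b1\<bar>"
    using curve_chart_limits[OF g1(2), of b1 c e1] g1(1) c y e1(1) unfolding \<alpha>'_def U_def x0_def by auto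
  obtain d2 where d2: "d2 > 0" "\<And>s. s \<in> {0..b2} \<Longrightarrow> \<bar>s\<bar> < d2 \<Longrightarrow> \<gamma>2 s \<in> cdom c \<and> dist (cmap c (\<gamma>2 s)) x0 < r \<and> dist (\<kappa>' s) V < r"
    using curve_chart_limits[OF g2(2), of 0 c r] g2(1) c y r unfolding \<kappa>'_def V_def x0_def by auto
  obtain K1 where K1: "\<And>p q. a1 \<le> p \<Longrightarrow> p \<le> q \<Longrightarrow> q \<le> b1 \<Longrightarrow> integral {p..q} (\<lambda>t. finsler_F L (velocity A {a1..b1} \<gamma>1 t)) \<le> K1 * (q - p)"
    using small_piece_length[OF g1(2,1)] by blast
  obtain K2 where K2: "\<And>p q. 0 \<le> p \<Longrightarrow> p \<le> q \<Longrightarrow> q \<le> b2 \<Longrightarrow> integral {p..q} (\<lambda>t. finsler_F L (velocity A {0..b2} \<gamma>2 t)) \<le> K2 * (q - p)"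
    using small_piece_length[OF g2(2,1)] by blast
  define M where "M = norm U + norm m0 + norm b0 + 3 * \<rho>"
  have M: "M > 0" using \<rho> by (simp add: M_def add_nonneg_pos)
  \<comment> \<open>The first four entries keep \<delta> inside the intervals where the limits
    apply, \<open>\<rho> / (4 * \<mu> * M)\<close> keeps the arc within \<rho> of x0,
    \<open>2 * r / (norm U + 1)\<close> is for \<open>push_path\<close>, and the last entry bounds
    the length of the two discarded pieces by e.\<close>
  have "\<exists>\<delta>>0. \<forall>x\<in>{(b1 - a1) / 2, b2 / 2, d1 / 2, d2 / 2, \<rho> / (4 * \<mu> * M), 2 * r / (norm U + 1), e / (\<bar>K1\<bar> + \<bar>K2\<bar> + 1)}. \<delta> \<le> x"
    by (rule common_lower_bound) (use g1 g2 d1(1) d2(1) \<rho>(1) \<mu> M r e in \<open>auto intro!: divide_pos_pos mult_pos_pos add_nonneg_pos\<close>)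
  then obtain \<delta> where \<delta>: "\<delta> > 0" "\<delta> \<le> (b1 - a1) / 2" "\<delta> \<le> b2 / 2" "\<delta> \<le> d1 / 2" "\<delta> \<le> d2 / 2" "\<delta> \<le> \<rho> / (4 * \<mu> * M)"
     "\<delta> \<le> 2 * r / (norm U + 1)" "\<delta> \<le> e / (\<bar>K1\<bar> + \<bar>K2\<bar> + 1)" by blast
  define s where "s = b1 - \<delta>"
  have s: "a1 < s" "s < b1" "s \<in> {a1..b1}" "\<bar>s - b1\<bar> < d1" "s - b1 = - \<delta>" using \<delta>(1,2,4) g1(1) d1(1) by (auto simp: s_def)
  note D1 = d1(2)[OF s(3,4), unfolded s(5)]
  define x1 where "x1 = cmap c (\<gamma>1 s)"
  define a where "a = \<alpha>' s"
  define \<sigma> where "\<sigma> = \<mu> * \<delta>"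
  have \<sigma>: "\<sigma> > 0" using \<mu> \<delta> by (simp add: \<sigma>_def)
  define z where "z = x0 - (\<theta> * \<delta>) *\<^sub>R U"
  \<comment> \<open>The middle velocity is solved from the condition that the arc ends exactly at z.
    It is timelike because it lies within \<rho> of \<open>m0\<close>.\<close>
  define m where "m = (3 / \<sigma>) *\<^sub>R (z - x1) - a - b0"
  have aU: "dist a U < e1" using D1 by (simp add: a_def)
  have mm: "dist m m0 < \<rho>"
  proof -
    define k where "k = 3 / \<sigma>"
    have "k * ((1 - \<theta>) * \<delta>) = B + 1 + 2 * \<theta>" using \<delta>(1) \<theta> B by (simp add: k_def \<sigma>_def \<mu>_def field_simps)
    then have "m - m0 = k *\<^sub>R (z - x1) - a - b0 - m0 + (B + 1 + 2 * \<theta>) *\<^sub>R U - (k * ((1 - \<theta>) * \<delta>)) *\<^sub>R U"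
      by (simp add: m_def k_def)
    also have "\<dots> = - (k *\<^sub>R (x1 - x0 + \<delta> *\<^sub>R U)) - (a - U)"
      by (simp add: z_def b0_def m0_def algebra_simps)
    also have "k = 3 / \<sigma>" by (simp add: k_def)
    finally have "norm (m - m0) \<le> norm ((3 / \<sigma>) *\<^sub>R (x1 - x0 + \<delta> *\<^sub>R U)) + norm (a - U)"
      using norm_triangle_ineq4[of "- ((3 / \<sigma>) *\<^sub>R (x1 - x0 + \<delta> *\<^sub>R U))" "a - U"] by simp
    also have "norm ((3 / \<sigma>) *\<^sub>R (x1 - x0 + \<delta> *\<^sub>R U)) \<le> (3 / \<sigma>) * (e1 * \<delta>)"
      using D1 \<sigma> \<delta>(1) by (simp add: x1_def mult_left_mono divide_right_mono)
    also have "(3 / \<sigma>) * (e1 * \<delta>) = 3 * e1 / \<mu>" using \<mu> \<delta>(1) by (simp add: \<sigma>_def)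
    also have "3 * e1 / \<mu> \<le> \<rho> / 4" using e1(3) \<mu> by (simp add: field_simps)
    finally show ?thesis using aU e1(2) \<rho>(1) by (simp add: dist_norm)
  qed
  have na: "norm a \<le> norm U + \<rho>" "norm m \<le> norm m0 + \<rho>"
    using norm_triangle_sub[of a U] norm_triangle_sub[of m m0] aU mm e1 \<rho> by (auto simp: dist_norm)
  have small: "dist x1 x0 + \<sigma> * (norm a + norm m + norm b0) < \<rho>"
  proof -
    have "norm a + norm m + norm b0 \<le> M" using na \<rho> by (simp add: M_def)
    then have "\<sigma> * (norm a + norm m + norm b0) \<le> \<sigma> * M" using \<sigma> by (intro mult_left_mono) auto
    also have "\<dots> \<le> \<rho> / 4" using \<delta>(6) \<mu> M by (simp add: \<sigma>_def field_simps)
    finally show ?thesis using D1 e1 \<rho> by (simp add: x1_def)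
  qed
  have zeq: "x1 + (\<sigma> / 3) *\<^sub>R (a + m + b0) = z" using \<sigma> by (simp add: m_def algebra_simps)
  obtain lb where lb: "causal_path A L X (tvec_of A c (cinv c x1) a) (tvec_of A c (cinv c z) b0) lb"
    using bezier_path[OF c(1) \<sigma>, of x0 \<rho> a m b0 x1] small \<rho>1(2)[of _ a] \<rho>2(2)[of _ m] \<rho>3(2)[of _ b0] aU mm e1 \<rho> \<rho>3(1) zeq by fastforce
  have in2: "\<gamma>2 t \<in> cdom c \<and> t \<in> {0..b2} \<and> dist (cmap c (\<gamma>2 t)) x0 < r \<and> dist (\<kappa>' t) V < r" if "t \<in> {0..\<delta>}" for t
    using d2(2)[of t] that \<delta>(3,5) d2(1) g2(1) by auto
  have sub2: "{0..\<delta>} \<subseteq> {0..b2}" using \<delta> g2 by auto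
  have "\<exists>len. causal_path A L X (tvec_of A c (cinv c (cmap c (\<gamma>2 0) - (\<theta> * \<delta>) *\<^sub>R U)) (\<kappa>' 0 + (2 * \<theta>) *\<^sub>R U))
     (tvec_of A c (cinv c (cmap c (\<gamma>2 \<delta>))) (\<kappa>' \<delta>)) len"
  proof (rule push_path[OF c(1) \<delta>(1) \<theta>(1) push])
    show "2 * \<theta> < r" by (rule \<theta>(3))
    have "\<delta> * norm U \<le> \<delta> * (norm U + 1)" using \<delta>(1) by simp
    also have "\<dots> \<le> 2 * r" using \<delta>(7) by (subst (asm) pos_le_divide_eq) (auto simp: add_nonneg_pos)
    finally show "\<delta> * norm U \<le> 2 * r" .
    fix t assume t: "t \<in> {0..\<delta>}"
    show "cmap c (\<gamma>2 t) \<in> cimg c \<and> dist (cmap c (\<gamma>2 t)) x0 < r \<and> dist (\<kappa>' t) V < r \<and> \<kappa>' t \<in> closure (Om c (cmap c (\<gamma>2 t)))"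
      using in2[OF t] causal2[of t] by auto
    have "((cmap c \<circ> \<gamma>2) has_vector_derivative \<kappa>' t) (at t within {0..b2})"
      unfolding \<kappa>'_def using in2[OF t] by (intro C1_curve_chart(1)[OF g2(2) _ c(1)]) auto
    then show "((\<lambda>t. cmap c (\<gamma>2 t)) has_vector_derivative \<kappa>' t) (at t within {0..\<delta>})"
      using sub2 has_vector_derivative_within_subset by (fastforce simp: o_def)
  next
    show "continuous_on {0..\<delta>} \<kappa>'"
      unfolding continuous_on_eq_continuous_within
    proof
      fix t assume t: "t \<in> {0..\<delta>}"
      have "continuous (at t within {0..b2}) \<kappa>'"
        unfolding \<kappa>'_def using in2[OF t] by (intro C1_curve_chart(2)[OF g2(2) _ c(1)]) auto
      then show "continuous (at t within {0..\<delta>}) \<kappa>'" using sub2 continuous_within_subset by blast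
    qed
    show "tvec_of A c (cinv c (cmap c (\<gamma>2 \<delta>))) (\<kappa>' \<delta>) \<in> causal_cone A L X (cinv c (cmap c (\<gamma>2 \<delta>)))"
      using in2[of \<delta>] \<delta>(1) causal2(1)[of \<delta>] c by (simp add: chart_simps)
  qed
  then obtain lp where lp: "causal_path A L X (tvec_of A c (cinv c z) b0) (velocity A {0..b2} \<gamma>2 \<delta>) lp"
    using y c in2[of \<delta>] \<delta>(1) causal2(4)[of \<delta>] by (auto simp: z_def b0_def V_def x0_def chart_simps)
  have s_vel: "velocity A {a1..b1} \<gamma>1 s = tvec_of A c (cinv c x1) a"
    using C1_curve_velocity[OF g1(2) s(3) c(1) _ ivl_perfect[OF g1(1) s(3)]] D1 c by (simp add: x1_def a_def \<alpha>'_def chart_simps)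
  let ?F1 = "\<lambda>t. finsler_F L (velocity A {a1..b1} \<gamma>1 t)" and ?F2 = "\<lambda>t. finsler_F L (velocity A {0..b2} \<gamma>2 t)"
  have p1: "causal_path A L X u (tvec_of A c (cinv c x1) a) (integral {a1..s} ?F1)"
    using causal_path_sub[OF g1(2,3) _ s(1)] s g1(4) by (simp add: s_vel)
  have \<delta>b: "\<delta> < b2" using \<delta> g2 by auto
  have p2: "causal_path A L X (velocity A {0..b2} \<gamma>2 \<delta>) w (integral {\<delta>..b2} ?F2)"
    using causal_path_sub[OF g2(2,3) _ \<delta>b] \<delta>(1) g2(5) by simp
  \<comment> \<open>The first curve up to s, the arc to z, the pushed copy of the second curve up to
    \<delta>, and the rest of the second curve. The two middle pieces enter the length estimate only
    through nonnegativity.\<close>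
  have path: "causal_path A L X u w (integral {a1..s} ?F1 + lb + lp + integral {\<delta>..b2} ?F2)"
    by (intro causal_path_trans[OF causal_path_trans[OF causal_path_trans[OF p1 lb] lp] p2])
  have "integral {a1..s} ?F1 + integral {s..b1} ?F1 = l1"
    using g1 s by (subst Henstock_Kurzweil_Integration.integral_combine)
      (auto intro: integrable_continuous_interval[OF F_velocity_continuous[OF g1(2,1)]] simp: curve_length_def)
  moreover have "integral {0..\<delta>} ?F2 + integral {\<delta>..b2} ?F2 = l2"
    using g2 \<delta>(1) \<delta>b by (subst Henstock_Kurzweil_Integration.integral_combine)
      (auto intro: integrable_continuous_interval[OF F_velocity_continuous[OF g2(2,1)]] simp: curve_length_def)
  moreover have "integral {s..b1} ?F1 + integral {0..\<delta>} ?F2 \<le> e"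
  proof -
    have "integral {s..b1} ?F1 + integral {0..\<delta>} ?F2 \<le> K1 * \<delta> + K2 * \<delta>"
      using K1[of s b1] K2[of 0 \<delta>] s \<delta>(1) \<delta>b by (simp add: s_def)
    also have "\<dots> \<le> \<delta> * (\<bar>K1\<bar> + \<bar>K2\<bar> + 1)"
    proof -
      have "K1 * \<delta> \<le> \<bar>K1\<bar> * \<delta>" "K2 * \<delta> \<le> \<bar>K2\<bar> * \<delta>" using \<delta>(1) by (auto intro!: mult_right_mono)
      moreover have "\<delta> * (\<bar>K1\<bar> + \<bar>K2\<bar> + 1) = \<bar>K1\<bar> * \<delta> + \<bar>K2\<bar> * \<delta> + \<delta>" by (simp add: algebra_simps)
      ultimately show ?thesis using \<delta>(1) by linarith
    qed
    also have "\<dots> \<le> e" using \<delta>(8) by (simp add: pos_le_divide_eq add_nonneg_pos)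
    finally show ?thesis .
  qed
  ultimately show ?thesis
    using path causal_path_nonneg[OF lb] causal_path_nonneg[OF lp] by (intro exI conjI) auto
qed

end

section \<open>First variation of length\<close>

context spacetime
begin

definition unit_curve :: "(real \<Rightarrow> 'm) \<Rightarrow> bool" where
  "unit_curve \<zeta> \<longleftrightarrow> C1_curve A UNIV \<zeta> \<and> has_timelike_velocity A L X UNIV \<zeta> \<and>
     (\<forall>t. finsler_F L (velocity A UNIV \<zeta> t) = 1)"

abbreviation vel where "vel \<zeta> t \<equiv> velocity A UNIV \<zeta> t"

lemma vel_timelike: "unit_curve \<zeta> \<Longrightarrow> vel \<zeta> t \<in> timelike_cone A L X (\<zeta> t)"
  by (simp add: unit_curve_def has_timelike_velocity_def)

lemma unit_curve_path:
  assumes "unit_curve \<zeta>" "p < q"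
  shows "causal_path A L X (vel \<zeta> p) (vel \<zeta> q) (q - p)"
proof -
  have C1: "C1_curve A UNIV \<zeta>" using assms by (simp add: unit_curve_def)
  note sub = C1_curve_subset[OF C1 subset_UNIV assms(2)]
  have "integral {p..q} (\<lambda>t. finsler_F L (velocity A {p..q} \<zeta> t)) = integral {p..q} (\<lambda>t. 1)"
    by (rule integral_cong) (use assms(1) sub(2) in \<open>simp add: unit_curve_def\<close>)
  then have "curve_length A L \<zeta> p q = q - p" using assms(2) by (simp add: curve_length_def)
  then show ?thesis
    unfolding causal_path_def using sub assms vel_timelike[OF assms(1)] timelike_causal
    by (intro exI[of _ \<zeta>] exI[of _ p] exI[of _ q]) (auto simp: has_causal_velocity_def)
qed

lemma reverse_unit_curve:
  assumes "unit_curve \<zeta>"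
  shows "spacetime.unit_curve A (reverse_L L) (reverse_X X) (\<lambda>t. \<zeta> (- t))"
    and "vel (\<lambda>t. \<zeta> (- t)) t = tminus (vel \<zeta> (- t))"
proof -
  interpret rev: spacetime A "reverse_L L" "reverse_X X" by (rule reverse_spacetime)
  have C1: "C1_curve A UNIV \<zeta>" using assms by (simp add: unit_curve_def)
  have C1': "C1_curve A UNIV (\<lambda>t. \<zeta> (-1 * t + 0))"
    by (rule C1_curve_affine(1)[OF C1]) auto
  have v: "vel (\<lambda>t. \<zeta> (- t)) t = tminus (vel \<zeta> (- t))" for t
  proof -
    have "vel (\<lambda>t. \<zeta> (-1 * t + 0)) t = tscale (-1) (vel \<zeta> (-1 * t + 0))"
      by (rule C1_curve_affine(2)[OF C1]) auto
    then show ?thesis by (simp add: tscale_minus)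
  qed
  show "vel (\<lambda>t. \<zeta> (- t)) t = tminus (vel \<zeta> (- t))" by (rule v)
  show "rev.unit_curve (\<lambda>t. \<zeta> (- t))"
    unfolding rev.unit_curve_def has_timelike_velocity_def v
    using C1' reverse_timelike[OF vel_timelike[OF assms]] assms
    by (simp add: unit_curve_def finsler_F_def reverse_L_def reverse_involution)
qed

lemma coord_vel:
  assumes "unit_curve \<zeta>" "c \<in> A" "\<zeta> t \<in> cdom c"
  shows "vel \<zeta> t = tvec_of A c (\<zeta> t) (coord_velocity c UNIV \<zeta> t)"
    and "coord_velocity c UNIV \<zeta> t \<in> Om c (cmap c (\<zeta> t))"
    and "l c (cmap c (\<zeta> t)) (coord_velocity c UNIV \<zeta> t) = - 1 / 2"
proof -
  show v: "vel \<zeta> t = tvec_of A c (\<zeta> t) (coord_velocity c UNIV \<zeta> t)"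
    by (rule C1_curve_velocity) (use assms in \<open>auto simp: unit_curve_def\<close>)
  show "coord_velocity c UNIV \<zeta> t \<in> Om c (cmap c (\<zeta> t))"
    using vel_timelike[OF assms(1), of t] assms unfolding v by (simp add: tvec_of_timelike)
  have "finsler_F L (vel \<zeta> t) = 1" using assms(1) by (simp add: unit_curve_def)
  then show "l c (cmap c (\<zeta> t)) (coord_velocity c UNIV \<zeta> t) = - 1 / 2"
    unfolding v using assms by (simp add: finsler_F_def Lc_def chart_simps)
qed

text \<open>Only the first order expansion of the length of one variation is needed, and it is taken over
  a parameter interval so short that the change of \<open>L\<close> along it contributes to the error only. Hence the
  geodesic equation does not enter.\<close>

lemma first_variation:
  assumes \<zeta>: "unit_curve \<zeta>" and c: "c \<in> A" "\<zeta> t0 \<in> cdom c" and e: "e > 0" and t1: "t0 < t1"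
  defines "x0 \<equiv> cmap c (\<zeta> t0)" and "W \<equiv> coord_velocity c UNIV \<zeta> t0"
  shows "\<exists>\<rho>>0. \<forall>y. dist y x0 < \<rho> \<longrightarrow> y \<in> cimg c \<and>
    (\<exists>u len. u \<in> timelike_cone A L X (cinv c y) \<and> causal_path A L X u (vel \<zeta> t1) len \<and>
      t1 - t0 + frechet_derivative (l c x0) (at W) (y - x0) - e * norm (y - x0) \<le> len)"
proof -
  define S where "S = {(x, v). x \<in> cimg c \<and> v \<in> Om c x}"
  define g where "g = (\<lambda>z. l c (fst z) (snd z))"
  define Dg where "Dg z = frechet_derivative g (at z)" for z
  define \<Phi> where "\<Phi> z = sqrt (- 2 * g z)" for z
  define D where "D z h = - Dg z h / \<Phi> z" for z h
  have S: "open S" unfolding S_def by (rule Om_open[OF c(1)])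
  have Ssub: "S \<subseteq> cimg c \<times> (UNIV - {0})" using Om_nonzero[OF c(1)] by (auto simp: S_def)
  have gs: "smooth_on S g"
    using smooth_on_subset[OF Ssub L_smooth[OF c(1)]] by (simp add: g_def case_prod_unfold)
  have gneg: "g z < 0" if "z \<in> S" for z using that Om_timelike[OF c(1)] by (auto simp: S_def g_def)
  have \<Phi>pos: "\<Phi> z > 0" if "z \<in> S" for z using gneg[OF that] by (simp add: \<Phi>_def)
  define z0 where "z0 = (x0, W)"
  have x0: "x0 \<in> cimg c" using c by (simp add: x0_def)
  have z0: "z0 \<in> S" "\<Phi> z0 = 1"
    using coord_vel[OF \<zeta> c] x0 by (auto simp: z0_def S_def \<Phi>_def g_def x0_def W_def)
  have dg: "(g has_derivative Dg z) (at z)" if "z \<in> S" for z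
    unfolding Dg_def by (rule smooth_on_has_derivative[OF gs that])
  have d\<Phi>: "(\<Phi> has_derivative D z) (at z)" if z: "z \<in> S" for z
  proof -
    have "((\<lambda>z. sqrt (- 2 * g z)) has_derivative (\<lambda>h. (- 2 * Dg z h) * (inverse (sqrt (- 2 * g z)) / 2))) (at z)"
      by (rule DERIV_compose_FDERIV[OF DERIV_real_sqrt has_derivative_mult_right[OF dg[OF z]]]) (use gneg[OF z] in simp)
    then show ?thesis unfolding \<Phi>_def D_def by (rule has_derivative_eq_rhs) (auto simp: fun_eq_iff divide_simps)
  qed
  have \<Phi>nz: "sqrt (- 2 * g z) \<noteq> 0" if "z \<in> S" for z using gneg[OF that] by simp
  have g_cont: "continuous_on S g" by (rule smooth_on_imp_continuous[OF gs])
  have D_cont: "continuous_on S (\<lambda>z. D z b)" for b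
    unfolding D_def \<Phi>_def Dg_def
    by (intro continuous_intros g_cont smooth_on_imp_continuous[OF smooth_on_derivative[OF gs]])
      (use \<Phi>nz in blast)
  obtain r where r: "r > 0" "ball z0 r \<subseteq> S"
    "\<And>z z'. z \<in> ball z0 r \<Longrightarrow> z' \<in> ball z0 r \<Longrightarrow> norm (\<Phi> z' - \<Phi> z - D z0 (z' - z)) \<le> e / 2 * norm (z' - z)"
    using strict_differentiability[OF S z0(1) d\<Phi> D_cont half_gt_zero[OF e]] by blast
  define K where "K = onorm (D z0)"
  have Kb: "bounded_linear (D z0)" using d\<Phi>[OF z0(1)] has_derivative_bounded_linear by blast
  have K: "\<bar>D z0 h\<bar> \<le> K * norm h" for h using onorm[OF Kb, of h] by (simp add: K_def)
  have K0: "K \<ge> 0" unfolding K_def by (rule onorm_pos_le[OF Kb])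
  define \<omega> where "\<omega> = frechet_derivative (l c x0) (at W)"
  have D\<omega>: "D z0 (0, h) = - \<omega> h" for h
  proof -
    have W: "W \<noteq> 0" using z0 Ssub by (auto simp: z0_def)
    have "((\<lambda>v. g (x0, v)) has_derivative (\<lambda>h. Dg z0 (0, h))) (at W)"
      by (rule has_derivative_compose[of "\<lambda>v. (x0, v)" "\<lambda>h. (0, h)" W UNIV g "Dg z0"])
        (use dg[OF z0(1)] in \<open>auto intro!: derivative_eq_intros simp: z0_def\<close>)
    then have "Dg z0 (0, h) = \<omega> h" unfolding \<omega>_def using frechet_eqI by (fastforce simp: g_def)
    then show ?thesis using z0(2) by (simp add: D_def)
  qed
  have lin: "linear (D z0)" using Kb bounded_linear.linear by blast
  define \<kappa> where "\<kappa> t = cmap c (\<zeta> t)" for t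
  define \<kappa>' where "\<kappa>' t = coord_velocity c UNIV \<zeta> t" for t
  have C1: "C1_curve A UNIV \<zeta>" using \<zeta> by (simp add: unit_curve_def)
  have t1': "t0 < t0 + 1" by simp
  note sub = C1_curve_subset[OF C1 subset_UNIV t1']
  have near: "\<exists>d>0. \<forall>t\<in>{t0..t0+1}. \<bar>t - t0\<bar> < d \<longrightarrow> \<zeta> t \<in> cdom c \<and> dist (\<kappa> t) x0 < r / 4 \<and> dist (\<kappa>' t) W < r / 4"
  proof -
    have "\<exists>d>0. \<forall>t\<in>{t0..t0+1}. \<bar>t - t0\<bar> < d \<longrightarrow> \<zeta> t \<in> cdom c \<and> dist (cmap c (\<zeta> t)) (cmap c (\<zeta> t0)) < r / 4 \<and>
       dist (coord_velocity c {t0..t0+1} \<zeta> t) (coord_velocity c {t0..t0+1} \<zeta> t0) < r / 4 \<and>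
       norm (cmap c (\<zeta> t) - cmap c (\<zeta> t0) - (t - t0) *\<^sub>R coord_velocity c {t0..t0+1} \<zeta> t0) \<le> r / 4 * \<bar>t - t0\<bar>"
      by (rule curve_chart_limits[OF sub(1) _ c]) (use r in auto)
    then obtain d where d: "d > 0" "\<And>t. t \<in> {t0..t0+1} \<Longrightarrow> \<bar>t - t0\<bar> < d \<Longrightarrow> \<zeta> t \<in> cdom c \<and>
       dist (cmap c (\<zeta> t)) (cmap c (\<zeta> t0)) < r / 4 \<and>
       dist (coord_velocity c {t0..t0+1} \<zeta> t) (coord_velocity c {t0..t0+1} \<zeta> t0) < r / 4"
      by blast
    have cv: "coord_velocity c {t0..t0+1} \<zeta> t = \<kappa>' t" if "t \<in> {t0..t0+1}" "\<zeta> t \<in> cdom c" for t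
      using arg_cong[OF sub(2)[OF that(1)], of "\<lambda>v. snd v c"] c that by (simp add: snd_velocity \<kappa>'_def)
    have cv0: "coord_velocity c {t0..t0+1} \<zeta> t0 = W" using cv[of t0] c by (simp add: W_def \<kappa>'_def)
    show ?thesis
    proof (intro exI[of _ d] conjI ballI impI d(1))
      fix t assume t: "t \<in> {t0..t0+1}" "\<bar>t - t0\<bar> < d"
      note * = d(2)[OF t]
      then show "\<zeta> t \<in> cdom c" "dist (\<kappa> t) x0 < r / 4" by (simp_all add: \<kappa>_def x0_def)
      show "dist (\<kappa>' t) W < r / 4" using * cv[OF t(1)] cv0 by simp
    qed
  qed
  then obtain d where d: "d > 0" "\<And>t. t \<in> {t0..t0+1} \<Longrightarrow> \<bar>t - t0\<bar> < d \<Longrightarrow> \<zeta> t \<in> cdom c \<and> dist (\<kappa> t) x0 < r / 4 \<and> dist (\<kappa>' t) W < r / 4"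
    by blast
  \<comment> \<open>The parameter interval has length s. Moving the base points by at most
    \<open>norm h\<close> changes the integrand by at most \<open>(K + e / 2) * norm h\<close> up to
    the velocity terms, and the last entry makes the integral of this at most
    \<open>e / 2 * norm h\<close>. The entry \<open>(t1 - t0) / 2\<close> leaves a piece of the
    original curve to append.\<close>
  have "\<exists>s>0. \<forall>x\<in>{1, d / 2, (t1 - t0) / 2, e / (2 * (K + e / 2 + 1))}. s \<le> x"
    by (rule common_lower_bound) (use d e K0 t1 in \<open>auto intro!: divide_pos_pos add_nonneg_pos\<close>)
  then obtain s where s: "s > 0" "s \<le> 1" "s \<le> d / 2" "s \<le> (t1 - t0) / 2" "s \<le> e / (2 * (K + e / 2 + 1))" by blast
  have sK: "(K + e / 2) * s \<le> e / 2"
  proof -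
    have "(K + e / 2 + 1) * s \<le> e / 2" using s(5) K0 e by (simp add: field_simps)
    then show ?thesis using s(1) by (simp add: distrib_right)
  qed
  have near_s: "\<zeta> t \<in> cdom c" "dist (\<kappa> t) x0 < r / 4" "dist (\<kappa>' t) W < r / 4" if "t \<in> {t0..t0+s}" for t
    using d(2)[of t] that s d(1) by auto
  \<comment> \<open>The variation moves base points by at most \<open>norm h\<close> and velocities
    by at most \<open>2 / s * norm h\<close>. Both stay below r/4, as does the deviation of the
    original curve from z0.\<close>
  define \<rho> where "\<rho> = r / (4 * (1 + 2 / s))"
  have \<rho>: "\<rho> > 0" using r s by (simp add: \<rho>_def add_pos_pos)
  have inb: "(p, q) \<in> ball z0 r" if "dist p x0 < r / 2" "dist q W < r / 2" for p q
    using that unfolding z0_def by (simp add: dist_Pair_Pair dist_commute) (smt (verit) sqrt_sum_squares_le_sum zero_le_dist field_sum_of_halves)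
  have main: "y \<in> cimg c \<and> (\<exists>u len. u \<in> timelike_cone A L X (cinv c y) \<and> causal_path A L X u (vel \<zeta> (t0 + s)) len \<and>
      s + \<omega> (y - x0) - e * norm (y - x0) \<le> len)" if y: "dist y x0 < \<rho>" for y
  proof -
    define h where "h = y - x0"
    have h: "norm h < \<rho>" using y by (simp add: h_def dist_norm)
    have hs: "norm h * (1 + 2 / s) < r / 4"
    proof -
      have p: "1 + 2 / s > 0" using s by (simp add: add_pos_pos)
      have "norm h * (1 + 2 / s) < \<rho> * (1 + 2 / s)" by (rule mult_strict_right_mono[OF h p])
      also have "\<dots> = r / 4"
      proof -
        have "r / (4 * k) * k = r / 4" if "k > 0" for k :: real using that by simp
        from this[OF p] show ?thesis unfolding \<rho>_def .
      qed
      finally show ?thesis .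
    qed
    define q where "q t = (t - t0) / s" for t
    \<comment> \<open>The weight \<open>(1 - q t)\<^sup>2\<close> equals 1 at the start and vanishes
      to second order at the end, so the varied curve starts at y and joins \<zeta> with equal
      velocity. Its negative derivative has integral 1, so the linear change of length is \<omega>
      h.\<close>
    define p where "p t = \<kappa> t + (1 - q t)\<^sup>2 *\<^sub>R h" for t
    define p' where "p' t = \<kappa>' t - (2 / s * (1 - q t)) *\<^sub>R h" for t
    have q01: "0 \<le> q t" "q t \<le> 1" if "t \<in> {t0..t0+s}" for t using that s by (auto simp: q_def)
    have \<Delta>: "norm ((1 - q t)\<^sup>2 *\<^sub>R h) \<le> norm h" "norm ((2 / s * (1 - q t)) *\<^sub>R h) \<le> 2 / s * norm h" if "t \<in> {t0..t0+s}" for t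
    proof -
      have "(1 - q t)\<^sup>2 \<le> 1" using q01[OF that] by (simp add: power_le_one)
      then show "norm ((1 - q t)\<^sup>2 *\<^sub>R h) \<le> norm h" by (simp add: mult_left_le_one_le)
      have "2 / s * (1 - q t) \<le> 2 / s * 1" using q01[OF that] s by (intro mult_left_mono) auto
      moreover have "0 \<le> 2 / s * (1 - q t)" using q01[OF that] s by simp
      ultimately have "\<bar>2 / s * (1 - q t)\<bar> \<le> 2 / s" by simp
      then show "norm ((2 / s * (1 - q t)) *\<^sub>R h) \<le> 2 / s * norm h"
        unfolding norm_scaleR by (rule mult_right_mono) simp
    qed
    have hb: "norm h < r / 4" "2 / s * norm h < r / 4"
      using hs s norm_ge_zero[of h] by (simp_all add: distrib_left mult.commute) (smt (verit) divide_nonneg_pos mult_nonneg_nonneg norm_ge_zero)+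
    have pb: "(p t, p' t) \<in> ball z0 r" "(\<kappa> t, \<kappa>' t) \<in> ball z0 r" if t: "t \<in> {t0..t0+s}" for t
    proof -
      have "dist (p t) x0 \<le> dist (\<kappa> t) x0 + norm h"
        using dist_triangle[of "p t" x0 "\<kappa> t"] \<Delta>(1)[OF t] by (simp add: p_def dist_norm)
      moreover have "dist (p' t) W \<le> dist (\<kappa>' t) W + 2 / s * norm h"
        using dist_triangle[of "p' t" W "\<kappa>' t"] \<Delta>(2)[OF t] by (simp add: p'_def dist_norm)
      ultimately show "(p t, p' t) \<in> ball z0 r" using near_s[OF t] hb by (intro inb) auto
      show "(\<kappa> t, \<kappa>' t) \<in> ball z0 r" using near_s[OF t] r(1) by (intro inb) auto
    qed
    have pS: "p t \<in> cimg c \<and> p' t \<in> Om c (p t)" if "t \<in> {t0..t0+s}" for t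
      using pb(1)[OF that] r(2) by (auto simp: S_def)
    have ts: "t0 < t0 + s" using s by simp
    have dq: "(q has_real_derivative 1 / s) (at t within R)" for t R
      unfolding q_def using s by (auto intro!: derivative_eq_intros)
    have pd: "(p has_vector_derivative p' t) (at t within {t0..t0+s})" if t: "t \<in> {t0..t0+s}" for t
    proof -
      have k: "(\<kappa> has_vector_derivative \<kappa>' t) (at t within {t0..t0+s})"
        using C1_curve_chart(1)[OF C1 UNIV_I c(1) near_s(1)[OF t]] has_vector_derivative_at_within
        unfolding \<kappa>_def \<kappa>'_def o_def by blast
      have "((\<lambda>t. (1 - q t)\<^sup>2) has_real_derivative - (2 / s * (1 - q t))) (at t within {t0..t0+s})"
        using dq by (auto intro!: derivative_eq_intros)
      from has_vector_derivative_add[OF k has_vector_derivative_scaleR[OF this has_vector_derivative_const[of h]]]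
      show ?thesis unfolding p_def p'_def by simp
    qed
    have \<kappa>'_cont: "continuous_on {t0..t0+s} \<kappa>'"
      unfolding continuous_on_eq_continuous_within \<kappa>'_def
      using C1_curve_chart(2)[OF C1 UNIV_I c(1) near_s(1)] continuous_at_imp_continuous_at_within by blast
    have p'_cont: "continuous_on {t0..t0+s} p'"
      unfolding p'_def q_def by (intro continuous_intros \<kappa>'_cont) (use s in auto)
    have path: "causal_path A L X (tvec_of A c (cinv c (p t0)) (p' t0)) (tvec_of A c (cinv c (p (t0 + s))) (p' (t0 + s)))
       (integral {t0..t0+s} (\<lambda>t. sqrt (- 2 * l c (p t) (p' t))))"
      using pS by (intro causal_path_timelike_chart[OF c(1) ts _ _ pd p'_cont]) auto
    have ends: "p t0 = y" "p (t0 + s) = \<kappa> (t0 + s)" "p' (t0 + s) = \<kappa>' (t0 + s)"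
      using s by (auto simp: p_def p'_def q_def \<kappa>_def h_def x0_def)
    have endv: "tvec_of A c (cinv c (p (t0 + s))) (p' (t0 + s)) = vel \<zeta> (t0 + s)"
      using coord_vel(1)[OF \<zeta> c(1) near_s(1)[of "t0 + s"]] near_s(1)[of "t0 + s"] s c
      by (simp add: ends \<kappa>_def \<kappa>'_def chart_simps)
    have yc: "y \<in> cimg c" "p' t0 \<in> Om c y" using pS[of t0] ends s by auto
    then have startv: "tvec_of A c (cinv c y) (p' t0) \<in> timelike_cone A L X (cinv c y)"
      using c by (simp add: tvec_of_timelike chart_simps)
    define C where "C = \<omega> h - e / 2 * norm h"
    have low: "1 + (2 / s * (1 - q t)) * C - (K + e / 2) * norm h \<le> sqrt (- 2 * l c (p t) (p' t))" if t: "t \<in> {t0..t0+s}" for t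
    proof -
      have k1: "\<Phi> (\<kappa> t, \<kappa>' t) = 1"
        using coord_vel(3)[OF \<zeta> c(1) near_s(1)[OF t]] by (simp add: \<Phi>_def g_def \<kappa>_def \<kappa>'_def)
      have diff: "(p t, p' t) - (\<kappa> t, \<kappa>' t) = ((1 - q t)\<^sup>2 *\<^sub>R h, - ((2 / s * (1 - q t)) *\<^sub>R h))"
        by (simp add: p_def p'_def)
      have "\<Phi> (p t, p' t) \<ge> 1 + D z0 ((1 - q t)\<^sup>2 *\<^sub>R h, - ((2 / s * (1 - q t)) *\<^sub>R h))
          - e / 2 * norm ((1 - q t)\<^sup>2 *\<^sub>R h, - ((2 / s * (1 - q t)) *\<^sub>R h))"
        using r(3)[OF pb(2)[OF t] pb(1)[OF t]] unfolding diff k1 real_norm_def abs_le_iff by linarith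
      moreover have "D z0 ((1 - q t)\<^sup>2 *\<^sub>R h, - ((2 / s * (1 - q t)) *\<^sub>R h)) =
          D z0 ((1 - q t)\<^sup>2 *\<^sub>R h, 0) + (2 / s * (1 - q t)) * \<omega> h"
      proof -
        have "((1 - q t)\<^sup>2 *\<^sub>R h, - ((2 / s * (1 - q t)) *\<^sub>R h)) = ((1 - q t)\<^sup>2 *\<^sub>R h, 0) + (- (2 / s * (1 - q t))) *\<^sub>R (0, h)" by simp
        then have "D z0 ((1 - q t)\<^sup>2 *\<^sub>R h, - ((2 / s * (1 - q t)) *\<^sub>R h)) =
            D z0 ((1 - q t)\<^sup>2 *\<^sub>R h, 0) + (- (2 / s * (1 - q t))) * D z0 (0, h)"
          using linear_add[OF lin] linear_scale[OF lin] by (metis real_scaleR_def)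
        then show ?thesis by (simp add: D\<omega>)
      qed
      moreover have "\<bar>D z0 ((1 - q t)\<^sup>2 *\<^sub>R h, 0)\<bar> \<le> K * norm h"
        using K[of "((1 - q t)\<^sup>2 *\<^sub>R h, 0)"] \<Delta>(1)[OF t] K0 by (simp add: norm_Pair) (meson mult_left_mono order_trans)
      moreover have "norm ((1 - q t)\<^sup>2 *\<^sub>R h, - ((2 / s * (1 - q t)) *\<^sub>R h)) \<le> norm h + 2 / s * (1 - q t) * norm h"
      proof -
        have "norm ((1 - q t)\<^sup>2 *\<^sub>R h, - ((2 / s * (1 - q t)) *\<^sub>R h)) \<le> norm ((1 - q t)\<^sup>2 *\<^sub>R h) + norm ((2 / s * (1 - q t)) *\<^sub>R h)"
          unfolding norm_Pair norm_minus_cancel by (rule sqrt_sum_squares_le_sum) auto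
        then show ?thesis using \<Delta>(1)[OF t] q01[OF t] s by (simp add: abs_mult)
      qed
      then have "e / 2 * norm ((1 - q t)\<^sup>2 *\<^sub>R h, - ((2 / s * (1 - q t)) *\<^sub>R h)) \<le> e / 2 * (norm h + 2 / s * (1 - q t) * norm h)"
        using e by (intro mult_left_mono) auto
      ultimately have "1 - K * norm h + (2 / s * (1 - q t)) * \<omega> h - e / 2 * (norm h + 2 / s * (1 - q t) * norm h) \<le> \<Phi> (p t, p' t)"
        by linarith
      moreover have "1 + x * C - (K + e / 2) * norm h = 1 - K * norm h + x * \<omega> h - e / 2 * (norm h + x * norm h)" for x
        by (simp add: C_def algebra_simps)
      ultimately show ?thesis by (simp only: \<Phi>_def g_def fst_conv snd_conv)
    qed
    have int: "((\<lambda>t. 1 + (2 / s * (1 - q t)) * C - (K + e / 2) * norm h) has_integral (s + C - (K + e / 2) * norm h * s)) {t0..t0+s}"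
    proof -
      have "((\<lambda>t. 1 + (2 / s * (1 - q t)) * C - (K + e / 2) * norm h) has_integral
         ((t0 + s) - (q (t0 + s) - 1)\<^sup>2 * C - (K + e / 2) * norm h * (t0 + s)) -
         (t0 - (q t0 - 1)\<^sup>2 * C - (K + e / 2) * norm h * t0)) {t0..t0+s}"
      proof (rule fundamental_theorem_of_calculus)
        show "t0 \<le> t0 + s" using s by simp
        fix t
        have "((\<lambda>t. t - (q t - 1)\<^sup>2 * C - (K + e / 2) * norm h * t) has_real_derivative
          (1 + (2 / s * (1 - q t)) * C - (K + e / 2) * norm h)) (at t within {t0..t0+s})"
        proof -
          have "((\<lambda>t. (q t - 1)\<^sup>2) has_real_derivative 2 * (q t - 1) * (1 / s)) (at t within {t0..t0+s})"
            using DERIV_power[OF DERIV_diff[OF dq DERIV_const[of 1]], where n = 2] by (simp add: mult.commute)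
          from DERIV_diff[OF DERIV_diff[OF DERIV_ident DERIV_cmult_right[OF this, of C]] DERIV_cmult_Id[of "(K + e / 2) * norm h"]]
          show ?thesis
          proof (rule DERIV_cong)
            have "1 - 2 * (x - 1) * i * C - m = 1 + (2 * i * (1 - x)) * C - m" for x i m :: real by (simp add: algebra_simps)
            from this[of "q t" "1 / s"]
            show "1 - 2 * (q t - 1) * (1 / s) * C - (K + e / 2) * norm h = 1 + (2 / s * (1 - q t)) * C - (K + e / 2) * norm h"
              by (simp only: times_divide_eq_right mult_1_right)
          qed
        qed
        then show "((\<lambda>t. t - (q t - 1)\<^sup>2 * C - (K + e / 2) * norm h * t) has_vector_derivative
          (1 + (2 / s * (1 - q t)) * C - (K + e / 2) * norm h)) (at t within {t0..t0+s})"
          by (simp add: has_real_derivative_iff_has_vector_derivative)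
      qed
      moreover have "(t0 + s - (q (t0 + s) - 1)\<^sup>2 * C - m * (t0 + s)) - (t0 - (q t0 - 1)\<^sup>2 * C - m * t0) = s + C - m * s" for m
        using s by (simp add: q_def algebra_simps)
      ultimately show ?thesis by simp
    qed
    have "continuous_on {t0..t0+s} (\<lambda>t. \<Phi> (p t, p' t))"
      unfolding \<Phi>_def
    proof (intro continuous_intros continuous_on_compose2[OF g_cont])
      show "continuous_on {t0..t0+s} p"
        using pd has_vector_derivative_continuous continuous_on_eq_continuous_within by blast
    qed (use pb(1) r(2) p'_cont in auto)
    then have "(\<lambda>t. sqrt (- 2 * l c (p t) (p' t))) integrable_on {t0..t0+s}"
      by (intro integrable_continuous_interval) (simp add: \<Phi>_def g_def)
    then have "s + C - (K + e / 2) * norm h * s \<le> integral {t0..t0+s} (\<lambda>t. sqrt (- 2 * l c (p t) (p' t)))"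
      using integral_le[OF has_integral_integrable[OF int] _ low] integral_unique[OF int] by simp
    moreover have "(K + e / 2) * s * norm h \<le> e / 2 * norm h" by (rule mult_right_mono[OF sK]) simp
    ultimately have "s + \<omega> h - e * norm h \<le> integral {t0..t0+s} (\<lambda>t. sqrt (- 2 * l c (p t) (p' t)))"
      by (simp add: C_def algebra_simps)
    then show ?thesis using path[unfolded endv ends(1)] startv yc(1) unfolding h_def by blast
  qed
  have lt: "t0 + s < t1" using s t1 by auto
  show ?thesis
  proof (intro exI[of _ \<rho>] conjI allI impI \<rho>)
    fix y assume y: "dist y x0 < \<rho>"
    show "y \<in> cimg c" using main[OF y] by blast
    from main[OF y] obtain u len where u: "u \<in> timelike_cone A L X (cinv c y)" "causal_path A L X u (vel \<zeta> (t0 + s)) len"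
      "s + \<omega> (y - x0) - e * norm (y - x0) \<le> len" by blast
    have "causal_path A L X u (vel \<zeta> t1) (len + (t1 - (t0 + s)))"
      by (rule causal_path_trans[OF u(2) unit_curve_path[OF \<zeta> lt]])
    then show "\<exists>u len. u \<in> timelike_cone A L X (cinv c y) \<and> causal_path A L X u (vel \<zeta> t1) len \<and>
      t1 - t0 + frechet_derivative (l c x0) (at W) (y - x0) - e * norm (y - x0) \<le> len"
      using u(1,3) unfolding \<omega>_def[symmetric] by (intro exI[of _ u] exI[of _ "len + (t1 - (t0 + s))"]) auto
  qed
qed

end

text \<open>The forward statement for the reversed structure. The differential of v \<mapsto> L(-v)
  at -W is the negative of that of L at W, which is why the linear term changes sign.\<close>

lemma (in spacetime) first_variation_reverse:
  assumes \<zeta>: "unit_curve \<zeta>" and c: "c \<in> A" "\<zeta> t0 \<in> cdom c" and e: "e > 0" and t1: "t1 < t0"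
  defines "x0 \<equiv> cmap c (\<zeta> t0)" and "W \<equiv> coord_velocity c UNIV \<zeta> t0"
  shows "\<exists>\<rho>>0. \<forall>y. dist y x0 < \<rho> \<longrightarrow> y \<in> cimg c \<and>
    (\<exists>w len. w \<in> timelike_cone A L X (cinv c y) \<and> causal_path A L X (vel \<zeta> t1) w len \<and>
      t0 - t1 - frechet_derivative (l c x0) (at W) (y - x0) - e * norm (y - x0) \<le> len)"
proof -
  interpret rev: spacetime A "reverse_L L" "reverse_X X" by (rule reverse_spacetime)
  let ?z = "\<lambda>t. \<zeta> (- t)"
  have x0: "x0 \<in> cimg c" using c by (simp add: x0_def)
  have cv: "coord_velocity c UNIV ?z (- t0) = - W"
    using arg_cong[OF reverse_unit_curve(2)[OF \<zeta>, of "- t0"], of "\<lambda>v. snd v c"] c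
    by (simp add: snd_velocity tminus_def W_def)
  interpret mn: minkowski_norm "l c x0" by (rule minkowski[OF c(1) x0])
  have W: "W \<noteq> 0" using coord_vel(2)[OF \<zeta> c] Om_nonzero[OF c(1) x0] by (auto simp: W_def x0_def)
  have fd: "frechet_derivative (Lc A (reverse_L L) c x0) (at (- W)) h = - frechet_derivative (l c x0) (at W) h" for h
  proof -
    have "Lc A (reverse_L L) c x0 = (\<lambda>v. l c x0 (- v))" using Lc_reverse[OF c(1) x0] by blast
    moreover have "((\<lambda>v. l c x0 (- v)) has_derivative (\<lambda>h. mn.D W (- h))) (at (- W))"
      by (rule has_derivative_compose[of uminus uminus "- W" UNIV "l c x0"])
        (use mn.has_derivative_D[OF W] in \<open>auto intro!: derivative_eq_intros\<close>)
    ultimately show ?thesis using linear_neg[OF mn.linear_D[OF W]] by (simp add: frechet_eqI mn.D_def)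
  qed
  have "\<exists>\<rho>>0. \<forall>y. dist y (cmap c (?z (- t0))) < \<rho> \<longrightarrow> y \<in> cimg c \<and>
    (\<exists>u len. u \<in> timelike_cone A (reverse_L L) (reverse_X X) (cinv c y) \<and> causal_path A (reverse_L L) (reverse_X X) u (vel ?z (- t1)) len \<and>
      - t1 - - t0 + frechet_derivative (Lc A (reverse_L L) c (cmap c (?z (- t0)))) (at (coord_velocity c UNIV ?z (- t0))) (y - cmap c (?z (- t0))) - e * norm (y - cmap c (?z (- t0))) \<le> len)"
    by (rule rev.first_variation[OF reverse_unit_curve(1)[OF \<zeta>] c(1) _ e]) (use c t1 in auto)
  then obtain \<rho> where \<rho>: "\<rho> > 0" "\<And>y. dist y x0 < \<rho> \<Longrightarrow> y \<in> cimg c \<and>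
    (\<exists>u len. u \<in> timelike_cone A (reverse_L L) (reverse_X X) (cinv c y) \<and> causal_path A (reverse_L L) (reverse_X X) u (vel ?z (- t1)) len \<and>
      t0 - t1 - frechet_derivative (l c x0) (at W) (y - x0) - e * norm (y - x0) \<le> len)"
    unfolding cv fd by (auto simp: x0_def[symmetric] fd)
  show ?thesis
  proof (intro exI[of _ \<rho>] conjI allI impI \<rho>(1))
    fix y assume y: "dist y x0 < \<rho>"
    from \<rho>(2)[OF y] show "y \<in> cimg c" by blast
    from \<rho>(2)[OF y] obtain u len where u: "u \<in> timelike_cone A (reverse_L L) (reverse_X X) (cinv c y)"
       "causal_path A (reverse_L L) (reverse_X X) u (vel ?z (- t1)) len"
       "t0 - t1 - frechet_derivative (l c x0) (at W) (y - x0) - e * norm (y - x0) \<le> len" by blast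
    have "tminus u \<in> timelike_cone A L X (cinv c y)" using rev.reverse_timelike[OF u(1)] by (simp add: reverse_involution)
    moreover have "causal_path A L X (vel \<zeta> t1) (tminus u) len"
      using rev.reverse_causal_path[OF u(2)] by (simp add: reverse_involution reverse_unit_curve(2)[OF \<zeta>])
    ultimately show "\<exists>w len. w \<in> timelike_cone A L X (cinv c y) \<and> causal_path A L X (vel \<zeta> t1) w len \<and>
      t0 - t1 - frechet_derivative (l c x0) (at W) (y - x0) - e * norm (y - x0) \<le> len" using u(3) by blast
  qed
qed

section \<open>Busemann functions\<close>

context spacetime
begin

text \<open>The metric content of a straight line, phrased without the spray so that it passes to
  the reversed structure through \<open>reverse_dist\<close>.\<close>

definition unit_line :: "(real \<Rightarrow> 'm) \<Rightarrow> bool" where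
  "unit_line \<zeta> \<longleftrightarrow> unit_curve \<zeta> \<and> (\<forall>s t. s < t \<longrightarrow> lorentz_dist A L X (\<zeta> s) (\<zeta> t) = ereal (t - s))"

text \<open>The causal relation. It distinguishes a genuine distance from the default value 0 of
  \<open>lorentz_dist\<close>; with the default value the reverse triangle inequality would
  fail.\<close>

definition reaches :: "'m \<Rightarrow> 'm \<Rightarrow> bool" where
  "reaches x y \<longleftrightarrow> (\<exists>u w len. causal_path A L X u w len \<and> fst u = x \<and> fst w = y)"

lemma fst_timelike: "u \<in> timelike_cone A L X p \<Longrightarrow> fst u = p"
  using timelike_cone_subset tangentD(1) by blast

lemma vel_timelike': "unit_curve \<zeta> \<Longrightarrow> vel \<zeta> t \<in> timelike_cone A L X (fst (vel \<zeta> t))"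
  using vel_timelike by simp

lemma ereal_add_le_Sup:
  assumes "\<And>s. s \<in> S \<Longrightarrow> ereal r + s \<le> D" "S \<noteq> {}"
  shows "ereal r + Sup S \<le> D"
proof -
  have "s \<le> D - ereal r" if "s \<in> S" for s
    using assms(1)[OF that] by (simp add: ereal_le_minus add.commute)
  then have "Sup S \<le> D - ereal r" by (rule Sup_least)
  then show ?thesis by (simp add: ereal_le_minus add.commute)
qed

text \<open>Concatenate the given curve with competitors for the second distance and let the loss in
  \<open>corner\<close> tend to 0. The competitors may start with any causal velocity, so it is the
  given curve that has to supply the timelike velocity at the joint.\<close>

lemma dist_after:
  assumes P: "causal_path A L X u v l1" "v \<in> timelike_cone A L X (fst v)" and r: "reaches (fst v) z"
  shows "ereal l1 + lorentz_dist A L X (fst v) z \<le> lorentz_dist A L X (fst u) z" and "reaches (fst u) z"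
proof -
  have le: "ereal (l1 + l2) \<le> lorentz_dist A L X (fst u) z" and re: "reaches (fst u) z"
    if p: "causal_path A L X v' w l2" "fst v' = fst v" "fst w = z" for v' w l2
  proof -
    obtain len where "causal_path A L X u w len" using corner[OF P p(1,2), of 1] by auto
    then show "reaches (fst u) z" using p(3) unfolding reaches_def by blast
    show "ereal (l1 + l2) \<le> lorentz_dist A L X (fst u) z"
    proof (rule ereal_le_epsilon2)
      fix e :: real assume "0 < e"
      then obtain len where len: "len \<ge> l1 + l2 - e" "causal_path A L X u w len" using corner[OF P p(1,2)] by blast
      then have "ereal len \<le> lorentz_dist A L X (fst u) z" using lorentz_dist_ge[OF len(2)] p(3) by simp
      then have "ereal (l1 + l2 - e) \<le> lorentz_dist A L X (fst u) z" using len(1) by (meson ereal_less_eq(3) order_trans)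
      then show "ereal (l1 + l2) \<le> lorentz_dist A L X (fst u) z + ereal e"
        by (cases "lorentz_dist A L X (fst u) z") auto
    qed
  qed
  from r obtain v' w l2 where p: "causal_path A L X v' w l2" "fst v' = fst v" "fst w = z" by (auto simp: reaches_def)
  show "reaches (fst u) z" by (rule re[OF p])
  show "ereal l1 + lorentz_dist A L X (fst v) z \<le> lorentz_dist A L X (fst u) z"
    unfolding lorentz_dist_eq[of A L X "fst v" z]
  proof (rule ereal_add_le_Sup)
    fix s assume "s \<in> insert 0 {ereal len | len u' w. causal_path A L X u' w len \<and> fst u' = fst v \<and> fst w = z}"
    then consider "s = 0" | len u' w where "s = ereal len" "causal_path A L X u' w len" "fst u' = fst v" "fst w = z" by blast
    then show "ereal l1 + s \<le> lorentz_dist A L X (fst u) z"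
    proof cases
      \<comment> \<open>The inserted value 0 in the supremum does not come from a curve; any
        existing curve to z, of nonnegative length, covers it.\<close>
      case 1
      have "ereal l1 \<le> ereal (l1 + l2)" using causal_path_nonneg[OF p(1)] by simp
      then show ?thesis using 1 le[OF p] by (metis add.right_neutral order_trans)
    next
      case 2
      then show ?thesis using le[OF 2(2-4)] by simp
    qed
  qed simp
qed

end

context spacetime
begin

lemma reverse_reaches: "reaches x y \<Longrightarrow> spacetime.reaches A (reverse_L L) (reverse_X X) y x"
  using reverse_causal_path spacetime.reaches_def[OF reverse_spacetime] unfolding reaches_def
  by (metis fst_tminus)

text \<open>By reversal: the curve that supplies the timelike velocity is now the second
  one.\<close>

lemma dist_before:
  assumes P: "causal_path A L X v w l2" "v \<in> timelike_cone A L X (fst v)" and r: "reaches x (fst v)"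
  shows "ereal l2 + lorentz_dist A L X x (fst v) \<le> lorentz_dist A L X x (fst w)" and "reaches x (fst w)"
proof -
  interpret rev: spacetime A "reverse_L L" "reverse_X X" by (rule reverse_spacetime)
  have t: "tminus v \<in> timelike_cone A (reverse_L L) (reverse_X X) (fst (tminus v))"
    using reverse_timelike[OF P(2)] by simp
  have r': "rev.reaches (fst (tminus v)) x" using reverse_reaches[OF r] by simp
  note * = rev.dist_after[OF reverse_causal_path[OF P(1)] t r']
  show "ereal l2 + lorentz_dist A L X x (fst v) \<le> lorentz_dist A L X x (fst w)"
    using *(1) by (simp add: reverse_dist)
  show "reaches x (fst w)" using rev.reverse_reaches[OF *(2)] by (simp add: reverse_involution)
qed

context
  fixes \<eta> assumes \<eta>: "unit_line \<eta>"
begin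

lemma \<eta>_curve: "unit_curve \<eta>"
  using \<eta> by (simp add: unit_line_def)

text \<open>The approximants whose limit defines \<open>busemann\<close>.\<close>

definition B where "B y t = ereal t - lorentz_dist A L X y (\<eta> t)"

lemma dist_mono:
  assumes "reaches y (\<eta> t1)" "t1 < t2"
  shows "ereal (t2 - t1) + lorentz_dist A L X y (\<eta> t1) \<le> lorentz_dist A L X y (\<eta> t2)" and "reaches y (\<eta> t2)"
  using dist_before[OF unit_curve_path[OF \<eta>_curve assms(2)] vel_timelike'[OF \<eta>_curve], of y] assms by simp_all

lemma reaches_mono: "reaches y (\<eta> t1) \<Longrightarrow> t1 \<le> t2 \<Longrightarrow> reaches y (\<eta> t2)"
  using dist_mono(2) by (cases "t1 = t2") auto

lemma B_antimono:
  assumes "reaches y (\<eta> t1)" "t1 \<le> s" "s \<le> t"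
  shows "B y t \<le> B y s"
proof (cases "s = t")
  case False
  have "ereal (t - s) + lorentz_dist A L X y (\<eta> s) \<le> lorentz_dist A L X y (\<eta> t)"
    by (rule dist_mono(1)[OF reaches_mono[OF assms(1,2)]]) (use False assms in simp)
  then show ?thesis unfolding B_def
    using lorentz_dist_nonneg[of A L X y "\<eta> s"]
    by (cases "lorentz_dist A L X y (\<eta> s)"; cases "lorentz_dist A L X y (\<eta> t)") auto
qed simp

text \<open>\<open>busemann\<close> is defined by \<open>Lim\<close>, which is meaningful only after
  convergence is known. By the reverse triangle inequality along \<eta> the approximants decrease
  once \<eta> t is reachable, so they converge to their infimum.\<close>

lemma B_tendsto:
  assumes "reaches y (\<eta> t1)"
  shows "(B y \<longlongrightarrow> busemann A L X \<eta> y) at_top"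
proof -
  define I where "I = (INF t\<in>{t1..}. B y t)"
  have "(B y \<longlongrightarrow> I) at_top"
  proof (rule order_tendstoI)
    fix a assume "a < I"
    then have "a < B y t" if "t \<ge> t1" for t
      unfolding I_def using that by (meson INF_lower atLeast_iff less_le_trans)
    then show "\<forall>\<^sub>F t in at_top. a < B y t" unfolding eventually_at_top_linorder by blast
  next
    fix a assume "I < a"
    then obtain s where s: "s \<ge> t1" "B y s < a" unfolding I_def by (auto simp: INF_less_iff)
    then have "B y t < a" if "t \<ge> s" for t using B_antimono[OF assms s(1) that] by simp
    then show "\<forall>\<^sub>F t in at_top. B y t < a" unfolding eventually_at_top_linorder by blast
  qed
  moreover from this have "busemann A L X \<eta> y = I"
    unfolding busemann_def B_def by (intro tendsto_Lim) simp_all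
  ultimately show ?thesis by simp
qed

lemma busemann_le_B:
  assumes "reaches y (\<eta> t1)" "t1 \<le> t"
  shows "busemann A L X \<eta> y \<le> B y t"
proof (rule tendsto_upperbound[OF B_tendsto[OF assms(1)]])
  show "\<forall>\<^sub>F s in at_top. B y s \<le> B y t"
    using B_antimono[OF assms] unfolding eventually_at_top_linorder by blast
qed simp

lemma busemann_ge:
  assumes "reaches y (\<eta> t1)" "\<And>t. t \<ge> t2 \<Longrightarrow> a \<le> B y t"
  shows "a \<le> busemann A L X \<eta> y"
proof (rule tendsto_lowerbound[OF B_tendsto[OF assms(1)]])
  show "\<forall>\<^sub>F s in at_top. a \<le> B y s"
    using assms(2) unfolding eventually_at_top_linorder by blast
qed simp

text \<open>\<open>dist_after\<close> compares the distances of both end points to \<eta> t for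
  every large t; this passes to the limit.\<close>

lemma busemann_along_path:
  assumes P: "causal_path A L X u w len" "w \<in> timelike_cone A L X (fst w)" and r: "reaches (fst w) (\<eta> t1)"
  shows "busemann A L X \<eta> (fst u) + ereal len \<le> busemann A L X \<eta> (fst w)" and "reaches (fst u) (\<eta> t1)"
proof -
  show r': "reaches (fst u) (\<eta> t1)" using dist_after[OF P r] by simp
  show "busemann A L X \<eta> (fst u) + ereal len \<le> busemann A L X \<eta> (fst w)"
  proof (rule busemann_ge[OF r])
    fix t assume t: "t \<ge> t1"
    have "busemann A L X \<eta> (fst u) + ereal len \<le> B (fst u) t + ereal len"
      by (intro add_right_mono busemann_le_B[OF r' t])
    also have "\<dots> \<le> B (fst w) t"
      using dist_after(1)[OF P reaches_mono[OF r t]] lorentz_dist_nonneg[of A L X "fst w" "\<eta> t"] unfolding B_def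
      by (cases "lorentz_dist A L X (fst u) (\<eta> t)"; cases "lorentz_dist A L X (fst w) (\<eta> t)") auto
    finally show "busemann A L X \<eta> (fst u) + ereal len \<le> B (fst w) t" .
  qed
qed

text \<open>The reverse triangle inequality along \<open>\<eta>(-s)\<close>, \<open>y\<close>, \<open>y'\<close>, \<open>\<eta>(t)\<close>.\<close>

lemma busemann_sum:
  assumes P: "causal_path A L X u w len" "u \<in> timelike_cone A L X (fst u)" "w \<in> timelike_cone A L X (fst w)"
    and r: "reaches (fst w) (\<eta> t1)" and s: "reaches (\<eta> (- s)) (fst u)"
  shows "lorentz_dist A L X (\<eta> (- s)) (fst u) - ereal s \<le> busemann A L X \<eta> (fst w)"
proof (rule busemann_ge[OF r])
  fix t assume t: "t \<ge> max t1 (1 - s)"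
  define D0 where "D0 = lorentz_dist A L X (\<eta> (- s)) (fst u)"
  have st: "lorentz_dist A L X (\<eta> (- s)) (\<eta> t) = ereal (s + t)"
    using \<eta> t by (simp add: unit_line_def add.commute)
  have D0: "D0 \<ge> 0" unfolding D0_def by (rule lorentz_dist_nonneg)
  \<comment> \<open>The curves realizing the outer two distances may meet u and w with lightlike
    velocities. The connecting path is timelike at both ends, so both corners can be cut: the one at
    w by \<open>corner\<close>, the one at u within \<open>dist_before\<close>.\<close>
  have *: "ereal l3 + D0 \<le> ereal (s + t)" if p: "causal_path A L X v' w' l3" "fst v' = fst w" "fst w' = \<eta> t" for v' w' l3
  proof (rule ereal_le_epsilon2)
    fix e :: real assume "0 < e"
    from corner[OF P(1,3) p(1,2) this] obtain len' where len': "len' \<ge> len + l3 - e" "causal_path A L X u w' len'" by blast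
    have "ereal len' + D0 \<le> ereal (s + t)"
      using dist_before(1)[OF len'(2) P(2) s] p(3) st by (simp add: D0_def)
    moreover have "l3 - e \<le> len'" using len'(1) causal_path_nonneg[OF P(1)] by simp
    ultimately show "ereal l3 + D0 \<le> ereal (s + t) + ereal e" by (cases D0) auto
  qed
  have "reaches (fst w) (\<eta> t)" using reaches_mono[OF r] t by simp
  then obtain v' w' l3 where p: "causal_path A L X v' w' l3" "fst v' = fst w" "fst w' = \<eta> t" by (auto simp: reaches_def)
  then obtain D where D: "D0 = ereal D" using *[OF p] D0 by (cases D0) auto
  have "lorentz_dist A L X (fst w) (\<eta> t) \<le> ereal (s + t - D)"
    unfolding lorentz_dist_eq[of A L X "fst w"]
  proof (rule Sup_least)
    fix z assume "z \<in> insert 0 {ereal len | len u' w'. causal_path A L X u' w' len \<and> fst u' = fst w \<and> fst w' = \<eta> t}"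
    then consider "z = 0" | len u' w' where "z = ereal len" "causal_path A L X u' w' len" "fst u' = fst w" "fst w' = \<eta> t" by blast
    then show "z \<le> ereal (s + t - D)"
    proof cases
      case 1
      then show ?thesis using *[OF p] D causal_path_nonneg[OF p(1)] by (simp flip: zero_ereal_def)
    next
      case 2
      then show ?thesis using *[OF 2(2-4)] D by simp
    qed
  qed
  then show "lorentz_dist A L X (\<eta> (- s)) (fst u) - ereal s \<le> B (fst w) t"
    unfolding D0_def[symmetric] D B_def by (cases "lorentz_dist A L X (fst w) (\<eta> t)") auto
qed

text \<open>The maximizing curve from \<zeta> 0 to \<eta> (\<tau> k) passes through a point q near
  \<zeta> (T + \<delta>), which lies between \<zeta> T and \<zeta> (T + 2\<delta>) causally. Hence
  its part before q has length at most T + 2\<delta>, and its part after q has length at most the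
  distance from \<zeta> T to \<eta> (\<tau> k). The two parts add up to the distance from \<zeta> 0.
  This sandwich takes the place of continuity of the distance.\<close>

lemma asymptote_step:
  assumes \<zeta>: "unit_line \<zeta>" and as: "asymptote A L X \<eta> (\<zeta> 0) \<zeta>" and T: "0 \<le> T" and \<delta>: "0 < \<delta>"
  obtains \<tau> :: "nat \<Rightarrow> real" where "filterlim \<tau> at_top sequentially"
    "\<forall>\<^sub>F k in sequentially. reaches (\<zeta> 0) (\<eta> (\<tau> k)) \<and> reaches (\<zeta> T) (\<eta> (\<tau> k)) \<and>
       B (\<zeta> T) (\<tau> k) \<le> B (\<zeta> 0) (\<tau> k) + ereal (T + 2 * \<delta>)"
proof -
  from as obtain z a \<tau> r \<rho> a' where \<tau>: "filterlim \<tau> at_top sequentially" and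
    z: "\<And>k. 0 < a k \<and> C1_curve A {0..a k} (z k) \<and> has_causal_velocity A L X {0..a k} (z k) \<and>
             is_maximizing A L X (z k) 0 (a k) \<and> z k 0 = \<zeta> 0 \<and> z k (a k) = \<eta> (\<tau> k)" and
    r: "strict_mono (r :: nat \<Rightarrow> nat)" and
    \<rho>: "\<And>k. 0 < a' k \<and> continuous_on {0..a' k} (\<rho> k) \<and> strict_mono_on {0..a' k} (\<rho> k) \<and>
                \<rho> k 0 = (0 :: real) \<and> \<rho> k (a' k) = a (r k)" and
    conv: "curves_converge (\<lambda>k. z (r k) \<circ> \<rho> k) a' \<zeta>"
    unfolding asymptote_def by blast
  have \<zeta>c: "unit_curve \<zeta>" using \<zeta> by (simp add: unit_line_def)
  obtain c where c: "c \<in> A" "\<zeta> (T + \<delta>) \<in> cdom c" using chart_exists by blast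
  define x0 where "x0 = cmap c (\<zeta> (T + \<delta>))"
  have Td: "T + \<delta> < T + 2 * \<delta>" "T < T + \<delta>" using \<delta> by simp_all
  \<comment> \<open>Of the two variation lemmas only the existence of causal curves between \<zeta>
    and the points near \<zeta> (T + \<delta>) is kept.\<close>
  obtain \<rho>1 where \<rho>1: "\<rho>1 > 0" "\<And>y. dist y x0 < \<rho>1 \<Longrightarrow>
      \<exists>u len. u \<in> timelike_cone A L X (cinv c y) \<and> causal_path A L X u (vel \<zeta> (T + 2 * \<delta>)) len"
    using first_variation[OF \<zeta>c c zero_less_one Td(1)] unfolding x0_def by blast
  obtain \<rho>2 where \<rho>2: "\<rho>2 > 0" "\<And>y. dist y x0 < \<rho>2 \<Longrightarrow>
      \<exists>w len. w \<in> timelike_cone A L X (cinv c y) \<and> causal_path A L X (vel \<zeta> T) w len"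
    using first_variation_reverse[OF \<zeta>c c zero_less_one Td(2)] unfolding x0_def by blast
  define N where "N = cdom c \<inter> cmap c -` ball x0 (min \<rho>1 \<rho>2)"
  have "open N"
    unfolding N_def using chart_continuous(1)[OF chart[OF c(1)]] chart_open(1)[OF chart[OF c(1)]]
    by (simp add: continuous_on_open_vimage Int_commute)
  moreover have "\<zeta> (T + \<delta>) \<in> N" using c \<rho>1 \<rho>2 by (simp add: N_def x0_def)
  ultimately have "\<forall>\<^sub>F k in sequentially. (z (r k) \<circ> \<rho> k) ` {T + \<delta>..T + \<delta>} \<subseteq> N"
    using conv T \<delta> unfolding curves_converge_def by (auto elim!: allE[of _ "T + \<delta>"] eventually_mono)
  \<comment> \<open>The additional 1 places the parameter T + \<delta> strictly inside [0, a' k], so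
    that q is an interior point of the maximizing curve.\<close>
  moreover have "\<forall>\<^sub>F k in sequentially. T + \<delta> + 1 \<le> a' k"
    using conv[unfolded curves_converge_def, rule_format, of 0 "T + \<delta> + 1" UNIV] T \<delta> by (auto elim: eventually_mono)
  ultimately have "\<forall>\<^sub>F k in sequentially. reaches (\<zeta> 0) (\<eta> (\<tau> (r k))) \<and> reaches (\<zeta> T) (\<eta> (\<tau> (r k))) \<and>
       B (\<zeta> T) (\<tau> (r k)) \<le> B (\<zeta> 0) (\<tau> (r k)) + ereal (T + 2 * \<delta>)"
  proof eventually_elim
    case (elim k)
    define Z where "Z = z (r k)"
    define b where "b = a (r k)"
    define \<sigma> where "\<sigma> = \<rho> k (T + \<delta>)"
    define q where "q = Z \<sigma>"
    have Z: "0 < b" "C1_curve A {0..b} Z" "has_causal_velocity A L X {0..b} Z" "is_maximizing A L X Z 0 b" "Z 0 = \<zeta> 0" "Z b = \<eta> (\<tau> (r k))"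
      using z[of "r k"] by (auto simp: Z_def b_def)
    have mono: "strict_mono_on {0..a' k} (\<rho> k)" "\<rho> k 0 = 0" "\<rho> k (a' k) = b" using \<rho>[of k] by (auto simp: b_def)
    have \<sigma>: "0 < \<sigma>" "\<sigma> < b"
      using strict_mono_onD[OF mono(1), of 0 "T + \<delta>"] strict_mono_onD[OF mono(1), of "T + \<delta>" "a' k"] mono(2,3) elim T \<delta>
      by (auto simp: \<sigma>_def)
    have qN: "q \<in> cdom c" "dist (cmap c q) x0 < \<rho>1" "dist (cmap c q) x0 < \<rho>2" 
      using elim(1) by (auto simp: N_def q_def Z_def \<sigma>_def dist_commute)
    have cq: "cinv c (cmap c q) = q" using c qN by (simp add: chart_simps)
    obtain u l4 where u: "u \<in> timelike_cone A L X q" "causal_path A L X u (vel \<zeta> (T + 2 * \<delta>)) l4"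
      using \<rho>1(2)[OF qN(2)] unfolding cq by blast
    obtain w l5 where w: "w \<in> timelike_cone A L X q" "causal_path A L X (vel \<zeta> T) w l5"
      using \<rho>2(2)[OF qN(3)] unfolding cq by blast
    define l1 where "l1 = integral {0..\<sigma>} (\<lambda>t. finsler_F L (velocity A {0..b} Z t))"
    define l2 where "l2 = integral {\<sigma>..b} (\<lambda>t. finsler_F L (velocity A {0..b} Z t))"
    have p1: "causal_path A L X (velocity A {0..b} Z 0) (velocity A {0..b} Z \<sigma>) l1"
      unfolding l1_def using \<sigma> by (intro causal_path_sub Z) auto
    have p2: "causal_path A L X (velocity A {0..b} Z \<sigma>) (velocity A {0..b} Z b) l2"
      unfolding l2_def using \<sigma> by (intro causal_path_sub Z) auto
    have "l1 + l2 = curve_length A L Z 0 b"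
      unfolding l1_def l2_def curve_length_def using \<sigma>
      by (intro Henstock_Kurzweil_Integration.integral_combine integrable_continuous_interval F_velocity_continuous Z) auto
    then have d0: "lorentz_dist A L X (\<zeta> 0) (\<eta> (\<tau> (r k))) = ereal (l1 + l2)"
      using Z(4-6) by (simp add: is_maximizing_def)
    have r0: "reaches (\<zeta> 0) (\<eta> (\<tau> (r k)))"
      unfolding reaches_def using causal_path_trans[OF p1 p2] Z(5,6) by (metis fst_velocity)
    have rq: "reaches (\<zeta> 0) q" "reaches q (\<eta> (\<tau> (r k)))"
      unfolding reaches_def using p1 p2 Z(5,6) by (metis fst_velocity q_def)+
    have fu: "fst u = q" "fst w = q" using u w fst_timelike by auto
    have "ereal l1 \<le> lorentz_dist A L X (\<zeta> 0) q" using lorentz_dist_ge[OF p1] Z(5) by (simp add: q_def)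
    moreover have "ereal l4 + lorentz_dist A L X (\<zeta> 0) q \<le> lorentz_dist A L X (\<zeta> 0) (\<zeta> (T + 2 * \<delta>))"
      using dist_before(1)[OF u(2), of "\<zeta> 0"] u(1) rq(1) fu by simp
    moreover have "lorentz_dist A L X (\<zeta> 0) (\<zeta> (T + 2 * \<delta>)) = ereal (T + 2 * \<delta>)"
      using \<zeta> T \<delta> by (simp add: unit_line_def)
    ultimately have l1: "l1 \<le> T + 2 * \<delta>"
      using causal_path_nonneg[OF u(2)] by (cases "lorentz_dist A L X (\<zeta> 0) q") auto
    have wq: "w \<in> timelike_cone A L X (fst w)" "reaches (fst w) (\<eta> (\<tau> (r k)))" using w(1) rq(2) fu by auto
    note da = dist_after[OF w(2) wq]
    have "ereal l2 \<le> lorentz_dist A L X q (\<eta> (\<tau> (r k)))" using lorentz_dist_ge[OF p2] Z(6) by (simp add: q_def)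
    with da(1) have l2: "ereal l2 \<le> lorentz_dist A L X (\<zeta> T) (\<eta> (\<tau> (r k)))"
      using causal_path_nonneg[OF w(2)] fu
      by (cases "lorentz_dist A L X q (\<eta> (\<tau> (r k)))"; cases "lorentz_dist A L X (\<zeta> T) (\<eta> (\<tau> (r k)))") auto
    have "B (\<zeta> T) (\<tau> (r k)) \<le> B (\<zeta> 0) (\<tau> (r k)) + ereal (T + 2 * \<delta>)"
      unfolding B_def d0 using l1 l2 by (cases "lorentz_dist A L X (\<zeta> T) (\<eta> (\<tau> (r k)))") auto
    then show ?case using r0 da(2) by simp
  qed
  moreover have "filterlim (\<lambda>k. \<tau> (r k)) at_top sequentially"
    by (rule filterlim_compose[OF \<tau> filterlim_subseq[OF r]])
  ultimately show thesis using that[of "\<lambda>k. \<tau> (r k)"] by simp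
qed

text \<open>Let k tend to infinity and then \<delta> to 0 in \<open>asymptote_step\<close>. The
  inequality is opposite to \<open>busemann_along_path\<close>, and it transfers the value at
  \<zeta> 0 to an upper bound along the whole half line.\<close>

lemma asymptote_busemann:
  assumes \<zeta>: "unit_line \<zeta>" and as: "asymptote A L X \<eta> (\<zeta> 0) \<zeta>" and T: "0 \<le> T"
  shows "\<exists>t1. reaches (\<zeta> T) (\<eta> t1)" and "busemann A L X \<eta> (\<zeta> T) \<le> busemann A L X \<eta> (\<zeta> 0) + ereal T"
proof -
  obtain \<tau> :: "nat \<Rightarrow> real" where
    "\<forall>\<^sub>F k in sequentially. reaches (\<zeta> 0) (\<eta> (\<tau> k)) \<and> reaches (\<zeta> T) (\<eta> (\<tau> k)) \<and>
       B (\<zeta> T) (\<tau> k) \<le> B (\<zeta> 0) (\<tau> k) + ereal (T + 2 * 1)"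
    using asymptote_step[OF assms zero_less_one] by blast
  then obtain t1 where r: "reaches (\<zeta> 0) (\<eta> t1)" "reaches (\<zeta> T) (\<eta> t1)"
    using eventually_happens' sequentially_bot by blast
  then show "\<exists>t1. reaches (\<zeta> T) (\<eta> t1)" by blast
  show "busemann A L X \<eta> (\<zeta> T) \<le> busemann A L X \<eta> (\<zeta> 0) + ereal T"
  proof (rule ereal_le_epsilon2)
    fix e :: real assume "0 < e"
    then have e2: "0 < e / 2" by simp
    obtain \<tau> :: "nat \<Rightarrow> real" where \<tau>: "filterlim \<tau> at_top sequentially"
      "\<forall>\<^sub>F k in sequentially. reaches (\<zeta> 0) (\<eta> (\<tau> k)) \<and> reaches (\<zeta> T) (\<eta> (\<tau> k)) \<and>
         B (\<zeta> T) (\<tau> k) \<le> B (\<zeta> 0) (\<tau> k) + ereal (T + 2 * (e / 2))"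
      using asymptote_step[OF assms e2] by blast
    have lim: "((\<lambda>k. B (\<zeta> 0) (\<tau> k)) \<longlongrightarrow> busemann A L X \<eta> (\<zeta> 0)) sequentially"
      by (rule filterlim_compose[OF B_tendsto[OF r(1)] \<tau>(1)])
    have "\<forall>\<^sub>F k in sequentially. t1 \<le> \<tau> k" using \<tau>(1) by (simp add: filterlim_at_top)
    with \<tau>(2) have "\<forall>\<^sub>F k in sequentially. busemann A L X \<eta> (\<zeta> T) - ereal (T + e) \<le> B (\<zeta> 0) (\<tau> k)"
    proof eventually_elim
      case (elim k)
      then have "B (\<zeta> T) (\<tau> k) \<le> B (\<zeta> 0) (\<tau> k) + ereal (T + e)" by simp
      then have "busemann A L X \<eta> (\<zeta> T) \<le> B (\<zeta> 0) (\<tau> k) + ereal (T + e)"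
        using busemann_le_B[OF r(2) elim(2)] order_trans by blast
      then show ?case by (simp add: ereal_minus_le)
    qed
    then have "busemann A L X \<eta> (\<zeta> T) - ereal (T + e) \<le> busemann A L X \<eta> (\<zeta> 0)"
      by (intro tendsto_lowerbound[OF lim]) auto
    then show "busemann A L X \<eta> (\<zeta> T) \<le> busemann A L X \<eta> (\<zeta> 0) + ereal T + ereal e"
      by (simp add: ereal_minus_le add.assoc)
  qed
qed

end

end

lemma (in spacetime) reverse_unit_line:
  assumes "unit_line \<zeta>"
  shows "spacetime.unit_line A (reverse_L L) (reverse_X X) (\<lambda>t. \<zeta> (- t))"
proof -
  interpret rev: spacetime A "reverse_L L" "reverse_X X" by (rule reverse_spacetime)
  show ?thesis
    using reverse_unit_curve(1) assms unfolding rev.unit_line_def unit_line_def reverse_dist by auto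
qed

lemma (in spacetime) busemann_bar_reverse:
  "busemann_bar A L X \<eta> = busemann A (reverse_L L) (reverse_X X) (\<lambda>t. \<eta> (- t))"
  by (simp add: busemann_bar_def busemann_def reverse_dist fun_eq_iff)

text \<open>Forward and backward lines give upper bounds for both Busemann functions with the same first order terms, and
  the reverse triangle inequality turns the upper bound for one into a lower bound for the other.\<close>

theorem (in spacetime) busemann_bar_derivative:
  assumes \<eta>: "unit_line \<eta>" and \<zeta>: "unit_line \<zeta>"
    and as: "asymptote A L X \<eta> (\<zeta> 0) \<zeta>"
    and as': "asymptote A (reverse_L L) (reverse_X X) (\<lambda>t. \<eta> (- t)) (\<zeta> 0) (\<lambda>t. \<zeta> (- t))"
    and sum: "busemann A L X \<eta> (\<zeta> 0) + busemann_bar A L X \<eta> (\<zeta> 0) = 0"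
    and c: "c \<in> A" "\<zeta> t0 \<in> cdom c"
  defines "x0 \<equiv> cmap c (\<zeta> t0)" and "W \<equiv> coord_velocity c UNIV \<zeta> t0"
  shows "((\<lambda>y. real_of_ereal (busemann_bar A L X \<eta> (cinv c y))) has_derivative frechet_derivative (l c x0) (at W)) (at x0)"
proof -
  interpret rev: spacetime A "reverse_L L" "reverse_X X" by (rule reverse_spacetime)
  note \<eta>r = reverse_unit_line[OF \<eta>]
  let ?b = "busemann A L X \<eta>" and ?bb = "busemann_bar A L X \<eta>"
  \<comment> \<open>In \<open>ereal\<close> a sum with an infinite summand is never 0, so both
    values are finite and opposite.\<close>
  obtain b0 where b0: "?b (\<zeta> 0) = ereal b0" "?bb (\<zeta> 0) = ereal (- b0)"
    using sum by (cases "?b (\<zeta> 0)"; cases "?bb (\<zeta> 0)") auto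
  have \<zeta>c: "unit_curve \<zeta>" using \<zeta> by (simp add: unit_line_def)
  \<comment> \<open>For either sign of t0, this puts \<zeta> T after and \<zeta> (-T) before \<zeta>
    t0, so the point under consideration is compared with a forward and a backward point of the same
    line.\<close>
  define T where "T = \<bar>t0\<bar> + 1"
  have T: "0 \<le> T" "t0 < T" "- T < t0" by (auto simp: T_def)
  define \<omega> where "\<omega> = frechet_derivative (l c x0) (at W)"
  have x0: "x0 \<in> cimg c" using c by (simp add: x0_def)
  have W: "W \<in> Om c x0" using coord_vel(2)[OF \<zeta>c c] by (simp add: W_def x0_def)
  have W0: "W \<noteq> 0" by (rule Om_nonzero[OF c(1) x0 W])
  have bl: "bounded_linear \<omega>"
    using minkowski_norm.has_derivative_D[OF minkowski[OF c(1) x0] W0] has_derivative_bounded_linear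
    unfolding \<omega>_def minkowski_norm.D_def[OF minkowski[OF c(1) x0]] by blast
  obtain t1 where t1: "reaches (\<zeta> T) (\<eta> t1)" using asymptote_busemann(1)[OF \<eta> \<zeta> as T(1)] by blast
  have bT: "?b (\<zeta> T) \<le> ereal (b0 + T)" using asymptote_busemann(2)[OF \<eta> \<zeta> as T(1)] b0 by simp
  have as'': "asymptote A (reverse_L L) (reverse_X X) (\<lambda>t. \<eta> (- t)) ((\<lambda>t. \<zeta> (- t)) 0) (\<lambda>t. \<zeta> (- t))"
    using as' by simp
  obtain s1 where s1: "rev.reaches (\<zeta> (- T)) (\<eta> (- s1))"
    using rev.asymptote_busemann(1)[OF \<eta>r reverse_unit_line[OF \<zeta>] as'' T(1)] by blast
  have bbT: "?bb (\<zeta> (- T)) \<le> ereal (- b0 + T)"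
    using rev.asymptote_busemann(2)[OF \<eta>r reverse_unit_line[OF \<zeta>] as'' T(1)] b0 by (simp add: busemann_bar_reverse)
  have upper: "\<exists>\<rho>>0. \<forall>y. dist y x0 < \<rho> \<longrightarrow> y \<in> cimg c \<and> reaches (cinv c y) (\<eta> t1) \<and>
      ?b (cinv c y) \<le> ereal (b0 + t0 - \<omega> (y - x0) + e * norm (y - x0))" if e: "e > 0" for e
  proof -
    obtain \<rho> where \<rho>: "\<rho> > 0" "\<And>y. dist y x0 < \<rho> \<Longrightarrow> y \<in> cimg c \<and>
    (\<exists>u len. u \<in> timelike_cone A L X (cinv c y) \<and> causal_path A L X u (vel \<zeta> T) len \<and>
      T - t0 + \<omega> (y - x0) - e * norm (y - x0) \<le> len)"
      using first_variation[OF \<zeta>c c e T(2)] unfolding x0_def W_def \<omega>_def by blast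
    show ?thesis
    proof (intro exI[of _ \<rho>] conjI allI impI \<rho>(1))
      fix y assume y: "dist y x0 < \<rho>"
      show "y \<in> cimg c" using \<rho>(2)[OF y] by blast
      from \<rho>(2)[OF y] obtain u len where u: "u \<in> timelike_cone A L X (cinv c y)" "causal_path A L X u (vel \<zeta> T) len"
         "T - t0 + \<omega> (y - x0) - e * norm (y - x0) \<le> len" by blast
      have f: "fst u = cinv c y" using fst_timelike u by blast
      note * = busemann_along_path[OF \<eta> u(2) vel_timelike'[OF \<zeta>c], of t1]
      show "reaches (cinv c y) (\<eta> t1)" using *(2) t1 f by simp
      have "?b (cinv c y) + ereal len \<le> ereal (b0 + T)" using *(1) t1 f bT by (simp add: order_trans)
      then show "?b (cinv c y) \<le> ereal (b0 + t0 - \<omega> (y - x0) + e * norm (y - x0))"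
        using u(3) by (cases "?b (cinv c y)") auto
    qed
  qed
  have upper': "\<exists>\<rho>>0. \<forall>y. dist y x0 < \<rho> \<longrightarrow> rev.reaches (cinv c y) (\<eta> (- s1)) \<and>
      ?bb (cinv c y) \<le> ereal (- b0 - t0 + \<omega> (y - x0) + e * norm (y - x0))" if e: "e > 0" for e
  proof -
    obtain \<rho> where \<rho>: "\<rho> > 0" "\<And>y. dist y x0 < \<rho> \<Longrightarrow>
    (\<exists>u len. u \<in> timelike_cone A L X (cinv c y) \<and> causal_path A L X (vel \<zeta> (- T)) u len \<and>
      t0 - - T - \<omega> (y - x0) - e * norm (y - x0) \<le> len)"
      using first_variation_reverse[OF \<zeta>c c e T(3)] unfolding x0_def W_def \<omega>_def by blast
    show ?thesis
    proof (intro exI[of _ \<rho>] conjI allI impI \<rho>(1))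
      fix y assume y: "dist y x0 < \<rho>"
      from \<rho>(2)[OF y] obtain u len where u: "u \<in> timelike_cone A L X (cinv c y)" "causal_path A L X (vel \<zeta> (- T)) u len"
         "t0 - - T - \<omega> (y - x0) - e * norm (y - x0) \<le> len" by blast
      have f: "fst u = cinv c y" using fst_timelike u by blast
      have v: "tminus (vel \<zeta> (- T)) \<in> timelike_cone A (reverse_L L) (reverse_X X) (fst (tminus (vel \<zeta> (- T))))"
        using reverse_timelike[OF vel_timelike[OF \<zeta>c]] by simp
      note * = rev.busemann_along_path[OF \<eta>r reverse_causal_path[OF u(2)] v, of s1]
      show "rev.reaches (cinv c y) (\<eta> (- s1))" using *(2) s1 f by simp
      have "?bb (cinv c y) + ereal len \<le> ereal (- b0 + T)"
        using *(1) s1 f bbT by (simp add: order_trans busemann_bar_reverse)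
      then show "?bb (cinv c y) \<le> ereal (- b0 - t0 + \<omega> (y - x0) + e * norm (y - x0))"
        using u(3) by (cases "?bb (cinv c y)") auto
    qed
  qed
  obtain \<rho>0 where \<rho>0: "\<rho>0 > 0" "\<And>x' v'. dist x' x0 < \<rho>0 \<Longrightarrow> dist v' W < \<rho>0 \<Longrightarrow> x' \<in> cimg c \<and> v' \<in> Om c x'"
    using Om_near[OF c(1) x0 W] by blast
  have main: "\<exists>\<rho>>0. \<forall>y. dist y x0 < \<rho> \<longrightarrow> \<bar>real_of_ereal (?bb (cinv c y)) - (- b0 - t0 + \<omega> (y - x0))\<bar> \<le> e * norm (y - x0)"
    if e: "e > 0" for e
  proof -
    obtain \<rho>1 where \<rho>1: "\<rho>1 > 0" "\<And>y. dist y x0 < \<rho>1 \<Longrightarrow> y \<in> cimg c \<and> reaches (cinv c y) (\<eta> t1) \<and>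
      ?b (cinv c y) \<le> ereal (b0 + t0 - \<omega> (y - x0) + e * norm (y - x0))" using upper[OF e] by blast
    obtain \<rho>2 where \<rho>2: "\<rho>2 > 0" "\<And>y. dist y x0 < \<rho>2 \<Longrightarrow> rev.reaches (cinv c y) (\<eta> (- s1)) \<and>
      ?bb (cinv c y) \<le> ereal (- b0 - t0 + \<omega> (y - x0) + e * norm (y - x0))" using upper'[OF e] by blast
    define \<rho> where "\<rho> = min \<rho>0 (min \<rho>1 \<rho>2)"
    have \<rho>: "\<rho> > 0" using \<rho>0 \<rho>1 \<rho>2 by (simp add: \<rho>_def)
    show ?thesis
    proof (intro exI[of _ \<rho>] conjI allI impI \<rho>)
      fix y assume y: "dist y x0 < \<rho>"
      have up: "?bb (cinv c y) \<le> ereal (- b0 - t0 + \<omega> (y - x0) + e * norm (y - x0))"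
        and rr: "rev.reaches (cinv c y) (\<eta> (- s1))" using \<rho>2(2)[of y] y by (auto simp: \<rho>_def)
      \<comment> \<open>The lower bound at y is obtained from the upper bound for the other Busemann
        function at \<open>y + s *\<^sub>R W\<close>. The short segment between them has constant
        velocity W and is the timelike connection that \<open>busemann_sum\<close> asks for; s tends
        to 0 afterwards.\<close>
      define low where "low s = - b0 - t0 + \<omega> (y + s *\<^sub>R W - x0) - e * norm (y + s *\<^sub>R W - x0)" for s
      \<comment> \<open>Chosen so that the displaced points remain within \<rho> of x0.\<close>
      define s0 where "s0 = (\<rho> - dist y x0) / (norm W + 1)"
      have nW: "norm W + 1 > 0" by (simp add: add_nonneg_pos)
      have s0: "s0 > 0" using y nW by (simp add: s0_def)
      have near: "dist (y + s *\<^sub>R W) x0 < \<rho>" if s: "0 \<le> s" "s < s0" for s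
      proof -
        have "dist (y + s *\<^sub>R W) x0 \<le> dist y x0 + s * norm W"
          using dist_triangle[of "y + s *\<^sub>R W" x0 y] s by (simp add: dist_norm)
        also have "s * norm W \<le> s * (norm W + 1)" using s by (intro mult_left_mono) auto
        also have "s * (norm W + 1) < s0 * (norm W + 1)" using s nW by simp
        also have "s0 * (norm W + 1) = \<rho> - dist y x0" using nW by (simp add: s0_def)
        finally show ?thesis by simp
      qed
      have ge: "ereal (low s) \<le> ?bb (cinv c y)" if s: "0 < s" "s < s0" for s
      proof -
        have io: "y + t *\<^sub>R W \<in> cimg c \<and> W \<in> Om c (y + t *\<^sub>R W)" if "t \<in> {0..s}" for t
          using \<rho>0(2)[of "y + t *\<^sub>R W" W] near[of t] that s \<rho>0(1) by (simp add: \<rho>_def)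
        let ?u = "tvec_of A c (cinv c y) W" and ?w = "tvec_of A c (cinv c (y + s *\<^sub>R W)) W"
        obtain len where path: "causal_path A L X ?u ?w len"
        proof -
          have "causal_path A L X (tvec_of A c (cinv c (y + 0 *\<^sub>R W)) W) (tvec_of A c (cinv c (y + s *\<^sub>R W)) W)
            (integral {0..s} (\<lambda>t. sqrt (- 2 * l c (y + t *\<^sub>R W) W)))"
            by (rule causal_path_timelike_chart[OF c(1) s(1)]) (use io in \<open>auto intro!: derivative_eq_intros\<close>)
          then show thesis using that by simp
        qed
        have tl: "?u \<in> timelike_cone A L X (fst ?u)" "?w \<in> timelike_cone A L X (fst ?w)"
          using io[of 0] io[of s] s c by (auto simp: tvec_of_timelike chart_simps)
        have y': "reaches (fst ?w) (\<eta> t1)"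
          "?b (fst ?w) \<le> ereal (- low s)"
        proof -
          have eq: "b0 + t0 - \<omega> (y + s *\<^sub>R W - x0) + e * norm (y + s *\<^sub>R W - x0) = - low s" by (simp add: low_def)
          have "dist (y + s *\<^sub>R W) x0 < \<rho>1" using near[of s] s by (simp add: \<rho>_def)
          from \<rho>1(2)[OF this, unfolded eq] show "reaches (fst ?w) (\<eta> t1)" "?b (fst ?w) \<le> ereal (- low s)" by auto
        qed
        have "- ?b (fst ?w) \<le> busemann A (reverse_L L) (reverse_X X) (\<lambda>t. \<eta> (- t)) (cinv c y)"
        proof (rule rev.busemann_ge[OF \<eta>r rr])
          fix s' assume s': "s1 \<le> s'"
          have "rev.reaches (cinv c y) (\<eta> (- s'))" using rev.reaches_mono[OF \<eta>r rr s'] .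
          then have "reaches (\<eta> (- s')) (fst ?u)" using rev.reverse_reaches by (fastforce simp: reverse_involution)
          then have "lorentz_dist A L X (\<eta> (- s')) (cinv c y) - ereal s' \<le> ?b (fst ?w)"
            using busemann_sum[OF \<eta> path tl y'(1)] by simp
          then have "- ?b (fst ?w) \<le> - (lorentz_dist A L X (\<eta> (- s')) (cinv c y) - ereal s')" by simp
          also have "\<dots> = rev.B (\<lambda>t. \<eta> (- t)) (cinv c y) s'"
            unfolding rev.B_def[OF \<eta>r] reverse_dist by (cases "lorentz_dist A L X (\<eta> (- s')) (cinv c y)") auto
          finally show "- ?b (fst ?w) \<le> rev.B (\<lambda>t. \<eta> (- t)) (cinv c y) s'" .
        qed
        moreover have "ereal (low s) \<le> - ?b (fst ?w)" using y'(2) by (cases "?b (fst ?w)") auto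
        ultimately show ?thesis unfolding busemann_bar_reverse using order_trans by blast
      qed
      obtain f where f: "?bb (cinv c y) = ereal f"
        using up ge[of "s0 / 2"] s0 by (cases "?bb (cinv c y)") auto
      have "(low \<longlongrightarrow> low 0) (at_right 0)"
        unfolding low_def by (intro tendsto_intros bounded_linear.tendsto[OF bl])
      moreover have "\<forall>\<^sub>F s in at_right 0. low s \<le> f"
        using ge f s0 by (auto simp: eventually_at_right[of 0 s0] intro!: exI[of _ s0])
      ultimately have "low 0 \<le> f" by (intro tendsto_upperbound) auto
      then show "\<bar>real_of_ereal (?bb (cinv c y)) - (- b0 - t0 + \<omega> (y - x0))\<bar> \<le> e * norm (y - x0)"
        using up unfolding f low_def by (simp add: abs_le_iff)
    qed
  qed
  have f0: "real_of_ereal (?bb (cinv c x0)) = - b0 - t0"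
  proof -
    obtain \<rho> where "\<rho> > 0" and \<rho>: "\<And>y. dist y x0 < \<rho> \<Longrightarrow>
      \<bar>real_of_ereal (?bb (cinv c y)) - (- b0 - t0 + \<omega> (y - x0))\<bar> \<le> 1 * norm (y - x0)"
      using main[OF zero_less_one] by blast
    then show ?thesis using \<rho>[of x0] linear_0[OF bounded_linear.linear[OF bl]] by simp
  qed
  show ?thesis
    unfolding has_derivative_at_alt \<omega>_def[symmetric]
  proof (intro conjI bl allI impI)
    fix e :: real assume "0 < e"
    from main[OF this] show "\<exists>d>0. \<forall>y. norm (y - x0) < d \<longrightarrow>
      norm (real_of_ereal (?bb (cinv c y)) - real_of_ereal (?bb (cinv c x0)) - \<omega> (y - x0)) \<le> e * norm (y - x0)"
      unfolding f0 by (simp add: dist_norm algebra_simps)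
  qed
qed

section \<open>Berwald structures\<close>

lemma lorentzian_signature_invertible:
  assumes "lorentzian_signature (G :: real^'i^'i::finite)"
  shows "invertible G"
proof -
  have "x = 0" if "G *v x = 0" for x
    using lorentzian_signature_nondegenerate[OF assms, of x] that by simp
  then show ?thesis using matrix_left_invertible_ker invertible_left_inverse by blast
qed

lemma matrix_inv_right: 
  assumes "invertible (M :: 'a::semiring_1^'n^'n)"
  shows "M ** matrix_inv M = mat 1"
  using assms unfolding matrix_inv_def invertible_def by (rule someI2_ex) simp

lemma differentiable_prod:
  fixes f :: "'a \<Rightarrow> 'b::real_normed_vector \<Rightarrow> real"
  assumes "\<And>i. i \<in> I \<Longrightarrow> f i differentiable (at x)"
  shows "(\<lambda>x. \<Prod>i\<in>I. f i x) differentiable (at x)"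
  using assms by (induction I rule: infinite_finite_induct) auto

lemma differentiable_det:
  fixes M :: "'b::real_normed_vector \<Rightarrow> real^'n^'n::finite"
  assumes "\<And>i j. (\<lambda>v. M v $ i $ j) differentiable (at x)"
  shows "(\<lambda>v. det (M v)) differentiable (at x)"
  unfolding det_def
  by (intro differentiable_sum ballI differentiable_mult differentiable_prod differentiable_const assms) simp

text \<open>By Cramer's rule the entries of the inverse are quotients of determinants, hence
  rational functions of the entries of M.\<close>

lemma differentiable_matrix_inv:
  fixes M :: "'b::real_normed_vector \<Rightarrow> real^'n^'n::finite"
  assumes S: "open S" "v0 \<in> S" and M: "\<And>v i j. v \<in> S \<Longrightarrow> (\<lambda>v. M v $ i $ j) differentiable (at v)"
    and inv: "\<And>v. v \<in> S \<Longrightarrow> invertible (M v)"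
  shows "(\<lambda>v. matrix_inv (M v) $ i $ j) differentiable (at v0)"
proof -
  \<comment> \<open>M v with its i-th column replaced by the j-th basis vector.\<close>
  define R where "R v = (\<chi> r s. if s = i then (axis j 1 :: real^'n) $ r else M v $ r $ s)" for v
  have d: "(\<lambda>v. det (R v) / det (M v)) differentiable (at v0)"
  proof (intro differentiable_divide differentiable_det)
    show "(\<lambda>v. R v $ r $ s) differentiable (at v0)" for r s
      using M[OF S(2)] by (cases "s = i") (simp_all add: R_def)
    show "det (M v0) \<noteq> 0" using inv[OF S(2)] by (simp add: invertible_det_nz)
  qed (rule M[OF S(2)])
  have eq: "matrix_inv (M v) $ i $ j = det (R v) / det (M v)" if "v \<in> S" for v
  proof -
    have "M v *v (matrix_inv (M v) *v axis j 1) = axis j 1"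
      using inv[OF that] by (simp add: matrix_vector_mul_assoc matrix_inv_right)
    then have "matrix_inv (M v) *v axis j 1 = (\<chi> k. det (\<chi> r s. if s = k then (axis j 1 :: real^'n) $ r else M v $ r $ s) / det (M v))"
      using cramer[of "M v" "matrix_inv (M v) *v axis j 1" "axis j 1"] inv[OF that] by (simp add: invertible_det_nz)
    then have "(matrix_inv (M v) *v axis j 1) $ i = det (R v) / det (M v)" by (simp add: R_def)
    then show ?thesis by (simp add: matrix_vector_mult_basis column_def)
  qed
  from d obtain D where "((\<lambda>v. det (R v) / det (M v)) has_derivative D) (at v0)" by (auto simp: differentiable_def)
  then have "((\<lambda>v. matrix_inv (M v) $ i $ j) has_derivative D) (at v0)"
    by (rule has_derivative_transform_within_open[OF _ S]) (simp add: eq)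
  then show ?thesis by (auto simp: differentiable_def)
qed

text \<open>Constancy on one side suffices, as the derivative is known to exist. In the fibre this
  fits constancy along a ray.\<close>

lemma pd_zero_along:
  fixes g :: "real^'i::finite \<Rightarrow> real"
  assumes "g differentiable (at x)" "e > 0" "\<And>s. 0 \<le> s \<Longrightarrow> s < e \<Longrightarrow> g (x + s *\<^sub>R axis k 1) = g x"
  shows "pd k g x = 0"
proof -
  have "((\<lambda>s. g (x + s *\<^sub>R axis k 1)) has_derivative (\<lambda>t. frechet_derivative g (at x) (t *\<^sub>R axis k 1))) (at 0)"
    by (rule has_derivative_compose[of "\<lambda>s. x + s *\<^sub>R axis k 1" "\<lambda>t. t *\<^sub>R axis k 1" 0 UNIV g])
      (use frechet_has_derivative[OF assms(1)] in \<open>auto intro!: derivative_eq_intros\<close>)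
  then have "((\<lambda>s. g (x + s *\<^sub>R axis k 1)) has_derivative (\<lambda>t. frechet_derivative g (at x) (t *\<^sub>R axis k 1))) (at 0 within {0..e/2})"
    by (rule has_derivative_at_withinI)
  then have 1: "((\<lambda>s. g (x + s *\<^sub>R axis k 1)) has_vector_derivative pd k g x) (at 0 within {0..e/2})"
    using linear_frechet_derivative[OF assms(1)] by (simp add: has_vector_derivative_def pd_def linear_scale)
  have "((\<lambda>s. g x) has_vector_derivative 0) (at 0 within {0..e/2})" by simp
  then have 2: "((\<lambda>s. g (x + s *\<^sub>R axis k 1)) has_vector_derivative 0) (at 0 within {0..e/2})"
    by (rule has_vector_derivative_transform[rotated 2]) (use assms(2,3) in auto)
  show ?thesis
    by (rule vector_derivative_unique_within[OF _ 1 2]) (use ivl_perfect[of 0 "e/2" 0] assms(2) in auto)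
qed

lemma pd_cong:
  assumes "open U" "x \<in> U" "\<And>y. y \<in> U \<Longrightarrow> f y = g y" "g differentiable (at x)"
  shows "pd k f x = pd k g x"
proof -
  have "(f has_derivative frechet_derivative g (at x)) (at x)"
    by (rule has_derivative_transform_within_open[OF frechet_has_derivative[OF assms(4)] assms(1,2)]) (use assms in auto)
  from frechet_eqI[OF this] show ?thesis by (simp add: pd_def)
qed

section \<open>Partial derivatives on the slit tangent bundle\<close>

definition slit_smooth :: "(real^'i::finite) set \<Rightarrow> (real^'i \<Rightarrow> real^'i \<Rightarrow> real) \<Rightarrow> bool" where
  "slit_smooth U f \<longleftrightarrow> smooth_on (U \<times> (UNIV - {0})) (\<lambda>(x, v). f x v)"

lemma open_slit_set: "open U \<Longrightarrow> open (U \<times> (UNIV - {0 :: real^'i::finite}))"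
  by (intro open_Times open_delete open_UNIV)

lemma slit_partial:
  assumes f: "slit_smooth U f" and x: "x \<in> U" "v \<noteq> 0"
  shows "dv \<alpha> f x v = frechet_derivative (\<lambda>(x, v). f x v) (at (x, v)) (0, axis \<alpha> 1)"
    and "dx \<alpha> f x v = frechet_derivative (\<lambda>(x, v). f x v) (at (x, v)) (axis \<alpha> 1, 0)"
    and "f x differentiable (at v)" and "(\<lambda>y. f y v) differentiable (at x)"
proof -
  let ?D = "frechet_derivative (\<lambda>(x, v). f x v) (at (x, v))"
  have D: "((\<lambda>(x, v). f x v) has_derivative ?D) (at (x, v))"
    by (rule smooth_on_has_derivative[OF f[unfolded slit_smooth_def]]) (use x in auto)
  have "((\<lambda>v. (\<lambda>(x, v). f x v) (x, v)) has_derivative (\<lambda>h. ?D (0, h))) (at v)"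
    by (rule has_derivative_compose[of "\<lambda>v. (x, v)" "\<lambda>h. (0, h)" v UNIV _ ?D]) (use D in \<open>auto intro!: derivative_eq_intros\<close>)
  then have 1: "(f x has_derivative (\<lambda>h. ?D (0, h))) (at v)" by simp
  have "((\<lambda>y. (\<lambda>(x, v). f x v) (y, v)) has_derivative (\<lambda>h. ?D (h, 0))) (at x)"
    by (rule has_derivative_compose[of "\<lambda>y. (y, v)" "\<lambda>h. (h, 0)" x UNIV _ ?D]) (use D in \<open>auto intro!: derivative_eq_intros\<close>)
  then have 2: "((\<lambda>y. f y v) has_derivative (\<lambda>h. ?D (h, 0))) (at x)" by simp
  show "dv \<alpha> f x v = ?D (0, axis \<alpha> 1)" using frechet_eqI[OF 1] by (simp add: dv_def pd_def)
  show "dx \<alpha> f x v = ?D (axis \<alpha> 1, 0)" using frechet_eqI[OF 2] by (simp add: dx_def pd_def)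
  show "f x differentiable (at v)" using 1 by (rule differentiableI)
  show "(\<lambda>y. f y v) differentiable (at x)" using 2 by (rule differentiableI)
qed

lemma slit_smooth_dv: assumes "open U" "slit_smooth U f" shows "slit_smooth U (dv \<alpha> f)"
  unfolding slit_smooth_def
  by (rule smooth_on_cong[OF open_slit_set[OF assms(1)] _ smooth_on_derivative[OF assms(2)[unfolded slit_smooth_def], of "(0, axis \<alpha> 1)"]])
    (erule SigmaE, simp add: slit_partial(1)[OF assms(2)])

lemma slit_smooth_dx: assumes "open U" "slit_smooth U f" shows "slit_smooth U (dx \<alpha> f)"
  unfolding slit_smooth_def
  by (rule smooth_on_cong[OF open_slit_set[OF assms(1)] _ smooth_on_derivative[OF assms(2)[unfolded slit_smooth_def], of "(axis \<alpha> 1, 0)"]])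
    (erule SigmaE, simp add: slit_partial(2)[OF assms(2)])

lemma dv_commute:
  assumes U: "open U" and f: "slit_smooth U f" and x: "x \<in> U" "v \<noteq> 0"
  shows "dv \<alpha> (dv \<beta> f) x v = dv \<beta> (dv \<alpha> f) x v"
proof -
  let ?F = "\<lambda>(x, v). f x v"
  have z: "(x, v) \<in> U \<times> (UNIV - {0})" using x by simp
  have *: "dv \<alpha> (dv \<beta> f) x v = frechet_derivative (\<lambda>z. frechet_derivative ?F (at z) (0, axis \<beta> 1)) (at (x, v)) (0, axis \<alpha> 1)" for \<alpha> \<beta>
  proof -
    have "((\<lambda>(x, v). dv \<beta> f x v) has_derivative frechet_derivative (\<lambda>z. frechet_derivative ?F (at z) (0, axis \<beta> 1)) (at (x, v))) (at (x, v))"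
      by (rule has_derivative_transform_within_open[OF smooth_on_has_derivative[OF smooth_on_derivative[OF f[unfolded slit_smooth_def]] z] open_slit_set[OF U] z])
        (erule SigmaE, simp add: slit_partial(1)[OF f])
    from frechet_eqI[OF this] show ?thesis using slit_partial(1)[OF slit_smooth_dv[OF U f] x, of \<alpha> \<beta>] by simp
  qed
  show ?thesis unfolding * by (rule symmetric_frechet[OF open_slit_set[OF U] f[unfolded slit_smooth_def] z])
qed

lemma (in minkowski_norm) G_homogeneous:
  assumes "v \<noteq> 0" "r > 0"
  shows "G (r *\<^sub>R v) = G v"
proof -
  have rv: "r *\<^sub>R v \<noteq> 0" using assms by simp
  have H: "H (r *\<^sub>R v) u w = H v u w" for u w
  proof -
    have "((\<lambda>y. D (r *\<^sub>R y) w) has_derivative (\<lambda>u. H (r *\<^sub>R v) (r *\<^sub>R u) w)) (at v)"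
      by (rule has_derivative_compose[of "\<lambda>v. r *\<^sub>R v" "\<lambda>v. r *\<^sub>R v" v UNIV "\<lambda>y. D y w" "\<lambda>u. H (r *\<^sub>R v) u w"])
        (use has_derivative_H[OF rv] in \<open>auto intro!: derivative_eq_intros\<close>)
    moreover have "((\<lambda>y. D (r *\<^sub>R y) w) has_derivative (\<lambda>u. r * H v u w)) (at v)"
      by (rule has_derivative_transform_within_open[OF has_derivative_mult_right[OF has_derivative_H[OF assms(1)], of r w] open_delete[OF open_UNIV, of 0]])
        (use assms D_homogeneous in auto)
    ultimately have "H (r *\<^sub>R v) (r *\<^sub>R u) w = r * H v u w" using has_derivative_unique by metis
    moreover have "H (r *\<^sub>R v) (r *\<^sub>R u) w = r * H (r *\<^sub>R v) u w"
      using linear_scale[OF linear_H[OF rv], of r u w] by simp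
    ultimately show ?thesis using assms(2) by simp
  qed
  have "G v $ a $ b = H v (axis a 1) (axis b 1)" if "v \<noteq> 0" for v a b
    using H_eq_G[OF that] by (simp add: matrix_vector_mult_basis column_def inner_axis' )
  then show ?thesis using H assms(1) rv by (simp add: vec_eq_iff)
qed

section \<open>Berwald structures in coordinates adapted to a parallel field\<close>

context spacetime
begin

text \<open>The assumptions \<open>parallel\<close> and \<open>line_fund\<close> are the product
  form of g_W for the k-th coordinate field W: its k-th row is that of -dt^2 + h, and its components
  do not depend on the k-th coordinate. Nothing is assumed about the fundamental tensor at other
  vectors; \<open>berwald\<close> is what reaches them.\<close>

context
  fixes c :: "('m, real^'i) chart" and k :: 'i
  assumes c: "c \<in> A"
    and berwald: "\<And>x \<alpha> \<beta> \<delta> v w. x \<in> cimg c \<Longrightarrow> v \<noteq> 0 \<Longrightarrow> w \<noteq> 0 \<Longrightarrow> chern A L c \<alpha> \<beta> \<delta> x v = chern A L c \<alpha> \<beta> \<delta> x w"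
    and parallel: "\<And>x \<beta>. x \<in> cimg c \<Longrightarrow> fund A L c x (axis k 1) $ k $ \<beta> = (if \<beta> = k then -1 else 0)"
    and line_dom: "\<And>x s. x \<in> cimg c \<Longrightarrow> x + s *\<^sub>R axis k 1 \<in> cimg c"
    and line_fund: "\<And>x s. x \<in> cimg c \<Longrightarrow> fund A L c (x + s *\<^sub>R axis k 1) (axis k 1) = fund A L c x (axis k 1)"
begin

abbreviation g where "g \<alpha> \<beta> \<equiv> dv \<alpha> (dv \<beta> (l c))"

lemma fund_g: "fund A L c x v $ \<alpha> $ \<beta> = g \<alpha> \<beta> x v"
  by (simp add: fund_def)

lemma open_U: "open (cimg c)"
  by (rule chart_open(2)[OF chart[OF c]])

lemma smooth_l: "slit_smooth (cimg c) (l c)"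
  using L_smooth[OF c] by (simp add: slit_smooth_def)

lemma smooth_g: "slit_smooth (cimg c) (g \<alpha> \<beta>)"
  by (intro slit_smooth_dv open_U smooth_l)

lemma fund_G: "x \<in> cimg c \<Longrightarrow> fund A L c x v = minkowski_norm.G (l c x) v"
  by (simp add: minkowski_norm.G_def[OF minkowski[OF c]] fund_def dv_def[abs_def])

lemma fund_signature: "x \<in> cimg c \<Longrightarrow> v \<noteq> 0 \<Longrightarrow> lorentzian_signature (fund A L c x v)"
  using spacetime c unfolding finsler_spacetime_def lorentz_finsler_def by blast

lemma fund_homogeneous: "x \<in> cimg c \<Longrightarrow> v \<noteq> 0 \<Longrightarrow> r > 0 \<Longrightarrow> fund A L c x (r *\<^sub>R v) = fund A L c x v"
  by (simp add: fund_G minkowski_norm.G_homogeneous[OF minkowski[OF c]])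

lemma g_commute: "x \<in> cimg c \<Longrightarrow> v \<noteq> 0 \<Longrightarrow> g \<alpha> \<beta> x v = g \<beta> \<alpha> x v"
  by (rule dv_commute[OF open_U smooth_l])

lemma dv_g_swap:
  assumes "x \<in> cimg c" "v \<noteq> 0"
  shows "dv \<mu> (g \<alpha> \<beta>) x v = dv \<mu> (g \<beta> \<alpha>) x v"
  unfolding dv_def[of \<mu>]
  by (rule pd_cong[of "UNIV - {0}"]) (use assms g_commute slit_partial(3)[OF smooth_g assms] in auto)

text \<open>Together with \<open>dv_g_swap\<close> this is the total symmetry of the Cartan tensor,
  the third fibre derivative of L.\<close>

lemma dv_g_commute:
  assumes "x \<in> cimg c" "v \<noteq> 0"
  shows "dv \<mu> (g \<alpha> \<beta>) x v = dv \<beta> (g \<alpha> \<mu>) x v"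
proof -
  have "dv \<mu> (g \<alpha> \<beta>) x v = dv \<mu> (g \<beta> \<alpha>) x v" by (rule dv_g_swap[OF assms])
  also have "\<dots> = dv \<beta> (dv \<mu> (dv \<alpha> (l c))) x v"
    by (rule dv_commute[OF open_U slit_smooth_dv[OF open_U smooth_l] assms])
  also have "\<dots> = dv \<beta> (g \<alpha> \<mu>) x v" by (rule dv_g_swap[OF assms])
  finally show ?thesis .
qed

lemma dx_g_commute:
  assumes "x \<in> cimg c" "v \<noteq> 0"
  shows "dx \<mu> (g \<alpha> \<beta>) x v = dx \<mu> (g \<beta> \<alpha>) x v"
  unfolding dx_def
  by (rule pd_cong[OF open_U assms(1)]) (use assms g_commute slit_partial(4)[OF smooth_g assms] in auto)

text \<open>The fundamental tensor is homogeneous of degree 0, so its radial derivative vanishes.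
  The symmetry of the Cartan tensor moves this contraction to the index \<beta>.\<close>

lemma euler_g:
  assumes x: "x \<in> cimg c" "v \<noteq> 0"
  shows "(\<Sum>\<beta>\<in>UNIV. v $ \<beta> * dv \<mu> (g \<alpha> \<beta>) x v) = 0"
proof -
  have d: "g \<alpha> \<mu> x differentiable (at v)" by (rule slit_partial(3)[OF smooth_g x])
  let ?D = "frechet_derivative (g \<alpha> \<mu> x) (at v)"
  have "((\<lambda>s. g \<alpha> \<mu> x (0 + s *\<^sub>R v)) has_real_derivative ?D v) (at 1)"
    by (rule minkowski_norm.curve_derivative[OF minkowski[OF c x(1)]]) (use frechet_has_derivative[OF d] in simp)
  moreover have "((\<lambda>s. g \<alpha> \<mu> x (0 + s *\<^sub>R v)) has_real_derivative 0) (at 1)"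
  proof (rule has_field_derivative_transform_within[where d = 1])
    show "((\<lambda>s. g \<alpha> \<mu> x v) has_real_derivative 0) (at 1)" by simp
    fix s :: real assume "dist s 1 < 1"
    then have "s > 0" by (simp add: dist_real_def)
    then show "g \<alpha> \<mu> x v = g \<alpha> \<mu> x (0 + s *\<^sub>R v)"
      using arg_cong[OF fund_homogeneous[OF x], of s "\<lambda>M. M $ \<alpha> $ \<mu>"] by (simp add: fund_g)
  qed auto
  ultimately have "?D v = 0" using DERIV_unique by blast
  moreover have "?D v = (\<Sum>\<beta>\<in>UNIV. v $ \<beta> * ?D (axis \<beta> 1))"
  proof -
    have "?D v = ?D (\<Sum>\<beta>\<in>UNIV. v $ \<beta> *\<^sub>R axis \<beta> 1)" 
      by (simp add: basis_expansion scalar_mult_eq_scaleR[symmetric] del: scalar_mult_eq_scaleR)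
    then show ?thesis using linear_frechet_derivative[OF d] by (simp add: linear_sum linear_scale)
  qed
  moreover have "?D (axis \<beta> 1) = dv \<mu> (g \<alpha> \<beta>) x v" for \<beta>
    using dv_g_commute[OF x, of \<beta> \<alpha> \<mu>] by (simp add: dv_def[of \<beta>] pd_def)
  ultimately show ?thesis by simp
qed

lemma axis_nz: "(axis k 1 :: real^'i) \<noteq> 0" 
  by (simp add: axis_eq_0_iff)

text \<open>Stated for all positive multiples of the basis vector, because the nonlinear connection
  differentiates the spray along this ray.\<close>

lemma dx_at_axis:
  assumes x: "x \<in> cimg c" and r: "r > 0"
  shows "dx \<mu> (g \<alpha> k) x (r *\<^sub>R axis k 1) = 0" "dx \<mu> (g k \<alpha>) x (r *\<^sub>R axis k 1) = 0" "dx k (g \<alpha> \<beta>) x (r *\<^sub>R axis k 1) = 0"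
proof -
  have nz: "r *\<^sub>R axis k 1 \<noteq> (0 :: real^'i)" using axis_nz r by simp
  have const: "g k \<alpha> y (r *\<^sub>R axis k 1) = (if \<alpha> = k then -1 else 0)" if "y \<in> cimg c" for y
    using parallel[OF that, of \<alpha>] fund_homogeneous[OF that axis_nz r] by (simp add: fund_g[symmetric])
  show 1: "dx \<mu> (g k \<alpha>) x (r *\<^sub>R axis k 1) = 0"
    unfolding dx_def
    by (subst pd_cong[OF open_U x, of _ "\<lambda>_. if \<alpha> = k then -1 else 0"]) (use const in \<open>auto simp: pd_def frechet_derivative_const\<close>)
  show "dx \<mu> (g \<alpha> k) x (r *\<^sub>R axis k 1) = 0" using 1 dx_g_commute[OF x nz] by simp
  show "dx k (g \<alpha> \<beta>) x (r *\<^sub>R axis k 1) = 0"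
    unfolding dx_def
  proof (rule pd_zero_along[OF slit_partial(4)[OF smooth_g x nz] zero_less_one])
    fix s :: real
    show "g \<alpha> \<beta> (x + s *\<^sub>R axis k 1) (r *\<^sub>R axis k 1) = g \<alpha> \<beta> x (r *\<^sub>R axis k 1)"
      using line_fund[OF x, of s] fund_homogeneous[OF x axis_nz r] fund_homogeneous[OF line_dom[OF x] axis_nz r, of s]
      by (simp add: fund_g[symmetric])
  qed
qed

lemma christoffel_eq:
  "formal_christoffel A L c \<alpha> \<beta> \<delta> x v = 1/2 * (\<Sum>\<mu>\<in>UNIV. matrix_inv (fund A L c x v) $ \<alpha> $ \<mu> *
     (dx \<beta> (g \<mu> \<delta>) x v + dx \<delta> (g \<beta> \<mu>) x v - dx \<mu> (g \<beta> \<delta>) x v))"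
  by (simp add: formal_christoffel_def christoffel_def dx_def fund_g)

lemma christoffel_at_axis:
  "x \<in> cimg c \<Longrightarrow> r > 0 \<Longrightarrow> formal_christoffel A L c \<alpha> \<beta> k x (r *\<^sub>R axis k 1) = 0"
  by (simp add: christoffel_eq dx_at_axis)

text \<open>\<open>pd\<close> is given by \<open>frechet_derivative\<close>, so its value carries
  information only once the spray is known to be differentiable.\<close>

lemma spray_differentiable:
  assumes x: "x \<in> cimg c" "v \<noteq> 0"
  shows "spray A L c \<alpha> x differentiable (at v)"
proof -
  have inv: "(\<lambda>v. matrix_inv (fund A L c x v) $ \<alpha> $ \<mu>) differentiable (at v)" for \<alpha> \<mu>
    by (rule differentiable_matrix_inv[of "UNIV - {0}"])
      (use x slit_partial(3)[OF smooth_g x(1)] lorentzian_signature_invertible[OF fund_signature[OF x(1)]] in \<open>auto simp: fund_g\<close>)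
  have dd: "(\<lambda>v. dx \<mu> (g \<alpha> \<beta>) x v) differentiable (at v)" for \<mu> \<alpha> \<beta>
    using slit_partial(3)[OF slit_smooth_dx[OF open_U smooth_g] x] by (simp add: eta_contract_eq)
  have vd: "(\<lambda>v. v $ \<beta>) differentiable (at v)" for \<beta> :: 'i
    by (intro bounded_linear_imp_differentiable bounded_linear_vec_nth)
  have "spray A L c \<alpha> x = (\<lambda>v. 1/2 * (\<Sum>\<beta>\<in>UNIV. \<Sum>\<delta>\<in>UNIV. 1/2 * (\<Sum>\<mu>\<in>UNIV. matrix_inv (fund A L c x v) $ \<alpha> $ \<mu> *
     (dx \<beta> (g \<mu> \<delta>) x v + dx \<delta> (g \<beta> \<mu>) x v - dx \<mu> (g \<beta> \<delta>) x v)) * v $ \<beta> * v $ \<delta>))"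
    by (simp add: spray_def christoffel_eq fun_eq_iff)
  moreover have "\<dots> differentiable (at v)"
    by (intro differentiable_mult differentiable_sum ballI differentiable_add differentiable_diff inv dd vd differentiable_const finite)
  ultimately show ?thesis by simp
qed

lemma spray_at_axis:
  assumes x: "x \<in> cimg c" and r: "r > 0"
  shows "spray A L c \<alpha> x (r *\<^sub>R axis k 1) = 0"
proof -
  have "formal_christoffel A L c \<alpha> \<beta> \<delta> x (r *\<^sub>R axis k 1) * (r *\<^sub>R axis k 1 :: real^'i) $ \<beta> * (r *\<^sub>R axis k 1 :: real^'i) $ \<delta> = 0" for \<beta> \<delta>
    using christoffel_at_axis[OF x r, of \<alpha> \<beta>] by (cases "\<delta> = k") (auto simp: axis_def)
  then show ?thesis unfolding spray_def by (simp only: sum.neutral_const mult_zero_right)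
qed

text \<open>For the lower index k and the base vector e_k, the derivative of the spray is radial,
  and the spray vanishes on the ray.\<close>

lemma nonlinear_conn_at_axis:
  assumes x: "x \<in> cimg c"
  shows "nonlinear_conn A L c \<alpha> k x (axis k 1) = 0"
  unfolding nonlinear_conn_def dv_def
proof (rule pd_zero_along[OF spray_differentiable[OF x axis_nz] zero_less_one])
  fix s :: real assume "0 \<le> s"
  then have "spray A L c \<alpha> x ((1 + s) *\<^sub>R axis k 1) = 0" "spray A L c \<alpha> x (1 *\<^sub>R axis k 1) = 0"
    by (intro spray_at_axis x; simp)+
  then show "spray A L c \<alpha> x (axis k 1 + s *\<^sub>R axis k 1) = spray A L c \<alpha> x (axis k 1)"
    by (simp add: scaleR_left_distrib)
qed

lemma dv_g_at_axis:
  assumes x: "x \<in> cimg c"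
  shows "dv \<mu> (g \<alpha> k) x (axis k 1) = 0"
proof -
  have "(\<Sum>\<beta>\<in>UNIV. (axis k 1 :: real^'i) $ \<beta> * dv \<mu> (g \<alpha> \<beta>) x (axis k 1)) = dv \<mu> (g \<alpha> k) x (axis k 1)"
    by (subst sum.remove[of _ k]) (auto simp: axis_def intro!: sum.neutral)
  with euler_g[OF x axis_nz] show ?thesis by simp
qed

lemma chern_eq:
  "chern A L c \<alpha> \<beta> \<delta> x v = 1/2 * (\<Sum>\<kappa>\<in>UNIV. matrix_inv (fund A L c x v) $ \<alpha> $ \<kappa> *
     ((dx \<beta> (g \<kappa> \<delta>) x v + dx \<delta> (g \<beta> \<kappa>) x v - dx \<kappa> (g \<beta> \<delta>) x v) -
      (\<Sum>\<mu>\<in>UNIV. dv \<mu> (g \<kappa> \<delta>) x v * nonlinear_conn A L c \<mu> \<beta> x v + dv \<mu> (g \<beta> \<kappa>) x v * nonlinear_conn A L c \<mu> \<delta> x v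
              - dv \<mu> (g \<beta> \<delta>) x v * nonlinear_conn A L c \<mu> \<kappa> x v)))"
  by (simp add: chern_def Let_def christoffel_eq fund_g right_diff_distrib sum_subtractf sum_distrib_left)

text \<open>At e_k all base derivatives in the formula vanish by \<open>dx_at_axis\<close>. Of the
  three fibre terms, the two in which k is an index of g vanish by \<open>dv_g_at_axis\<close>, and
  the remaining one contains the nonlinear connection with lower index k. The Berwald property
  carries the result to v.\<close>

lemma chern_zero:
  assumes x: "x \<in> cimg c" "v \<noteq> 0"
  shows "chern A L c \<alpha> \<beta> k x v = 0"
proof -
  have "chern A L c \<alpha> \<beta> k x (axis k 1) = 0"
    using dx_at_axis[OF x(1) zero_less_one] by (simp add: chern_eq dv_g_at_axis[OF x(1)] nonlinear_conn_at_axis[OF x(1)])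
  then show ?thesis using berwald[OF x(1) x(2) axis_nz] by simp
qed

text \<open>Lowering the upper index turns \<open>chern_zero\<close> into the equations Q = 0.
  Exchanging \<beta> and \<kappa> flips the sign of every term of Q except the two belonging to the
  direction k, so adding the two equations isolates these: g is horizontally constant in that
  direction.\<close>

lemma horizontal_g:
  assumes x: "x \<in> cimg c" "v \<noteq> 0"
  shows "dx k (g \<beta> \<kappa>) x v = (\<Sum>\<mu>\<in>UNIV. dv \<mu> (g \<beta> \<kappa>) x v * nonlinear_conn A L c \<mu> k x v)"
proof -
  define N where "N \<mu> \<beta> = nonlinear_conn A L c \<mu> \<beta> x v" for \<mu> \<beta>
  define Q where "Q \<beta> \<kappa> = (dx \<beta> (g \<kappa> k) x v + dx k (g \<beta> \<kappa>) x v - dx \<kappa> (g \<beta> k) x v) -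
      (\<Sum>\<mu>\<in>UNIV. dv \<mu> (g \<kappa> k) x v * N \<mu> \<beta> + dv \<mu> (g \<beta> \<kappa>) x v * N \<mu> k - dv \<mu> (g \<beta> k) x v * N \<mu> \<kappa>)" for \<beta> \<kappa>
  have Q0: "Q \<beta> \<kappa> = 0" for \<beta> \<kappa>
  proof -
    let ?M = "fund A L c x v"
    have inv: "invertible ?M" by (rule lorentzian_signature_invertible[OF fund_signature[OF x]])
    have "matrix_inv ?M *v (\<chi> \<kappa>. Q \<beta> \<kappa>) = 0"
      using chern_zero[OF x, of _ \<beta>] by (simp add: chern_eq vec_eq_iff matrix_vector_mult_def Q_def N_def)
    then have "?M *v (matrix_inv ?M *v (\<chi> \<kappa>. Q \<beta> \<kappa>)) = 0" by simp
    then have "(\<chi> \<kappa>. Q \<beta> \<kappa>) = 0" by (simp add: matrix_vector_mul_assoc matrix_inv_right[OF inv])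
    then show ?thesis by (simp add: vec_eq_iff)
  qed
  have s: "dx k (g \<kappa> \<beta>) x v = dx k (g \<beta> \<kappa>) x v" by (rule dx_g_commute[OF x])
  have t: "dv \<mu> (g \<kappa> \<beta>) x v = dv \<mu> (g \<beta> \<kappa>) x v" for \<mu>
    by (rule dv_g_swap[OF x])
  have "Q \<beta> \<kappa> + Q \<kappa> \<beta> = 2 * (dx k (g \<beta> \<kappa>) x v - (\<Sum>\<mu>\<in>UNIV. dv \<mu> (g \<beta> \<kappa>) x v * N \<mu> k))"
    unfolding Q_def s t by (simp add: sum.distrib sum_subtractf)
  then show ?thesis using Q0 by (simp add: N_def)
qed

text \<open>2 L(v) is g_v(v, v), so \<open>horizontal_g\<close> expresses its derivative by fibre
  derivatives of g contracted with v, multiplied by the nonlinear connection at v. These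
  contractions vanish by \<open>euler_g\<close>, whatever the connection is.\<close>

lemma dx_l_zero:
  assumes x: "x \<in> cimg c" "v \<noteq> 0"
  shows "dx k (l c) x v = 0"
proof -
  have eq: "(\<Sum>\<beta>\<in>UNIV. \<Sum>\<kappa>\<in>UNIV. v $ \<beta> * v $ \<kappa> * g \<beta> \<kappa> y v) = 2 * l c y v" if y: "y \<in> cimg c" for y
  proof -
    interpret minkowski_norm "l c y" by (rule minkowski[OF c y])
    have "v \<bullet> (G v *v v) = 2 * l c y v" using H_eq_G[OF x(2), of v v] H_euler[OF x(2)] D_euler[OF x(2)] by simp
    moreover have "v \<bullet> (G v *v v) = (\<Sum>\<beta>\<in>UNIV. \<Sum>\<kappa>\<in>UNIV. v $ \<beta> * v $ \<kappa> * g \<beta> \<kappa> y v)"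
      unfolding fund_G[OF y, symmetric] inner_vec_def matrix_vector_mult_def
      by (simp add: fund_g sum_distrib_left ac_simps)
    ultimately show ?thesis by simp
  qed
  have d: "((\<lambda>y. \<Sum>\<beta>\<in>UNIV. \<Sum>\<kappa>\<in>UNIV. v $ \<beta> * v $ \<kappa> * g \<beta> \<kappa> y v) has_derivative
      (\<lambda>h. \<Sum>\<beta>\<in>UNIV. \<Sum>\<kappa>\<in>UNIV. v $ \<beta> * v $ \<kappa> * frechet_derivative (\<lambda>y. g \<beta> \<kappa> y v) (at x) h)) (at x)"
    by (intro has_derivative_sum has_derivative_mult_right frechet_has_derivative slit_partial(4)[OF smooth_g x])
  have d1: "((\<lambda>y. 2 * l c y v) has_derivative
      (\<lambda>h. \<Sum>\<beta>\<in>UNIV. \<Sum>\<kappa>\<in>UNIV. v $ \<beta> * v $ \<kappa> * frechet_derivative (\<lambda>y. g \<beta> \<kappa> y v) (at x) h)) (at x)"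
    by (rule has_derivative_transform_within_open[OF d open_U x(1)]) (rule eq)
  have d2: "((\<lambda>y. 2 * l c y v) has_derivative (\<lambda>h. 2 * frechet_derivative (\<lambda>y. l c y v) (at x) h)) (at x)"
    by (intro has_derivative_mult_right frechet_has_derivative slit_partial(4)[OF smooth_l x])
  have "2 * frechet_derivative (\<lambda>y. l c y v) (at x) (axis k 1) =
     (\<Sum>\<beta>\<in>UNIV. \<Sum>\<kappa>\<in>UNIV. v $ \<beta> * v $ \<kappa> * frechet_derivative (\<lambda>y. g \<beta> \<kappa> y v) (at x) (axis k 1))"
    by (rule fun_cong[OF has_derivative_unique[OF d2 d1]])
  then have "2 * dx k (l c) x v = (\<Sum>\<beta>\<in>UNIV. \<Sum>\<kappa>\<in>UNIV. v $ \<beta> * v $ \<kappa> * dx k (g \<beta> \<kappa>) x v)"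
    by (simp add: dx_def pd_def)
  also have "\<dots> = (\<Sum>\<beta>\<in>UNIV. \<Sum>\<kappa>\<in>UNIV. \<Sum>\<mu>\<in>UNIV. v $ \<beta> * nonlinear_conn A L c \<mu> k x v * (v $ \<kappa> * dv \<mu> (g \<beta> \<kappa>) x v))"
    unfolding horizontal_g[OF x] sum_distrib_left by (intro sum.cong refl) (simp only: ac_simps)
  also have "\<dots> = (\<Sum>\<beta>\<in>UNIV. \<Sum>\<mu>\<in>UNIV. \<Sum>\<kappa>\<in>UNIV. v $ \<beta> * nonlinear_conn A L c \<mu> k x v * (v $ \<kappa> * dv \<mu> (g \<beta> \<kappa>) x v))"
    by (intro sum.cong refl sum.swap)
  also have "\<dots> = 0" by (simp add: sum_distrib_left[symmetric] euler_g[OF x])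
  finally show ?thesis by simp
qed

lemma translation_invariant:
  assumes x: "x \<in> cimg c"
  shows "l c (x + s *\<^sub>R axis k 1) v = l c x v"
proof (cases "v = 0")
  case True
  then show ?thesis using minkowski_norm.f_zero[OF minkowski[OF c]] line_dom[OF x] x by simp
next
  case False
  have "((\<lambda>s. l c (x + s *\<^sub>R axis k 1) v) has_real_derivative 0) (at s)" for s
  proof -
    have y: "x + s *\<^sub>R axis k 1 \<in> cimg c" by (rule line_dom[OF x])
    have "((\<lambda>s. l c (x + s *\<^sub>R axis k 1) v) has_real_derivative frechet_derivative (\<lambda>y. l c y v) (at (x + s *\<^sub>R axis k 1)) (axis k 1)) (at s)"
      using minkowski_norm.curve_derivative[OF minkowski[OF c x] frechet_has_derivative[OF slit_partial(4)[OF smooth_l y False]]] by simp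
    then show ?thesis using dx_l_zero[OF y False] by (simp add: dx_def pd_def)
  qed
  then have "(\<lambda>s. l c (x + s *\<^sub>R axis k 1) v) s = (\<lambda>s. l c (x + s *\<^sub>R axis k 1) v) 0"
    by (intro DERIV_isconst_all) simp
  then show ?thesis by simp
qed

end

end

section \<open>Product manifolds\<close>

text \<open>Stated for families of charts instead of maximal atlases, and with a covering condition
  on the middle family alone, so that it applies to single charts and to the family of product
  charts.\<close>

lemma smooth_map_compose:
  assumes ch: "\<And>c. c \<in> A \<Longrightarrow> is_chart c" "\<And>d. d \<in> B \<Longrightarrow> is_chart d" "\<And>e. e \<in> C \<Longrightarrow> is_chart e"
    and cov: "(\<Union>d\<in>B. cdom d) = UNIV"
    and f: "smooth_map A B f" and g: "smooth_map B C g"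
  shows "smooth_map A C (\<lambda>p. g (f p))"
  unfolding smooth_map_def
proof (intro conjI ballI)
  have cf: "continuous_on UNIV f" "continuous_on UNIV g" using f g by (auto simp: smooth_map_def)
  then show cgf: "continuous_on UNIV (\<lambda>p. g (f p))" by (intro continuous_on_compose2[OF cf(2) cf(1)]) auto
  fix c e assume c: "c \<in> A" and e: "e \<in> C"
  define S where "S = cmap c ` (cdom c \<inter> (\<lambda>p. g (f p)) -` cdom e)"
  show "smooth_on S (cmap e \<circ> (\<lambda>p. g (f p)) \<circ> cinv c)"
  proof (rule smooth_on_local)
    fix x assume "x \<in> S"
    then obtain p where p: "p \<in> cdom c" "g (f p) \<in> cdom e" "x = cmap c p" by (auto simp: S_def)
    obtain d where d: "d \<in> B" "f p \<in> cdom d" using cov by blast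
    have oc: "is_chart c" "is_chart d" "open (cdom d)" "open (cdom e)"
      using ch c d(1) e chart_open(1) by blast+
    define U where "U = cmap c ` (cdom c \<inter> (f -` cdom d \<inter> (\<lambda>p. g (f p)) -` cdom e))"
    have oU: "open U" unfolding U_def by (intro chart_image_open open_Int open_vimage oc cf cgf)
    have US: "U \<inter> S = U" by (auto simp: U_def S_def)
    define V where "V = cmap d ` (cdom d \<inter> g -` cdom e)"
    have oV: "open V" unfolding V_def by (intro chart_image_open open_vimage oc cf)
    have sf: "smooth_on U (cmap d \<circ> f \<circ> cinv c)"
      by (rule smooth_on_subset[of _ "cmap c ` (cdom c \<inter> f -` cdom d)"]) (use f c d in \<open>auto simp: U_def smooth_map_def\<close>)
    have sg: "smooth_on V (cmap e \<circ> g \<circ> cinv d)" using g d e by (auto simp: V_def smooth_map_def)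
    have "smooth_on U (\<lambda>x. (cmap e \<circ> g \<circ> cinv d) ((cmap d \<circ> f \<circ> cinv c) x))"
      by (rule smooth_on_compose[OF oU oV _ sf sg]) (auto simp: U_def V_def chart_cinv[OF oc(1)])
    then have "smooth_on U (cmap e \<circ> (\<lambda>p. g (f p)) \<circ> cinv c)"
      by (rule smooth_on_cong[OF oU, rotated]) (auto simp: U_def chart_cinv[OF oc(1)] chart_cinv[OF oc(2)])
    then show "\<exists>U. open U \<and> x \<in> U \<and> smooth_on (U \<inter> S) (cmap e \<circ> (\<lambda>p. g (f p)) \<circ> cinv c)"
      using oU US p d by (intro exI[of _ U]) (auto simp: U_def)
  qed
qed

lemma smooth_map_id_iff: "smooth_map A B id \<longleftrightarrow> (\<forall>c\<in>A. \<forall>d\<in>B. smooth_on (cmap c ` (cdom c \<inter> cdom d)) (cmap d \<circ> cinv c))"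
  by (simp add: smooth_map_def continuous_on_id)

lemma compatible_iff: "compatible c d \<longleftrightarrow> smooth_map {c} {d} id \<and> smooth_map {d} {c} id"
  by (simp add: smooth_map_id_iff compatible_def Int_commute)

text \<open>Compatibility is transitive only through a family that covers the overlap; it is read
  here as smoothness of the identity and composed.\<close>

lemma compatible_trans:
  assumes "is_chart c" "is_chart d" "\<And>p. p \<in> P \<Longrightarrow> is_chart p" "(\<Union>p\<in>P. cdom p) = UNIV"
    and "\<And>p. p \<in> P \<Longrightarrow> compatible c p" "\<And>p. p \<in> P \<Longrightarrow> compatible d p"
  shows "compatible c d"
proof -
  have 1: "smooth_map {c} P id" "smooth_map P {c} id" "smooth_map {d} P id" "smooth_map P {d} id"
    using assms(5,6) unfolding smooth_map_id_iff compatible_def by (simp_all add: Int_commute)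
  have "smooth_map {c} {d} (\<lambda>p. id (id p))"
    by (rule smooth_map_compose[OF _ assms(3) _ assms(4) 1(1) 1(4)]) (use assms(1,2) in simp_all)
  moreover have "smooth_map {d} {c} (\<lambda>p. id (id p))"
    by (rule smooth_map_compose[OF _ assms(3) _ assms(4) 1(3) 1(2)]) (use assms(1,2) in simp_all)
  ultimately show ?thesis by (simp add: compatible_iff id_def)
qed

section \<open>Charts and translations of the product with the line\<close>

definition product_chart :: "('s, 'f::euclidean_space) chart \<Rightarrow> (real \<times> 's, real \<times> 'f) chart" where
  "product_chart b = (UNIV \<times> cdom b, map_prod id (cmap b))"

lemma product_chart:
  assumes b: "is_chart (b :: ('s::topological_space, 'f::euclidean_space) chart)"
  shows "is_chart (product_chart b)" and "cimg (product_chart b) = UNIV \<times> cimg b"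
    and "y \<in> cimg b \<Longrightarrow> cinv (product_chart b) (t, y) = (t, cinv b y)"
proof -
  show im: "cimg (product_chart b) = UNIV \<times> cimg b" by (force simp: product_chart_def)
  have inj: "inj_on (map_prod id (cmap b)) (UNIV \<times> cdom b)"
  proof (rule inj_onI)
    fix z z' assume *: "z \<in> UNIV \<times> cdom b" "z' \<in> UNIV \<times> cdom b" "map_prod id (cmap b) z = map_prod id (cmap b) z'"
    then have "fst z = fst z'" "cmap b (snd z) = cmap b (snd z')" "snd z \<in> cdom b" "snd z' \<in> cdom b"
      by (auto simp: prod_eq_iff)
    then show "z = z'" using chart_cinv(1)[OF b] by (metis prod_eqI)
  qed
  show inv: "cinv (product_chart b) (t, y) = (t, cinv b y)" if "y \<in> cimg b" for t y
    unfolding product_chart_def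
    by (simp, rule inv_into_f_eq[OF inj]) (use that chart_cinv[OF b] in auto)
  have c1: "continuous_on (UNIV \<times> cdom b) (map_prod id (cmap b))"
    unfolding map_prod_def case_prod_unfold
    by (intro continuous_on_Pair continuous_on_fst continuous_on_id continuous_on_compose2[OF chart_continuous(1)[OF b] continuous_on_snd[OF continuous_on_id]])
      (auto simp: continuous_on_fst continuous_on_id)
  have c2: "continuous_on (UNIV \<times> cimg b) (cinv (product_chart b))"
  proof -
    have "continuous_on (UNIV \<times> cimg b) (\<lambda>z. (fst z, cinv b (snd z)))"
      by (intro continuous_on_Pair continuous_on_fst continuous_on_id continuous_on_compose2[OF chart_continuous(2)[OF b] continuous_on_snd[OF continuous_on_id]])
        auto
    then show ?thesis by (rule continuous_on_eq) (auto simp: inv)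
  qed
  show "is_chart (product_chart b)"
    unfolding is_chart_def im homeomorphism_def
  proof (intro conjI)
    show "open (cdom (product_chart b))" "open (UNIV \<times> cimg b)"
      using chart_open[OF b] by (auto simp: product_chart_def intro: open_Times)
    show "continuous_on (cdom (product_chart b)) (cmap (product_chart b))" using c1 by (simp add: product_chart_def)
    show "\<forall>z\<in>cdom (product_chart b). cinv (product_chart b) (cmap (product_chart b) z) = z"
      using inv chart_cinv(1)[OF b] by (auto simp: product_chart_def)
    show "\<forall>z\<in>UNIV \<times> cimg b. cmap (product_chart b) (cinv (product_chart b) z) = z"
      using inv chart_cinv(2)[OF b] by (auto simp: product_chart_def)
    show "cinv (product_chart b) ` (UNIV \<times> cimg b) = cdom (product_chart b)"
    proof (intro equalityI subsetI)
      fix z assume z: "z \<in> cdom (product_chart b)"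
      then have "z = cinv (product_chart b) (fst z, cmap b (snd z))"
        using inv chart_cinv(1)[OF b] by (auto simp: product_chart_def)
      then show "z \<in> cinv (product_chart b) ` (UNIV \<times> cimg b)" using z by (auto simp: product_chart_def)
    qed (use inv chart_cinv(3)[OF b] in \<open>auto simp: product_chart_def\<close>)
  qed (use im c2 in auto)
qed

lemma line_product_alt: "line_product B = {c. is_chart c \<and> (\<forall>b\<in>B. compatible c (product_chart b))}"
  by (simp add: line_product_def product_chart_def)

definition shift :: "real \<Rightarrow> real \<times> 's \<Rightarrow> real \<times> 's" where "shift t = (\<lambda>(s, x). (s + t, x))"

locale line_mfd = S: smooth_mfd S for S :: "('s::{t2_space,second_countable_topology}, 'f::euclidean_space) chart set"
begin

abbreviation P where "P \<equiv> line_product S"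

lemma product_is_chart: "b \<in> S \<Longrightarrow> is_chart (product_chart b)"
  by (rule product_chart(1)[OF S.chart])

text \<open>The case t = 0 is the compatibility of two product charts.\<close>

lemma product_shift_smooth: 
  assumes b: "b \<in> S" "b' \<in> S"
  shows "smooth_on (cmap (product_chart b) ` (cdom (product_chart b) \<inter> shift t -` cdom (product_chart b')))
    (cmap (product_chart b') \<circ> shift t \<circ> cinv (product_chart b))"
proof -
  let ?U = "cmap b ` (cdom b \<inter> cdom b')"
  have o: "open ?U" by (rule S.overlap_open[OF b])
  have im: "cmap (product_chart b) ` (cdom (product_chart b) \<inter> shift t -` cdom (product_chart b')) = UNIV \<times> ?U"
    by (force simp: product_chart_def shift_def)
  have oU: "open ((UNIV :: real set) \<times> ?U)" by (intro open_Times open_UNIV o)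
  have "smooth_on (UNIV \<times> ?U) (\<lambda>z. (fst z + t, (cmap b' \<circ> cinv b) (snd z)))"
    by (intro smooth_on_Pair[OF oU] smooth_on_add[OF oU] smooth_on_linear[OF oU] smooth_on_const[OF oU]
      smooth_on_compose[OF oU o _ smooth_on_linear[OF oU] S.transition_smooth[OF b]] bounded_linear_fst bounded_linear_snd) auto
  then show ?thesis unfolding im
  proof (rule smooth_on_cong[OF oU, rotated])
    fix z assume "z \<in> (UNIV :: real set) \<times> ?U"
    then obtain a x where z: "z = (a, cmap b x)" "x \<in> cdom b" "x \<in> cdom b'" by auto
    have inv: "cinv (product_chart b) z = (a, x)"
      using product_chart(3)[OF S.chart[OF b(1)], of "cmap b x" a] z b by (simp add: S.chart_simps)
    show "(fst z + t, (cmap b' \<circ> cinv b) (snd z)) = (cmap (product_chart b') \<circ> shift t \<circ> cinv (product_chart b)) z"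
      unfolding o_apply inv using z b by (simp add: S.chart_simps shift_def product_chart_def)
  qed
qed

lemma product_compatible: "b \<in> S \<Longrightarrow> b' \<in> S \<Longrightarrow> compatible (product_chart b) (product_chart b')"
  using product_shift_smooth[of b b' 0] product_shift_smooth[of b' b 0]
  by (simp add: compatible_def shift_def vimage_def Int_commute comp_def)

lemma product_in_P: "b \<in> S \<Longrightarrow> product_chart b \<in> P"
  by (simp add: line_product_alt product_is_chart product_compatible)

lemma product_cover: "(\<Union>p\<in>product_chart ` S. cdom p) = UNIV"
proof -
  have "z \<in> (\<Union>p\<in>product_chart ` S. cdom p)" for z
  proof -
    obtain b where "b \<in> S" "snd z \<in> cdom b" using S.chart_exists by blast
    then show ?thesis by (intro UN_I[of "product_chart b"]) (auto simp: product_chart_def mem_Times_iff)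
  qed
  then show ?thesis by blast
qed

sublocale smooth_mfd P
proof
  show "smooth_manifold P"
    unfolding smooth_manifold_def
  proof (intro conjI ballI allI impI)
    show "(\<Union>c\<in>P. cdom c) = UNIV" using product_cover product_in_P by blast
    fix c d assume c: "c \<in> P" and d: "d \<in> P"
    have P: "is_chart c" "p \<in> product_chart ` S \<Longrightarrow> compatible c p" if "c \<in> P" for c p
      using that unfolding line_product_alt by blast+
    show "compatible c d"
      by (rule compatible_trans[OF P(1)[OF c] P(1)[OF d] _ product_cover P(2)[OF c] P(2)[OF d]]) (use product_is_chart in blast)
  next
    fix c assume c: "is_chart c \<and> (\<forall>d\<in>P. compatible c d)"
    then have "compatible c (product_chart b)" if "b \<in> S" for b using product_in_P[OF that] by (rule bspec[OF conjunct2])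
    then show "c \<in> P" using c unfolding line_product_alt by simp
  qed (simp add: line_product_alt)
qed

text \<open>The product charts are only a small part of the maximal atlas. Composing with the
  identity on either side extends smoothness from them to all charts.\<close>

lemma smooth_map_shift: "smooth_map P P (shift t)"
proof -
  let ?Q = "product_chart ` S"
  have Q: "q \<in> ?Q \<Longrightarrow> is_chart q" for q using product_is_chart by blast
  have cov: "(\<Union>d\<in>P. cdom d) = UNIV" using product_cover product_in_P by blast
  have 1: "smooth_map P ?Q id" "smooth_map ?Q P id"
    using product_in_P transition_smooth by (auto simp: smooth_map_id_iff)
  have "continuous_on UNIV (\<lambda>z :: real \<times> 's. (fst z + t, snd z))"
    by (intro continuous_on_Pair continuous_on_add continuous_on_fst continuous_on_snd continuous_on_id continuous_on_const)
  then have cont: "continuous_on UNIV (shift t :: real \<times> 's \<Rightarrow> _)" by (simp add: shift_def case_prod_unfold)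
  have 2: "smooth_map ?Q ?Q (shift t)"
    unfolding smooth_map_def
  proof (intro conjI ballI cont)
    fix c d assume "c \<in> ?Q" "d \<in> ?Q"
    then obtain b b' where "b \<in> S" "b' \<in> S" "c = product_chart b" "d = product_chart b'" by blast
    then show "smooth_on (cmap c ` (cdom c \<inter> shift t -` cdom d)) (cmap d \<circ> shift t \<circ> cinv c)"
      using product_shift_smooth by blast
  qed
  have 3: "smooth_map P ?Q (\<lambda>p. shift t (id p))"
    by (rule smooth_map_compose[OF chart Q Q product_cover 1(1) 2])
  have "smooth_map P P (\<lambda>p. id (shift t (id p)))"
    by (rule smooth_map_compose[OF chart Q chart product_cover 3 1(2)])
  then show ?thesis by simp
qed

end

text \<open>\<open>dmap\<close> is computed in the arbitrarily chosen chart \<open>chart_at\<close>.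
  The chain rule makes any pair of charts available, in particular those in which the map is
  simple.\<close>

lemma dmap_tvec_of:
  assumes A: "smooth_mfd A" and B: "smooth_mfd B" and c: "c \<in> A" "p \<in> cdom c" and d: "d \<in> B" "f p \<in> cdom d"
    and f: "continuous_on UNIV f" and T: "((cmap d \<circ> f \<circ> cinv c) has_derivative T) (at (cmap c p))"
  shows "dmap A B f (tvec_of A c p u) = tvec_of B d (f p) (T u)"
proof -
  interpret A: smooth_mfd A by (rule A)
  interpret B: smooth_mfd B by (rule B)
  define c0 where "c0 = chart_at A p"
  have c0: "c0 \<in> A" "p \<in> cdom c0" using A.chart_at by (auto simp: c0_def)
  have key: "frechet_derivative (cmap e \<circ> f \<circ> cinv c0) (at (cmap c0 p)) (A.trans c c0 p u) = B.trans d e (f p) (T u)"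
    if e: "e \<in> B" "f p \<in> cdom e" for e
  proof -
    define U where "U = cmap c0 ` (cdom c0 \<inter> (cdom c \<inter> f -` cdom d))"
    have oU: "open U" unfolding U_def
      using f c d chart_open(1)[OF A.chart] chart_open(1)[OF B.chart] 
      by (intro chart_image_open A.chart c0 open_Int open_vimage) auto
    have 1: "((\<lambda>x. (cmap d \<circ> f \<circ> cinv c) ((cmap c \<circ> cinv c0) x)) has_derivative (\<lambda>w. T (A.trans c0 c p w))) (at (cmap c0 p))"
      by (rule has_derivative_compose[OF A.trans_derivative[OF c0(1) c(1) c0(2) c(2)]]) (use T c0 in \<open>simp add: A.chart_simps o_def\<close>)
    have 2: "((\<lambda>x. (cmap e \<circ> cinv d) ((cmap d \<circ> f \<circ> cinv c) ((cmap c \<circ> cinv c0) x))) has_derivative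
       (\<lambda>w. B.trans d e (f p) (T (A.trans c0 c p w)))) (at (cmap c0 p))"
      by (rule has_derivative_compose[OF 1]) (use B.trans_derivative[OF d(1) e(1) d(2) e(2)] c c0 in \<open>simp add: A.chart_simps o_def\<close>)
    have "((cmap e \<circ> f \<circ> cinv c0) has_derivative (\<lambda>w. B.trans d e (f p) (T (A.trans c0 c p w)))) (at (cmap c0 p))"
      by (rule has_derivative_transform_within_open[OF 2 oU]) (use c c0 d in \<open>auto simp: U_def A.chart_simps B.chart_simps\<close>)
    from frechet_eqI[OF this] show ?thesis
      by (simp add: A.trans_chain[OF c(1) c0(1) c(1) c(2) c0(2) c(2)] A.trans_same[OF c])
  qed
  show ?thesis
  proof (rule prod_eqI)
    show "fst (dmap A B f (tvec_of A c p u)) = fst (tvec_of B d (f p) (T u))" by (simp add: dmap_def Let_def tvec_of_def)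
    show "snd (dmap A B f (tvec_of A c p u)) = snd (tvec_of B d (f p) (T u))"
    proof
      fix e
      show "snd (dmap A B f (tvec_of A c p u)) e = snd (tvec_of B d (f p) (T u)) e"
      proof (cases "e \<in> B \<and> f p \<in> cdom e")
        case True
        then show ?thesis using key[of e] A.snd_tvec_of[OF c0, of c u] B.snd_tvec_of[of e "f p" d "T u"]
          by (simp add: dmap_def Let_def c0_def[symmetric])
      next
        case False
        then show ?thesis by (auto simp: dmap_def Let_def tvec_of_def)
      qed
    qed
  qed
qed

lemma (in smooth_mfd) dfun_tvec_of:
  assumes c: "c \<in> A" "p \<in> cdom c" and T: "((f \<circ> cinv c) has_derivative T) (at (cmap c p))"
  shows "dfun A f (tvec_of A c p u) = T u"
proof -
  define c0 where "c0 = chart_at A p"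
  have c0: "c0 \<in> A" "p \<in> cdom c0" using chart_at by (auto simp: c0_def)
  have 1: "((\<lambda>x. (f \<circ> cinv c) ((cmap c \<circ> cinv c0) x)) has_derivative (\<lambda>w. T (trans c0 c p w))) (at (cmap c0 p))"
    by (rule has_derivative_compose[OF trans_derivative[OF c0(1) c(1) c0(2) c(2)]]) (use T c0 in \<open>simp add: chart_simps o_def\<close>)
  have "((f \<circ> cinv c0) has_derivative (\<lambda>w. T (trans c0 c p w))) (at (cmap c0 p))"
    by (rule has_derivative_transform_within_open[OF 1 overlap_open[OF c0(1) c(1)]]) (use c c0 in \<open>auto simp: chart_simps\<close>)
  from frechet_eqI[OF this] show ?thesis
    by (simp add: dfun_def Let_def c0_def[symmetric] snd_tvec_of[OF c0] trans_chain[OF c(1) c0(1) c(1) c(2) c0(2) c(2)] trans_same[OF c])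
qed

text \<open>Product charts have values in the line times the coordinate space of \<Sigma>, charts of
  M in another space of the same dimension; J is the linear identification and K its inverse. The
  pushed chart is compatible with all charts of A since \<Theta> is a diffeomorphism, so it belongs
  to A by maximality.\<close>

lemma pushed_chart:
  assumes A: "smooth_mfd (A :: ('m::{t2_space,second_countable_topology}, 'e::euclidean_space) chart set)"
    and P: "smooth_mfd (P :: ('k::{t2_space,second_countable_topology}, 'f::euclidean_space) chart set)"
    and \<Theta>: "diffeomorphism P A \<Theta>" and q: "q \<in> P"
    and J: "bounded_linear J" "bounded_linear K" "\<And>z. K (J z) = z" "\<And>y. J (K y) = y"
  defines "d \<equiv> (\<Theta> ` cdom q, \<lambda>p. J (cmap q (inv \<Theta> p)))"
  shows "d \<in> A" and "cimg d = J ` cimg q" and "y \<in> cimg d \<Longrightarrow> cinv d y = \<Theta> (cinv q (K y))"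
proof -
  interpret A: smooth_mfd A by (rule A)
  interpret P: smooth_mfd P by (rule P)
  have bij: "bij \<Theta>" and s: "smooth_map P A \<Theta>" "smooth_map A P (inv \<Theta>)" using \<Theta> by (auto simp: diffeomorphism_def)
  have inv: "inv \<Theta> (\<Theta> z) = z" "\<Theta> (inv \<Theta> p) = p" for z p using bij by (auto simp: bij_is_inj bij_is_surj surj_f_inv_f)
  have cont: "continuous_on UNIV \<Theta>" "continuous_on UNIV (inv \<Theta>)" using s by (auto simp: smooth_map_def)
  have dom: "cdom d = inv \<Theta> -` cdom q"
  proof (intro set_eqI iffI)
    fix p assume "p \<in> inv \<Theta> -` cdom q"
    then have "\<Theta> (inv \<Theta> p) \<in> \<Theta> ` cdom q" by blast
    then show "p \<in> cdom d" by (simp add: d_def inv)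
  qed (auto simp: d_def inv)
  have od: "open (cdom d)" unfolding dom by (intro open_vimage chart_open(1)[OF P.chart[OF q]] cont)
  show im: "cimg d = J ` cimg q" by (simp add: d_def image_image inv)
  have imK: "J ` cimg q = K -` cimg q"
  proof (intro set_eqI iffI)
    fix y assume "y \<in> K -` cimg q"
    then have "J (K y) \<in> J ` cimg q" by blast
    then show "y \<in> J ` cimg q" by (simp only: J(4))
  next
    fix y assume "y \<in> J ` cimg q"
    then obtain z where "z \<in> cimg q" "y = J z" by (rule imageE)
    then show "y \<in> K -` cimg q" by (simp only: vimage_eq J(3))
  qed
  have Kc: "continuous_on UNIV K" using J(2) by (simp add: linear_continuous_on)
  have Jc: "continuous_on UNIV J" using J(1) by (simp add: linear_continuous_on)
  have oi: "open (cimg d)" unfolding im imK by (intro open_vimage chart_open(2)[OF P.chart[OF q]] Kc)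
  have inj: "inj_on (cmap d) (cdom d)"
  proof (rule inj_onI)
    fix p p' assume *: "p \<in> cdom d" "p' \<in> cdom d" "cmap d p = cmap d p'"
    then have "cmap q (inv \<Theta> p) = cmap q (inv \<Theta> p')" using J(3) by (metis d_def snd_conv)
    then have "inv \<Theta> p = inv \<Theta> p'" using * unfolding dom by (metis P.chart_simps(1)[OF q] vimageE)
    then show "p = p'" using inv by metis
  qed
  show ci: "cinv d y = \<Theta> (cinv q (K y))" if y: "y \<in> cimg d" for y
  proof (rule inv_into_f_eq[OF inj])
    have Ky: "K y \<in> cimg q" using y unfolding im imK by simp
    show "\<Theta> (cinv q (K y)) \<in> cdom d" unfolding dom using P.chart_simps(3)[OF q Ky] inv by simp
    show "cmap d (\<Theta> (cinv q (K y))) = y" using P.chart_simps(2)[OF q Ky] inv J(4) by (simp add: d_def)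
  qed
  have c1: "continuous_on (cdom d) (cmap d)"
  proof -
    have "continuous_on (cdom d) (\<lambda>p. cmap q (inv \<Theta> p))"
      by (rule continuous_on_compose2[OF chart_continuous(1)[OF P.chart[OF q]] continuous_on_subset[OF cont(2)]]) (auto simp: dom)
    then have "continuous_on (cdom d) (\<lambda>p. J (cmap q (inv \<Theta> p)))"
      by (rule continuous_on_compose2[OF Jc]) auto
    then show ?thesis by (simp add: d_def)
  qed
  have c2: "continuous_on (cimg d) (cinv d)"
  proof -
    have "continuous_on (cimg d) (\<lambda>y. cinv q (K y))"
      by (rule continuous_on_compose2[OF chart_continuous(2)[OF P.chart[OF q]] continuous_on_subset[OF Kc]]) (auto simp: im imK)
    then have "continuous_on (cimg d) (\<lambda>y. \<Theta> (cinv q (K y)))"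
      by (rule continuous_on_compose2[OF cont(1)]) auto
    then show ?thesis by (rule continuous_on_eq) (simp add: ci)
  qed
  have ch: "is_chart d"
    unfolding is_chart_def homeomorphism_def
  proof (intro conjI od oi c1 c2 ballI)
    show "cinv d ` cimg d = cdom d" by (simp add: image_image inv_into_f_f[OF inj])
  qed (use inj in \<open>auto simp: inv_into_f_f f_inv_into_f\<close>)
  have comp: "compatible d e" if e: "e \<in> A" for e
    unfolding compatible_def
  proof
    have oS: "open (cmap d ` (cdom d \<inter> cdom e))" by (intro chart_image_open ch chart_open(1) A.chart e)
    let ?V = "cmap q ` (cdom q \<inter> \<Theta> -` cdom e)"
    have oV: "open ?V" by (intro chart_image_open P.chart q open_vimage chart_open(1) A.chart e cont)
    have "smooth_on (cmap d ` (cdom d \<inter> cdom e)) (\<lambda>y. (cmap e \<circ> \<Theta> \<circ> cinv q) (K y))"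
    proof (rule smooth_on_compose[OF oS oV _ smooth_on_linear[OF oS J(2)]])
      show "K ` cmap d ` (cdom d \<inter> cdom e) \<subseteq> ?V"
      proof clarify
        fix p assume "p \<in> cdom d" "p \<in> cdom e"
        then have "inv \<Theta> p \<in> cdom q \<inter> \<Theta> -` cdom e" using inv by (simp add: dom)
        then show "K (cmap d p) \<in> ?V" using J(3) by (simp add: d_def)
      qed
      show "smooth_on ?V (cmap e \<circ> \<Theta> \<circ> cinv q)" using s q e by (auto simp: smooth_map_def)
    qed
    then show "smooth_on (cmap d ` (cdom d \<inter> cdom e)) (cmap e \<circ> cinv d)"
      by (rule smooth_on_cong[OF oS, rotated]) (use ci in auto)
  next
    have oS: "open (cmap e ` (cdom d \<inter> cdom e))" 
      using chart_image_open[OF A.chart[OF e] od] by (simp add: Int_commute)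
    have "smooth_on (cmap e ` (cdom d \<inter> cdom e)) (\<lambda>y. J ((cmap q \<circ> inv \<Theta> \<circ> cinv e) y))"
    proof (rule smooth_on_compose[OF oS open_UNIV _ _ smooth_on_linear[OF open_UNIV J(1)]])
      show "smooth_on (cmap e ` (cdom d \<inter> cdom e)) (cmap q \<circ> inv \<Theta> \<circ> cinv e)"
        using s(2) q e unfolding dom by (auto simp: smooth_map_def Int_commute)
    qed auto
    then show "smooth_on (cmap e ` (cdom d \<inter> cdom e)) (cmap d \<circ> cinv e)"
      by (simp add: d_def o_def)
  qed
  have max: "\<forall>c. is_chart c \<and> (\<forall>d\<in>A. compatible c d) \<longrightarrow> c \<in> A" using A.manifold unfolding smooth_manifold_def by blast
  show "d \<in> A" by (rule mp[OF spec[OF max]]) (intro conjI ballI ch comp)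
qed

text \<open>The index types are related only by their cardinalities, so a bijection between the
  indices other than k and the smaller type has to be chosen; k becomes the index of time.\<close>

lemma split_coordinates:
  assumes "CARD('i::finite) = CARD('j::finite) + 1"
  obtains J :: "real \<times> (real^'j) \<Rightarrow> real^'i" and K k where
    "bounded_linear J" "bounded_linear K" "\<And>z. K (J z) = z" "\<And>y. J (K y) = y"
    "J (1, 0) = axis k 1" "\<And>y. fst (K y) = y $ k"
proof -
  fix k :: 'i
  have "card (UNIV - {k}) = card (UNIV :: 'j set)" using assms by simp
  then obtain \<sigma> where \<sigma>: "bij_betw \<sigma> (UNIV - {k}) (UNIV :: 'j set)"
    using finite_same_card_bij[of "UNIV - {k}" "UNIV :: 'j set"] by auto
  define \<tau> where "\<tau> = inv_into (UNIV - {k}) \<sigma>"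
  have \<tau>: "\<tau> j \<noteq> k" "\<sigma> (\<tau> j) = j" for j
    using bij_betw_inv_into_right[OF \<sigma>, of j] inv_into_into[of j \<sigma> "UNIV - {k}"] \<sigma> by (auto simp: \<tau>_def bij_betw_def)
  have \<sigma>': "\<tau> (\<sigma> i) = i" if "i \<noteq> k" for i using bij_betw_inv_into_left[OF \<sigma>, of i] that by (simp add: \<tau>_def)
  define J :: "real \<times> (real^'j) \<Rightarrow> real^'i" where "J z = (\<chi> i. if i = k then fst z else snd z $ \<sigma> i)" for z
  define K :: "real^'i \<Rightarrow> real \<times> (real^'j)" where "K y = (y $ k, \<chi> j. y $ \<tau> j)" for y
  show thesis
  proof (rule that[of J K k])
    show "bounded_linear J" unfolding J_def linear_conv_bounded_linear[symmetric] by (intro linearI) (auto simp: vec_eq_iff)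
    show "bounded_linear K" unfolding K_def linear_conv_bounded_linear[symmetric] by (intro linearI) (auto simp: vec_eq_iff)
    show "K (J z) = z" for z using \<tau> by (simp add: K_def J_def prod_eq_iff vec_eq_iff)
    show "J (K y) = y" for y using \<sigma>' by (simp add: K_def J_def vec_eq_iff)
    show "J (1, 0) = axis k 1" by (simp add: J_def axis_def vec_eq_iff)
    show "fst (K y) = y $ k" for y by (simp add: K_def)
  qed
qed

section \<open>The splitting\<close>

context spacetime
begin

text \<open>If dh = g_v0(v0, .) with v0 of unit length, the reverse Cauchy-Schwarz inequality shows
  that the supremum in \<open>L_dual\<close> is -1, attained at v0. Its equality case then shows
  that v0 is the only vector meeting the conditions in \<open>legendre\<close>.\<close>

lemma gradient_eq:
  assumes v0: "v0 \<in> timelike_cone A L X p" "finsler_F L v0 = 1"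
    and d: "((h \<circ> cinv (chart_at A p)) has_derivative
       frechet_derivative (l (chart_at A p) (cmap (chart_at A p) p)) (at (snd v0 (chart_at A p)))) (at (cmap (chart_at A p) p))"
  shows "gradient A L X h p = v0"
proof -
  define c where "c = chart_at A p"
  define x0 where "x0 = cmap c p"
  define W where "W = snd v0 c"
  have c: "c \<in> A" "p \<in> cdom c" "x0 \<in> cimg c" using chart_at by (auto simp: c_def x0_def)
  interpret mn: minkowski_norm "l c x0" by (rule minkowski[OF c(1,3)])
  note cone = Om_cone[OF c(1,3)]
  have F: "finsler_F L v = mn.F (snd v c)" if "v \<in> timelike_cone A L X p" for v
    using L_chart[OF _ c(1,2), of v] timelike_cone_subset that unfolding finsler_F_def mn.F_def by (auto simp: x0_def)
  have in_cone: "snd v c \<in> mn.cone (Xc c x0)" if "v \<in> timelike_cone A L X p" for v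
    using timelike_cone_iff[OF c(1,2)] that cone by (simp add: x0_def)
  have df: "dfun A h v = mn.D W (snd v c)" if "v \<in> timelike_cone A L X p" for v
    using frechet_eqI[OF d, folded c_def, folded x0_def W_def] fst_timelike[OF that]
    by (simp add: dfun_def Let_def c_def[symmetric] mn.D_def x0_def[symmetric])
  have W: "W \<in> mn.cone (Xc c x0)" "mn.F W = 1" using in_cone[OF v0(1)] F[OF v0(1)] v0(2) by (auto simp: W_def)
  have fW: "l c x0 W = - 1 / 2" using mn.F_sq[of W] W(2) mn.cone_timelike[OF W(1)] by simp
  have W0: "W \<noteq> 0" using fW by auto
  have DW: "mn.D W W = - 1" using mn.D_euler[OF W0] fW by simp
  have "Sup (dfun A h ` {v \<in> timelike_cone A L X p. finsler_F L v = 1}) = - 1"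
  proof (rule cSup_eq_maximum)
    show "- 1 \<in> dfun A h ` {v \<in> timelike_cone A L X p. finsler_F L v = 1}"
      using v0 df[OF v0(1)] DW by (intro image_eqI[of _ _ v0]) (auto simp: W_def)
    fix x assume "x \<in> dfun A h ` {v \<in> timelike_cone A L X p. finsler_F L v = 1}"
    then obtain v where v: "v \<in> timelike_cone A L X p" "finsler_F L v = 1" "x = dfun A h v" by blast
    show "x \<le> - 1" using mn.D_reverse_CS[OF W(1) in_cone[OF v(1)]] W(2) F[OF v(1)] v df[OF v(1)] by simp
  qed
  then have Ld: "L_dual A L X p (dfun A h) = - 1 / 2" by (simp add: L_dual_def)
  have L0: "L v0 = - 1 / 2"
    using L_chart[OF _ c(1,2), of v0] timelike_cone_subset v0(1) fW by (auto simp: x0_def W_def)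
  show ?thesis
    unfolding gradient_def legendre_def Ld
  proof (rule the_equality)
    show "v0 \<in> timelike_cone A L X p \<and> L v0 = - 1 / 2 \<and> L v0 = dfun A h v0 / 2"
      using v0(1) L0 df[OF v0(1)] DW by (simp add: W_def)
    fix v assume v: "v \<in> timelike_cone A L X p \<and> L v = - 1 / 2 \<and> L v = dfun A h v / 2"
    then have vc: "v \<in> timelike_cone A L X p" by blast
    have "finsler_F L v = 1" using v by (simp add: finsler_F_def)
    then have "mn.F (snd v c) = 1" using F[OF vc] by simp
    moreover have "mn.D W (snd v c) = - 1" using v df[OF vc] by simp
    \<comment> \<open>Any solution has F = 1 and the value -1 under \<open>D W\<close>, that is,
      equality in the reverse Cauchy-Schwarz inequality with W.\<close>
    ultimately have "snd v c = W"
      using mn.D_reverse_CS_eq[OF W(1) in_cone[OF vc]] W(2) by simp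
    then show "v = v0"
      using tvec_of_snd[OF _ c(1,2), of v] tvec_of_snd[OF _ c(1,2), of v0] timelike_cone_subset vc v0(1) by (auto simp: W_def)
  qed
qed

text \<open>\<open>g_at\<close> is computed in \<open>chart_at\<close>. A change of charts is linear
  on the fibre, so second fibre derivatives of L transform as a bilinear form.\<close>

lemma g_at_chart:
  assumes v: "v \<in> tangent_space A p" and u: "u \<in> tangent_space A p" and w: "w \<in> tangent_space A p"
    and d: "d \<in> A" "p \<in> cdom d" and nz: "snd v d \<noteq> 0"
  shows "g_at A L v u w = snd u d \<bullet> (fund A L d (cmap d p) (snd v d) *v snd w d)"
proof -
  define c where "c = chart_at A p"
  have c: "c \<in> A" "p \<in> cdom c" using chart_at by (auto simp: c_def)
  have ci: "cmap c p \<in> cimg c" "cmap d p \<in> cimg d" using c d by auto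
  define T where "T = trans c d p"
  interpret mc: minkowski_norm "l c (cmap c p)" by (rule minkowski[OF c(1) ci(1)])
  interpret md: minkowski_norm "l d (cmap d p)" by (rule minkowski[OF d(1) ci(2)])
  have T: "linear T" using linear_trans c d by (simp add: T_def)
  have Td: "(T has_derivative T) (at y)" for y
    using T by (simp add: bounded_linear_imp_has_derivative linear_conv_bounded_linear)
  have Tnz: "T y \<noteq> 0" if "y \<noteq> 0" for y
  proof
    assume "T y = 0"
    then have "trans d c p (T y) = 0" using linear_trans[of d c p] c d by (simp add: linear_0)
    then show False using trans_chain[OF c(1) d(1) c(1) c(2) d(2) c(2), of y] trans_same[OF c] that by (simp add: T_def)
  qed
  have lT: "l c (cmap c p) y = l d (cmap d p) (T y)" for y
    using tvec_of_trans[OF c(1) d(1) c(2) d(2), of y] c d by (simp add: Lc_def chart_simps T_def)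
  have DT: "mc.D y h = md.D (T y) (T h)" if "y \<noteq> 0" for y h
  proof -
    have "((\<lambda>y. l d (cmap d p) (T y)) has_derivative (\<lambda>h. md.D (T y) (T h))) (at y)"
      by (rule has_derivative_compose[OF Td md.has_derivative_D[OF Tnz[OF that]]])
    then have "(l c (cmap c p) has_derivative (\<lambda>h. md.D (T y) (T h))) (at y)"
      by (simp add: lT[abs_def])
    from has_derivative_unique[OF mc.has_derivative_D[OF that] this] show ?thesis by (rule fun_cong)
  qed
  have HT: "mc.H y a b = md.H (T y) (T a) (T b)" if "y \<noteq> 0" for y a b
  proof -
    have "((\<lambda>y. md.D (T y) (T b)) has_derivative (\<lambda>h. md.H (T y) (T h) (T b))) (at y)"
      by (rule has_derivative_compose[OF Td md.has_derivative_H[OF Tnz[OF that]]])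
    then have "((\<lambda>y. mc.D y b) has_derivative (\<lambda>h. md.H (T y) (T h) (T b))) (at y)"
      by (rule has_derivative_transform_within_open[OF _ open_delete[OF open_UNIV, of 0]]) (use DT that in auto)
    from has_derivative_unique[OF mc.has_derivative_H[OF that] this] show ?thesis by (rule fun_cong)
  qed
  have Tv: "snd v d = T (snd v c)" "snd u d = T (snd u c)" "snd w d = T (snd w c)"
    unfolding T_def using tangentD(3)[OF v c(1) d(1) c(2) d(2)] tangentD(3)[OF u c(1) d(1) c(2) d(2)]
      tangentD(3)[OF w c(1) d(1) c(2) d(2)] by blast+
  have vn: "snd v c \<noteq> 0" using nz linear_0[OF T] Tv(1) by metis
  have fe: "fund A L e (cmap e p) = minkowski_norm.G (l e (cmap e p))" if "e \<in> A" "p \<in> cdom e" for e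
    using minkowski_norm.G_def[OF minkowski[OF that(1)], of "cmap e p"] that by (simp add: fund_def dv_def[abs_def] fun_eq_iff)
  have "g_at A L v u w = snd u c \<bullet> (fund A L c (cmap c p) (snd v c) *v snd w c)"
    using tangentD(1)[OF v] by (simp add: g_at_def Let_def c_def)
  also have "\<dots> = mc.H (snd v c) (snd u c) (snd w c)" by (simp add: fe c mc.H_eq_G[OF vn])
  also have "\<dots> = md.H (snd v d) (snd u d) (snd w d)" by (simp add: HT[OF vn] Tv)
  also have "\<dots> = snd u d \<bullet> (fund A L d (cmap d p) (snd v d) *v snd w d)" by (simp add: fe d md.H_eq_G[OF nz])
  finally show ?thesis .
qed

lemma straight_line_unit_line:
  assumes "straight_line A L X \<zeta>"
  shows "unit_line \<zeta>"
proof -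
  have g: "geodesic A L UNIV \<zeta>" "has_timelike_velocity A L X UNIV \<zeta>" using assms by (auto simp: straight_line_def timelike_geodesic_def)
  have "C1_curve A UNIV \<zeta>"
    unfolding C1_curve_def
  proof (intro conjI ballI impI)
    show "continuous_on UNIV \<zeta>" using g by (simp add: geodesic_def)
    fix c t assume c: "c \<in> A" "\<zeta> t \<in> cdom c"
    have *: "(cmap c \<circ> \<zeta>) differentiable (at t within UNIV) \<and> (coord_velocity c UNIV \<zeta> has_vector_derivative
       (\<chi> \<alpha>. - 2 * spray A L c \<alpha> (cmap c (\<zeta> t)) (coord_velocity c UNIV \<zeta> t))) (at t within UNIV)"
      using g(1) c unfolding geodesic_def by blast
    then show "cmap c \<circ> \<zeta> differentiable at t" by simp
    show "isCont (coord_velocity c UNIV \<zeta>) t" by (rule has_vector_derivative_continuous[OF conjunct2[OF *]])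
  qed
  then show ?thesis using assms g(2) by (simp add: unit_line_def unit_curve_def straight_line_def)
qed

text \<open>The charts \<open>d b\<close> are product charts transported to M. In them the
  translation is the addition of a multiple of e_k and its differential is the identity on
  coordinates, so invariance of L becomes \<open>translation_invariant\<close>.\<close>

lemma splitting_translation:
  fixes S :: "('s::{t2_space,second_countable_topology}, real^'j::finite) chart set"
  assumes card: "CARD('i) = CARD('j) + 1" and bw: "berwald A L" and line: "straight_line A L X \<eta>"
    and split: "splitting A L X \<eta> S h \<Theta>"
  shows "diffeomorphism A A (translation \<Theta> t)"
    and "v \<in> tangent_bundle A \<Longrightarrow> L (dmap A A (translation \<Theta> t) v) = L v"
proof -
  define V where "V = gradient A L X (\<lambda>x. real_of_ereal (busemann_bar A L X \<eta> x))"
  have S: "smooth_manifold S" "riemannian_metric S h"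
    and iso: "metric_isometry (line_product S) (lorentz_product S h) A (\<lambda>u w. g_at A L (V (fst u)) u w) \<Theta>"
    and bi: "\<And>x. bi_asymptotic A L X \<eta> (\<lambda>t. \<Theta> (t, x))"
    using split by (auto simp: splitting_def complete_riemannian_def Let_def V_def)
  interpret S: smooth_mfd S by unfold_locales (rule S(1))
  interpret LP: line_mfd S by unfold_locales
  have mfdP: "smooth_mfd (line_product S)" and mfdS: "smooth_mfd S" and mfdA: "smooth_mfd A" by unfold_locales
  have dif: "diffeomorphism (line_product S) A \<Theta>" using iso by (simp add: metric_isometry_def)
  have bij: "bij \<Theta>" and s: "smooth_map (line_product S) A \<Theta>" "smooth_map A (line_product S) (inv \<Theta>)"
    using dif by (auto simp: diffeomorphism_def)
  have inv: "inv \<Theta> (\<Theta> z) = z" "\<Theta> (inv \<Theta> p) = p" for z p using bij by (auto simp: bij_is_inj bij_is_surj surj_f_inv_f)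
  have cont: "continuous_on UNIV \<Theta>" using s by (simp add: smooth_map_def)
  define \<tau> where "\<tau> t p = \<Theta> (shift t (inv \<Theta> p))" for t p
  have trans: "translation \<Theta> t = \<tau> t" for t by (auto simp: translation_def \<tau>_def shift_def fun_eq_iff)
  have sm: "smooth_map A A (\<tau> t)" for t
  proof -
    have cov: "(\<Union>d\<in>line_product S. cdom d) = UNIV" using LP.product_cover LP.product_in_P by blast
    have "smooth_map A (line_product S) (\<lambda>p. shift t (inv \<Theta> p))"
      by (rule smooth_map_compose[OF chart LP.chart LP.chart cov s(2) LP.smooth_map_shift])
    from smooth_map_compose[OF chart LP.chart chart cov this s(1)] show ?thesis by (simp add: \<tau>_def[abs_def])
  qed
  have comp: "\<tau> a \<circ> \<tau> (- a) = id" for a by (auto simp: \<tau>_def fun_eq_iff inv shift_def case_prod_unfold)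
  show diff: "diffeomorphism A A (translation \<Theta> t)"
  proof -
    have 1: "\<tau> t \<circ> \<tau> (- t) = id" "\<tau> (- t) \<circ> \<tau> t = id" using comp[of t] comp[of "- t"] by auto
    have "inv (\<tau> t) = \<tau> (- t)" by (rule inv_unique_comp[OF 1])
    then show ?thesis unfolding trans diffeomorphism_def using sm o_bij[OF 1(2,1)] by simp
  qed
  obtain J :: "real \<times> (real^'j) \<Rightarrow> real^'i" and K k where
    J: "bounded_linear J" "bounded_linear K" "\<And>z. K (J z) = z" "\<And>y. J (K y) = y"
    and Jk: "J (1, 0) = axis k 1" "\<And>y. fst (K y) = y $ k"
    using split_coordinates[OF card] by blast
  have Jlin: "linear J" using J(1) bounded_linear.linear by blast
  have Jd: "(J has_derivative J) (at y)" for y by (rule bounded_linear_imp_has_derivative[OF J(1)])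
  have Jshift: "J (a + r, z) = J (a, z) + r *\<^sub>R axis k 1" for a r z
  proof -
    have "J (a + r, z) = J ((a, z) + r *\<^sub>R (1, 0))" by simp
    then show ?thesis using Jlin by (simp only: linear_add linear_scale Jk)
  qed
  define d where "d b = (\<Theta> ` cdom (product_chart b), \<lambda>p. J (cmap (product_chart b) (inv \<Theta> p)))" for b
  have dA: "d b \<in> A" and dimg: "cimg (d b) = J ` (UNIV \<times> cimg b)" and dinv: "\<And>y. y \<in> cimg (d b) \<Longrightarrow> cinv (d b) y = \<Theta> (cinv (product_chart b) (K y))"
    if b: "b \<in> S" for b
    using pushed_chart[OF mfdA mfdP dif LP.product_in_P[OF b] J, folded d_def] product_chart(2)[OF S.chart[OF b]] by simp_all
  have ddom: "\<Theta> (a, x) \<in> cdom (d b)" if "x \<in> cdom b" for a x b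
    using that by (auto simp: d_def product_chart_def)
  have dmap: "cmap (d b) (\<Theta> (a, x)) = J (a, cmap b x)" for a x b
    by (simp add: d_def product_chart_def inv)
  have \<eta>: "unit_line \<eta>" by (rule straight_line_unit_line[OF line])
  have z: "unit_line (\<lambda>t. \<Theta> (t, x))" for x using bi by (intro straight_line_unit_line) (simp add: bi_asymptotic_def)
  have zc: "unit_curve (\<lambda>t. \<Theta> (t, x))" for x using z by (simp add: unit_line_def)
  have Vz: "V (\<Theta> (a, x)) = vel (\<lambda>t. \<Theta> (t, x)) a" for a x
    unfolding V_def
  proof (rule gradient_eq)
    let ?c = "chart_at A (\<Theta> (a, x))" and ?z = "\<lambda>t. \<Theta> (t, x)"
    show "vel ?z a \<in> timelike_cone A L X (\<Theta> (a, x))" using vel_timelike[OF zc] .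
    show "finsler_F L (vel ?z a) = 1" using zc by (simp add: unit_curve_def)
    have "((\<lambda>y. real_of_ereal (busemann_bar A L X \<eta> (cinv ?c y))) has_derivative
        frechet_derivative (l ?c (cmap ?c (?z a))) (at (coord_velocity ?c UNIV ?z a))) (at (cmap ?c (?z a)))"
      using bi[of x] unfolding bi_asymptotic_def
      by (intro busemann_bar_derivative[OF \<eta> z _ _ _ chart_at]) simp_all
    then show "((\<lambda>x. real_of_ereal (busemann_bar A L X \<eta> x)) \<circ> cinv ?c has_derivative
        frechet_derivative (l ?c (cmap ?c (\<Theta> (a, x)))) (at (snd (vel ?z a) ?c))) (at (cmap ?c (\<Theta> (a, x))))"
      using chart_at by (simp add: o_def snd_velocity)
  qed
  have vz: "vel (\<lambda>t. \<Theta> (t, x)) a = tvec_of A (d b) (\<Theta> (a, x)) (axis k 1)" if b: "b \<in> S" "x \<in> cdom b" for a x b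
  proof (rule velocity_eq[OF dA[OF b(1)] ddom[OF b(2)]])
    have "(cmap (d b) \<circ> (\<lambda>t. \<Theta> (t, x))) r = J (0, cmap b x) + r *\<^sub>R axis k 1" for r
      using Jshift[of 0 r "cmap b x"] unfolding o_def dmap add_0 .
    then have "cmap (d b) \<circ> (\<lambda>t. \<Theta> (t, x)) = (\<lambda>r. J (0, cmap b x) + r *\<^sub>R axis k 1)"
      by (rule ext)
    moreover have "((\<lambda>r. J (0, cmap b x) + r *\<^sub>R axis k 1) has_vector_derivative 0 + (a *\<^sub>R 0 + 1 *\<^sub>R axis k 1)) (at a)"
      by (intro has_vector_derivative_add has_vector_derivative_const has_vector_derivative_scaleR DERIV_ident)
    ultimately show "(cmap (d b) \<circ> (\<lambda>t. \<Theta> (t, x)) has_vector_derivative axis k 1) (at a)"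
      by simp
    show "isCont (\<lambda>t. \<Theta> (t, x)) a"
      using zc[of x] by (simp add: unit_curve_def C1_curve_def continuous_on_eq_continuous_at)
  qed auto
  \<comment> \<open>The components of -dt^2 + h at (a, x). They do not involve a, which will give
    \<open>line_fund\<close>.\<close>
  define R where "R b x \<alpha> \<beta> = - fst \<alpha> * fst \<beta> + h (tvec_of S b x (snd \<alpha>)) (tvec_of S b x (snd \<beta>))" for b x \<alpha> \<beta>
  \<comment> \<open>The isometry condition evaluated on coordinate vectors. By \<open>Vz\<close> and
    \<open>vz\<close> the reference vector of the metric is e_k in the chart \<open>d b\<close>, so
    the condition concerns the fundamental tensor at e_k.\<close>
  have fundR: "J \<alpha> \<bullet> (fund A L (d b) (J (a, cmap b x)) (axis k 1) *v J \<beta>) = R b x \<alpha> \<beta>"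
    if b: "b \<in> S" "x \<in> cdom b" for a x b \<alpha> \<beta>
  proof -
    let ?q = "product_chart b" and ?P = "line_product S"
    have q: "?q \<in> ?P" "(a, x) \<in> cdom ?q" using LP.product_in_P b by (auto simp: product_chart_def)
    have qx1: "cmap ?q (a, x) = (a, cmap b x)" by (simp add: product_chart_def)
    have "cmap ?q (a, x) \<in> cimg ?q" using q(2) by (rule imageI)
    then have qx: "cmap ?q (a, x) = (a, cmap b x)" "(a, cmap b x) \<in> cimg ?q" by (simp_all only: qx1)
    note oq = chart_open(2)[OF LP.chart[OF q(1)]]
    have qinv: "cinv ?q (r, y) = (r, cinv b y)" if "y \<in> cimg b" for r y by (rule product_chart(3)[OF S.chart[OF b(1)] that])
    have qimg: "cimg ?q = UNIV \<times> cimg b" by (rule product_chart(2)[OF S.chart[OF b(1)]])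
    have 1: "dmap ?P A \<Theta> (tvec_of ?P ?q (a, x) w) = tvec_of A (d b) (\<Theta> (a, x)) (J w)" for w
    proof (rule dmap_tvec_of[OF mfdP mfdA q dA[OF b(1)] ddom[OF b(2)] cont])
      show "(cmap (d b) \<circ> \<Theta> \<circ> cinv ?q has_derivative J) (at (cmap ?q (a, x)))"
        unfolding qx(1)
      proof (rule has_derivative_transform_within_open[OF Jd oq qx(2)])
        fix w assume "w \<in> cimg ?q"
        then have "cmap ?q (cinv ?q w) = w" by (rule LP.chart_simps(2)[OF q(1)])
        then show "J w = (cmap (d b) \<circ> \<Theta> \<circ> cinv ?q) w" by (simp add: d_def inv)
      qed
    qed
    have 2: "dfun ?P fst (tvec_of ?P ?q (a, x) w) = fst w" for w
    proof (rule LP.dfun_tvec_of[OF q])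
      show "(fst \<circ> cinv ?q has_derivative fst) (at (cmap ?q (a, x)))"
        unfolding qx(1)
        by (rule has_derivative_transform_within_open[OF bounded_linear_imp_has_derivative[OF bounded_linear_fst] oq qx(2)])
          (auto simp: qimg qinv simp del: split_paired_All)
    qed
    have 3: "dmap ?P S snd (tvec_of ?P ?q (a, x) w) = tvec_of S b x (snd w)" for w
    proof -
      have "dmap ?P S snd (tvec_of ?P ?q (a, x) w) = tvec_of S b (snd (a, x)) (snd w)"
      proof (rule dmap_tvec_of[OF mfdP mfdS q b(1)])
        show "(cmap b \<circ> snd \<circ> cinv ?q has_derivative snd) (at (cmap ?q (a, x)))"
          unfolding qx(1)
          by (rule has_derivative_transform_within_open[OF bounded_linear_imp_has_derivative[OF bounded_linear_snd] oq qx(2)])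
            (auto simp: qimg qinv S.chart_simps b(1) simp del: split_paired_All)
      qed (use b in \<open>auto intro: continuous_on_snd continuous_on_id\<close>)
      then show ?thesis by simp
    qed
    let ?u = "tvec_of ?P ?q (a, x) \<alpha>" and ?w = "tvec_of ?P ?q (a, x) \<beta>"
    have tan: "?u \<in> tangent_space ?P (a, x)" "?w \<in> tangent_space ?P (a, x)" by (intro LP.tvec_of_tangent q)+
    have "g_at A L (V (fst (dmap ?P A \<Theta> ?u))) (dmap ?P A \<Theta> ?u) (dmap ?P A \<Theta> ?w) = lorentz_product S h ?u ?w"
      using iso tan unfolding metric_isometry_def by blast
    also have "lorentz_product S h ?u ?w = R b x \<alpha> \<beta>" by (simp add: lorentz_product_def 2 3 R_def)
    also have "g_at A L (V (fst (dmap ?P A \<Theta> ?u))) (dmap ?P A \<Theta> ?u) (dmap ?P A \<Theta> ?w) =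
        J \<alpha> \<bullet> (fund A L (d b) (J (a, cmap b x)) (axis k 1) *v J \<beta>)"
      unfolding 1 fst_tvec_of Vz vz[OF b] using dA[OF b(1)] ddom[OF b(2), of a]
      by (subst g_at_chart[of _ "\<Theta> (a, x)" _ _ "d b"])
        (auto simp: snd_tvec_of_same tvec_of_tangent dmap axis_eq_0_iff)
    finally show ?thesis .
  qed
  have inv_L: "l (d b) (y + r *\<^sub>R axis k 1) v = l (d b) y v" if b: "b \<in> S" and y: "y \<in> cimg (d b)" for b y r v
  proof (rule translation_invariant[OF dA[OF b] _ _ _ _ y])
    show "chern A L (d b) \<alpha> \<beta> \<delta> x v = chern A L (d b) \<alpha> \<beta> \<delta> x w" if "x \<in> cimg (d b)" "v \<noteq> 0" "w \<noteq> 0" for x \<alpha> \<beta> \<delta> v w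
      using bw dA[OF b] that unfolding berwald_def by blast
    fix x assume x: "x \<in> cimg (d b)"
    then obtain a p where p: "p \<in> cdom b" "x = J (a, cmap b p)" unfolding dimg[OF b] by auto
    have xr: "x + r *\<^sub>R axis k 1 = J (a + r, cmap b p)" for r by (simp add: p Jshift)
    show "x + r *\<^sub>R axis k 1 \<in> cimg (d b)" for r unfolding xr dimg[OF b] using p by blast
    have comp: "fund A L (d b) (J (a', cmap b p)) (axis k 1) $ \<alpha> $ \<beta> = R b p (K (axis \<alpha> 1)) (K (axis \<beta> 1))" for a' \<alpha> \<beta>
      using fundR[OF b p(1), of "K (axis \<alpha> 1)" a' "K (axis \<beta> 1)"]
      by (simp add: J matrix_vector_mult_basis column_def inner_axis')
    show "fund A L (d b) (x + r *\<^sub>R axis k 1) (axis k 1) = fund A L (d b) x (axis k 1)" for r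
      unfolding xr unfolding p(2) by (simp add: vec_eq_iff comp)
    have Kk: "K (axis k 1) = (1, 0)" using J(3)[of "(1, 0)"] by (simp add: Jk)
    have "bilinear (\<lambda>u w. h (tvec_of S b p u) (tvec_of S b p w))"
      using S(2) b p(1) by (auto simp: riemannian_metric_def smooth_bilinear_field_def)
    then have "h (tvec_of S b p 0) (tvec_of S b p w) = 0" for w by (rule bilinear_lzero)
    moreover have "axis \<beta> (1::real) $ k = (if \<beta> = k then 1 else 0)" for \<beta> :: 'i by (simp add: axis_def)
    ultimately show "fund A L (d b) x (axis k 1) $ k $ \<beta> = (if \<beta> = k then - 1 else 0)" for \<beta>
      unfolding p(2) comp by (simp add: R_def Kk Jk)
  qed
  show "L (dmap A A (translation \<Theta> t) v) = L v" if vt: "v \<in> tangent_bundle A"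
  proof -
    obtain p where v: "v \<in> tangent_space A p" by (rule UN_E[OF vt[unfolded tangent_bundle_def]])
    obtain a x where p: "p = \<Theta> (a, x)" using inv(2)[of p] by (metis surj_pair)
    obtain b where b: "b \<in> S" "x \<in> cdom b" using S.chart_exists by blast
    let ?d = "d b"
    have dp: "?d \<in> A" "p \<in> cdom ?d" using dA[OF b(1)] ddom[OF b(2)] p by auto
    define u where "u = snd v ?d"
    have vu: "v = tvec_of A ?d p u" using tvec_of_snd[OF v dp] by (simp add: u_def)
    have tp: "\<tau> t p = \<Theta> (a + t, x)" by (simp add: \<tau>_def p inv shift_def)
    have tdp: "\<tau> t p \<in> cdom ?d" using ddom[OF b(2)] by (simp add: tp)
    have "dmap A A (\<tau> t) (tvec_of A ?d p u) = tvec_of A ?d (\<tau> t p) u"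
    proof (rule dmap_tvec_of[where f = "\<tau> t" and T = "\<lambda>u. u", OF mfdA mfdA dp dp(1) tdp])
      show "continuous_on UNIV (\<tau> t)" using sm by (simp add: smooth_map_def)
      \<comment> \<open>The domain of \<open>d b\<close> is invariant under translations because a
        product chart covers the whole line, so one chart serves for p and its image.\<close>
      have id: "((\<lambda>y. y + t *\<^sub>R axis k 1) has_derivative (\<lambda>u. u)) (at (cmap ?d p))" by (auto intro!: derivative_eq_intros)
      show "(cmap ?d \<circ> \<tau> t \<circ> cinv ?d has_derivative (\<lambda>u. u)) (at (cmap ?d p))"
      proof (rule has_derivative_transform_within_open[OF id chart_open(2)[OF chart[OF dp(1)]]])
        fix y assume y: "y \<in> cimg ?d"
        then obtain a' p' where p': "p' \<in> cdom b" "y = J (a', cmap b p')" unfolding dimg[OF b(1)] by auto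
        have "cinv ?d y = \<Theta> (a', p')"
          using dinv[OF b(1) y] p' product_chart(3)[OF S.chart[OF b(1)], of "cmap b p'" a'] b(1) by (simp add: J S.chart_simps)
        then show "y + t *\<^sub>R axis k 1 = (cmap ?d \<circ> \<tau> t \<circ> cinv ?d) y"
          by (simp add: \<tau>_def inv shift_def dmap p'(2) Jshift)
      qed (rule imageI[OF dp(2)])
    qed
    moreover have "L (tvec_of A ?d (\<tau> t p) u) = l ?d (J (a, cmap b x) + t *\<^sub>R axis k 1) u"
    proof -
      have "cmap ?d (\<tau> t p) = J (a, cmap b x) + t *\<^sub>R axis k 1" by (simp only: tp dmap Jshift)
      then show ?thesis unfolding Lc_def by (metis chart_simps(1)[OF dp(1) tdp])
    qed
    moreover have "L (tvec_of A ?d p u) = l ?d (J (a, cmap b x)) u"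
    proof -
      have "cmap ?d p = J (a, cmap b x)" by (simp only: p dmap)
      then show ?thesis unfolding Lc_def by (metis chart_simps(1)[OF dp])
    qed
    moreover have "J (a, cmap b x) \<in> cimg ?d" unfolding dimg[OF b(1)] using b(2) by blast
    ultimately show ?thesis unfolding trans vu by (simp add: inv_L[OF b(1)])
  qed
qed

end

theorem corollary1p3:
  fixes n :: nat
    and A :: "('m::{t2_space,second_countable_topology}, real^'i) chart set"
    and L :: "('m, real^'i) tvec \<Rightarrow> real"
    and X :: "'m \<Rightarrow> ('m, real^'i) tvec"
    and \<Psi> :: "'m \<Rightarrow> real"
    and N :: ereal
    and \<epsilon> :: real
    and \<eta> :: "real \<Rightarrow> 'm"
    and g :: "('m, real^'i) tvec \<Rightarrow> ('m, real^'i) tvec \<Rightarrow> real"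
    and B :: "('q::{t2_space,second_countable_topology}, real^'i) chart set"
    and \<pi> :: "'q \<Rightarrow> 'm"
    and X' :: "'q \<Rightarrow> ('q, real^'i) tvec"
    and \<eta>' :: "real \<Rightarrow> 'q"
    and S :: "('s::{t2_space,second_countable_topology}, real^'j) chart set"
    and h :: "('s, real^'j) tvec \<Rightarrow> ('s, real^'j) tvec \<Rightarrow> real"
    and \<Theta> :: "real \<times> 's \<Rightarrow> 'm"
  assumes dim: "CARD('i) = n + 1" "1 \<le> n" "CARD('j) = n"
    and spacetime: "finsler_spacetime A L X" "berwald A L" "timelike_geodesically_complete A L X"
    and weight: "smooth_fun A \<Psi>"
    and N: "(N \<noteq> -\<infinity> \<and> N < 0) \<or> ereal (real n) \<le> N"
    and Ric_N: "\<forall>p. \<forall>v\<in>timelike_cone A L X p. 0 \<le> Ric_weighted n A L \<Psi> N v"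
    and eps: "\<epsilon> \<in> eps_range n N" "timelike_eps_complete n A L X \<Psi> \<epsilon>"
    and line: "straight_line A L X \<eta>"
    and metric: "lorentzian_metric A g" "metric_timelike_complete A g" "levi_civita_is_chern A g L"
      "\<forall>t. g (velocity A UNIV \<eta> t) (velocity A UNIV \<eta> t) < 0"
    and cover: "universal_cover B A \<pi>" "continuous_on UNIV \<eta>'" "\<forall>t. \<pi> (\<eta>' t) = \<eta> t"
    and cover_line: "metric_line B (pullback_metric B A \<pi> g) X' \<eta>'"
    and split: "splitting A L X \<eta> S h \<Theta>"
  shows "\<forall>t. diffeomorphism A A (translation \<Theta> t) \<and>
           (\<forall>v\<in>tangent_bundle A. L (dmap A A (translation \<Theta> t) v) = L v)"
proof -
  have card: "CARD('i) = CARD('j) + 1" using dim by simp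
  have M: "spacetime A L X" by unfold_locales (rule spacetime(1))
  show ?thesis using spacetime.splitting_translation[OF M card spacetime(2) line split] by blast
qed

end
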